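(* Point evaluations are bounded on $\mathcal B^p_\alpha$ for all $\alpha\in\mathbb R$ and $1\le p<\infty$; that is, for every $x_0\in\mathbb B$ there is a constant $C$ such that $|f(x_0)|\le C\|f\|_{\mathcal B^p_\alpha}$ for all $f\in\mathcal B^p_\alpha$.
   Context: Let $n\ge2$, $\mathbb B$ the open unit ball of $\mathbb R^n$, $\nu$ the volume measure normalized so that $\nu(\mathbb B)=1$. $\mathcal H(\mathbb B)$ is the space of $\mathcal H$-harmonic functions: $f\in C^2(\mathbb B)$ with $\Delta_hf=0$, where $\Delta_hf(x)=(1-|x|^2)^2\Delta f(x)+2(n-2)(1-|x|^2)\langle x,\nabla f(x)\rangle$. For $\alpha\in\mathbb R$, $d\nu_\alpha(x)=\frac1{V_\alpha}(1-|x|^2)^\alpha d\nu(x)$, with $V_\alpha=\frac{\Gamma(n/2+1)\Gamma(\alpha+1)}{\Gamma(n/2+\alpha+1)}$ if $\alpha>-1$ and $V_\alpha=1$ if $\alpha\le-1$; $L^p_\alpha$ is the Lebesgue space $L^p(\mathbb B,\nu_\alpha)$. Operators $D^t_s$: Let $H_m$ be the space of Euclidean harmonic polynomials on $\mathbb R^n$ homogeneous of degree $m$, and $S_m(r)=\frac{{}_2F_1(m,1-n/2;m+n/2;r^2)}{{}_2F_1(m,1-n/2;m+n/2;1)}$, $0\le r\le1$. Every $f\in\mathcal H(\mathbb B)$ has a unique expansion $f(x)=\sum_{m\ge0}S_m(|x|)f_m(x)$ with $f_m\in H_m$. Define positive numbers $c_m(\alpha)$ by: if $\alpha>-1$, $\frac1{c_m(\alpha)}=\frac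 n{V_\alpha}\int_0^1r^{2m+n-1}(1-r^2)^\alpha S_m^2(r)\,dr$; if $\alpha\le-1$, $c_0(\alpha)=1$ and $c_m(\alpha)=\frac{\Gamma(m)}{\Gamma(m-\alpha-1)}$ for $m\ge1$. For $s,t\in\mathbb R$, $D^t_sf(x)=\sum_{m\ge0}\frac{c_m(s+t)}{c_m(s)}S_m(|x|)f_m(x)$. Tangential derivatives: $T_{i,j}f=x_i\frac{\partial f}{\partial x_j}-x_j\frac{\partial f}{\partial x_i}$ for $1\le i<j\le n$; $\mathcal T^k=\{T_{i_1,j_1}\circ\cdots\circ T_{i_k,j_k}\}$ for $k\ge1$, $\mathcal T^0=\{\mathrm{Id}\}$. Bergman-Besov space: for $\alpha\in\mathbb R$, $1\le p<\infty$, $\mathcal B^p_\alpha$ consists of all $f\in\mathcal H(\mathbb B)$ satisfying the following conditions, which are equivalent: $D^t_sf\in L^p_{\alpha+pt}$ for some (equivalently, all) $s,t\in\mathbb R$ with $\alpha+pt>-1$; $T^kf\in L^p_{\alpha+pk}$ for all $T^k\in\mathcal T^k$, for some (equivalently, all) integers $k\ge0$ with $\alpha+pk>-1$. $\|f\|_{\mathcal B^p_\alpha}$ denotes any one of the (mutually equivalent) norms $\|D^t_sf\|_{L^p_{\alpha+pt}}$ ($\alpha+pt>-1$) or $\sum_{T^k\in\mathcal T^k}\|T^kf\|_{L^p_{\alpha+pk}}+|f(0)|$ ($\alpha+pk>-1$). *)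

theory Defs
  imports "HOL-Analysis.Analysis"
begin

text \<open>
  The space is \<open>real ^ 'n\<close>, with \<open>n = CARD('n)\<close>; the order on the index type \<open>'n\<close> only serves to
  speak of pairs \<open>i < j\<close>.  Functions on the unit ball are total functions of which only the values
  on \<open>ball 0 1\<close> matter.
\<close>

section \<open>H-harmonic functions\<close>

definition partial :: "'n \<Rightarrow> (real ^ 'n::finite \<Rightarrow> complex) \<Rightarrow> real ^ 'n \<Rightarrow> complex" where
  "partial j f x = frechet_derivative f (at x) (axis j 1)"

text \<open>For open \<open>S\<close> this is the usual class of twice continuously differentiable functions.\<close>

definition C2_on :: "(real ^ 'n::finite) set \<Rightarrow> (real ^ 'n \<Rightarrow> complex) \<Rightarrow> bool" where
  "C2_on S f \<longleftrightarrow>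
     (\<forall>x\<in>S. f differentiable (at x)) \<and>
     (\<forall>j. \<forall>x\<in>S. partial j f differentiable (at x)) \<and>
     (\<forall>i j. continuous_on S (partial i (partial j f)))"

definition laplacian :: "(real ^ 'n::finite \<Rightarrow> complex) \<Rightarrow> real ^ 'n \<Rightarrow> complex" where
  "laplacian f x = (\<Sum>i\<in>UNIV. partial i (partial i f) x)"

definition hyp_laplacian :: "(real ^ 'n::finite \<Rightarrow> complex) \<Rightarrow> real ^ 'n \<Rightarrow> complex" where
  "hyp_laplacian f x =
     (1 - (norm x)\<^sup>2)\<^sup>2 *\<^sub>R laplacian f x
     + (2 * (real CARD('n) - 2) * (1 - (norm x)\<^sup>2)) *\<^sub>R (\<Sum>i\<in>UNIV. x $ i *\<^sub>R partial i f x)"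

definition hyp_harmonic :: "(real ^ 'n::finite \<Rightarrow> complex) set" where
  "hyp_harmonic = {f. C2_on (ball 0 1) f \<and> (\<forall>x\<in>ball 0 1. hyp_laplacian f x = 0)}"

section \<open>The spaces \<open>L\<^sup>p\<^sub>\<alpha>\<close>\<close>

definition vol_const :: "'n::finite itself \<Rightarrow> real \<Rightarrow> real" where
  "vol_const _ \<alpha> = (if \<alpha> > -1
     then Gamma (real CARD('n) / 2 + 1) * Gamma (\<alpha> + 1) / Gamma (real CARD('n) / 2 + \<alpha> + 1)
     else 1)"

definition nu :: "(real ^ 'n::finite) measure" where
  "nu = uniform_measure (lebesgue_on (ball 0 1)) (ball 0 1)"

definition nu_weighted :: "real \<Rightarrow> (real ^ 'n::finite) measure" where
  "nu_weighted \<alpha> = density nu (\<lambda>x. ennreal (1 / vol_const TYPE('n) \<alpha> * (1 - (norm x)\<^sup>2) powr \<alpha>))"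

definition Lp :: "real \<Rightarrow> real \<Rightarrow> (real ^ 'n::finite \<Rightarrow> complex) set" where
  "Lp p \<alpha> = {f \<in> borel_measurable (nu_weighted \<alpha>).
              integrable (nu_weighted \<alpha>) (\<lambda>x. norm (f x) powr p)}"

text \<open>The norm is extended-valued: it is infinite outside \<open>Lp p \<alpha>\<close>.\<close>

definition Lp_norm :: "real \<Rightarrow> real \<Rightarrow> (real ^ 'n::finite \<Rightarrow> complex) \<Rightarrow> ennreal" where
  "Lp_norm p \<alpha> f =
     (if f \<in> Lp p \<alpha> then ennreal ((\<integral>x. norm (f x) powr p \<partial>nu_weighted \<alpha>) powr (1 / p)) else \<infinity>)"

section \<open>The operators \<open>D\<^sup>t\<^sub>s\<close>\<close>

text \<open>
  Homogeneous polynomials are represented by their polynomial functions; over the reals,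
  homogeneity of the polynomial and of the function coincide.
\<close>

definition harmonic_poly :: "nat \<Rightarrow> (real ^ 'n::finite \<Rightarrow> complex) set" where
  "harmonic_poly m = {q. polynomial_function q \<and>
     (\<forall>c x. q (c *\<^sub>R x) = c ^ m *\<^sub>R q x) \<and> (\<forall>x. laplacian q x = 0)}"

definition hyp2F1 :: "real \<Rightarrow> real \<Rightarrow> real \<Rightarrow> real \<Rightarrow> real" where
  "hyp2F1 a b c z = eval_fps (fps_hypergeo [a, b] [c] 1) z"

definition S_fun :: "'n::finite itself \<Rightarrow> nat \<Rightarrow> real \<Rightarrow> real" where
  "S_fun _ m r =
     hyp2F1 (real m) (1 - real CARD('n) / 2) (real m + real CARD('n) / 2) (r\<^sup>2)
     / hyp2F1 (real m) (1 - real CARD('n) / 2) (real m + real CARD('n) / 2) 1"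

definition is_expansion ::
    "(real ^ 'n::finite \<Rightarrow> complex) \<Rightarrow> (nat \<Rightarrow> real ^ 'n \<Rightarrow> complex) \<Rightarrow> bool" where
  "is_expansion f F \<longleftrightarrow> (\<forall>m. F m \<in> harmonic_poly m) \<and>
     (\<forall>x\<in>ball 0 1. (\<lambda>m. S_fun TYPE('n) m (norm x) *\<^sub>R F m x) sums f x)"

text \<open>Every H-harmonic function has exactly one expansion.\<close>

definition expansion_term ::
    "(real ^ 'n::finite \<Rightarrow> complex) \<Rightarrow> nat \<Rightarrow> real ^ 'n \<Rightarrow> complex" where
  "expansion_term f = (THE F. is_expansion f F)"

definition c_coeff :: "'n::finite itself \<Rightarrow> nat \<Rightarrow> real \<Rightarrow> real" where
  "c_coeff N m \<alpha> = (if \<alpha> > -1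
     then 1 / (real CARD('n) / vol_const N \<alpha> *
            (LBINT r:{0..1}. r ^ (2 * m + CARD('n) - 1) * (1 - r\<^sup>2) powr \<alpha> * (S_fun N m r)\<^sup>2))
     else if m = 0 then 1
     else Gamma (real m) / Gamma (real m - \<alpha> - 1))"

definition D_op :: "real \<Rightarrow> real \<Rightarrow> (real ^ 'n::finite \<Rightarrow> complex) \<Rightarrow> real ^ 'n \<Rightarrow> complex" where
  "D_op s t f x = (\<Sum>m. (c_coeff TYPE('n) m (s + t) / c_coeff TYPE('n) m s * S_fun TYPE('n) m (norm x))
                       *\<^sub>R expansion_term f m x)"

section \<open>Tangential derivatives\<close>

definition tangential ::
    "'n \<Rightarrow> 'n \<Rightarrow> (real ^ 'n::finite \<Rightarrow> complex) \<Rightarrow> real ^ 'n \<Rightarrow> complex" where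
  "tangential i j f x = x $ i *\<^sub>R partial j f x - x $ j *\<^sub>R partial i f x"

primrec tangential_ops ::
    "nat \<Rightarrow> ((real ^ 'n::{finite,linorder} \<Rightarrow> complex) \<Rightarrow> real ^ 'n::{finite,linorder} \<Rightarrow> complex) set" where
  "tangential_ops 0 = {id}"
| "tangential_ops (Suc k) = {tangential i j \<circ> T | i j T. i < j \<and> T \<in> tangential_ops k}"

section \<open>Bergman-Besov spaces\<close>

text \<open>
  The conditions for different \<open>s, t\<close> or \<open>k\<close> are equivalent, so asking for just one of them is no
  restriction, and all norms in \<open>bergman_besov_norms\<close> are finite and mutually equivalent on
  the space.
\<close>

definition bergman_besov :: "real \<Rightarrow> real \<Rightarrow> (real ^ 'n::{finite,linorder} \<Rightarrow> complex) set" where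
  "bergman_besov p \<alpha> = {f \<in> hyp_harmonic.
     (\<exists>s t. \<alpha> + p * t > -1 \<and> D_op s t f \<in> Lp p (\<alpha> + p * t)) \<or>
     (\<exists>k::nat. \<alpha> + p * real k > -1 \<and> (\<forall>T\<in>tangential_ops k. T f \<in> Lp p (\<alpha> + p * real k)))}"

definition D_norm ::
    "real \<Rightarrow> real \<Rightarrow> real \<Rightarrow> real \<Rightarrow> (real ^ 'n::finite \<Rightarrow> complex) \<Rightarrow> ennreal" where
  "D_norm p \<alpha> s t f = Lp_norm p (\<alpha> + p * t) (D_op s t f)"

definition T_norm ::
    "real \<Rightarrow> real \<Rightarrow> nat \<Rightarrow> (real ^ 'n::{finite,linorder} \<Rightarrow> complex) \<Rightarrow> ennreal" where
  "T_norm p \<alpha> k f =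
     (\<Sum>T\<in>tangential_ops k. Lp_norm p (\<alpha> + p * real k) (T f)) + ennreal (norm (f 0))"

definition bergman_besov_norms ::
    "real \<Rightarrow> real \<Rightarrow> ((real ^ 'n::{finite,linorder} \<Rightarrow> complex) \<Rightarrow> ennreal) set" where
  "bergman_besov_norms p \<alpha> =
     {D_norm p \<alpha> s t | s t. \<alpha> + p * t > -1} \<union>
     {T_norm p \<alpha> k | k. \<alpha> + p * real k > -1}"

end

theory Submission
  imports Defs "HOL-Probability.Probability_Measure"
begin

text \<open>Pairing an \<open>\<H>\<close>-harmonic \<open>f\<close> with a spherical harmonic of degree \<open>m\<close> on the spheres of radius \<open>r\<close>
  gives a regular solution of the radial equation, hence by the Wronskian a multiple of
  \<open>r\<^sup>m F(r\<^sup>2)\<close>.  This produces the expansion of \<open>f\<close>, and it bounds the \<open>m\<close>-th term by the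
  \<open>L\<^sup>1\<close> means of \<open>f\<close> over spheres, which on a thin annulus are dominated by the weighted \<open>L\<^sup>p\<close> norm.
  All other factors (sup norms of normalized spherical harmonics, the quotients \<open>c\<^sub>m(s + t) / c\<^sub>m(s)\<close>)
  grow subexponentially in \<open>m\<close>, so that the series at \<open>x\<^sub>0\<close> is dominated by a geometric one when the
  annulus lies outside of \<open>|x\<^sub>0|\<close>.  For the tangential norms, \<open>T\<^sub>i\<^sub>j\<close> acts on each term separately, and on
  spherical harmonics of degree \<open>m \<ge> 1\<close> some \<open>T\<^sub>i\<^sub>j\<close> is bounded below because \<open>-\<Sum>T\<^sub>i\<^sub>j\<^sup>2\<close> over \<open>i < j\<close> is
  \<open>m (m + n - 2)\<close>.\<close>

section \<open>Harmonic polynomials\<close>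

text \<open>The norms measure \<open>D_op s t f\<close> or the tangential derivatives of
  \<open>f\<close>, not \<open>f\<close>, so averaging \<open>f\<close> itself around
  \<open>x0\<close> does not bound its value there; the operators have to be inverted first, and
  this is possible degree by degree. A loss in degree \<open>m\<close> is harmless as long as it is
  subexponential, because moving from a radius \<open>a\<close> down to \<open>norm x0 < a\<close>
  gains a geometric factor. Crude bounds therefore suffice: sup norms on the sphere are only shown
  to grow at most like \<open>(1 + \<rho>) ^ m\<close> for every \<rho> > 0, and
  \<open>c_coeff\<close> is only compared with such powers. The quantity that must be controlled
  uniformly in \<open>m\<close> is \<open>radw N m r\<close> against \<open>r ^ m\<close> at fixed
  \<open>r < 1\<close>; this comes from monotonicity arguments for the radial equation. The
  estimates are proved for every H-harmonic \<open>f\<close>: where the relevant function is not in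
  \<open>Lp\<close>, the norm is infinite and a positive constant makes the inequality
  trivial.\<close>

lemma partial_eqI: "(f has_derivative f') (at x) \<Longrightarrow> partial j f x = f' (axis j 1)"
  unfolding partial_def by (metis frechet_derivative_at)

lemma vec_eq_sum_axis: "v = (\<Sum>j\<in>UNIV. v $ j *\<^sub>R axis j (1::real))" for v :: "real ^ 'n::finite"
  by (simp add: vec_eq_iff axis_def if_distrib[where f="(*) _"] cong: if_cong)

text \<open>Writing the derivative as a sum over coordinates lets every calculus rule for
  \<open>partial\<close> be read off from the rule for \<open>has_derivative\<close> by evaluating
  at \<open>axis j 1\<close>.\<close>

lemma has_derivative_partial:
  fixes f :: "real ^ 'n::finite \<Rightarrow> complex"
  assumes "f differentiable (at x)"
  shows "(f has_derivative (\<lambda>v. \<Sum>j\<in>UNIV. v $ j *\<^sub>R partial j f x)) (at x)"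
proof -
  have D: "(f has_derivative frechet_derivative f (at x)) (at x)"
    using assms frechet_derivative_works by blast
  then have lin: "linear (frechet_derivative f (at x))"
    using has_derivative_linear by blast
  have "frechet_derivative f (at x) v = (\<Sum>j\<in>UNIV. v $ j *\<^sub>R partial j f x)" for v
  proof -
    have "frechet_derivative f (at x) v = frechet_derivative f (at x) (\<Sum>j\<in>UNIV. v $ j *\<^sub>R axis j 1)"
      using vec_eq_sum_axis[of v] by simp
    also have "\<dots> = (\<Sum>j\<in>UNIV. v $ j *\<^sub>R partial j f x)"
      unfolding partial_def by (simp add: linear_sum[OF lin] linear_scale[OF lin])
    finally show ?thesis .
  qed
  then have "frechet_derivative f (at x) = (\<lambda>v. \<Sum>j\<in>UNIV. v $ j *\<^sub>R partial j f x)"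
    by (rule ext)
  with D show ?thesis by simp
qed

lemma partial_const [simp]: "partial j (\<lambda>x. c) x = 0"
  by (rule partial_eqI[where f'="\<lambda>_. 0", simplified]) simp

lemma partial_add:
  "f differentiable (at x) \<Longrightarrow> g differentiable (at x) \<Longrightarrow>
   partial j (\<lambda>x. f x + g x) x = partial j f x + partial j g x"
  by (subst partial_eqI[OF has_derivative_add[OF has_derivative_partial has_derivative_partial]])
    (auto simp: axis_def if_distrib[where f="\<lambda>r. r *\<^sub>R _"] cong: if_cong)

lemma partial_diff:
  "f differentiable (at x) \<Longrightarrow> g differentiable (at x) \<Longrightarrow>
   partial j (\<lambda>x. f x - g x) x = partial j f x - partial j g x"
  by (subst partial_eqI[OF has_derivative_diff[OF has_derivative_partial has_derivative_partial]])
    (auto simp: axis_def if_distrib[where f="\<lambda>r. r *\<^sub>R _"] cong: if_cong)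

lemma partial_mult:
  "f differentiable (at x) \<Longrightarrow> g differentiable (at x) \<Longrightarrow>
   partial j (\<lambda>x. f x * g x) x = f x * partial j g x + partial j f x * g x"
  by (subst partial_eqI[OF has_derivative_mult[OF has_derivative_partial has_derivative_partial]])
    (auto simp: axis_def if_distrib[where f="\<lambda>r. r *\<^sub>R _"] cong: if_cong)

lemma partial_cmult:
  "f differentiable (at x) \<Longrightarrow> partial j (\<lambda>x. c * f x) x = c * partial j f x"
  by (subst partial_mult) auto

lemma partial_scaleR:
  "f differentiable (at x) \<Longrightarrow> partial j (\<lambda>x. c *\<^sub>R f x) x = c *\<^sub>R partial j f x"
  using partial_cmult[of f x j "complex_of_real c"] by (simp add: scaleR_conv_of_real)

lemma partial_sum:
  assumes "finite A" "\<And>a. a \<in> A \<Longrightarrow> f a differentiable (at x)"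
  shows "partial j (\<lambda>x. \<Sum>a\<in>A. f a x) x = (\<Sum>a\<in>A. partial j (f a) x)"
  using assms by (induction A rule: finite_induct) (auto simp: partial_add)

lemma partial_cnj:
  assumes "f differentiable (at x)"
  shows "partial j (\<lambda>x. cnj (f x)) x = cnj (partial j f x)"
    by (subst partial_eqI[OF has_derivative_cnj[OF has_derivative_partial[OF assms]]])
      (auto simp: axis_def if_distrib[where f="\<lambda>r. r *\<^sub>R _"] if_distrib[where f="\<lambda>r. of_real r * _"] cong: if_cong)

abbreviation crd :: "'n \<Rightarrow> real ^ 'n::finite \<Rightarrow> complex" where
  "crd i \<equiv> (\<lambda>x. complex_of_real (x $ i))"

lemma has_derivative_crd: "(crd i has_derivative (\<lambda>v. of_real (v $ i))) (at x)"
  by (auto intro!: derivative_eq_intros bounded_linear_imp_has_derivative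
      bounded_linear_compose[OF bounded_linear_of_real bounded_linear_vec_nth])

lemma differentiable_crd [simp]: "crd i differentiable (at x)"
  using has_derivative_crd unfolding differentiable_def by blast

lemma partial_crd: "partial j (crd i) x = of_bool (i = j)"
  by (subst partial_eqI[OF has_derivative_crd]) (auto simp: axis_def)

text \<open>A real-linear functional on the complex plane is a combination of \<open>Re\<close> and
  \<open>Im\<close> with coefficients given by its values at \<open>1\<close> and
  \<open>\<i>\<close>.\<close>

lemma polynomial_function_complex_iff:
  fixes q :: "'a::real_normed_vector \<Rightarrow> complex"
  shows "polynomial_function q \<longleftrightarrow>
    real_polynomial_function (\<lambda>x. Re (q x)) \<and> real_polynomial_function (\<lambda>x. Im (q x))"
proof safe
  assume "polynomial_function q"
  then show "real_polynomial_function (\<lambda>x. Re (q x))" "real_polynomial_function (\<lambda>x. Im (q x))"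
    using bounded_linear_Re bounded_linear_Im by (auto simp: polynomial_function_def comp_def)
next
  assume *: "real_polynomial_function (\<lambda>x. Re (q x))" "real_polynomial_function (\<lambda>x. Im (q x))"
  show "polynomial_function q"
    unfolding polynomial_function_def
  proof safe
    fix f :: "complex \<Rightarrow> real" assume f: "bounded_linear f"
    then have lin: "linear f" by (simp add: bounded_linear.linear)
    have "f z = Re z * f 1 + Im z * f \<i>" for z
    proof -
      have "f z = f (Re z *\<^sub>R 1 + Im z *\<^sub>R \<i>)"
        by (rule arg_cong[where f=f]) (simp add: complex_eq_iff)
      then show ?thesis by (simp add: linear_add[OF lin] linear_scale[OF lin])
    qed
    then have "f (q x) = Re (q x) * f 1 + Im (q x) * f \<i>" for x by blast
    then have "f \<circ> q = (\<lambda>x. Re (q x) * f 1 + Im (q x) * f \<i>)"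
      by (intro ext) (simp only: comp_apply)
    then show "real_polynomial_function (f \<circ> q)"
      using * by (auto intro!: real_polynomial_function.intros(2-4))
  qed
qed

lemma polynomial_function_cmult [intro]:
  fixes q r :: "'a::real_normed_vector \<Rightarrow> complex"
  shows "polynomial_function q \<Longrightarrow> polynomial_function r \<Longrightarrow> polynomial_function (\<lambda>x. q x * r x)"
  unfolding polynomial_function_complex_iff
  by (auto intro: real_polynomial_function.intros(3,4) real_polynomial_function_diff)

lemma polynomial_function_cnj [intro]:
  fixes q :: "'a::real_normed_vector \<Rightarrow> complex"
  shows "polynomial_function q \<Longrightarrow> polynomial_function (\<lambda>x. cnj (q x))"
  unfolding polynomial_function_complex_iff
  by (auto intro: real_polynomial_function_minus)

lemma polynomial_function_crd [intro, simp]: "polynomial_function (crd i)"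
  by (rule polynomial_function_bounded_linear)
    (rule bounded_linear_compose[OF bounded_linear_of_real bounded_linear_vec_nth])

text \<open>Real polynomial functions are generated by all bounded linear functionals. Expanding
  such a functional in coordinates leaves the functions \<open>crd i\<close> as generators, on which
  \<open>partial\<close> is known explicitly.\<close>

lemma polynomial_function_complex_induct [consumes 1, case_names const crd add mult]:
  fixes q :: "real ^ 'n::finite \<Rightarrow> complex"
  assumes q: "polynomial_function q"
    and const: "\<And>c. P (\<lambda>x. c)"
    and crd: "\<And>i. P (crd i)"
    and add: "\<And>q r. P q \<Longrightarrow> P r \<Longrightarrow> P (\<lambda>x. q x + r x)"
    and mult: "\<And>q r. P q \<Longrightarrow> P r \<Longrightarrow> P (\<lambda>x. q x * r x)"
  shows "P q"
proof -
  have sum: "P (\<lambda>x. \<Sum>a\<in>A. f a x)" if "finite A" "\<And>a. P (f a)" for A and f :: "'n \<Rightarrow> _"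
    using that by (induction A rule: finite_induct) (auto intro: add const)
  have real: "P (\<lambda>x. complex_of_real (p x))" if "real_polynomial_function p" for p
    using that
  proof (induction p)
    case (linear f)
    have lin: "linear f" using linear by (simp add: bounded_linear.linear)
    have "f x = (\<Sum>j\<in>UNIV. x $ j * f (axis j 1))" for x
      by (subst vec_eq_sum_axis[of x]) (simp add: linear_sum[OF lin] linear_scale[OF lin])
    then have "complex_of_real (f x) = (\<Sum>j\<in>UNIV. crd j x * of_real (f (axis j 1)))" for x
      by (metis (no_types, lifting) of_real_mult of_real_sum sum.cong)
    then have "(\<lambda>x. complex_of_real (f x)) = (\<lambda>x. \<Sum>j\<in>UNIV. crd j x * of_real (f (axis j 1)))"
      by (rule ext)
    then show ?case by (auto intro!: sum mult crd const)
  qed (auto intro: const add mult)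
  have "P (\<lambda>x. of_real (Re (q x)) + \<i> * of_real (Im (q x)))"
    using q by (auto intro!: add mult const real simp: polynomial_function_complex_iff)
  then show ?thesis by (simp add: complex_eq_iff flip: complex_eq)
qed

lemma differentiable_poly [simp]:
  fixes q :: "real ^ 'n::finite \<Rightarrow> complex"
  shows "polynomial_function q \<Longrightarrow> q differentiable (at x)"
  by (rule differentiable_at_polynomial_function)

lemma partial_poly_mult:
  fixes q r :: "real ^ 'n::finite \<Rightarrow> complex"
  shows "polynomial_function q \<Longrightarrow> polynomial_function r \<Longrightarrow>
    partial j (\<lambda>x. q x * r x) = (\<lambda>x. q x * partial j r x + partial j q x * r x)"
  by (auto simp: partial_mult fun_eq_iff)

lemma partial_poly_add:
  fixes q r :: "real ^ 'n::finite \<Rightarrow> complex"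
  shows "polynomial_function q \<Longrightarrow> polynomial_function r \<Longrightarrow>
    partial j (\<lambda>x. q x + r x) = (\<lambda>x. partial j q x + partial j r x)"
  by (auto simp: partial_add fun_eq_iff)

lemma partial_poly_diff:
  fixes q r :: "real ^ 'n::finite \<Rightarrow> complex"
  shows "polynomial_function q \<Longrightarrow> polynomial_function r \<Longrightarrow>
    partial j (\<lambda>x. q x - r x) = (\<lambda>x. partial j q x - partial j r x)"
  by (auto simp: partial_diff fun_eq_iff)

lemma partial_const_fun [simp]: "partial j (\<lambda>x. c) = (\<lambda>x. 0)"
  by (simp add: fun_eq_iff)

lemma partial_crd_fun: "partial j (crd i) = (\<lambda>x. of_bool (i = j))"
  by (simp add: fun_eq_iff partial_crd)

lemma polynomial_function_partial [intro, simp]: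
  fixes q :: "real ^ 'n::finite \<Rightarrow> complex"
  assumes "polynomial_function q" shows "polynomial_function (partial j q)"
proof -
  \<comment> \<open>The product rule needs differentiable factors, so polynomiality of
    \<open>q\<close> is carried through the induction.\<close>
  have "polynomial_function q \<and> polynomial_function (partial j q)"
    using assms
    by (induction q rule: polynomial_function_complex_induct)
      (auto simp: partial_poly_mult partial_poly_add partial_crd_fun)
  then show ?thesis ..
qed

lemma partial_commute_poly:
  fixes q :: "real ^ 'n::finite \<Rightarrow> complex"
  assumes "polynomial_function q" shows "partial i (partial j q) = partial j (partial i q)"
proof -
  have "polynomial_function q \<and> partial i (partial j q) = partial j (partial i q)"
    using assms
  proof (induction q rule: polynomial_function_complex_induct)
    case (mult q r)
    then show ?case
      by (auto simp: partial_poly_mult partial_poly_add polynomial_function_cmult fun_eq_iff algebra_simps)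
  qed (auto simp: partial_poly_add partial_crd_fun)
  then show ?thesis ..
qed

lemma laplacian_add:
  fixes q r :: "real ^ 'n::finite \<Rightarrow> complex"
  shows "polynomial_function q \<Longrightarrow> polynomial_function r \<Longrightarrow>
    laplacian (\<lambda>x. q x + r x) x = laplacian q x + laplacian r x"
  by (simp add: laplacian_def partial_poly_add sum.distrib)

lemma laplacian_diff:
  fixes q r :: "real ^ 'n::finite \<Rightarrow> complex"
  shows "polynomial_function q \<Longrightarrow> polynomial_function r \<Longrightarrow>
    laplacian (\<lambda>x. q x - r x) x = laplacian q x - laplacian r x"
  by (simp add: laplacian_def partial_poly_diff sum_subtractf)

lemma laplacian_cmult:
  fixes q :: "real ^ 'n::finite \<Rightarrow> complex"
  shows "polynomial_function q \<Longrightarrow> laplacian (\<lambda>x. c * q x) x = c * laplacian q x"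
  by (simp add: laplacian_def partial_poly_mult sum_distrib_left)

lemma partial_cnj_poly:
  fixes q :: "real ^ 'n::finite \<Rightarrow> complex"
  shows "polynomial_function q \<Longrightarrow> partial j (\<lambda>x. cnj (q x)) = (\<lambda>x. cnj (partial j q x))"
  by (auto simp: partial_cnj fun_eq_iff)

lemma laplacian_cnj:
  fixes q :: "real ^ 'n::finite \<Rightarrow> complex"
  shows "polynomial_function q \<Longrightarrow> laplacian (\<lambda>x. cnj (q x)) x = cnj (laplacian q x)"
  by (simp add: laplacian_def partial_cnj_poly)

lemma laplacian_partial:
  fixes q :: "real ^ 'n::finite \<Rightarrow> complex"
  assumes q: "polynomial_function q"
  shows "laplacian (partial j q) = partial j (laplacian q)"
proof
  fix x
  have "partial i (partial i (partial j q)) = partial j (partial i (partial i q))" for i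
    using q partial_commute_poly[of q i j] partial_commute_poly[of "partial i q" i j] by simp
  then have "laplacian (partial j q) x = (\<Sum>i\<in>UNIV. partial j (partial i (partial i q)) x)"
    by (simp add: laplacian_def)
  also have "\<dots> = partial j (\<lambda>x. \<Sum>i\<in>UNIV. partial i (partial i q) x) x"
    using q by (subst partial_sum) auto
  finally show "laplacian (partial j q) x = partial j (laplacian q) x"
    by (simp add: laplacian_def[abs_def])
qed

lemma laplacian_crd_mult:
  fixes q :: "real ^ 'n::finite \<Rightarrow> complex"
  assumes q: "polynomial_function q"
  shows "laplacian (\<lambda>x. crd i x * q x) x = 2 * partial i q x + crd i x * laplacian q x"
proof -
  have "partial k (partial k (\<lambda>x. crd i x * q x)) x
      = crd i x * partial k (partial k q) x + 2 * (of_bool (i = k) * partial k q x)" for k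
    using q
    by (subst partial_poly_mult | auto simp: partial_poly_add partial_poly_mult partial_crd_fun
        polynomial_function_cmult)+
  then show ?thesis
    unfolding laplacian_def
    by (simp add: sum.distrib sum_distrib_left[symmetric] of_bool_def if_distrib[where f="\<lambda>c. c * _"]
        cong: if_cong)
qed

text \<open>The radial derivative \<open>r d/dr\<close>, which is also the first-order part of
  \<open>hyp_laplacian\<close>.\<close>

definition euler :: "(real ^ 'n::finite \<Rightarrow> complex) \<Rightarrow> real ^ 'n \<Rightarrow> complex" where
  "euler f x = (\<Sum>i\<in>UNIV. x $ i *\<^sub>R partial i f x)"

lemma nsq_eq: "complex_of_real ((norm x)\<^sup>2) = (\<Sum>i\<in>UNIV. crd i x * crd i x)"
  for x :: "real ^ 'n::finite"
  by (simp add: power2_norm_eq_inner inner_vec_def)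

lemma polynomial_function_nsq [intro, simp]:
  "polynomial_function (\<lambda>x::real ^ 'n::finite. complex_of_real ((norm x)\<^sup>2))"
  unfolding nsq_eq by (auto intro!: polynomial_function_sum)

text \<open>For a homogeneous harmonic \<open>q\<close> the Euler term is a multiple of
  \<open>q\<close>, so that the right side becomes a multiple of \<open>q\<close> as a whole. This
  determines the constant \<kappa> in \<open>harmonic_poly_crd_mult\<close>.\<close>

lemma laplacian_nsq_mult:
  fixes q :: "real ^ 'n::finite \<Rightarrow> complex"
  assumes q: "polynomial_function q"
  shows "laplacian (\<lambda>x. of_real ((norm x)\<^sup>2) * q x) x
    = 2 * of_nat CARD('n) * q x + 4 * euler q x + of_real ((norm x)\<^sup>2) * laplacian q x"
proof -
  have nsq: "partial k (\<lambda>x::real^'n. complex_of_real ((norm x)\<^sup>2)) = (\<lambda>x. 2 * crd k x)" for k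
  proof
    fix x
    have "partial k (\<lambda>x::real^'n. complex_of_real ((norm x)\<^sup>2)) x
        = (\<Sum>i\<in>UNIV. partial k (\<lambda>x. crd i x * crd i x) x)"
      unfolding nsq_eq by (rule partial_sum) (auto simp: polynomial_function_cmult)
    also have "\<dots> = (\<Sum>i\<in>UNIV. if i = k then 2 * crd i x else 0)"
      by (rule sum.cong) (auto simp: partial_mult partial_crd)
    finally show "partial k (\<lambda>x::real^'n. complex_of_real ((norm x)\<^sup>2)) x = 2 * crd k x"
      by simp
  qed
  have 1: "partial k (\<lambda>x. of_real ((norm x)\<^sup>2) * q x)
      = (\<lambda>x. of_real ((norm x)\<^sup>2) * partial k q x + (2 * crd k x) * q x)" for k
    using q by (subst partial_poly_mult) (simp_all only: polynomial_function_nsq nsq)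
  have 2: "partial k (\<lambda>x. (2 * crd k x) * q x) x = 2 * (crd k x * partial k q x) + 2 * q x" for k x
    using q by (subst partial_mult) (auto simp: partial_cmult partial_crd polynomial_function_cmult)
  have "partial k (partial k (\<lambda>x. of_real ((norm x)\<^sup>2) * q x)) x
      = of_real ((norm x)\<^sup>2) * partial k (partial k q) x + 4 * (crd k x * partial k q x) + 2 * q x" for k
    unfolding 1 using q
    by (subst partial_add)
      (auto simp: 2 partial_mult nsq polynomial_function_cmult simp del: of_real_power)
  then show ?thesis
    unfolding laplacian_def euler_def
    by (simp add: sum.distrib sum_distrib_left scaleR_conv_of_real mult_ac)
qed

lemma polynomial_function_norm_power2 [intro, simp]:
  "polynomial_function (\<lambda>x::real ^ 'n::finite. (complex_of_real (norm x))\<^sup>2)"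
  using polynomial_function_nsq by simp

section \<open>Homogeneous harmonic polynomials\<close>

lemma harmonic_polyD:
  assumes "q \<in> harmonic_poly m"
  shows "polynomial_function q" "q (c *\<^sub>R x) = c ^ m *\<^sub>R q x" "laplacian q x = 0"
  using assms by (auto simp: harmonic_poly_def)

lemma harmonic_poly_zero [simp, intro]: "(\<lambda>x. 0) \<in> harmonic_poly m"
  by (auto simp: harmonic_poly_def laplacian_def)

lemma harmonic_poly_const [simp, intro]: "(\<lambda>x. c) \<in> harmonic_poly 0"
  by (auto simp: harmonic_poly_def laplacian_def)

lemma harmonic_poly_add [intro]:
  "q \<in> harmonic_poly m \<Longrightarrow> r \<in> harmonic_poly m \<Longrightarrow> (\<lambda>x. q x + r x) \<in> harmonic_poly m"
  by (auto simp: harmonic_poly_def laplacian_add scaleR_right_distrib)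

lemma harmonic_poly_diff [intro]:
  "q \<in> harmonic_poly m \<Longrightarrow> r \<in> harmonic_poly m \<Longrightarrow> (\<lambda>x. q x - r x) \<in> harmonic_poly m"
  by (auto simp: harmonic_poly_def laplacian_diff scaleR_right_diff_distrib)

lemma harmonic_poly_cmult [intro]:
  "q \<in> harmonic_poly m \<Longrightarrow> (\<lambda>x. c * q x) \<in> harmonic_poly m"
  by (auto simp: harmonic_poly_def laplacian_cmult)

lemma harmonic_poly_scaleR [intro]:
  "q \<in> harmonic_poly m \<Longrightarrow> (\<lambda>x. c *\<^sub>R q x) \<in> harmonic_poly m"
  using harmonic_poly_cmult[of q m "of_real c"] by (simp add: scaleR_conv_of_real[where 'a=complex])

lemma harmonic_poly_cnj [intro]:
  "q \<in> harmonic_poly m \<Longrightarrow> (\<lambda>x. cnj (q x)) \<in> harmonic_poly m"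
  by (auto simp: harmonic_poly_def laplacian_cnj)

lemma harmonic_poly_sum [intro]:
  "finite A \<Longrightarrow> (\<And>a. a \<in> A \<Longrightarrow> f a \<in> harmonic_poly m) \<Longrightarrow> (\<lambda>x. \<Sum>a\<in>A. f a x) \<in> harmonic_poly m"
  by (induction A rule: finite_induct) auto

lemma continuous_on_poly [intro]:
  fixes q :: "real ^ 'n::finite \<Rightarrow> complex"
  shows "polynomial_function q \<Longrightarrow> continuous_on S q"
  by (rule continuous_on_polymonial_function)

lemma partial_scaled:
  fixes q :: "real ^ 'n::finite \<Rightarrow> complex"
  assumes "q differentiable (at (c *\<^sub>R x))"
  shows "partial j (\<lambda>x. q (c *\<^sub>R x)) x = c *\<^sub>R partial j q (c *\<^sub>R x)"
proof -
  have "((\<lambda>x. q (c *\<^sub>R x)) has_derivative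
      (\<lambda>v. \<Sum>k\<in>UNIV. (c *\<^sub>R v) $ k *\<^sub>R partial k q (c *\<^sub>R x))) (at x)"
    by (rule has_derivative_compose[where f="\<lambda>x. c *\<^sub>R x" and f'="\<lambda>x. c *\<^sub>R x" and g=q,
          OF _ has_derivative_partial[OF assms]])
      (auto intro!: derivative_eq_intros)
  from partial_eqI[OF this, of j] show ?thesis
    by (simp add: axis_def if_distrib[where f="\<lambda>r. (c * r) *\<^sub>R _"] cong: if_cong)
qed

text \<open>Euler's identity: \<open>q (t *\<^sub>R x) = t ^ m *\<^sub>R q x\<close> is
  differentiated in \<open>t\<close> at \<open>t = 1\<close>, by the chain rule on the left and
  directly on the right.\<close>

lemma euler_harmonic:
  fixes q :: "real ^ 'n::finite \<Rightarrow> complex"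
  assumes q: "q \<in> harmonic_poly m"
  shows "euler q x = of_nat m * q x"
proof -
  have d: "q differentiable (at (1 *\<^sub>R x))" using harmonic_polyD(1)[OF q] by simp
  have "((\<lambda>t. q (t *\<^sub>R x)) has_derivative
      (\<lambda>t. \<Sum>k\<in>UNIV. (t *\<^sub>R x) $ k *\<^sub>R partial k q (1 *\<^sub>R x))) (at (1::real))"
    by (rule has_derivative_compose[where f="\<lambda>t. t *\<^sub>R x" and f'="\<lambda>t. t *\<^sub>R x" and g=q,
          OF _ has_derivative_partial[OF d]])
      (auto intro!: derivative_eq_intros)
  moreover have "((\<lambda>t. q (t *\<^sub>R x)) has_derivative (\<lambda>t. (real m * t) *\<^sub>R q x)) (at (1::real))"
    unfolding harmonic_polyD(2)[OF q] by (auto intro!: derivative_eq_intros)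
  ultimately have "(\<lambda>t. \<Sum>k\<in>UNIV. (t *\<^sub>R x) $ k *\<^sub>R partial k q (1 *\<^sub>R x)) = (\<lambda>t. (real m * t) *\<^sub>R q x)"
    by (rule has_derivative_unique)
  from fun_cong[OF this, of 1] show ?thesis
    by (simp add: euler_def scaleR_conv_of_real[where 'a=complex])
qed

lemma harmonic_poly_0_const:
  assumes "q \<in> harmonic_poly 0" shows "q x = q 0"
  using harmonic_polyD(2)[OF assms, of 0 x] by simp

text \<open>The truncated degree \<open>m - 1\<close> is harmless at \<open>m = 0\<close>: the
  derivative is then zero, and zero belongs to \<open>harmonic_poly\<close> of every degree.\<close>

lemma harmonic_poly_partial [intro]:
  fixes q :: "real ^ 'n::finite \<Rightarrow> complex"
  assumes q: "q \<in> harmonic_poly m"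
  shows "partial i q \<in> harmonic_poly (m - 1)"
proof (cases m)
  case 0
  then have "q = (\<lambda>x. q 0)" using harmonic_poly_0_const q by auto
  then have "partial i q = (\<lambda>x. 0)" by (metis partial_const_fun)
  then show ?thesis by simp
next
  case (Suc k)
  note P = harmonic_polyD(1)[OF q]
  have nz: "partial i q (c *\<^sub>R x) = c ^ k *\<^sub>R partial i q x" if "c \<noteq> 0" for c x
  proof -
    have "c *\<^sub>R partial i q (c *\<^sub>R x) = partial i (\<lambda>x. q (c *\<^sub>R x)) x"
      using P by (simp add: partial_scaled)
    also have "\<dots> = c ^ m *\<^sub>R partial i q x"
      unfolding harmonic_polyD(2)[OF q] using P by (simp add: partial_scaleR)
    finally show ?thesis using that Suc by (metis power_Suc scaleR_left_imp_eq scaleR_scaleR)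
  qed
  \<comment> \<open>The preceding step divides by \<open>c\<close> and so misses
    \<open>c = 0\<close>. With \<open>k = 0\<close> this case is not vacuous, since
    \<open>0 ^ 0 = 1\<close>; it is recovered by continuity in \<open>c\<close>.\<close>
  have z: "partial i q (0 *\<^sub>R x) = 0 ^ k *\<^sub>R partial i q x" for x
  proof -
    let ?F = "\<lambda>c. partial i q (c *\<^sub>R x) - c ^ k *\<^sub>R partial i q x"
    have "continuous_on UNIV ?F"
      by (intro continuous_intros continuous_on_compose2[OF continuous_on_poly[of "partial i q" UNIV]])
        (auto simp: P)
    then have "isCont ?F 0"
      using continuous_on_eq_continuous_at[OF open_UNIV] by blast
    then have "(?F \<longlongrightarrow> ?F 0) (at 0)"
      by (simp only: isCont_def)
    moreover have "eventually (\<lambda>c. ?F c = 0) (at 0)"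
      using nz by (auto simp: eventually_at_filter)
    then have "(?F \<longlongrightarrow> 0) (at 0)"
      by (rule tendsto_eventually)
    ultimately have "?F 0 = 0" by (rule tendsto_unique[rotated]) simp
    then show ?thesis by simp
  qed
  have "partial i q (c *\<^sub>R x) = c ^ k *\<^sub>R partial i q x" for c x
    using nz z by (cases "c = 0") auto
  moreover have "laplacian q = (\<lambda>x. 0)" using harmonic_polyD(3)[OF q] by auto
  then have "laplacian (partial i q) x = 0" for x
    using laplacian_partial[OF P, of i] by simp
  ultimately show ?thesis
    using P Suc by (auto simp: harmonic_poly_def)
qed

text \<open>For \<open>m = 0\<close> and \<open>n = 2\<close> the coefficient is \<open>1 / 0 = 0\<close>, which is harmless because \<open>q\<close> is constant then.\<close>

lemma harmonic_poly_crd_mult: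
  fixes q :: "real ^ 'n::finite \<Rightarrow> complex"
  assumes q: "q \<in> harmonic_poly m"
  defines "\<kappa> \<equiv> 1 / (real CARD('n) + 2 * real m - 2)"
  shows "(\<lambda>x. crd i x * q x - \<kappa> *\<^sub>R (of_real ((norm x)\<^sup>2) * partial i q x)) \<in> harmonic_poly (Suc m)"
proof -
  note P = harmonic_polyD(1)[OF q]
  have Q: "partial i q \<in> harmonic_poly (m - 1)" by (rule harmonic_poly_partial[OF q])
  have Qm: "partial i q (c *\<^sub>R x) = c ^ (m - 1) *\<^sub>R partial i q x" for c x
    using harmonic_polyD(2)[OF Q] by blast
  have Q0: "partial i q = (\<lambda>x. 0)" if "m = 0"
  proof -
    have "q = (\<lambda>x. q 0)" using harmonic_poly_0_const q that by auto
    then show ?thesis by (metis partial_const_fun)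
  qed
  let ?B = "\<lambda>x. complex_of_real \<kappa> * (of_real ((norm x)\<^sup>2) * partial i q x)"
  have pB: "polynomial_function ?B" using P
    by (intro polynomial_function_cmult) (auto simp del: of_real_power)
  have pA: "polynomial_function (\<lambda>x. crd i x * q x)" using P by auto
  have L: "laplacian (\<lambda>x. crd i x * q x - ?B x) x = 0" for x
  proof -
    have "laplacian ?B x = of_real \<kappa> * laplacian (\<lambda>x. of_real ((norm x)\<^sup>2) * partial i q x) x"
      using P by (intro laplacian_cmult polynomial_function_cmult) auto
    also have "laplacian (\<lambda>x. of_real ((norm x)\<^sup>2) * partial i q x) x
        = (2 * of_nat CARD('n) + 4 * of_nat (m - 1)) * partial i q x"
      using P harmonic_polyD(3)[OF Q] euler_harmonic[OF Q]
      by (subst laplacian_nsq_mult) (auto simp: algebra_simps)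
    also have "of_real \<kappa> * \<dots> = 2 * partial i q x"
    proof (cases "m = 0")
      case False
      then have *: "2 * of_nat CARD('n) + 4 * of_nat (m - 1)
          = complex_of_real (2 * (real CARD('n) + 2 * real m - 2))"
        by (simp add: of_nat_diff algebra_simps)
      have "real CARD('n) \<ge> 1" "real m \<ge> 1"
        using False by (simp_all add: Suc_leI)
      then have "real CARD('n) + 2 * real m - 2 \<noteq> 0" by linarith
      moreover have "1 / D * (2 * D) = 2" if "D \<noteq> 0" for D :: real
        using that by simp
      ultimately have "\<kappa> * (2 * (real CARD('n) + 2 * real m - 2)) = 2"
        unfolding \<kappa>_def by blast
      then have "complex_of_real \<kappa> * complex_of_real (2 * (real CARD('n) + 2 * real m - 2)) = 2"
        by (metis of_real_mult of_real_numeral)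
      then show ?thesis unfolding * mult.assoc[symmetric] by (simp only:)
    qed (simp add: Q0)
    finally show ?thesis
      using P pA pB harmonic_polyD(3)[OF q] by (simp add: laplacian_diff laplacian_crd_mult del: of_real_power)
  qed
  have M: "crd i (c *\<^sub>R x) * q (c *\<^sub>R x) - ?B (c *\<^sub>R x) = c ^ Suc m *\<^sub>R (crd i x * q x - ?B x)" for c x
  proof (cases "m = 0")
    case True then show ?thesis
      using harmonic_polyD(2)[OF q, of c x] Q0 by (simp add: scaleR_conv_of_real[where 'a=complex])
  next
    case False
    then have "c\<^sup>2 * c ^ (m - 1) = c ^ Suc m" by (cases m) (auto simp: power2_eq_square)
    then have "complex_of_real c ^ 2 * complex_of_real c ^ (m - 1) = of_real c * of_real c ^ m"
      by (metis of_real_mult of_real_power power_Suc)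
    then show ?thesis unfolding harmonic_polyD(2)[OF q] Qm
      by (simp add: scaleR_conv_of_real[where 'a=complex] algebra_simps power_mult_distrib)
  qed
  have "(\<lambda>x. crd i x * q x - ?B x) \<in> harmonic_poly (Suc m)"
    unfolding harmonic_poly_def by (intro CollectI conjI allI polynomial_function_diff[OF pA pB] L M)
  then show ?thesis by (simp add: scaleR_conv_of_real[where 'a=complex])
qed

section \<open>Tangential derivatives\<close>

lemma tangential_poly:
  "tangential i j q = (\<lambda>x. crd i x * partial j q x - crd j x * partial i q x)"
  by (simp add: fun_eq_iff tangential_def scaleR_conv_of_real[where 'a=complex])

text \<open>The Laplacian of \<open>x\<^sub>i \<partial>\<^sub>j q - x\<^sub>j \<partial>\<^sub>i
  q\<close> is twice the commutator of \<open>\<partial>\<^sub>i\<close> and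
  \<open>\<partial>\<^sub>j\<close> on \<open>q\<close>, hence zero.\<close>

lemma harmonic_poly_tangential [intro]:
  fixes q :: "real ^ 'n::finite \<Rightarrow> complex"
  assumes q: "q \<in> harmonic_poly m"
  shows "tangential i j q \<in> harmonic_poly m"
proof -
  note P = harmonic_polyD(1)[OF q]
  have H: "partial k q (c *\<^sub>R x) = c ^ (m - 1) *\<^sub>R partial k q x" "laplacian (partial k q) x = 0" for k c x
    using harmonic_polyD[OF harmonic_poly_partial[OF q, of k]] by blast+
  have "laplacian (tangential i j q) x = 0" for x
    unfolding tangential_poly using P partial_commute_poly[OF P, of i j]
    by (subst laplacian_diff) (auto simp: laplacian_crd_mult H)
  moreover have "tangential i j q (c *\<^sub>R x) = c ^ m *\<^sub>R tangential i j q x" for c x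
  proof (cases m)
    case 0
    then have "q = (\<lambda>x. q 0)" using harmonic_poly_0_const q by auto
    then have "partial k q = (\<lambda>x. 0)" for k by (metis partial_const_fun)
    then show ?thesis by (simp add: tangential_poly)
  next
    case (Suc k)
    then show ?thesis
      unfolding tangential_poly H vector_scaleR_component
      by (simp add: scaleR_conv_of_real[where 'a=complex] algebra_simps)
  qed
  ultimately show ?thesis using P
    by (auto simp: harmonic_poly_def tangential_poly intro!: polynomial_function_diff polynomial_function_cmult)
qed

lemma tangential_mult:
  fixes f g :: "real ^ 'n::finite \<Rightarrow> complex"
  shows "f differentiable (at x) \<Longrightarrow> g differentiable (at x) \<Longrightarrow>
   tangential i j (\<lambda>x. f x * g x) x = f x * tangential i j g x + tangential i j f x * g x"
  by (simp add: tangential_def partial_mult algebra_simps scaleR_conv_of_real[where 'a=complex])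

lemma tangential_swap: "tangential j i f x = - tangential i j f x"
  by (simp add: tangential_def)

lemma partial_euler:
  fixes f :: "real ^ 'n::finite \<Rightarrow> complex"
  assumes pf: "\<And>j. partial j f differentiable (at x)"
  shows "partial k (euler f) x = partial k f x + (\<Sum>i\<in>UNIV. x $ i *\<^sub>R partial k (partial i f) x)"
proof -
  have cd: "(\<lambda>x. crd i x * partial j f x) differentiable (at x)" for i j
    by (intro differentiable_mult pf) auto
  have "partial k (euler f) x = partial k (\<lambda>x. \<Sum>i\<in>UNIV. crd i x * partial i f x) x"
    by (simp add: euler_def[abs_def] scaleR_conv_of_real[where 'a=complex])
  also have "\<dots> = (\<Sum>i\<in>UNIV. partial k (\<lambda>x. crd i x * partial i f x) x)"
    by (rule partial_sum) (auto simp: cd)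
  also have "\<dots> = (\<Sum>i\<in>UNIV. crd i x * partial k (partial i f) x + (if i = k then partial i f x else 0))"
    by (intro sum.cong) (auto simp: partial_mult pf partial_crd)
  finally show ?thesis by (simp add: sum.distrib scaleR_conv_of_real[where 'a=complex])
qed

lemma euler_euler:
  fixes f :: "real ^ 'n::finite \<Rightarrow> complex"
  assumes pf: "\<And>j. partial j f differentiable (at x)"
  shows "euler (euler f) x = euler f x + (\<Sum>i\<in>UNIV. \<Sum>j\<in>UNIV. (x $ i * x $ j) *\<^sub>R partial i (partial j f) x)"
  by (simp add: euler_def[of "euler f"] euler_def[of f] partial_euler pf scaleR_right_distrib
      scaleR_sum_right sum.distrib)

text \<open>The sum over all ordered pairs makes symmetry of second derivatives unnecessary.\<close>

lemma sum_tangential_squared: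
  fixes f :: "real ^ 'n::finite \<Rightarrow> complex"
  assumes f: "f differentiable (at x)" and pf: "\<And>j. partial j f differentiable (at x)"
  shows "(\<Sum>i\<in>UNIV. \<Sum>j\<in>UNIV. tangential i j (tangential i j f) x)
    = 2 * ((norm x)\<^sup>2 *\<^sub>R laplacian f x - euler (euler f) x - (real CARD('n) - 2) *\<^sub>R euler f x)"
proof -
  let ?x = "\<lambda>i. complex_of_real (x $ i)" and ?p = "\<lambda>i. partial i f x"
  let ?pp = "\<lambda>i j. partial i (partial j f) x"
  have cd: "(\<lambda>x. crd i x * partial j f x) differentiable (at x)" for i j
    by (intro differentiable_mult pf) auto
  have T: "partial k (tangential i j f) x
      = ?x i * ?pp k j + of_bool (i = k) * ?p j - ?x j * ?pp k i - of_bool (j = k) * ?p i" for i j k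
    unfolding tangential_poly
    by (subst partial_diff) (auto simp: cd partial_mult pf partial_crd)
  have EE: "euler (euler f) x = euler f x + (\<Sum>i\<in>UNIV. \<Sum>j\<in>UNIV. ?x i * ?x j * ?pp i j)"
    by (simp add: euler_euler pf scaleR_conv_of_real[where 'a=complex])
  \<comment> \<open>The last summand corrects the generic formula on the diagonal, where the
    operator vanishes. After summation this correction and the first-order term of
    \<open>euler_euler\<close> turn the factor \<open>n\<close> into \<open>n - 2\<close>.\<close>
  have TT: "tangential i j (tangential i j f) x
     = ?x i * ?x i * ?pp j j + ?x j * ?x j * ?pp i i - ?x i * ?x j * ?pp j i - ?x j * ?x i * ?pp i j
       - ?x i * ?p i - ?x j * ?p j + (if i = j then 2 * (?x i * ?p i) else 0)" for i j
    unfolding tangential_def[of i j "tangential i j f"] T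
    by (auto simp: scaleR_conv_of_real[where 'a=complex] algebra_simps)
  have *: "(\<Sum>i\<in>UNIV. \<Sum>j\<in>UNIV. ?x i * ?x i * ?pp j j) = (norm x)\<^sup>2 *\<^sub>R laplacian f x"
    by (simp add: nsq_eq laplacian_def scaleR_conv_of_real[where 'a=complex] sum_product del: of_real_power)
  moreover have "(\<Sum>i\<in>UNIV. \<Sum>j\<in>UNIV. ?x i * ?x i * ?pp j j) = (norm x)\<^sup>2 *\<^sub>R laplacian f x"
    by fact
  moreover have "(\<Sum>i\<in>UNIV. \<Sum>j\<in>UNIV. ?x j * ?x j * ?pp i i) = (norm x)\<^sup>2 *\<^sub>R laplacian f x"
    by (subst sum.swap) fact
  moreover have "(\<Sum>i\<in>UNIV. \<Sum>j\<in>UNIV. ?x j * ?x i * ?pp i j) = (\<Sum>i\<in>UNIV. \<Sum>j\<in>UNIV. ?x i * ?x j * ?pp i j)"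
    by (simp add: mult.commute)
  moreover have "(\<Sum>i\<in>UNIV. \<Sum>j\<in>UNIV. ?x i * ?x j * ?pp j i) = (\<Sum>i\<in>UNIV. \<Sum>j\<in>UNIV. ?x i * ?x j * ?pp i j)"
    by (subst sum.swap) (simp add: mult.commute)
  moreover have "(\<Sum>i\<in>UNIV. \<Sum>j\<in>(UNIV::'n set). ?x i * ?p i) = of_nat CARD('n) * euler f x"
    by (simp add: euler_def scaleR_conv_of_real[where 'a=complex] sum_distrib_left)
  moreover have "(\<Sum>i\<in>(UNIV::'n set). \<Sum>j\<in>UNIV. ?x j * ?p j) = of_nat CARD('n) * euler f x"
    by (simp add: euler_def scaleR_conv_of_real[where 'a=complex])
  moreover have "(\<Sum>i\<in>UNIV. \<Sum>j\<in>UNIV. if i = j then 2 * (?x i * ?p i) else 0) = 2 * euler f x"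
    by (simp add: euler_def scaleR_conv_of_real[where 'a=complex] sum_distrib_left)
  ultimately show ?thesis
    unfolding EE TT sum.distrib sum_subtractf
    by (simp add: scaleR_conv_of_real[where 'a=complex] algebra_simps)
qed

text \<open>By Euler's identity \<open>euler\<close> acts as multiplication by \<open>m\<close>.
  What results is the eigenvalue \<open>m (m + n - 2)\<close> of the spherical Laplacian, doubled
  because each pair occurs in both orders.\<close>

lemma sum_tangential_squared_harmonic:
  fixes q :: "real ^ 'n::finite \<Rightarrow> complex"
  assumes q: "q \<in> harmonic_poly m"
  shows "(\<Sum>i\<in>UNIV. \<Sum>j\<in>UNIV. tangential i j (tangential i j q) x)
    = - (2 * real m * (real m + real CARD('n) - 2)) *\<^sub>R q x"
proof -
  note P = harmonic_polyD(1)[OF q]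
  have "euler q = (\<lambda>x. of_nat m * q x)" using euler_harmonic[OF q] by auto
  moreover have "euler (\<lambda>x. of_nat m * q x) x = of_nat m * (of_nat m * q x)"
    using q by (intro euler_harmonic) auto
  ultimately show ?thesis
    using P harmonic_polyD(3)[OF q]
    by (subst sum_tangential_squared) (auto simp: scaleR_conv_of_real[where 'a=complex] algebra_simps)
qed

section \<open>The invariant measure on the sphere\<close>

text \<open>The value at the origin is an arbitrary unit vector, so that the map lands on the sphere
  everywhere.\<close>

definition sph :: "real ^ 'n::finite \<Rightarrow> real ^ 'n" where
  "sph x = (if x = 0 then axis undefined 1 else x /\<^sub>R norm x)"

text \<open>Normalized surface measure as the image of the uniform distribution on the ball under
  radial projection. Total mass one and rotation invariance are inherited from Lebesgue
  measure.\<close>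

definition sphm :: "(real ^ 'n::finite) measure" where
  "sphm = distr (uniform_measure lborel (ball 0 1)) (restrict_space borel (sphere 0 1)) sph"

lemma norm_sph [simp]: "norm (sph x) = 1"
  by (simp add: sph_def)

lemma sph_measurable_borel [measurable]: "sph \<in> borel \<rightarrow>\<^sub>M borel"
  unfolding sph_def[abs_def] by measurable

lemma sph_measurable: "sph \<in> borel \<rightarrow>\<^sub>M restrict_space borel (sphere 0 1)"
  by (rule measurable_restrict_space2) auto

lemma sph_measurable_uniform:
  "sph \<in> uniform_measure lborel (ball 0 1) \<rightarrow>\<^sub>M restrict_space borel (sphere 0 1)"
  using sph_measurable by (simp add: measurable_def)

lemma space_sphm [simp]: "space sphm = sphere 0 1"
  by (simp add: sphm_def)

lemma sets_sphm [simp, measurable_cong]: "sets sphm = sets (restrict_space borel (sphere 0 1))"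
  by (simp add: sphm_def)

lemma emeasure_lborel_unit_ball:
  "emeasure lborel (ball (0 :: 'a :: euclidean_space) 1) \<noteq> 0"
  "emeasure lborel (ball (0 :: 'a :: euclidean_space) 1) \<noteq> \<infinity>"
proof -
  show "emeasure lborel (ball (0 :: 'a) 1) \<noteq> \<infinity>"
    using emeasure_lborel_ball_finite[of "0::'a" 1] by auto
  have "measure lborel (ball (0 :: 'a) 1) > 0"
    using content_ball_pos[of 1 "0::'a"] by simp
  then show "emeasure lborel (ball (0 :: 'a) 1) \<noteq> 0"
    by (auto simp: measure_def)
qed

lemma prob_space_uniform_ball: "prob_space (uniform_measure lborel (ball (0 :: 'a :: euclidean_space) 1))"
  by (rule prob_space_uniform_measure[OF emeasure_lborel_unit_ball])

lemma prob_space_sphm: "prob_space (sphm :: (real ^ 'n::finite) measure)"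
  unfolding sphm_def
  by (rule prob_space.prob_space_distr[OF prob_space_uniform_ball sph_measurable_uniform])

interpretation sphm: prob_space "sphm :: (real ^ 'n::finite) measure"
  by (rule prob_space_sphm)

lemma measurable_sphm_continuous:
  "continuous_on (sphere 0 1) h \<Longrightarrow> (h :: _ \<Rightarrow> 'b::topological_space) \<in> borel_measurable sphm"
  unfolding measurable_cong_sets[OF sets_sphm refl]
  by (rule borel_measurable_continuous_on_restrict)

lemma integrable_sphm_continuous:
  fixes h :: "real ^ 'n::finite \<Rightarrow> 'b::{banach, second_countable_topology}"
  assumes "continuous_on (sphere 0 1) h"
  shows "integrable sphm h"
proof -
  have "bounded (h ` sphere 0 1)"
    using assms by (intro compact_imp_bounded compact_continuous_image) auto
  then obtain B where "\<forall>x\<in>sphere 0 1. norm (h x) \<le> B" by (auto simp: bounded_iff)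
  then show ?thesis
    using assms by (intro sphm.integrable_const_bound[where B=B] AE_I2 measurable_sphm_continuous) auto
qed

lemma integral_sphm_eq:
  fixes h :: "real ^ 'n::finite \<Rightarrow> 'b::{banach, second_countable_topology}"
  assumes "h \<in> borel_measurable sphm"
  shows "integral\<^sup>L sphm h = integral\<^sup>L (uniform_measure lborel (ball 0 1)) (\<lambda>x. h (sph x))"
  unfolding sphm_def
  using assms sph_measurable_uniform
  by (subst integral_distr) (auto simp: measurable_cong_sets[OF sets_sphm refl])

text \<open>The uniqueness argument for Haar measure, with the invariant unit ball as comparison set.\<close>

lemma nn_integral_lborel_orthogonal:
  fixes R :: "'a::euclidean_space \<Rightarrow> 'a"
  assumes R: "orthogonal_transformation R" and [measurable]: "g \<in> borel_measurable borel"
  shows "(\<integral>\<^sup>+x. g (R x) \<partial>lborel) = (\<integral>\<^sup>+x. g x \<partial>lborel)"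
proof -
  have lin: "linear R" using R by (simp add: orthogonal_transformation_linear)
  have "continuous_on UNIV R"
    using lin by (simp add: linear_continuous_on linear_conv_bounded_linear[symmetric])
  then have [measurable]: "R \<in> borel \<rightarrow>\<^sub>M borel" by (rule borel_measurable_continuous_onI)
  let ?f = "indicator (ball 0 1) :: 'a \<Rightarrow> ennreal" and ?K = "emeasure lborel (ball (0::'a) 1)"
  have [measurable]: "ball (0::'a) 1 \<in> sets borel" by simp
  have fR: "?f (R x) = ?f x" for x using R by (simp add: indicator_def orthogonal_transformation_norm)
  have shift: "(\<integral>\<^sup>+x. u (a + x) \<partial>lborel) = (\<integral>\<^sup>+x. u x \<partial>lborel)"
    if [measurable]: "u \<in> borel_measurable borel" for u :: "'a \<Rightarrow> ennreal" and a
    by (subst (2) lborel_distr_plus[of a, symmetric]) (simp add: nn_integral_distr)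
  have flip: "(\<integral>\<^sup>+y. u (a - y) \<partial>lborel) = (\<integral>\<^sup>+x. u x \<partial>lborel)"
    if [measurable]: "u \<in> borel_measurable borel" for u :: "'a \<Rightarrow> ennreal" and a
    by (subst (2) lborel_affine[of "-1" a]) (simp_all add: nn_integral_density nn_integral_distr)
  have "?K * (\<integral>\<^sup>+y. g y \<partial>lborel) = (\<integral>\<^sup>+x. (\<integral>\<^sup>+y. ?f (R x) * g y \<partial>lborel) \<partial>lborel)"
    unfolding fR by (subst nn_integral_cmult, simp, subst nn_integral_multc) auto
  also have "\<dots> = (\<integral>\<^sup>+x. (\<integral>\<^sup>+y. ?f (R x) * g (R x + y) \<partial>lborel) \<partial>lborel)"
    by (simp add: nn_integral_cmult shift)
  also have "\<dots> = (\<integral>\<^sup>+y. (\<integral>\<^sup>+x. ?f (R x) * g (R x + y) \<partial>lborel) \<partial>lborel)"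
    by (rule lborel_pair.Fubini'[symmetric]) measurable
  \<comment> \<open>Translating \<open>x\<close> by \<open>- inv R y\<close> turns
    \<open>R x + y\<close> into \<open>R x\<close>; integrating over \<open>y\<close> first then
    separates the two factors.\<close>
  also have "\<dots> = (\<integral>\<^sup>+y. (\<integral>\<^sup>+x. ?f (R x - y) * g (R x) \<partial>lborel) \<partial>lborel)"
  proof (rule nn_integral_cong)
    fix y
    have y: "R (inv R y) = y"
      using orthogonal_transformation_surj[OF R] by (simp add: surj_f_inv_f)
    show "(\<integral>\<^sup>+x. ?f (R x) * g (R x + y) \<partial>lborel) = (\<integral>\<^sup>+x. ?f (R x - y) * g (R x) \<partial>lborel)"
      by (subst shift[where a="- inv R y", symmetric])
        (simp_all add: linear_add[OF lin] linear_neg[OF lin] linear_diff[OF lin] y)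
  qed
  also have "\<dots> = (\<integral>\<^sup>+x. (\<integral>\<^sup>+y. ?f (R x - y) * g (R x) \<partial>lborel) \<partial>lborel)"
    by (rule lborel_pair.Fubini'[symmetric]) measurable
  also have "\<dots> = (\<integral>\<^sup>+x. (\<integral>\<^sup>+y. ?f y \<partial>lborel) * g (R x) \<partial>lborel)"
    by (intro nn_integral_cong) (simp add: nn_integral_multc flip)
  also have "\<dots> = ?K * (\<integral>\<^sup>+x. g (R x) \<partial>lborel)"
    by (simp add: nn_integral_cmult)
  finally show ?thesis
    using emeasure_lborel_unit_ball[where 'a='a] by (simp add: ennreal_mult_cancel_left)
qed

lemma distr_lborel_orthogonal:
  fixes R :: "'a::euclidean_space \<Rightarrow> 'a"
  assumes R: "orthogonal_transformation R"
  shows "distr lborel borel R = lborel"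
proof (rule measure_eqI)
  have "continuous_on UNIV R"
    using R by (simp add: orthogonal_transformation_linear linear_continuous_on linear_conv_bounded_linear[symmetric])
  then have [measurable]: "R \<in> borel \<rightarrow>\<^sub>M borel" by (rule borel_measurable_continuous_onI)
  fix A assume "A \<in> sets (distr lborel borel R)"
  then have [measurable]: "A \<in> sets borel" by simp
  have "emeasure (distr lborel borel R) A = (\<integral>\<^sup>+x. indicator A x \<partial>distr lborel borel R)"
    by simp
  also have "\<dots> = (\<integral>\<^sup>+x. indicator A (R x) \<partial>lborel)"
    by (rule nn_integral_distr) auto
  also have "\<dots> = emeasure lborel A"
    by (subst nn_integral_lborel_orthogonal[OF R]) auto
  finally show "emeasure (distr lborel borel R) A = emeasure lborel A" .
qed simp

text \<open>\<open>R\<close> preserves the uniform distribution on the ball and commutes with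
  \<open>sph\<close> away from the origin, which is a null set.\<close>

lemma integral_sphm_orthogonal:
  fixes h :: "real ^ 'n::finite \<Rightarrow> 'b::{banach, second_countable_topology}" and R :: "real ^ 'n \<Rightarrow> real ^ 'n"
  assumes R: "orthogonal_transformation R" and h: "continuous_on (sphere 0 1) h"
  shows "(\<integral>x. h (R x) \<partial>sphm) = integral\<^sup>L sphm h"
proof -
  let ?U = "uniform_measure lborel (ball 0 1) :: (real ^ 'n) measure"
  have cont: "continuous_on S R" for S
    using R by (simp add: linear_continuous_on orthogonal_transformation_linear linear_conv_bounded_linear[symmetric])
  then have [measurable]: "R \<in> borel \<rightarrow>\<^sub>M borel" by (intro borel_measurable_continuous_onI) auto
  have norm: "norm (R x) = norm x" for x using R by (simp add: orthogonal_transformation_norm)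
  have lin: "linear R" using R by (simp add: orthogonal_transformation_linear)
  have "continuous_on (sphere 0 1) (\<lambda>x. h (R x))"
    by (rule continuous_on_compose2[OF h cont]) (auto simp: norm)
  then have hR: "(\<lambda>x. h (R x)) \<in> borel_measurable sphm" by (rule measurable_sphm_continuous)
  have hm: "h \<in> borel_measurable sphm" using h by (rule measurable_sphm_continuous)
  have [measurable]: "(\<lambda>x. h (sph x)) \<in> borel_measurable borel" "(\<lambda>x. h (R (sph x))) \<in> borel_measurable borel"
    using measurable_compose[OF sph_measurable] hm hR
    by (auto simp: measurable_cong_sets[OF sets_sphm refl])
  have U: "distr ?U borel R = ?U"
  proof -
    have "distr ?U borel R = uniform_measure (distr lborel borel R) (ball 0 1)"
    proof (rule measure_eqI)
      fix A :: "(real^'n) set" assume "A \<in> sets (distr ?U borel R)"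
      then have [measurable]: "A \<in> sets borel" by simp
      have "ball 0 1 \<inter> R -` A = R -` (ball 0 1 \<inter> A)" by (auto simp: norm)
      moreover have "R -` ball 0 1 = ball 0 1" by (auto simp: norm)
      ultimately show "emeasure (distr ?U borel R) A = emeasure (uniform_measure (distr lborel borel R) (ball 0 1)) A"
        using measurable_sets[of R borel borel A] measurable_sets[of R borel borel "ball 0 1 \<inter> A"]
        by (simp add: emeasure_distr)
    qed simp
    then show ?thesis unfolding distr_lborel_orthogonal[OF R] .
  qed
  have AE: "AE x in ?U. x \<noteq> 0"
  proof (rule AE_uniform_measureI)
    show "AE x in lborel. x \<in> ball 0 1 \<longrightarrow> x \<noteq> (0::real^'n)"
      using AE_lborel_singleton[of "0::real^'n"] by eventually_elim auto
  qed simp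
  have "(\<integral>x. h (R x) \<partial>sphm) = (\<integral>x. h (R (sph x)) \<partial>?U)"
    by (rule integral_sphm_eq[OF hR])
  also have "\<dots> = (\<integral>x. h (sph (R x)) \<partial>?U)"
  proof (rule integral_cong_AE)
    show "AE x in ?U. h (R (sph x)) = h (sph (R x))"
      using AE
    proof eventually_elim
      case (elim x)
      then have "R x \<noteq> 0" using norm[of x] by (metis norm_eq_zero)
      then show ?case using elim by (simp add: sph_def linear_scale[OF lin] norm)
    qed
  qed simp_all
  also have "\<dots> = (\<integral>x. h (sph x) \<partial>distr ?U borel R)"
    by (subst integral_distr) auto
  also have "\<dots> = integral\<^sup>L sphm h"
    unfolding U by (rule integral_sphm_eq[OF hm, symmetric])
  finally show ?thesis .
qed

text \<open>The measure has full support: if \<open>u\<close> were positive at \<open>x\<close>,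
  then \<open>u (y /\<^sub>R norm y)\<close> would be positive on a nonempty open part of the
  punctured ball, which is not negligible.\<close>

lemma integral_sphm_eq_0_imp:
  fixes u :: "real ^ 'n::finite \<Rightarrow> real"
  assumes u: "continuous_on (sphere 0 1) u" and nn: "\<And>x. x \<in> sphere 0 1 \<Longrightarrow> u x \<ge> 0"
    and 0: "integral\<^sup>L sphm u = 0" and x: "x \<in> sphere 0 1"
  shows "u x = 0"
proof (rule ccontr)
  assume "u x \<noteq> 0"
  then have pos: "u x > 0" using nn[OF x] by linarith
  let ?U = "uniform_measure lborel (ball 0 1) :: (real ^ 'n) measure"
  let ?S = "{y. y \<in> ball 0 1 - {0} \<and> u (y /\<^sub>R norm y) \<in> {0<..}}"
  have cont: "continuous_on (ball 0 1 - {0}) (\<lambda>y. u (y /\<^sub>R norm y))"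
    by (rule continuous_on_compose2[OF u]) (auto intro!: continuous_intros, metis left_inverse norm_eq_zero)
  have "open ?S"
    using continuous_open_preimage[OF cont _ open_greaterThan[of 0]]
    by (auto simp: open_delete vimage_def Int_def)
  moreover have "(1/2) *\<^sub>R x \<in> ?S" using pos x by auto
  ultimately have "\<not> negligible ?S" using open_not_negligible by blast
  moreover have "negligible ?S"
  proof -
    have um: "u \<in> borel_measurable sphm" using u by (rule measurable_sphm_continuous)
    have "AE y in sphm. 0 \<le> u y"
      by (rule AE_I2) (use nn in auto)
    then have "AE y in sphm. u y = 0"
      using integral_nonneg_eq_0_iff_AE[OF integrable_sphm_continuous[OF u]] 0 by auto
    moreover have [measurable]: "u \<in> borel_measurable (restrict_space borel (sphere 0 1))"
      using um by (simp add: measurable_cong_sets[OF sets_sphm refl])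
    have "{x \<in> space (restrict_space borel (sphere 0 1)). u x = 0} \<in> sets (restrict_space borel (sphere 0 1))"
      by measurable
    ultimately have "AE y in ?U. u (sph y) = 0"
      unfolding sphm_def by (subst (asm) AE_distr_iff[OF sph_measurable_uniform])
    then have "AE y in lborel. y \<in> ball 0 1 \<longrightarrow> u (sph y) = 0"
      using emeasure_lborel_ball_finite[of "0::real^'n" 1]
      by (subst (asm) AE_uniform_measure) (auto simp: emeasure_lborel_unit_ball)
    then have "AE y in lborel. y \<notin> ?S"
      by eventually_elim (auto simp: sph_def split: if_splits)
    then show ?thesis
      using AE_iff_null_sets[of ?S lborel] \<open>open ?S\<close>
      by (simp add: negligible_iff_null_sets null_sets_completionI)
  qed
  ultimately show False by simp
qed

section \<open>Polar coordinates\<close>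

lemma nn_integral_lborel_scaleR:
  fixes g :: "'a::euclidean_space \<Rightarrow> ennreal"
  assumes [measurable]: "g \<in> borel_measurable borel" and "s > 0"
  shows "(\<integral>\<^sup>+x. g x \<partial>lborel) = ennreal (s ^ DIM('a)) * (\<integral>\<^sup>+x. g (s *\<^sub>R x) \<partial>lborel)"
  using assms(2) by (subst lborel_affine[of s 0])
     (simp_all add: nn_integral_density nn_integral_distr nn_integral_cmult)

lemma nn_integral_power_tail:
  assumes "a > 0" "n > 0"
  shows "(\<integral>\<^sup>+s. indicator {a<..} s * ennreal (1 / s ^ Suc n) \<partial>lborel) = ennreal (1 / (real n * a ^ n))"
proof -
  have "(\<integral>\<^sup>+s. ennreal (1 / s ^ Suc n) * indicator {a..} s \<partial>lborel) = ennreal (0 - (- 1 / (real n * a ^ n)))"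
  proof (rule nn_integral_FTC_atLeast)
    show "((\<lambda>s. - 1 / (real n * s ^ n)) has_real_derivative 1 / s ^ Suc n) (at s)" if "a \<le> s" for s
    proof -
      have "s > 0" using that assms by simp
      then show ?thesis using \<open>n > 0\<close>
        by (auto intro!: derivative_eq_intros simp: field_simps power_eq_if[of s n])
    qed
    show "((\<lambda>s. - 1 / (real n * s ^ n)) \<longlongrightarrow> 0) at_top"
    proof -
      have "((\<lambda>s::real. inverse (s ^ n)) \<longlongrightarrow> 0) at_top"
        using \<open>n > 0\<close> by (intro tendsto_inverse_0_at_top filterlim_pow_at_top filterlim_ident)
      then have "((\<lambda>s::real. - (1 / real n) * inverse (s ^ n)) \<longlongrightarrow> - (1 / real n) * 0) at_top"
        by (intro tendsto_intros)
      then show ?thesis by (simp add: divide_inverse)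
    qed
  qed (use assms in auto)
  moreover have "(\<integral>\<^sup>+s. indicator {a<..} s * ennreal (1 / s ^ Suc n) \<partial>lborel)
      = (\<integral>\<^sup>+s. ennreal (1 / s ^ Suc n) * indicator {a..} s \<partial>lborel)"
    using AE_lborel_singleton[of a]
    by (intro nn_integral_cong_AE) (auto simp: indicator_def)
  ultimately show ?thesis by simp
qed

text \<open>By definition of \<open>sphm\<close> a spherical mean is an average of
  \<open>h (r *\<^sub>R sph x)\<close> over the ball. The substitution \<open>r = norm x * s\<close>
  replaces \<open>r *\<^sub>R sph x\<close> by \<open>s *\<^sub>R x\<close>, and
  \<open>y = s *\<^sub>R x\<close> replaces the condition \<open>norm x < 1\<close> by
  \<open>s > norm y\<close>. Integrating out \<open>s\<close> with
  \<open>nn_integral_power_tail\<close> leaves \<open>h y / n\<close>.\<close>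

lemma nn_integral_polar:
  fixes h :: "real ^ 'n::finite \<Rightarrow> ennreal"
  assumes [measurable]: "h \<in> borel_measurable borel"
  shows "(\<integral>\<^sup>+x. h x \<partial>lborel) = of_nat CARD('n) * emeasure lborel (ball (0::real^'n) 1) *
    (\<integral>\<^sup>+r. indicator {0<..} r * (ennreal (r ^ (CARD('n) - 1)) * (\<integral>\<^sup>+z. h (r *\<^sub>R z) \<partial>sphm)) \<partial>lborel)"
proof -
  let ?n = "CARD('n)" and ?K = "emeasure lborel (ball (0::real^'n) 1)"
  have n: "?n > 0" "Suc (?n - 1) = ?n" by simp_all
  have [measurable]: "ball (0::real^'n) 1 \<in> sets borel" by simp
  have K: "?K * ((\<integral>\<^sup>+x. indicator (ball 0 1) x * h (r *\<^sub>R sph x) \<partial>lborel) / ?K)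
      = (\<integral>\<^sup>+x. indicator (ball 0 1) x * h (r *\<^sub>R sph x) \<partial>lborel)" for r
    using emeasure_lborel_unit_ball[where 'a="real^'n"]
    by (simp add: ennreal_times_divide mult.commute[of ?K] mult_divide_eq_ennreal)
  have S: "?K * (\<integral>\<^sup>+z. h (r *\<^sub>R z) \<partial>sphm) = (\<integral>\<^sup>+x. indicator (ball 0 1) x * h (r *\<^sub>R sph x) \<partial>lborel)" for r
  proof -
    have m: "(\<lambda>z. h (r *\<^sub>R z)) \<in> borel_measurable (restrict_space borel (sphere 0 1))"
      by (rule measurable_restrict_space1) measurable
    have "(\<integral>\<^sup>+z. h (r *\<^sub>R z) \<partial>sphm) = (\<integral>\<^sup>+x. h (r *\<^sub>R sph x) \<partial>uniform_measure lborel (ball 0 1))"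
      unfolding sphm_def using sph_measurable_uniform m
      by (subst nn_integral_distr) auto
    also have "\<dots> = (\<integral>\<^sup>+x. indicator (ball 0 1) x * h (r *\<^sub>R sph x) \<partial>lborel) / ?K"
      by (subst nn_integral_uniform_measure) (auto simp: mult.commute)
    finally show ?thesis using K by simp
  qed
  have "?K * (\<integral>\<^sup>+r. indicator {0<..} r * (ennreal (r ^ (?n - 1)) * (\<integral>\<^sup>+z. h (r *\<^sub>R z) \<partial>sphm)) \<partial>lborel)
    = (\<integral>\<^sup>+r. indicator {0<..} r * (ennreal (r ^ (?n - 1)) * (?K * (\<integral>\<^sup>+z. h (r *\<^sub>R z) \<partial>sphm))) \<partial>lborel)"
  proof (subst nn_integral_cmult[symmetric])
    have "(\<lambda>r. \<integral>\<^sup>+z. h (r *\<^sub>R z) \<partial>sphm) = (\<lambda>r. (\<integral>\<^sup>+x. indicator (ball 0 1) x * h (r *\<^sub>R sph x) \<partial>lborel) / ?K)"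
      using emeasure_lborel_unit_ball[where 'a="real^'n"]
      by (simp add: S[symmetric] mult.commute[of ?K] mult_divide_eq_ennreal)
    moreover have "(\<lambda>r. (\<integral>\<^sup>+x. indicator (ball 0 1) x * h (r *\<^sub>R sph x) \<partial>lborel) / ?K) \<in> borel_measurable lborel"
      by measurable
    ultimately have "(\<lambda>r. \<integral>\<^sup>+z. h (r *\<^sub>R z) \<partial>sphm) \<in> borel_measurable lborel" by (simp only:)
    then show "(\<lambda>r. indicator {0<..} r * (ennreal (r ^ (?n - 1)) * (\<integral>\<^sup>+z. h (r *\<^sub>R z) \<partial>sphm))) \<in> borel_measurable lborel"
      by simp
  qed (simp add: mult_ac)
  also have "\<dots> = (\<integral>\<^sup>+r. (\<integral>\<^sup>+x. indicator {0<..} r * (ennreal (r ^ (?n - 1)) *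
        (indicator (ball 0 1) x * h (r *\<^sub>R sph x))) \<partial>lborel) \<partial>lborel)"
    unfolding S by (simp add: nn_integral_cmult)
  also have "\<dots> = (\<integral>\<^sup>+x. (\<integral>\<^sup>+r. indicator {0<..} r * (ennreal (r ^ (?n - 1)) *
        (indicator (ball 0 1) x * h (r *\<^sub>R sph x))) \<partial>lborel) \<partial>(lborel::(real^'n) measure))"
    by (rule lborel_pair.Fubini') measurable
  also have "\<dots> = (\<integral>\<^sup>+x. (\<integral>\<^sup>+s. indicator {0<..} s * (ennreal (s ^ (?n - 1)) *
        (indicator (ball 0 1) x * ennreal (norm x ^ ?n) * h (s *\<^sub>R x))) \<partial>lborel) \<partial>(lborel::(real^'n) measure))"
  proof (rule nn_integral_cong_AE)
    show "AE x in (lborel::(real^'n) measure).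
        (\<integral>\<^sup>+r. indicator {0<..} r * (ennreal (r ^ (?n - 1)) * (indicator (ball 0 1) x * h (r *\<^sub>R sph x))) \<partial>lborel)
      = (\<integral>\<^sup>+s. indicator {0<..} s * (ennreal (s ^ (?n - 1)) *
        (indicator (ball 0 1) x * ennreal (norm x ^ ?n) * h (s *\<^sub>R x))) \<partial>lborel)"
      using AE_lborel_singleton[of "0::real^'n"]
    proof eventually_elim
      case (elim x)
      have 1: "norm x * s > 0 \<longleftrightarrow> s > 0" for s using elim by (simp add: zero_less_mult_iff)
      have 2: "(norm x * s) *\<^sub>R sph x = s *\<^sub>R x" for s using elim by (simp add: sph_def)
      have 3: "ennreal (norm x) * (indicator {0<..} s * (ennreal ((norm x * s) ^ (?n - 1)) * b))
         = indicator {0<..} s * (ennreal (s ^ (?n - 1)) * (ennreal (norm x ^ ?n) * b))" for s b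
      proof (cases "s > 0")
        case True
        have "ennreal (norm x) * ennreal ((norm x * s) ^ (?n - 1)) = ennreal (s ^ (?n - 1)) * ennreal (norm x ^ ?n)"
          using True by (simp add: ennreal_mult[symmetric] power_mult_distrib mult_ac flip: power_Suc)
        then show ?thesis using True by (simp add: mult.assoc[symmetric])
      qed simp
      have "(\<integral>\<^sup>+r. indicator {0<..} r * (ennreal (r ^ (?n - 1)) * (indicator (ball 0 1) x * h (r *\<^sub>R sph x))) \<partial>lborel)
        = ennreal (norm x) * (\<integral>\<^sup>+s. indicator {0<..} (norm x * s) * (ennreal ((norm x * s) ^ (?n - 1)) *
            (indicator (ball 0 1) x * h ((norm x * s) *\<^sub>R sph x))) \<partial>lborel)"
        using elim by (subst nn_integral_real_affine[where c="norm x" and t=0]) auto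
      also have "\<dots> = (\<integral>\<^sup>+s. ennreal (norm x) * (indicator {0<..} s * (ennreal ((norm x * s) ^ (?n - 1)) *
            (indicator (ball 0 1) x * h (s *\<^sub>R x)))) \<partial>lborel)"
        unfolding 2 by (subst nn_integral_cmult) (auto simp: indicator_def 1 cong: if_cong)
      finally show ?case unfolding 3 by (simp add: mult_ac)
    qed
  qed
  also have "\<dots> = (\<integral>\<^sup>+s. (\<integral>\<^sup>+x. indicator {0<..} s * (ennreal (s ^ (?n - 1)) *
        (indicator (ball 0 1) x * ennreal (norm x ^ ?n) * h (s *\<^sub>R x))) \<partial>(lborel::(real^'n) measure)) \<partial>lborel)"
    by (rule lborel_pair.Fubini') measurable
  \<comment> \<open>The power of \<open>s\<close> is \<open>n - 1\<close> from the radial density,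
    \<open>- n\<close> from the Jacobian of \<open>y = s x\<close>, and \<open>- n\<close> from
    \<open>norm x ^ n = norm y ^ n / s ^ n\<close>; together \<open>- (n + 1)\<close>.\<close>
  also have "\<dots> = (\<integral>\<^sup>+s. (\<integral>\<^sup>+y. indicator {norm y<..} s * ennreal (1 / s ^ Suc ?n) *
        (ennreal (norm y ^ ?n) * h y) \<partial>(lborel::(real^'n) measure)) \<partial>lborel)"
  proof (rule nn_integral_cong)
    fix s :: real
    show "(\<integral>\<^sup>+x. indicator {0<..} s * (ennreal (s ^ (?n - 1)) *
        (indicator (ball 0 1) x * ennreal (norm x ^ ?n) * h (s *\<^sub>R x))) \<partial>(lborel::(real^'n) measure))
      = (\<integral>\<^sup>+y. indicator {norm y<..} s * ennreal (1 / s ^ Suc ?n) *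
        (ennreal (norm y ^ ?n) * h y) \<partial>(lborel::(real^'n) measure))"
    proof (cases "s > 0")
      case True
      have eq: "indicator {0<..} s * (ennreal (s ^ (?n - 1)) *
          (indicator (ball 0 1) x * ennreal (norm x ^ ?n) * h (s *\<^sub>R x)))
        = ennreal (s ^ ?n) * (indicator {norm (s *\<^sub>R x)<..} s * ennreal (1 / s ^ Suc ?n) *
          (ennreal (norm (s *\<^sub>R x) ^ ?n) * h (s *\<^sub>R x)))" for x :: "real^'n"
      proof (cases "norm x < 1")
        case nx: True
        have "s ^ ?n * (1 / s ^ Suc ?n) * (norm (s *\<^sub>R x) ^ ?n) = s ^ (?n - 1) * norm x ^ ?n"
        proof -
          obtain k where k: "?n = Suc k" using n by metis
          have "s ^ Suc k * (1 / s ^ Suc (Suc k)) * s ^ Suc k = s ^ k"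
            using True by (simp add: field_simps)
          then have "s ^ ?n * (1 / s ^ Suc ?n) * s ^ ?n = s ^ (?n - 1)"
            unfolding k diff_Suc_1 .
          then show ?thesis
            using True by (simp only: norm_scaleR power_mult_distrib abs_of_pos mult.assoc[symmetric])
        qed
        then have "ennreal (s ^ ?n) * ennreal (1 / s ^ Suc ?n) * ennreal (norm (s *\<^sub>R x) ^ ?n)
            = ennreal (s ^ (?n - 1)) * ennreal (norm x ^ ?n)"
          using True by (simp add: ennreal_mult[symmetric] del: norm_scaleR)
        then show ?thesis using True nx by (simp add: mult.assoc[symmetric] del: norm_scaleR)
            (simp add: mult_less_cancel_left_pos)
      qed (use True in \<open>auto simp: indicator_def\<close>)
      let ?G = "\<lambda>y::real^'n. indicator {norm y<..} s * ennreal (1 / s ^ Suc ?n) * (ennreal (norm y ^ ?n) * h y)"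
      have [measurable]: "(\<lambda>y::real^'n. indicator {norm y<..} s :: ennreal) \<in> borel_measurable borel"
        unfolding indicator_def greaterThan_def mem_Collect_eq by measurable
      have [measurable]: "?G \<in> borel_measurable borel" by measurable
      have "(\<integral>\<^sup>+y. ?G y \<partial>lborel) = ennreal (s ^ ?n) * (\<integral>\<^sup>+x. ?G (s *\<^sub>R x) \<partial>lborel)"
        using nn_integral_lborel_scaleR[of ?G s] True by simp
      also have "\<dots> = (\<integral>\<^sup>+x. ennreal (s ^ ?n) * ?G (s *\<^sub>R x) \<partial>lborel)"
        by (rule nn_integral_cmult[symmetric]) measurable
      finally show ?thesis unfolding eq by (rule sym)
    next
      case False
      then have "\<not> norm y < s" for y :: "real^'n" using norm_ge_zero[of y] by linarith
      then show ?thesis using False by simp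
    qed
  qed
  also have "\<dots> = (\<integral>\<^sup>+y. (\<integral>\<^sup>+s. indicator {norm y<..} s * ennreal (1 / s ^ Suc ?n) *
        (ennreal (norm y ^ ?n) * h y) \<partial>lborel) \<partial>(lborel::(real^'n) measure))"
  proof (rule lborel_pair.Fubini'[symmetric])
    have [measurable]: "(\<lambda>x. indicator {norm (snd x)<..} (fst x) :: ennreal)
        \<in> borel_measurable (lborel \<Otimes>\<^sub>M (lborel :: (real^'n) measure))"
      unfolding indicator_def greaterThan_def mem_Collect_eq by measurable
    show "(\<lambda>(s, y). indicator {norm y<..} s * ennreal (1 / s ^ Suc ?n) * (ennreal (norm y ^ ?n) * h y))
        \<in> borel_measurable (lborel \<Otimes>\<^sub>M (lborel :: (real^'n) measure))"
      by measurable
  qed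
  also have "\<dots> = (\<integral>\<^sup>+y. ennreal (1 / real ?n) * h y \<partial>(lborel::(real^'n) measure))"
  proof (rule nn_integral_cong_AE)
    show "AE y in (lborel::(real^'n) measure). (\<integral>\<^sup>+s. indicator {norm y<..} s * ennreal (1 / s ^ Suc ?n) *
        (ennreal (norm y ^ ?n) * h y) \<partial>lborel) = ennreal (1 / real ?n) * h y"
      using AE_lborel_singleton[of "0::real^'n"]
    proof eventually_elim
      case (elim y)
      then have "(\<integral>\<^sup>+s. indicator {norm y<..} s * ennreal (1 / s ^ Suc ?n) * (ennreal (norm y ^ ?n) * h y) \<partial>lborel)
          = ennreal (1 / (real ?n * norm y ^ ?n)) * (ennreal (norm y ^ ?n) * h y)"
        by (subst nn_integral_multc) (auto simp: nn_integral_power_tail[OF _ n(1)] simp del: power_Suc)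
      also have "\<dots> = ennreal (1 / real ?n) * h y"
        using elim by (simp add: mult.assoc[symmetric] ennreal_mult[symmetric])
      finally show ?case .
    qed
  qed
  also have "\<dots> = ennreal (1 / real ?n) * (\<integral>\<^sup>+y. h y \<partial>lborel)"
    by (rule nn_integral_cmult) simp
  finally have "of_nat ?n * (?K * (\<integral>\<^sup>+r. indicator {0<..} r * (ennreal (r ^ (?n - 1)) * (\<integral>\<^sup>+z. h (r *\<^sub>R z) \<partial>sphm)) \<partial>lborel))
      = of_nat ?n * (ennreal (1 / real ?n) * (\<integral>\<^sup>+y. h y \<partial>lborel))" by simp
  also have "\<dots> = (\<integral>\<^sup>+y. h y \<partial>lborel)"
    by (simp add: mult.assoc[symmetric] ennreal_of_nat_eq_real_of_nat ennreal_mult[symmetric])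
  finally show ?thesis by (simp add: mult.assoc)
qed

section \<open>Spherical means\<close>

text \<open>As a limit of difference quotients the derivative can be tested along sequences, which
  is the setting of dominated convergence.\<close>

lemma has_vector_derivative_iff_quotient:
  fixes f :: "real \<Rightarrow> 'b::real_normed_vector"
  shows "(f has_vector_derivative D) (at x) \<longleftrightarrow> ((\<lambda>t. (f t - f x) /\<^sub>R (t - x)) \<longlongrightarrow> D) (at x)"
proof -
  have "norm ((1 / norm (t - x)) *\<^sub>R (f t - (f x + (t - x) *\<^sub>R D))) = norm ((f t - f x) /\<^sub>R (t - x) - D)"
    if "t \<noteq> x" for t
  proof -
    have "(f t - f x) /\<^sub>R (t - x) - D = (1 / (t - x)) *\<^sub>R (f t - (f x + (t - x) *\<^sub>R D))"
    proof -
      have "(1 / (t - x)) *\<^sub>R (f t - (f x + (t - x) *\<^sub>R D))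
          = (1 / (t - x)) *\<^sub>R (f t - f x) - ((1 / (t - x)) * (t - x)) *\<^sub>R D"
        by (simp only: diff_diff_eq[symmetric] scaleR_diff_right scaleR_scaleR)
      then show ?thesis using that by (simp add: divide_inverse)
    qed
    then show ?thesis by simp
  qed
  then have "((\<lambda>t. norm ((1 / norm (t - x)) *\<^sub>R (f t - (f x + (t - x) *\<^sub>R D)))) \<longlongrightarrow> 0) (at x)
     \<longleftrightarrow> ((\<lambda>t. norm ((f t - f x) /\<^sub>R (t - x) - D)) \<longlongrightarrow> 0) (at x)"
    by (intro filterlim_cong) (auto simp: eventually_at_filter)
  then show ?thesis
    unfolding has_vector_derivative_def has_derivative_at2 tendsto_norm_zero_iff
    by (simp add: bounded_linear_scaleR_left LIM_zero_iff)
qed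

text \<open>Differentiation under the integral: by the mean value inequality the bound
  \<open>B\<close> on the derivative also dominates the difference quotients.\<close>

lemma has_vector_derivative_integral:
  fixes u :: "real \<Rightarrow> 'x \<Rightarrow> 'b::{banach, second_countable_topology}"
  assumes M: "finite_measure M" and e: "e > 0"
    and int: "\<And>t. \<bar>t - t0\<bar> < e \<Longrightarrow> integrable M (u t)"
    and meas: "v t0 \<in> borel_measurable M"
    and deriv: "\<And>t x. \<bar>t - t0\<bar> < e \<Longrightarrow> x \<in> space M \<Longrightarrow> ((\<lambda>t. u t x) has_vector_derivative v t x) (at t)"
    and bound: "\<And>t x. \<bar>t - t0\<bar> < e \<Longrightarrow> x \<in> space M \<Longrightarrow> norm (v t x) \<le> B"
  shows "((\<lambda>t. \<integral>x. u t x \<partial>M) has_vector_derivative (\<integral>x. v t0 x \<partial>M)) (at t0)"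
  unfolding has_vector_derivative_iff_quotient tendsto_at_iff_sequentially comp_def
proof safe
  fix X assume ne: "\<forall>i. X i \<in> UNIV - {t0}" and X: "X \<longlonglongrightarrow> t0"
  \<comment> \<open>\<open>Y\<close> agrees with \<open>X\<close> eventually, but stays in the
    \<open>e\<close>-neighbourhood and off \<open>t0\<close> for every index, so that the domination
    holds for all terms of the sequence.\<close>
  define Y where "Y i = (if \<bar>X i - t0\<bar> < e then X i else t0 + e / 2)" for i
  have Y: "\<bar>Y i - t0\<bar> < e" "Y i \<noteq> t0" for i using ne e by (auto simp: Y_def)
  have ev: "eventually (\<lambda>i. Y i = X i) sequentially"
    using tendstoD[OF X e] by eventually_elim (simp add: Y_def dist_real_def)
  then have YX: "Y \<longlonglongrightarrow> t0" using X by (simp add: tendsto_cong)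
  have t0: "\<bar>t0 - t0\<bar> < e" using e by simp
  let ?q = "\<lambda>i x. (u (Y i) x - u t0 x) /\<^sub>R (Y i - t0)"
  have "(\<lambda>i. \<integral>x. ?q i x \<partial>M) \<longlonglongrightarrow> (\<integral>x. v t0 x \<partial>M)"
  proof (rule integral_dominated_convergence[where w="\<lambda>_. B"])
    show "integrable M (\<lambda>_. B)" using finite_measure.integrable_const[OF M] .
    show "AE x in M. (\<lambda>i. ?q i x) \<longlonglongrightarrow> v t0 x"
    proof (rule AE_I2)
      fix x assume "x \<in> space M"
      from deriv[OF t0 this] have "((\<lambda>t. (u t x - u t0 x) /\<^sub>R (t - t0)) \<longlongrightarrow> v t0 x) (at t0)"
        unfolding has_vector_derivative_iff_quotient .
      then show "(\<lambda>i. ?q i x) \<longlonglongrightarrow> v t0 x"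
        unfolding tendsto_at_iff_sequentially comp_def using Y(2) YX by auto
    qed
    show "AE x in M. norm (?q i x) \<le> B" for i
    proof (rule AE_I2)
      fix x assume x: "x \<in> space M"
      have "norm (u (Y i) x - u t0 x) \<le> B * norm (Y i - t0)"
      proof (rule differentiable_bound[where S="ball t0 e" and f'="\<lambda>t h. h *\<^sub>R v t x"])
        fix t assume "t \<in> ball t0 e"
        then have t: "\<bar>t - t0\<bar> < e" by (simp add: dist_real_def abs_minus_commute)
        show "((\<lambda>t. u t x) has_derivative (\<lambda>h. h *\<^sub>R v t x)) (at t within ball t0 e)"
          using deriv[OF t x] unfolding has_vector_derivative_def by (rule has_derivative_at_withinI)
        show "onorm (\<lambda>h. h *\<^sub>R v t x) \<le> B"
          using bound[OF t x] order_trans[OF norm_ge_zero bound[OF t x]]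
          by (intro onorm_bound) (auto simp: mult.commute[of B] intro!: mult_left_mono)
      qed (use Y(1)[of i] e in \<open>auto simp: dist_real_def abs_minus_commute\<close>)
      then show "norm (?q i x) \<le> B" using Y(2)[of i]
        by (simp add: inverse_eq_divide pos_divide_le_eq)
    qed
  qed (use int[OF Y(1)] int[OF t0] meas in auto)
  moreover have "(\<integral>x. ?q i x \<partial>M) = ((\<integral>x. u (Y i) x \<partial>M) - (\<integral>x. u t0 x \<partial>M)) /\<^sub>R (Y i - t0)" for i
    using int[OF Y(1)] int[OF t0] by simp
  ultimately have "(\<lambda>i. ((\<integral>x. u (Y i) x \<partial>M) - (\<integral>x. u t0 x \<partial>M)) /\<^sub>R (Y i - t0)) \<longlonglongrightarrow> (\<integral>x. v t0 x \<partial>M)"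
    by (simp only:)
  then show "(\<lambda>i. ((\<integral>x. u (X i) x \<partial>M) - (\<integral>x. u t0 x \<partial>M)) /\<^sub>R (X i - t0)) \<longlonglongrightarrow> (\<integral>x. v t0 x \<partial>M)"
    by (rule Lim_transform_eventually) (use ev in \<open>eventually_elim, simp\<close>)
qed

lemma compact_bound_obtain:
  fixes f :: "'a::topological_space \<Rightarrow> 'b::real_normed_vector"
  assumes "compact S" "continuous_on S f"
  obtains B where "\<And>x. x \<in> S \<Longrightarrow> norm (f x) \<le> B"
  using compact_imp_bounded[OF compact_continuous_image[OF assms(2,1)]] by (auto simp: bounded_iff)

lemma integral_sphm_sum2:
  fixes g :: "'i \<Rightarrow> 'j \<Rightarrow> real ^ 'n::finite \<Rightarrow> complex"
  assumes "\<And>i j. continuous_on (sphere 0 1) (g i j)"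
  shows "(\<integral>z. (\<Sum>i\<in>A. \<Sum>j\<in>B. g i j z) \<partial>sphm) = (\<Sum>i\<in>A. \<Sum>j\<in>B. \<integral>z. g i j z \<partial>sphm)"
proof -
  have "(\<integral>z. (\<Sum>i\<in>A. \<Sum>j\<in>B. g i j z) \<partial>sphm) = (\<Sum>i\<in>A. \<integral>z. (\<Sum>j\<in>B. g i j z) \<partial>sphm)"
    by (intro Bochner_Integration.integral_sum integrable_sphm_continuous continuous_intros assms)
  also have "\<dots> = (\<Sum>i\<in>A. \<Sum>j\<in>B. \<integral>z. g i j z \<partial>sphm)"
    by (intro sum.cong refl Bochner_Integration.integral_sum integrable_sphm_continuous assms)
  finally show ?thesis .
qed

section \<open>Rotations and integration by parts on the sphere\<close>

definition C1_on :: "(real ^ 'n::finite) set \<Rightarrow> (real ^ 'n \<Rightarrow> complex) \<Rightarrow> bool" where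
  "C1_on S f \<longleftrightarrow> (\<forall>x\<in>S. f differentiable (at x)) \<and> (\<forall>j. continuous_on S (partial j f))"

lemma C1_onD: "C1_on S f \<Longrightarrow> x \<in> S \<Longrightarrow> f differentiable (at x)" "C1_on S f \<Longrightarrow> continuous_on S (partial j f)"
  by (auto simp: C1_on_def)

lemma C1_on_continuous: "C1_on S f \<Longrightarrow> continuous_on S f"
  by (auto simp: C1_on_def differentiable_on_def differentiable_at_withinI intro!: differentiable_imp_continuous_on)

lemma C2_onD: "C2_on S f \<Longrightarrow> C1_on S f" "C2_on S f \<Longrightarrow> C1_on S (partial j f)"
proof -
  show 1: "C1_on S (partial j f)" if "C2_on S f" for j using that by (auto simp: C2_on_def C1_on_def)
  show "C1_on S f" if "C2_on S f"
    using that C1_on_continuous[OF 1[OF that]] by (auto simp: C2_on_def C1_on_def)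
qed

lemma C1_on_poly [intro]: "polynomial_function f \<Longrightarrow> C1_on S f"
  by (auto simp: C1_on_def)

lemma C1_on_mult:
  assumes "C1_on S f" "C1_on S g" shows "C1_on S (\<lambda>x. f x * g x)"
proof -
  have "continuous_on S (partial j (\<lambda>x. f x * g x))" for j
  proof -
    have "continuous_on S (\<lambda>x. f x * partial j g x + partial j f x * g x)"
      using assms by (intro continuous_intros C1_on_continuous C1_onD)
    moreover have "partial j (\<lambda>x. f x * g x) x = f x * partial j g x + partial j f x * g x" if "x \<in> S" for x
      using assms that by (intro partial_mult C1_onD)
    ultimately show ?thesis by (simp cong: continuous_on_cong)
  qed
  then show ?thesis using assms by (auto simp: C1_on_def)
qed

lemma C1_on_diff:
  assumes "C1_on S f" "C1_on S g" shows "C1_on S (\<lambda>x. f x - g x)"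
proof -
  have "continuous_on S (partial j (\<lambda>x. f x - g x))" for j
  proof -
    have "continuous_on S (\<lambda>x. partial j f x - partial j g x)"
      using assms by (intro continuous_intros C1_onD)
    moreover have "partial j (\<lambda>x. f x - g x) x = partial j f x - partial j g x" if "x \<in> S" for x
      using assms that by (intro partial_diff C1_onD)
    ultimately show ?thesis by (simp cong: continuous_on_cong)
  qed
  then show ?thesis using assms by (auto simp: C1_on_def)
qed

lemma C1_on_tangential:
  "C1_on S (partial i f) \<Longrightarrow> C1_on S (partial j f) \<Longrightarrow> C1_on S (tangential i j f)"
  unfolding tangential_poly by (intro C1_on_diff C1_on_mult) auto

lemma differentiable_scaled:
  fixes f :: "real ^ 'n::finite \<Rightarrow> complex"
  assumes "f differentiable (at (c *\<^sub>R x))" shows "(\<lambda>x. f (c *\<^sub>R x)) differentiable (at x)"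
  using differentiable_chain_at[of "\<lambda>x. c *\<^sub>R x" x f] assms by (simp add: comp_def)

lemma C1_on_scaled:
  fixes f :: "real ^ 'n::finite \<Rightarrow> complex"
  assumes f: "C1_on S f" and T: "(\<lambda>x. c *\<^sub>R x) ` T \<subseteq> S"
  shows "C1_on T (\<lambda>x. f (c *\<^sub>R x))"
proof -
  have 1: "f differentiable (at (c *\<^sub>R x))" if "x \<in> T" for x using that T f by (auto simp: C1_on_def)
  have "continuous_on T (partial j (\<lambda>x. f (c *\<^sub>R x)))" for j
  proof -
    have "continuous_on T (\<lambda>x. c *\<^sub>R partial j f (c *\<^sub>R x))"
      by (intro continuous_intros continuous_on_compose2[OF C1_onD(2)[OF f]]) (use T in auto)
    then show ?thesis using partial_scaled[OF 1] by (simp cong: continuous_on_cong)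
  qed
  then show ?thesis using differentiable_scaled[OF 1] by (auto simp: C1_on_def)
qed

text \<open>The flow of \<open>tangential i j\<close>.\<close>

definition rot :: "'n \<Rightarrow> 'n \<Rightarrow> real \<Rightarrow> real ^ 'n::finite \<Rightarrow> real ^ 'n" where
  "rot i j \<theta> x = x + (cos \<theta> - 1) *\<^sub>R (x $ i *\<^sub>R axis i 1 + x $ j *\<^sub>R axis j 1)
    + sin \<theta> *\<^sub>R (x $ i *\<^sub>R axis j 1 - x $ j *\<^sub>R axis i 1)"

lemma rot_nth:
  assumes "i \<noteq> j"
  shows "rot i j \<theta> x $ i = cos \<theta> * x $ i - sin \<theta> * x $ j"
    "rot i j \<theta> x $ j = sin \<theta> * x $ i + cos \<theta> * x $ j"
    "k \<noteq> i \<Longrightarrow> k \<noteq> j \<Longrightarrow> rot i j \<theta> x $ k = x $ k"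
  using assms by (auto simp: rot_def axis_def algebra_simps)

lemma orthogonal_transformation_rot:
  assumes ij: "i \<noteq> j" shows "orthogonal_transformation (rot i j \<theta>)"
  unfolding orthogonal_transformation_def
proof safe
  show "linear (rot i j \<theta>)"
    by (rule linearI) (simp_all add: rot_def algebra_simps)
  fix v w :: "real ^ 'a"
  have split: "(\<Sum>k\<in>UNIV. a k) = a i + a j + (\<Sum>k\<in>UNIV - {i} - {j}. a k)" for a :: "'a \<Rightarrow> real"
    using ij by (simp add: sum.remove[of UNIV i] sum.remove[of "UNIV - {i}" j])
  have "(\<Sum>k\<in>UNIV - {i} - {j}. rot i j \<theta> v $ k * rot i j \<theta> w $ k) = (\<Sum>k\<in>UNIV - {i} - {j}. v $ k * w $ k)"
    by (intro sum.cong) (auto simp: rot_nth(3)[OF ij])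
  moreover have "rot i j \<theta> v $ i * rot i j \<theta> w $ i + rot i j \<theta> v $ j * rot i j \<theta> w $ j
     = (v $ i * w $ i + v $ j * w $ j) * ((sin \<theta>)\<^sup>2 + (cos \<theta>)\<^sup>2)"
    unfolding rot_nth[OF ij] by algebra
  ultimately show "rot i j \<theta> v \<bullet> rot i j \<theta> w = v \<bullet> w"
    by (simp add: inner_vec_def split)
qed

lemma has_vector_derivative_rot:
  assumes "i \<noteq> j"
  shows "((\<lambda>\<theta>. rot i j \<theta> x) has_vector_derivative
    (rot i j \<theta> x $ i *\<^sub>R axis j 1 - rot i j \<theta> x $ j *\<^sub>R axis i 1)) (at \<theta>)"
proof -
  have "((\<lambda>\<theta>. rot i j \<theta> x) has_vector_derivative
    ((- sin \<theta>) *\<^sub>R (x $ i *\<^sub>R axis i 1 + x $ j *\<^sub>R axis j 1)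
     + cos \<theta> *\<^sub>R (x $ i *\<^sub>R axis j 1 - x $ j *\<^sub>R axis i 1))) (at \<theta>)"
    unfolding rot_def[abs_def] has_vector_derivative_def
    by (auto intro!: derivative_eq_intros simp: algebra_simps)
  then show ?thesis unfolding rot_nth[OF assms]
    by (simp add: algebra_simps)
qed

lemma has_vector_derivative_along_rot:
  fixes h :: "real ^ 'n::finite \<Rightarrow> complex"
  assumes ij: "i \<noteq> j" and h: "h differentiable (at (rot i j \<theta> x))"
  shows "((\<lambda>\<theta>. h (rot i j \<theta> x)) has_vector_derivative tangential i j h (rot i j \<theta> x)) (at \<theta>)"
proof -
  let ?y = "rot i j \<theta> x"
  let ?w = "?y $ i *\<^sub>R axis j 1 - ?y $ j *\<^sub>R axis i 1"
  have "((\<lambda>\<theta>. h (rot i j \<theta> x)) has_vector_derivative (\<Sum>k\<in>UNIV. ?w $ k *\<^sub>R partial k h ?y)) (at \<theta>)"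
    using diff_chain_at[OF has_vector_derivative_rot[OF ij, unfolded has_vector_derivative_def]
        has_derivative_partial[OF h]]
    by (simp add: has_vector_derivative_def comp_def scaleR_sum_right)
  moreover have "(\<Sum>k\<in>UNIV. ?w $ k *\<^sub>R partial k h ?y)
      = (\<Sum>k\<in>UNIV. if k = j then ?y $ i *\<^sub>R partial k h ?y else 0) - (\<Sum>k\<in>UNIV. if k = i then ?y $ j *\<^sub>R partial k h ?y else 0)"
    unfolding sum_subtractf[symmetric] by (intro sum.cong) (auto simp: axis_def ij)
  ultimately show ?thesis by (simp add: tangential_def)
qed

text \<open>The integral of \<open>h\<close> over the sphere does not change along the rotation
  flow; differentiating at angle zero under the integral sign gives the claim. The radius
  \<open>R > 1\<close> puts the sphere inside the open set on which \<open>h\<close> is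
  differentiable.\<close>

lemma integral_tangential_eq_0:
  fixes h :: "real ^ 'n::finite \<Rightarrow> complex"
  assumes R: "R > 1" and h: "C1_on (ball 0 R) h"
  shows "(\<integral>z. tangential i j h z \<partial>sphm) = 0"
proof (cases "i = j")
  case True then show ?thesis by (simp add: tangential_def)
next
  case ij: False
  have contT: "continuous_on (sphere 0 1) (tangential i j h)"
    unfolding tangential_def[abs_def]
    by (intro continuous_intros continuous_on_subset[OF C1_onD(2)[OF h]]) (use R in auto)
  have conth: "continuous_on (sphere 0 1) h"
    using C1_on_continuous[OF h] by (rule continuous_on_subset) (use R in auto)
  have nrm: "norm (rot i j \<theta> x) = norm x" for \<theta> and x :: "real^'n"
    using orthogonal_transformation_rot[OF ij] by (simp add: orthogonal_transformation_norm)
  have contr: "continuous_on S (rot i j \<theta>)" for S \<theta>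
    unfolding rot_def[abs_def] by (intro continuous_intros)
  obtain B where B: "\<And>z. z \<in> sphere 0 1 \<Longrightarrow> norm (tangential i j h z) \<le> B"
    using compact_bound_obtain[OF compact_sphere contT] by metis
  have "((\<lambda>\<theta>. \<integral>z. h (rot i j \<theta> z) \<partial>sphm) has_vector_derivative (\<integral>z. tangential i j h (rot i j 0 z) \<partial>sphm)) (at 0)"
  proof (rule has_vector_derivative_integral[where e=1 and B=B])
    show "integrable sphm (\<lambda>z. h (rot i j \<theta> z))" for \<theta>
      by (intro integrable_sphm_continuous continuous_on_compose2[OF conth contr]) (auto simp: nrm)
    show "(\<lambda>z. tangential i j h (rot i j 0 z)) \<in> borel_measurable sphm"
      by (intro measurable_sphm_continuous continuous_on_compose2[OF contT contr]) (auto simp: nrm)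
    show "((\<lambda>\<theta>. h (rot i j \<theta> z)) has_vector_derivative tangential i j h (rot i j \<theta> z)) (at \<theta>)"
      if "z \<in> space sphm" for z \<theta>
      using that R by (intro has_vector_derivative_along_rot[OF ij] C1_onD(1)[OF h]) (auto simp: nrm)
    show "norm (tangential i j h (rot i j \<theta> z)) \<le> B" if "z \<in> space sphm" for z \<theta>
      using that by (intro B) (auto simp: nrm)
  qed (auto intro: sphm.finite_measure_axioms)
  moreover have "(\<lambda>\<theta>. \<integral>z. h (rot i j \<theta> z) \<partial>sphm) = (\<lambda>\<theta>. integral\<^sup>L sphm h)"
    using integral_sphm_orthogonal[OF orthogonal_transformation_rot[OF ij] conth] by auto
  moreover have "rot i j 0 z = z" for z :: "real^'n" by (simp add: rot_def)
  ultimately have "((\<lambda>\<theta>::real. integral\<^sup>L sphm h) has_vector_derivative (\<integral>z. tangential i j h z \<partial>sphm)) (at 0)"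
    by simp
  moreover have "((\<lambda>\<theta>::real. integral\<^sup>L sphm h) has_vector_derivative 0) (at 0)" by simp
  ultimately show ?thesis by (rule vector_derivative_unique_at)
qed

lemma C1_on_tangential_continuous:
  "C1_on S f \<Longrightarrow> continuous_on S (tangential i j f)"
  unfolding tangential_def[abs_def] by (intro continuous_intros C1_onD)

lemma integral_tangential_by_parts:
  fixes f g :: "real ^ 'n::finite \<Rightarrow> complex"
  assumes R: "R > 1" and f: "C1_on (ball 0 R) f" and g: "C1_on (ball 0 R) g"
  shows "(\<integral>z. tangential i j f z * g z \<partial>sphm) = - (\<integral>z. f z * tangential i j g z \<partial>sphm)"
proof -
  have sub: "sphere 0 1 \<subseteq> ball (0::real^'n) R" using R by auto
  note c = continuous_on_subset[OF C1_on_tangential_continuous sub] continuous_on_subset[OF C1_on_continuous sub]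
  have "0 = (\<integral>z. tangential i j (\<lambda>x. f x * g x) z \<partial>sphm)"
    using integral_tangential_eq_0[OF R C1_on_mult[OF f g]] by simp
  also have "\<dots> = (\<integral>z. f z * tangential i j g z + tangential i j f z * g z \<partial>sphm)"
    using sub f g by (intro Bochner_Integration.integral_cong refl tangential_mult C1_onD) auto
  also have "\<dots> = (\<integral>z. f z * tangential i j g z \<partial>sphm) + (\<integral>z. tangential i j f z * g z \<partial>sphm)"
    by (intro Bochner_Integration.integral_add integrable_sphm_continuous continuous_intros c f g)
  finally show ?thesis by (simp add: eq_neg_iff_add_eq_0 add.commute)
qed

text \<open>The weight \<open>e\<close> is merely continuous because the formula is applied a second
  time to \<open>partial k f\<close> with the weight \<open>z $ k *\<^sub>R e z\<close>, which is no
  longer a spherical harmonic of one degree. Allowing negative \<open>r\<close> makes the derivative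
  two-sided at \<open>0\<close>.\<close>

lemma has_vector_derivative_spherical_mean:
  fixes f e :: "real ^ 'n::finite \<Rightarrow> complex"
  assumes f: "C1_on (ball 0 R) f" and e: "continuous_on (sphere 0 1) e" and r: "\<bar>r\<bar> < R"
  shows "((\<lambda>r. \<integral>z. f (r *\<^sub>R z) * e z \<partial>sphm) has_vector_derivative
     (\<Sum>k\<in>UNIV. \<integral>z. partial k f (r *\<^sub>R z) * (z $ k *\<^sub>R e z) \<partial>sphm)) (at r)"
proof -
  define d where "d = (R - \<bar>r\<bar>) / 2"
  have d: "d > 0" "\<bar>r\<bar> + d < R" using r by (auto simp: d_def field_simps)
  have td: "\<bar>t\<bar> \<le> \<bar>r\<bar> + d" if "\<bar>t - r\<bar> < d" for t using that by linarith
  let ?v = "\<lambda>t z. (\<Sum>k\<in>UNIV. z $ k *\<^sub>R partial k f (t *\<^sub>R z)) * e z"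
  have inb: "t *\<^sub>R z \<in> ball 0 R" if "\<bar>t - r\<bar> < d" "z \<in> sphere 0 1" for t and z :: "real^'n"
    using td[OF that(1)] that(2) d by auto
  have c: "continuous_on (sphere 0 1) (\<lambda>z. partial k f (t *\<^sub>R z))" if "\<bar>t - r\<bar> < d" for t k
    by (rule continuous_on_compose2[OF C1_onD(2)[OF f]]) (use inb[OF that] in \<open>auto intro!: continuous_intros\<close>)
  have r': "\<bar>r - r\<bar> < d" using d by simp
  have "continuous_on (cball 0 (\<bar>r\<bar> + d)) (\<lambda>x. \<Sum>k\<in>UNIV. norm (partial k f x))"
    by (intro continuous_intros continuous_on_subset[OF C1_onD(2)[OF f]]) (use d in auto)
  then obtain B where "\<And>x. x \<in> cball 0 (\<bar>r\<bar> + d) \<Longrightarrow> norm (\<Sum>k\<in>UNIV. norm (partial k f x)) \<le> B"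
    using compact_bound_obtain[OF compact_cball] by metis
  then have B: "\<And>x. norm x \<le> \<bar>r\<bar> + d \<Longrightarrow> (\<Sum>k\<in>UNIV. norm (partial k f x)) \<le> B"
    by (metis abs_le_D1 mem_cball_0 real_norm_def)
  obtain E where E: "\<And>z. z \<in> sphere 0 1 \<Longrightarrow> norm (e z) \<le> E"
    using compact_bound_obtain[OF compact_sphere e] by metis
  have "((\<lambda>r. \<integral>z. f (r *\<^sub>R z) * e z \<partial>sphm) has_vector_derivative (\<integral>z. ?v r z \<partial>sphm)) (at r)"
  proof (rule has_vector_derivative_integral[where e=d and B="B * E"])
    show "integrable sphm (\<lambda>z. f (t *\<^sub>R z) * e z)" if t: "\<bar>t - r\<bar> < d" for t
      by (intro integrable_sphm_continuous continuous_intros e continuous_on_compose2[OF C1_on_continuous[OF f]])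
        (use inb[OF t] in auto)
    show "?v r \<in> borel_measurable sphm"
      by (intro measurable_sphm_continuous continuous_intros c r' e)
    show "((\<lambda>t. f (t *\<^sub>R z) * e z) has_vector_derivative ?v t z) (at t)"
      if t: "\<bar>t - r\<bar> < d" and z: "z \<in> space sphm" for t z
    proof -
      have "f differentiable (at (t *\<^sub>R z))" using inb[OF t] z by (intro C1_onD(1)[OF f]) auto
      moreover have "((\<lambda>t. t *\<^sub>R z) has_derivative (\<lambda>t. t *\<^sub>R z)) (at t)"
        by (auto intro!: derivative_eq_intros)
      ultimately
      have "((\<lambda>t. f (t *\<^sub>R z)) has_vector_derivative (\<Sum>k\<in>UNIV. z $ k *\<^sub>R partial k f (t *\<^sub>R z))) (at t)"
        using diff_chain_at[OF _ has_derivative_partial]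
        by (fastforce simp: has_vector_derivative_def comp_def scaleR_sum_right)
      then show ?thesis by (rule has_vector_derivative_mult_left)
    qed
    show "norm (?v t z) \<le> B * E" if t: "\<bar>t - r\<bar> < d" and z: "z \<in> space sphm" for t z
    proof -
      have z1: "norm z = 1" using z by simp
      have "norm (\<Sum>k\<in>UNIV. z $ k *\<^sub>R partial k f (t *\<^sub>R z)) \<le> (\<Sum>k\<in>UNIV. norm (partial k f (t *\<^sub>R z)))"
        using component_le_norm_cart[of z] z1
        by (intro order_trans[OF norm_sum] sum_mono) (auto intro: mult_left_le_one_le)
      also have "\<dots> \<le> B" using td[OF t] z1 by (intro B) simp
      finally show ?thesis unfolding norm_mult
        using E[of z] z by (intro mult_mono) (auto intro: order_trans[OF norm_ge_zero])
    qed
  qed (use d in \<open>auto intro: sphm.finite_measure_axioms\<close>)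
  moreover have "(\<integral>z. ?v r z \<partial>sphm) = (\<integral>z. (\<Sum>k\<in>UNIV. partial k f (r *\<^sub>R z) * (z $ k *\<^sub>R e z)) \<partial>sphm)"
    by (simp only: sum_distrib_right, simp add: mult.commute)
  moreover have "\<dots> = (\<Sum>k\<in>UNIV. \<integral>z. partial k f (r *\<^sub>R z) * (z $ k *\<^sub>R e z) \<partial>sphm)"
    by (intro Bochner_Integration.integral_sum integrable_sphm_continuous continuous_intros c r' e)
  ultimately show ?thesis by simp
qed

lemma tangential_scaled:
  fixes f :: "real ^ 'n::finite \<Rightarrow> complex"
  assumes "f differentiable (at (c *\<^sub>R x))"
  shows "tangential i j (\<lambda>x. f (c *\<^sub>R x)) x = tangential i j f (c *\<^sub>R x)"
  by (simp add: tangential_def partial_scaled[OF assms] mult.commute)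

text \<open>Separation of variables: the pairing of \<open>f\<close> with a spherical harmonic turns the Laplacian into
  its radial part.\<close>

lemma spherical_mean_ODE:
  fixes f e :: "real ^ 'n::finite \<Rightarrow> complex"
  assumes f: "C2_on (ball 0 R) f" and e: "e \<in> harmonic_poly m"
  obtains a1 a2 where
    "\<And>r. 0 \<le> r \<Longrightarrow> r < R \<Longrightarrow> ((\<lambda>r. \<integral>z. f (r *\<^sub>R z) * e z \<partial>sphm) has_vector_derivative a1 r) (at r)"
    "\<And>r. 0 \<le> r \<Longrightarrow> r < R \<Longrightarrow> (a1 has_vector_derivative a2 r) (at r)"
    "\<And>r. 0 < r \<Longrightarrow> r < R \<Longrightarrow> r *\<^sub>R a1 r = (\<integral>z. euler f (r *\<^sub>R z) * e z \<partial>sphm)"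
    "\<And>r. 0 < r \<Longrightarrow> r < R \<Longrightarrow>
       r\<^sup>2 *\<^sub>R a2 r + ((real CARD('n) - 1) * r) *\<^sub>R a1 r
         - (real m * (real m + real CARD('n) - 2)) *\<^sub>R (\<integral>z. f (r *\<^sub>R z) * e z \<partial>sphm)
       = r\<^sup>2 *\<^sub>R (\<integral>z. laplacian f (r *\<^sub>R z) * e z \<partial>sphm)"
proof -
  note P = harmonic_polyD(1)[OF e]
  have ec: "continuous_on S e" for S using P by auto
  note f1 = C2_onD(1)[OF f] and f2 = C2_onD(2)[OF f]
  define a1 where "a1 r = (\<Sum>k\<in>UNIV. \<integral>z. partial k f (r *\<^sub>R z) * (z $ k *\<^sub>R e z) \<partial>sphm)" for r
  define a2 where "a2 r = (\<Sum>k\<in>UNIV. \<Sum>l\<in>UNIV. \<integral>z. partial l (partial k f) (r *\<^sub>R z) * (z $ l *\<^sub>R (z $ k *\<^sub>R e z)) \<partial>sphm)" for r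
  have inb: "r *\<^sub>R z \<in> ball 0 R" if "0 \<le> r" "r < R" "z \<in> sphere 0 1" for r and z :: "real^'n"
    using that by auto
  have cs: "continuous_on (sphere 0 1) (\<lambda>z. g (r *\<^sub>R z))" if "0 \<le> r" "r < R" "continuous_on (ball 0 R) g" for g :: "real^'n \<Rightarrow> complex" and r
    by (rule continuous_on_compose2[OF that(3)]) (use that inb in \<open>auto intro!: continuous_intros\<close>)
  note cp = cs[OF _ _ C1_onD(2)[OF f1]] cs[OF _ _ C1_onD(2)[OF f2]] cs[OF _ _ C1_on_continuous[OF f1]]
  have 1: "((\<lambda>r. \<integral>z. f (r *\<^sub>R z) * e z \<partial>sphm) has_vector_derivative a1 r) (at r)" if "0 \<le> r" "r < R" for r
    unfolding a1_def using that by (intro has_vector_derivative_spherical_mean[OF f1 ec]) auto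
  have 2: "(a1 has_vector_derivative a2 r) (at r)" if "0 \<le> r" "r < R" for r
    unfolding a1_def a2_def using that
    by (intro has_vector_derivative_sum has_vector_derivative_spherical_mean[OF f2] continuous_intros ec) auto
  have 3: "r *\<^sub>R a1 r = (\<integral>z. euler f (r *\<^sub>R z) * e z \<partial>sphm)" if "0 < r" "r < R" for r
  proof -
    have "(\<integral>z. euler f (r *\<^sub>R z) * e z \<partial>sphm) = (\<integral>z. r *\<^sub>R (\<Sum>k\<in>UNIV. partial k f (r *\<^sub>R z) * (z $ k *\<^sub>R e z)) \<partial>sphm)"
      by (intro Bochner_Integration.integral_cong refl)
        (simp add: euler_def sum_distrib_right sum_distrib_left mult.commute scaleR_sum_right)
    also have "\<dots> = r *\<^sub>R (\<Sum>k\<in>UNIV. \<integral>z. partial k f (r *\<^sub>R z) * (z $ k *\<^sub>R e z) \<partial>sphm)"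
      using that by (simp, subst Bochner_Integration.integral_sum)
        (auto intro!: integrable_sphm_continuous continuous_intros cp ec)
    finally show ?thesis by (simp add: a1_def)
  qed
  have 4: "r\<^sup>2 *\<^sub>R a2 r + ((real CARD('n) - 1) * r) *\<^sub>R a1 r
         - (real m * (real m + real CARD('n) - 2)) *\<^sub>R (\<integral>z. f (r *\<^sub>R z) * e z \<partial>sphm)
       = r\<^sup>2 *\<^sub>R (\<integral>z. laplacian f (r *\<^sub>R z) * e z \<partial>sphm)" if r: "0 < r" "r < R" for r
  proof -
    have r0: "0 \<le> r" using r by simp
    note int = integrable_sphm_continuous
    let ?T = "\<lambda>i j z. tangential i j (tangential i j f) (r *\<^sub>R z)"
    have cT: "continuous_on (sphere 0 1) (?T i j)" for i j
      by (intro cs[OF r0 r(2)] C1_on_tangential_continuous C1_on_tangential f2)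
    let ?H = "\<lambda>z. \<Sum>i\<in>UNIV. \<Sum>j\<in>UNIV. ((r *\<^sub>R z) $ i * (r *\<^sub>R z) $ j) *\<^sub>R partial i (partial j f) (r *\<^sub>R z)"
    have "r\<^sup>2 *\<^sub>R a2 r = (\<Sum>k\<in>UNIV. \<Sum>l\<in>UNIV. \<integral>z. r\<^sup>2 *\<^sub>R (partial l (partial k f) (r *\<^sub>R z) * (z $ l *\<^sub>R (z $ k *\<^sub>R e z))) \<partial>sphm)"
      unfolding a2_def scaleR_sum_right by (simp only: Bochner_Integration.integral_scaleR_right)
    also have "\<dots> = (\<integral>z. (\<Sum>k\<in>UNIV. \<Sum>l\<in>UNIV. r\<^sup>2 *\<^sub>R (partial l (partial k f) (r *\<^sub>R z) * (z $ l *\<^sub>R (z $ k *\<^sub>R e z)))) \<partial>sphm)"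
      by (rule integral_sphm_sum2[symmetric]) (intro continuous_intros cp ec r0 r)
    also have "\<dots> = (\<integral>z. ?H z * e z \<partial>sphm)"
      by (intro Bochner_Integration.integral_cong refl, subst sum.swap)
        (simp only: sum_distrib_right, simp add: power2_eq_square mult_ac)
    finally have A2: "r\<^sup>2 *\<^sub>R a2 r = (\<integral>z. ?H z * e z \<partial>sphm)" .
    \<comment> \<open>Both operators are moved onto \<open>e\<close>. Tangential operators commute
      with dilations, so the integrations by parts are done for the dilated function on the ball of
      radius \<open>R / r > 1\<close>.\<close>
    have TT: "(\<integral>z. ?T i j z * e z \<partial>sphm) = (\<integral>z. f (r *\<^sub>R z) * tangential i j (tangential i j e) z \<partial>sphm)" for i j
    proof -
      let ?F = "\<lambda>x. f (r *\<^sub>R x)" and ?G = "\<lambda>x. tangential i j f (r *\<^sub>R x)"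
      have R': "R / r > 1" using r by simp
      have sub: "(\<lambda>x. r *\<^sub>R x) ` ball 0 (R / r) \<subseteq> ball (0::real^'n) R"
        using r by (auto simp: field_simps)
      have F: "C1_on (ball 0 (R / r)) ?F" by (rule C1_on_scaled[OF f1 sub])
      have G: "C1_on (ball 0 (R / r)) ?G" by (rule C1_on_scaled[OF C1_on_tangential[OF f2 f2] sub])
      have "(\<integral>z. ?T i j z * e z \<partial>sphm) = (\<integral>z. tangential i j ?G z * e z \<partial>sphm)"
        by (intro Bochner_Integration.integral_cong refl)
          (simp add: tangential_scaled[OF C1_onD(1)[OF C1_on_tangential[OF f2 f2] inb[OF r0 r(2)]]])
      also have "\<dots> = - (\<integral>z. ?G z * tangential i j e z \<partial>sphm)"
        by (rule integral_tangential_by_parts[OF R' G]) (use P in auto)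
      also have "(\<integral>z. ?G z * tangential i j e z \<partial>sphm) = (\<integral>z. tangential i j ?F z * tangential i j e z \<partial>sphm)"
        by (intro Bochner_Integration.integral_cong refl)
          (simp add: tangential_scaled[OF C1_onD(1)[OF f1 inb[OF r0 r(2)]]])
      also have "\<dots> = - (\<integral>z. ?F z * tangential i j (tangential i j e) z \<partial>sphm)"
        by (rule integral_tangential_by_parts[OF R' F])
          (use harmonic_polyD(1)[OF harmonic_poly_tangential[OF e]] in auto)
      finally show ?thesis by simp
    qed
    have "(\<integral>z. (\<Sum>i\<in>UNIV. \<Sum>j\<in>UNIV. ?T i j z) * e z \<partial>sphm) = (\<Sum>i\<in>UNIV. \<Sum>j\<in>UNIV. \<integral>z. ?T i j z * e z \<partial>sphm)"
      unfolding sum_distrib_right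
      by (rule integral_sphm_sum2) (intro continuous_intros cT ec)
    also have "\<dots> = (\<Sum>i\<in>UNIV. \<Sum>j\<in>UNIV. \<integral>z. f (r *\<^sub>R z) * tangential i j (tangential i j e) z \<partial>sphm)"
      unfolding TT ..
    also have "\<dots> = (\<integral>z. f (r *\<^sub>R z) * (\<Sum>i\<in>UNIV. \<Sum>j\<in>UNIV. tangential i j (tangential i j e) z) \<partial>sphm)"
      unfolding sum_distrib_left
      by (rule integral_sphm_sum2[symmetric])
        (intro continuous_intros cp r0 r continuous_on_poly
          harmonic_polyD(1)[OF harmonic_poly_tangential[OF harmonic_poly_tangential[OF e]]])
    also have "\<dots> = (\<integral>z. (- (2 * real m * (real m + real CARD('n) - 2))) *\<^sub>R (f (r *\<^sub>R z) * e z) \<partial>sphm)"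
      unfolding sum_tangential_squared_harmonic[OF e] by simp
    finally have S: "(\<integral>z. (\<Sum>i\<in>UNIV. \<Sum>j\<in>UNIV. ?T i j z) * e z \<partial>sphm)
       = (- (2 * real m * (real m + real CARD('n) - 2))) *\<^sub>R (\<integral>z. f (r *\<^sub>R z) * e z \<partial>sphm)"
      by simp
    have cH: "continuous_on (sphere 0 1) ?H" by (intro continuous_intros cp r0 r)
    have cE: "continuous_on (sphere 0 1) (\<lambda>z. euler f (r *\<^sub>R z))"
      unfolding euler_def by (intro continuous_intros cp r0 r)
    have "r\<^sup>2 *\<^sub>R (\<integral>z. laplacian f (r *\<^sub>R z) * e z \<partial>sphm) = (\<integral>z. r\<^sup>2 *\<^sub>R (laplacian f (r *\<^sub>R z) * e z) \<partial>sphm)"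
      by simp
    \<comment> \<open>The Laplacian split into its spherical part (half of the sum over ordered
      pairs), the second radial derivative \<open>?H\<close>, and the first-order radial term with
      factor \<open>n - 1\<close>.\<close>
    also have "\<dots> = (\<integral>z. (1/2) *\<^sub>R ((\<Sum>i\<in>UNIV. \<Sum>j\<in>UNIV. ?T i j z) * e z) + ?H z * e z
        + (real CARD('n) - 1) *\<^sub>R (euler f (r *\<^sub>R z) * e z) \<partial>sphm)"
    proof (intro Bochner_Integration.integral_cong refl)
      fix z :: "real^'n" assume "z \<in> space sphm"
      then have z: "z \<in> sphere 0 1" by simp
      have d: "f differentiable (at (r *\<^sub>R z))" "\<And>j. partial j f differentiable (at (r *\<^sub>R z))"
        using inb[OF r0 r(2) z] C1_onD(1)[OF f1] C1_onD(1)[OF f2] by auto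
      have n: "(norm (r *\<^sub>R z))\<^sup>2 = r\<^sup>2" using z by simp
      show "r\<^sup>2 *\<^sub>R (laplacian f (r *\<^sub>R z) * e z) = (1/2) *\<^sub>R ((\<Sum>i\<in>UNIV. \<Sum>j\<in>UNIV. ?T i j z) * e z) + ?H z * e z
        + (real CARD('n) - 1) *\<^sub>R (euler f (r *\<^sub>R z) * e z)"
        unfolding sum_tangential_squared[OF d] euler_euler[OF d(2)] n
        by (simp add: scaleR_conv_of_real[where 'a=complex] algebra_simps)
    qed
    also have "\<dots> = (1/2) *\<^sub>R (\<integral>z. (\<Sum>i\<in>UNIV. \<Sum>j\<in>UNIV. ?T i j z) * e z \<partial>sphm) + (\<integral>z. ?H z * e z \<partial>sphm)
        + (real CARD('n) - 1) *\<^sub>R (\<integral>z. euler f (r *\<^sub>R z) * e z \<partial>sphm)"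
      by (subst Bochner_Integration.integral_add Bochner_Integration.integral_scaleR_right
          | intro int continuous_intros cT cH cE ec refl)+
    also have "\<dots> = r\<^sup>2 *\<^sub>R a2 r + ((real CARD('n) - 1) * r) *\<^sub>R a1 r
         - (real m * (real m + real CARD('n) - 2)) *\<^sub>R (\<integral>z. f (r *\<^sub>R z) * e z \<partial>sphm)"
      unfolding S A2[symmetric] 3[OF r, symmetric] by (simp add: algebra_simps)
    finally show ?thesis by simp
  qed
  from 1 2 3 4 show ?thesis by (rule that)
qed

section \<open>The regular radial solution\<close>

definition hypF :: "nat \<Rightarrow> nat \<Rightarrow> real \<Rightarrow> real" where
  "hypF N m z = hyp2F1 (real m) (1 - real N / 2) (real m + real N / 2) z"

definition hypf :: "nat \<Rightarrow> nat \<Rightarrow> real fps" where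
  "hypf N m = fps_hypergeo [real m, 1 - real N / 2] [real m + real N / 2] 1"

text \<open>The absolute values of the Taylor coefficients of \<open>(1 - z) powr (N/2 - 1)\<close>.
  They majorize the coefficients of \<open>hypf N m\<close> for all \<open>m\<close> at once, since
  the remaining quotient of Pochhammer symbols is at most one.\<close>

definition hypT :: "nat \<Rightarrow> nat \<Rightarrow> real" where
  "hypT N k = \<bar>pochhammer (1 - real N / 2) k\<bar> / fact k"

lemma hypF_eval: "hypF N m = eval_fps (hypf N m)"
  by (simp add: hypF_def[abs_def] hyp2F1_def hypf_def)

lemma hypf_nth: "fps_nth (hypf N m) k = pochhammer (real m) k * pochhammer (1 - real N / 2) k /
    (pochhammer (real m + real N / 2) k * fact k)"
  by (simp add: hypf_def)

lemma pochhammer_mono: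
  fixes a b :: real assumes "0 \<le> a" "a \<le> b" shows "pochhammer a k \<le> pochhammer b k"
  unfolding pochhammer_prod using assms by (intro prod_mono) auto

lemma hypf_bound:
  assumes "N \<ge> 2" shows "\<bar>fps_nth (hypf N m) k\<bar> \<le> hypT N k"
proof -
  have p: "0 \<le> pochhammer (real m) k" unfolding pochhammer_prod by (intro prod_nonneg) auto
  have q: "0 < pochhammer (real m + real N / 2) k" using assms by (intro pochhammer_pos) auto
  have le: "pochhammer (real m) k \<le> pochhammer (real m + real N / 2) k"
    by (rule pochhammer_mono) auto
  have "\<bar>fps_nth (hypf N m) k\<bar> = (pochhammer (real m) k / pochhammer (real m + real N / 2) k) * hypT N k"
    using p q by (simp add: hypf_nth hypT_def abs_mult)
  also have "\<dots> \<le> 1 * hypT N k"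
    using p q le by (intro mult_right_mono) (auto simp: hypT_def)
  finally show ?thesis by simp
qed

text \<open>With \<open>b = 1 - N/2\<close> the series telescopes: \<open>(k + 1) t (k + 1) = (k + b) t k\<close> for \<open>k \<ge> -b\<close>.\<close>

lemma summable_hypT:
  assumes "N \<ge> 2" shows "summable (hypT N)"
proof (cases "N = 2")
  case True
  have "hypT N k = 0" if "k \<notin> {0}" for k using that True by (simp add: hypT_def pochhammer_0_left)
  then show ?thesis by (intro summable_finite[of "{0}"]) auto
next
  case False
  define b where "b = 1 - real N / 2"
  have b: "b < 0" using False assms by (simp add: b_def)
  define K where "K = nat \<lceil>- b\<rceil>"
  have step: "real (Suc k) * hypT N (Suc k) = (real k + b) * hypT N k" if "k \<ge> K" for k
  proof -
    have "real k + b \<ge> 0" using that unfolding K_def by linarith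
    then have "\<bar>pochhammer b (Suc k)\<bar> = (real k + b) * \<bar>pochhammer b k\<bar>"
      by (simp add: pochhammer_Suc abs_mult)
    then show ?thesis
      unfolding hypT_def b_def[symmetric] fact_Suc by (simp del: of_nat_Suc)
  qed
  have sum: "(\<Sum>i<n. hypT N (i + K)) = (real K * hypT N K - real (n + K) * hypT N (n + K)) / (- b)" for n
  proof (induction n)
    case (Suc n)
    have "real (Suc n + K) * hypT N (Suc n + K) = (real (n + K) + b) * hypT N (n + K)"
      using step[of "n + K"] by simp
    then show ?case using Suc b by (simp add: field_simps)
  qed simp
  have nn: "hypT N k \<ge> 0" for k by (simp add: hypT_def)
  have "summable (\<lambda>i. hypT N (i + K))"
  proof (rule summableI_nonneg_bounded)
    show "(\<Sum>i<n. hypT N (i + K)) \<le> real K * hypT N K / (- b)" for n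
      unfolding sum using b nn[of "n + K"] by (intro divide_right_mono) auto
  qed (rule nn)
  then show ?thesis by (simp only: summable_iff_shift)
qed

section \<open>Convergence on the closed interval and the hypergeometric equation\<close>

lemma summable_hypf:
  assumes "N \<ge> 2" "\<bar>z\<bar> \<le> 1" shows "summable (\<lambda>k. fps_nth (hypf N m) k * z ^ k)"
proof (rule summable_comparison_test'[OF summable_hypT[OF assms(1)], of 0])
  fix k
  have "\<bar>fps_nth (hypf N m) k\<bar> * \<bar>z\<bar> ^ k \<le> hypT N k * 1"
    using hypf_bound[OF assms(1), of m k] assms(2)
    by (intro mult_mono power_le_one) (auto simp: hypT_def)
  then show "norm (fps_nth (hypf N m) k * z ^ k) \<le> hypT N k" by (simp add: abs_mult power_abs)
qed

lemma hypf_conv_radius: "N \<ge> 2 \<Longrightarrow> fps_conv_radius (hypf N m) \<ge> 1"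
  using conv_radius_geI[OF summable_hypf[of N 1 m]] by (simp add: fps_conv_radius_def one_ereal_def)

text \<open>The endpoint \<open>z = 1\<close> is the point of the statement, because
  \<open>S_fun\<close> divides by the value there; the summable majorant \<open>hypT\<close> gives
  uniform convergence up to it.\<close>

lemma continuous_on_hypF:
  assumes "N \<ge> 2" shows "continuous_on {-1..1} (hypF N m)"
proof -
  have "uniform_limit {-1..1} (\<lambda>n z. \<Sum>k<n. fps_nth (hypf N m) k * z ^ k) (\<lambda>z. \<Sum>k. fps_nth (hypf N m) k * z ^ k) sequentially"
  proof (rule Weierstrass_m_test[OF _ summable_hypT[OF assms]])
    fix k and z :: real assume "z \<in> {-1..1}"
    then have "\<bar>fps_nth (hypf N m) k\<bar> * \<bar>z\<bar> ^ k \<le> hypT N k * 1"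
      using hypf_bound[OF assms, of m k]
      by (intro mult_mono power_le_one) (auto simp: hypT_def)
    then show "norm (fps_nth (hypf N m) k * z ^ k) \<le> hypT N k" by (simp add: abs_mult power_abs)
  qed
  then have "continuous_on {-1..1} (\<lambda>z. \<Sum>k. fps_nth (hypf N m) k * z ^ k)"
    by (rule uniform_limit_theorem[rotated]) (auto intro!: continuous_intros always_eventually)
  then show ?thesis by (simp add: hypF_eval eval_fps_def[abs_def])
qed

definition hypF1 where "hypF1 N m = eval_fps (fps_deriv (hypf N m))"
definition hypF2 where "hypF2 N m = eval_fps (fps_deriv (fps_deriv (hypf N m)))"

lemma hypf_deriv_conv_radius:
  assumes "N \<ge> 2"
  shows "fps_conv_radius (fps_deriv (hypf N m)) \<ge> 1" "fps_conv_radius (fps_deriv (fps_deriv (hypf N m))) \<ge> 1"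
  using fps_conv_radius_deriv[of "hypf N m"] fps_conv_radius_deriv[of "fps_deriv (hypf N m)"]
    hypf_conv_radius[OF assms, of m] by (auto intro: order_trans)

lemma hypF_deriv:
  assumes "N \<ge> 2" "\<bar>z\<bar> < 1"
  shows "(hypF N m has_real_derivative hypF1 N m z) (at z)"
    "(hypF1 N m has_real_derivative hypF2 N m z) (at z)"
proof -
  have z: "ereal (norm z) < 1" using assms by (simp add: one_ereal_def)
  show "(hypF N m has_real_derivative hypF1 N m z) (at z)"
    unfolding hypF_eval hypF1_def
    by (rule has_field_derivative_eval_fps[OF less_le_trans[OF z hypf_conv_radius[OF assms(1)]]])
  show "(hypF1 N m has_real_derivative hypF2 N m z) (at z)"
    unfolding hypF2_def hypF1_def
    by (rule has_field_derivative_eval_fps[OF less_le_trans[OF z hypf_deriv_conv_radius(1)[OF assms(1)]]])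
qed

lemma hypf_rec:
  assumes "N \<ge> 2"
  shows "fps_nth (hypf N m) (Suc k) * (real (Suc k) * (real m + real N / 2 + real k))
    = fps_nth (hypf N m) k * ((real m + real k) * (1 - real N / 2 + real k))"
proof -
  have "pochhammer (real m + real N / 2) k \<noteq> 0" "real m + real N / 2 + real k \<noteq> 0"
    using assms pochhammer_pos[of "real m + real N / 2" k] by auto
  moreover have "(X * A) * (Y * B) / ((Z * C) * (S * F)) * (S * C) = X * Y / (Z * F) * (A * B)"
    if "C \<noteq> 0" "S \<noteq> 0" "Z \<noteq> 0" "F \<noteq> 0" for X A Y B Z C S F :: real
    using that by (simp add: field_simps)
  ultimately show ?thesis
    unfolding hypf_nth pochhammer_Suc fact_Suc by (simp del: of_nat_Suc)
qed

text \<open>The hypergeometric equation with \<open>a = m\<close>, \<open>b = 1 - N/2\<close>,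
  \<open>c = m + N/2\<close>, hence \<open>a + b + 1 = m + 2 - N/2\<close>. As an identity of formal
  power series it is the recursion \<open>hypf_rec\<close>, and it is evaluated inside the unit
  disc.\<close>

lemma hypF_ODE:
  assumes N: "N \<ge> 2" and z: "\<bar>z\<bar> < 1"
  shows "z * (1 - z) * hypF2 N m z + (real m + real N / 2 - (real m + 2 - real N / 2) * z) * hypF1 N m z
    - real m * (1 - real N / 2) * hypF N m z = 0"
proof -
  define f where "f = hypf N m"
  let ?a = "real m" and ?b = "1 - real N / 2" and ?c = "real m + real N / 2"
  define g where "g = fps_X * fps_deriv (fps_deriv f)"
  define h where "h = fps_X * (fps_X * fps_deriv (fps_deriv f))"
  define j where "j = fps_X * fps_deriv f"
  have id: "g - h + fps_const ?c * fps_deriv f - fps_const (?a + ?b + 1) * j - fps_const (?a * ?b) * f = 0"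
  proof (rule fps_ext)
    fix n
    have rec: "(1 + real n) * (?c + real n) * fps_nth f (Suc n) = (?a + real n) * (?b + real n) * fps_nth f n"
      using hypf_rec[OF N, of m n] by (simp add: f_def algebra_simps)
    have "fps_nth g n = real n * (real n + 1) * fps_nth f (Suc n)"
      by (cases n) (auto simp: g_def algebra_simps)
    moreover have "fps_nth h n = real n * (real n - 1) * fps_nth f n"
      by (cases n; cases "n - 1") (auto simp: h_def algebra_simps)
    moreover have "fps_nth j n = real n * fps_nth f n"
      by (cases n) (auto simp: j_def)
    ultimately have eq1: "fps_nth (g - h + fps_const c * fps_deriv f - fps_const d * j - fps_const e * f) n
        = (real n * (real n + 1) + c * (real n + 1)) * fps_nth f (Suc n) - (real n * (real n - 1) + d * real n + e) * fps_nth f n"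
      for c d e by (simp add: algebra_simps)
    have eq2: "(x * (x + 1) + c * (x + 1)) * A - (x * (x - 1) + (a + b + 1) * x + a * b) * B
        = (1 + x) * (c + x) * A - (a + x) * (b + x) * B" for a b c x A B :: real
      by (simp add: algebra_simps)
    show "fps_nth (g - h + fps_const ?c * fps_deriv f - fps_const (?a + ?b + 1) * j - fps_const (?a * ?b) * f) n = fps_nth 0 n"
      unfolding eq1 eq2 by (simp only: rec diff_self fps_zero_nth)
  qed
  have r: "ereal (norm z) < fps_conv_radius f" "ereal (norm z) < fps_conv_radius (fps_deriv f)"
     "ereal (norm z) < fps_conv_radius (fps_deriv (fps_deriv f))"
    using less_le_trans[OF _ hypf_conv_radius[OF N, of m]] less_le_trans[OF _ hypf_deriv_conv_radius(1)[OF N, of m]]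
      less_le_trans[OF _ hypf_deriv_conv_radius(2)[OF N, of m]] z
    unfolding f_def one_ereal_def real_norm_def ereal_less_eq by simp_all
  have rm: "ereal (norm z) < fps_conv_radius (p * q)"
    if "ereal (norm z) < fps_conv_radius p" "ereal (norm z) < fps_conv_radius q" for p q :: "real fps"
    by (rule less_le_trans[OF _ fps_conv_radius_mult]) (use that in simp)
  have ra: "ereal (norm z) < fps_conv_radius (p + q)" "ereal (norm z) < fps_conv_radius (p - q)"
    if "ereal (norm z) < fps_conv_radius p" "ereal (norm z) < fps_conv_radius q" for p q :: "real fps"
    by (rule less_le_trans[OF _ fps_conv_radius_add] less_le_trans[OF _ fps_conv_radius_diff]; use that in simp)+
  have rX: "ereal (norm z) < fps_conv_radius (fps_X :: real fps)" "ereal (norm z) < fps_conv_radius (fps_const c :: real fps)" for c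
    by auto
  have C: "ereal (norm z) < fps_conv_radius g" "ereal (norm z) < fps_conv_radius h" "ereal (norm z) < fps_conv_radius j"
    "ereal (norm z) < fps_conv_radius (fps_const c * fps_deriv f)" "ereal (norm z) < fps_conv_radius (fps_const c * f)"
    "ereal (norm z) < fps_conv_radius (fps_const c * j)" for c
    unfolding g_def h_def j_def by (intro r rm rX)+
  have "eval_fps (g - h + fps_const ?c * fps_deriv f - fps_const (?a + ?b + 1) * j - fps_const (?a * ?b) * f) z = 0"
    unfolding id by simp
  then have "eval_fps g z - eval_fps h z + eval_fps (fps_const ?c * fps_deriv f) z
      - eval_fps (fps_const (?a + ?b + 1) * j) z - eval_fps (fps_const (?a * ?b) * f) z = 0"
    by (simp only: eval_fps_diff eval_fps_add ra C)
  then have "z * hypF2 N m z - z * (z * hypF2 N m z) + ?c * hypF1 N m z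
      - (?a + ?b + 1) * (z * hypF1 N m z) - ?a * ?b * hypF N m z = 0"
    unfolding g_def h_def j_def hypF_eval hypF1_def hypF2_def f_def[symmetric]
    by (simp only: eval_fps_mult r rm rX eval_fps_X eval_fps_const)
  then show ?thesis by (simp add: algebra_simps)
qed

lemma hypF_0 [simp]: "hypF N m 0 = 1"
  unfolding hypF_eval eval_fps_at_0 by (simp add: hypf_nth)

text \<open>\<open>radW\<close> stands for \<open>r d/dr radw\<close>, and \<open>radk\<close> is the coefficient of the first order term that
  \<open>\<Delta>\<^sub>h\<close> has in addition to \<open>\<Delta>\<close>.\<close>

definition radw :: "nat \<Rightarrow> nat \<Rightarrow> real \<Rightarrow> real" where
  "radw N m r = r ^ m * hypF N m (r\<^sup>2)"

definition radW :: "nat \<Rightarrow> nat \<Rightarrow> real \<Rightarrow> real" where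
  "radW N m r = r ^ m * (real m * hypF N m (r\<^sup>2) + 2 * r\<^sup>2 * hypF1 N m (r\<^sup>2))"

definition radk :: "nat \<Rightarrow> real \<Rightarrow> real" where
  "radk N r = 2 * (real N - 2) * r\<^sup>2 / (1 - r\<^sup>2)"

lemma neg_1_le_power2: "- 1 \<le> (x::real)\<^sup>2" "- 1 < (x::real)\<^sup>2"
  using zero_le_power2[of x] by linarith+

lemma sq_less_1: "0 \<le> r \<Longrightarrow> r < 1 \<Longrightarrow> r\<^sup>2 < (1::real)"
  by (simp add: power_less_one_iff)

lemma DERIV_power_self:
  fixes x :: real
  assumes "x > 0" shows "((\<lambda>x. x ^ k) has_real_derivative real k * x ^ k / x) (at x)"
  by (rule DERIV_cong[OF DERIV_pow]) (use assms in \<open>cases k, auto\<close>)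

text \<open>The radial equation as a first-order system for the pair \<open>(w, r w')\<close>. The
  second component is \<open>hypF_ODE\<close> at \<open>z = r\<^sup>2\<close>, checked after
  multiplication by \<open>1 - z\<close>, the denominator of \<open>radk\<close>.\<close>

lemma radw_deriv:
  assumes N: "N \<ge> 2" and r: "0 < r" "r < 1"
  shows "(radw N m has_real_derivative radW N m r / r) (at r)"
    "(radW N m has_real_derivative
      (real m * (real m + real N - 2) * radw N m r - (real N - 2 + radk N r) * radW N m r) / r) (at r)"
proof -
  have r2: "\<bar>r\<^sup>2\<bar> < 1" using sq_less_1[of r] r by simp
  have sq: "((\<lambda>r. r\<^sup>2) has_real_derivative 2 * r) (at r)"
    by (auto intro!: derivative_eq_intros)
  note F = DERIV_chain2[OF hypF_deriv(1)[OF N r2, of m] sq] and F1 = DERIV_chain2[OF hypF_deriv(2)[OF N r2, of m] sq]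
  have pw: "real m * r ^ (m - 1) * r = real m * r ^ m" by (cases m) auto
  have pw': "real m * r ^ (m - 1) = real m * r ^ m / r" using pw r by (simp add: field_simps)
  show "(radw N m has_real_derivative radW N m r / r) (at r)"
    unfolding radw_def[abs_def] radW_def
    by (rule derivative_eq_intros F refl)+ (use r pw' in \<open>auto simp: field_simps power2_eq_square\<close>)
  let ?z = "r\<^sup>2" let ?F = "hypF N m ?z" let ?G = "hypF1 N m ?z" let ?H = "hypF2 N m ?z"
  have "(radW N m has_real_derivative
     (real m * r ^ (m - 1)) * (real m * ?F + 2 * ?z * ?G) + r ^ m * (real m * (?G * (2 * r)) + (2 * (2 * r) * ?G + 2 * ?z * (?H * (2 * r))))) (at r)"
    unfolding radW_def[abs_def]
    by (rule derivative_eq_intros F F1 refl)+ (simp add: algebra_simps)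
  moreover have "(real m * r ^ (m - 1)) * (real m * ?F + 2 * ?z * ?G) + r ^ m * (real m * (?G * (2 * r)) + (2 * (2 * r) * ?G + 2 * ?z * (?H * (2 * r))))
    = (real m * (real m + real N - 2) * radw N m r - (real N - 2 + radk N r) * radW N m r) / r"
  proof -
    have z1: "1 - ?z \<noteq> 0" "?z \<noteq> 0" using r2 r by auto
    have ode: "?z * (1 - ?z) * ?H = real m * (1 - real N / 2) * ?F - (real m + real N / 2 - (real m + 2 - real N / 2) * ?z) * ?G"
      using hypF_ODE[OF N r2, of m] by simp
    have k: "radk N r * (1 - ?z) = 2 * (real N - 2) * ?z" using z1 by (simp add: radk_def)
    have "(1 - ?z) * (real m * (real m * ?F + 2 * ?z * ?G) + (real m * (2 * ?z * ?G) + (4 * ?z * ?G + 4 * ?z * (?z * ?H))))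
      = (1 - ?z) * (real m * (real m + real N - 2) * ?F) - ((real N - 2) * (1 - ?z) + radk N r * (1 - ?z)) * (real m * ?F + 2 * ?z * ?G)"
    proof -
      have "(1 - ?z) * (4 * ?z * (?z * ?H)) = 4 * ?z * (?z * (1 - ?z) * ?H)" by simp
      then show ?thesis unfolding k using ode by (simp add: algebra_simps) algebra
    qed
    also have "\<dots> = (1 - ?z) * (real m * (real m + real N - 2) * ?F - (real N - 2 + radk N r) * (real m * ?F + 2 * ?z * ?G))"
      by (simp add: algebra_simps)
    finally have main: "real m * (real m * ?F + 2 * ?z * ?G) + (real m * (2 * ?z * ?G) + (4 * ?z * ?G + 4 * ?z * (?z * ?H)))
      = real m * (real m + real N - 2) * ?F - (real N - 2 + radk N r) * (real m * ?F + 2 * ?z * ?G)"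
      using z1(1) by (simp only: mult_cancel_left) simp
    have "(real m * (real m + real N - 2) * radw N m r - (real N - 2 + radk N r) * radW N m r) / r
      = r ^ m * (real m * (real m + real N - 2) * ?F - (real N - 2 + radk N r) * (real m * ?F + 2 * ?z * ?G)) / r"
      by (simp add: radw_def radW_def algebra_simps)
    then show ?thesis unfolding main[symmetric] pw' using r by (simp add: field_simps power2_eq_square)
  qed
  ultimately show "(radW N m has_real_derivative
      (real m * (real m + real N - 2) * radw N m r - (real N - 2 + radk N r) * radW N m r) / r) (at r)"
    by simp
qed

section \<open>Positivity and monotonicity of the radial solution\<close>

lemma continuous_on_radw:
  assumes "N \<ge> 2" shows "continuous_on {0..1} (radw N m)"
  unfolding radw_def[abs_def]
  by (intro continuous_intros continuous_on_compose2[OF continuous_on_hypF[OF assms]])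
    (auto simp: power_le_one neg_1_le_power2)

lemma continuous_on_hypF1:
  assumes "N \<ge> 2" shows "continuous_on {-1<..<1} (hypF1 N m)"
  using hypF_deriv(2)[OF assms, of _ m]
  by (intro continuous_at_imp_continuous_on ballI DERIV_isCont) (auto simp: abs_less_iff)

lemma continuous_on_radW:
  assumes "N \<ge> 2" shows "continuous_on {0..<1} (radW N m)"
  unfolding radW_def[abs_def]
  by (intro continuous_intros continuous_on_compose2[OF continuous_on_hypF[OF assms]]
      continuous_on_compose2[OF continuous_on_hypF1[OF assms]])
    (auto simp: sq_less_1 less_imp_le[OF sq_less_1] neg_1_le_power2)

lemma radW_0 [simp]: "radW N m 0 = 0"
  by (cases m) (simp_all add: radW_def)

text \<open>The derivatives used below carry a factor \<open>1 / r\<close>, so at the origin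
  continuity takes the place of differentiability.\<close>

lemma nondecreasing_from_0:
  fixes f :: "real \<Rightarrow> real"
  assumes "continuous_on {0..<b} f" "0 \<le> r" "r \<le> s" "s < b"
    and "\<And>x. 0 < x \<Longrightarrow> x < b \<Longrightarrow> (f has_real_derivative f' x) (at x)"
    and "\<And>x. 0 < x \<Longrightarrow> x < b \<Longrightarrow> f' x \<ge> 0"
  shows "f r \<le> f s"
proof (rule DERIV_nonneg_imp_increasing_open[OF assms(3)])
  show "\<exists>y. (f has_real_derivative y) (at x) \<and> 0 \<le> y" if "r < x" "x < s" for x
    using assms(5,6)[of x] that assms(2,4) by auto
qed (use assms in \<open>auto intro: continuous_on_subset\<close>)

text \<open>The integrating factor of the radial equation: it solves
  \<open>r \<mu>' = (N - 2 + radk) \<mu>\<close>, so that in the derivative of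
  \<open>radmu * radW\<close> only the zeroth order term survives.\<close>

definition radmu :: "nat \<Rightarrow> real \<Rightarrow> real" where
  "radmu N r = (r / (1 - r\<^sup>2)) ^ (N - 2)"

lemma radmu_deriv:
  assumes N: "N \<ge> 2" and r: "0 < r" "r < 1"
  shows "(radmu N has_real_derivative (real N - 2 + radk N r) * radmu N r / r) (at r)"
proof -
  have r2: "1 - r\<^sup>2 > 0" using sq_less_1[of r] r by simp
  have d1: "((\<lambda>r. 1 - r\<^sup>2) has_real_derivative (- (2 * r))) (at r)"
    by (auto intro!: derivative_eq_intros)
  have d: "((\<lambda>r. r / (1 - r\<^sup>2)) has_real_derivative (1 + r\<^sup>2) / (1 - r\<^sup>2)\<^sup>2) (at r)"
    by (rule DERIV_cong[OF DERIV_divide[OF DERIV_ident d1]]) (use r2 in \<open>auto simp: power2_eq_square\<close>)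
  have q: "r / (1 - r\<^sup>2) \<noteq> 0" using r r2 by simp
  have "real (N - 2) * (r / (1 - r\<^sup>2)) ^ (N - 2 - 1) = real (N - 2) * (r / (1 - r\<^sup>2)) ^ (N - 2) / (r / (1 - r\<^sup>2))"
    using q by (cases "N - 2") auto
  then have "real (N - 2) * (r / (1 - r\<^sup>2)) ^ (N - 2 - 1) * ((1 + r\<^sup>2) / (1 - r\<^sup>2)\<^sup>2)
     = real (N - 2) * radmu N r * ((1 + r\<^sup>2) / (1 - r\<^sup>2)) / r"
    using r r2 by (simp add: radmu_def power2_eq_square mult.commute)
  also have "real (N - 2) * ((1 + r\<^sup>2) / (1 - r\<^sup>2)) = real N - 2 + radk N r"
    using N r2 by (simp add: radk_def of_nat_diff field_simps)
  then have "real (N - 2) * radmu N r * ((1 + r\<^sup>2) / (1 - r\<^sup>2)) / r = (real N - 2 + radk N r) * radmu N r / r"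
    by (metis mult.assoc mult.commute)
  finally have eq: "real (N - 2) * (r / (1 - r\<^sup>2)) ^ (N - 2 - 1) * ((1 + r\<^sup>2) / (1 - r\<^sup>2)\<^sup>2) = (real N - 2 + radk N r) * radmu N r / r" .
  show ?thesis unfolding radmu_def[abs_def]
    using DERIV_power[OF d, of "N - 2"] eq by (simp add: radmu_def mult_ac)
qed

lemma continuous_on_radmu: "continuous_on {0..<1} (radmu N)"
  unfolding radmu_def[abs_def] using sq_less_1 by (intro continuous_intros) fastforce

lemma radmu_pos: "0 < r \<Longrightarrow> r < 1 \<Longrightarrow> radmu N r > 0"
  using sq_less_1[of r] by (simp add: radmu_def)

lemma radk_nonneg: "N \<ge> 2 \<Longrightarrow> 0 \<le> r \<Longrightarrow> r < 1 \<Longrightarrow> radk N r \<ge> 0"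
  using sq_less_1[of r] by (simp add: radk_def)

lemma radk_mono:
  assumes "N \<ge> 2" "0 \<le> r" "r \<le> s" "s < 1" shows "radk N r \<le> radk N s"
proof -
  have "r\<^sup>2 \<le> s\<^sup>2" "s\<^sup>2 < 1" using assms sq_less_1[of s] by (auto intro: power_mono)
  then show ?thesis using assms unfolding radk_def by (intro frac_le mult_left_mono) auto
qed

text \<open>Positivity: \<open>\<mu> w W\<close> is nondecreasing and vanishes at \<open>0\<close>, so that \<open>w\<^sup>2\<close> is nondecreasing.\<close>

lemma radw_pos_aux:
  assumes N: "N \<ge> 2" and r: "0 < r" "r < 1"
  shows "radw N m r > 0" "radW N m r \<ge> 0"
proof -
  have prod: "radw N m r * radW N m r \<ge> 0" if r: "0 < r" "r < 1" for r
  proof -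
    let ?f = "\<lambda>r. radmu N r * (radw N m r * radW N m r)"
    have "?f 0 \<le> ?f r"
    proof (rule nondecreasing_from_0[where b=1 and f="?f" and f'="\<lambda>x. radmu N x * ((radW N m x)\<^sup>2 + real m * (real m + real N - 2) * (radw N m x)\<^sup>2) / x"])
      show "continuous_on {0..<1} ?f"
        by (intro continuous_intros continuous_on_radmu continuous_on_radW[OF N] continuous_on_subset[OF continuous_on_radw[OF N]]) auto
      fix x :: real assume x: "0 < x" "x < 1"
      let ?V = "real m * (real m + real N - 2) * radw N m x - (real N - 2 + radk N x) * radW N m x"
      show "(?f has_real_derivative radmu N x * ((radW N m x)\<^sup>2 + real m * (real m + real N - 2) * (radw N m x)\<^sup>2) / x) (at x)"
        using x by (auto intro!: derivative_eq_intros radmu_deriv[OF N x] radw_deriv[OF N x] simp: field_simps power2_eq_square)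
      show "radmu N x * ((radW N m x)\<^sup>2 + real m * (real m + real N - 2) * (radw N m x)\<^sup>2) / x \<ge> 0"
        using x N radmu_pos[OF x, of N] by (intro divide_nonneg_pos mult_nonneg_nonneg add_nonneg_nonneg) auto
    qed (use r in auto)
    then show ?thesis using radmu_pos[OF r, of N] by (simp add: zero_le_mult_iff)
  qed
  have sqmono: "(radw N m s)\<^sup>2 \<le> (radw N m t)\<^sup>2" if "0 \<le> s" "s \<le> t" "t < 1" for s t
  proof (rule nondecreasing_from_0[where b=1 and f="\<lambda>r. (radw N m r)\<^sup>2" and f'="\<lambda>r. 2 * (radw N m r * radW N m r) / r"])
    show "continuous_on {0..<1} (\<lambda>r. (radw N m r)\<^sup>2)"
      by (intro continuous_intros continuous_on_subset[OF continuous_on_radw[OF N]]) auto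
    show "((\<lambda>r. (radw N m r)\<^sup>2) has_real_derivative 2 * (radw N m x * radW N m x) / x) (at x)"
      if "0 < x" "x < 1" for x
      using that by (auto intro!: derivative_eq_intros radw_deriv[OF N that])
    show "2 * (radw N m x * radW N m x) / x \<ge> 0" if "0 < x" "x < 1" for x
      using prod[OF that] that by simp
  qed (use that in auto)
  \<comment> \<open>Close to the origin \<open>radw\<close> is positive because \<open>hypF\<close>
    tends to \<open>1\<close>. Monotonicity of the square then excludes zeros further out, and the
    intermediate value theorem excludes a change of sign.\<close>
  have "((\<lambda>r. hypF N m (r\<^sup>2)) has_real_derivative hypF1 N m (0\<^sup>2) * (2 * 0)) (at 0)"
    by (rule DERIV_chain2[OF hypF_deriv(1)[OF N]]) (auto intro!: derivative_eq_intros)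
  then have "isCont (\<lambda>r. hypF N m (r\<^sup>2)) 0" by (rule DERIV_isCont)
  then have "eventually (\<lambda>r. hypF N m (r\<^sup>2) > 0) (at 0)"
    unfolding isCont_def by (intro order_tendstoD(1)[of _ "hypF N m (0\<^sup>2)"]) auto
  then obtain d where d: "d > 0" "\<And>x. x \<noteq> 0 \<Longrightarrow> \<bar>x\<bar> < d \<Longrightarrow> hypF N m (x\<^sup>2) > 0"
    unfolding eventually_at by (auto simp: dist_real_def)
  have pos0: "radw N m x > 0" if "0 < x" "x < d" for x
    using d(2)[of x] that by (simp add: radw_def)
  have nz: "radw N m x \<noteq> 0" if x: "0 < x" "x < 1" for x
  proof -
    define y where "y = min (d / 2) x"
    have y: "0 < y" "y < d" "y \<le> x" using d x by (auto simp: y_def)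
    have "0 < (radw N m y)\<^sup>2" using pos0[OF y(1,2)] by simp
    also have "\<dots> \<le> (radw N m x)\<^sup>2" using y x by (intro sqmono) auto
    finally show ?thesis by auto
  qed
  show w: "radw N m r > 0"
  proof (rule ccontr)
    assume "\<not> radw N m r > 0"
    define y where "y = min (d / 2) r"
    have y: "0 < y" "y < d" "y \<le> r" using d r by (auto simp: y_def)
    have "\<exists>x\<ge>y. x \<le> r \<and> radw N m x = 0"
    proof (rule IVT2')
      show "continuous_on {y..r} (radw N m)"
        using continuous_on_radw[OF N] by (rule continuous_on_subset) (use y r in auto)
    qed (use \<open>\<not> radw N m r > 0\<close> pos0[OF y(1,2)] y in auto)
    then show False using nz y r by force
  qed
  show "radW N m r \<ge> 0" using prod[OF r] w by (simp add: zero_le_mult_iff)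
qed

lemma radw_mono_aux:
  assumes N: "N \<ge> 2" and "0 \<le> r" "r \<le> s" "s \<le> 1"
  shows "radw N m r \<le> radw N m s"
proof (rule DERIV_nonneg_imp_increasing_open[OF assms(3)])
  show "\<exists>y. (radw N m has_real_derivative y) (at x) \<and> 0 \<le> y" if "r < x" "x < s" for x
    using radw_deriv(1)[OF N, of x m] radw_pos_aux(2)[OF N, of x m] that assms
    by (intro exI[of _ "radW N m x / x"]) auto
qed (use assms in \<open>auto intro: continuous_on_subset[OF continuous_on_radw[OF N]]\<close>)

lemma radw_pos:
  assumes N: "N \<ge> 2" and r: "0 < r" "r \<le> 1"
  shows "radw N m r > 0"
proof -
  have "0 < radw N m (r / 2)" using r by (intro radw_pos_aux[OF N]) auto
  also have "\<dots> \<le> radw N m r" using r by (intro radw_mono_aux[OF N]) auto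
  finally show ?thesis .
qed

text \<open>At \<open>z = 1\<close> this makes the denominator of \<open>S_fun\<close> positive; it
  holds there because \<open>radw\<close> is positive inside and nondecreasing up to the
  endpoint.\<close>

lemma hypF_pos:
  assumes N: "N \<ge> 2" and z: "0 \<le> z" "z \<le> 1"
  shows "hypF N m z > 0"
proof (cases "z = 0")
  case False
  then have "radw N m (sqrt z) > 0" using z by (intro radw_pos[OF N]) auto
  then show ?thesis using z by (simp add: radw_def zero_less_mult_iff)
qed simp

text \<open>The difference \<open>m w - W\<close> is \<open>- 2 r ^ (m + 2)\<close> times the
  derivative of \<open>hypF\<close> at \<open>r\<^sup>2\<close>. After multiplication by
  \<open>r ^ (m + N - 2)\<close> its derivative only contains \<open>radk * radW\<close>, which is
  nonnegative; hence \<open>hypF\<close> decreases.\<close>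

lemma radv_nonneg:
  assumes N: "N \<ge> 2" and r: "0 < r" "r < 1"
  shows "radW N m r \<le> real m * radw N m r"
proof -
  let ?f = "\<lambda>r. r ^ (m + N - 2) * (real m * radw N m r - radW N m r)"
  have "?f 0 \<le> ?f r"
  proof (rule nondecreasing_from_0[where b=1 and f="?f" and f'="\<lambda>x. x ^ (m + N - 2) * (radk N x * radW N m x) / x"])
    show "continuous_on {0..<1} ?f"
      by (intro continuous_intros continuous_on_radW[OF N] continuous_on_subset[OF continuous_on_radw[OF N]]) auto
    fix x :: real assume x: "0 < x" "x < 1"
    have "real (m + N - 2) = real m + real N - 2" using N by (simp add: of_nat_diff)
    note d = DERIV_mult[OF DERIV_power_self[OF x(1), of "m + N - 2", unfolded this]
        DERIV_diff[OF DERIV_cmult[OF radw_deriv(1)[OF N x, of m], of "real m"] radw_deriv(2)[OF N x, of m]]]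
    show "(?f has_real_derivative x ^ (m + N - 2) * (radk N x * radW N m x) / x) (at x)"
      by (rule DERIV_cong[OF d]) (use x in \<open>simp add: field_simps\<close>)
    show "x ^ (m + N - 2) * (radk N x * radW N m x) / x \<ge> 0"
      using x radw_pos_aux(2)[OF N x] radk_nonneg[OF N, of x] by simp
  qed (use r in auto)
  then have "?f 0 \<le> r ^ (m + N - 2) * (real m * radw N m r - radW N m r)" .
  moreover have f0: "?f 0 = 0" by (cases m) (auto simp: radw_def)
  ultimately have "0 \<le> r ^ (m + N - 2) * (real m * radw N m r - radW N m r)"
    by metis
  then show ?thesis using zero_less_power[OF r(1), of "m + N - 2"] by (simp add: zero_le_mult_iff)
qed

text \<open>The counterpart of \<open>radv_nonneg\<close>. Freezing \<open>radk\<close> at its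
  largest value \<open>K = radk N s\<close> on the interval makes the derivative of
  \<open>r ^ (m + N - 2) (W - (m - K) w)\<close> a sum of nonnegative terms.\<close>

lemma radv_lower:
  assumes N: "N \<ge> 2" and s: "0 < s" "s < 1"
  shows "(real m - radk N s) * radw N m s \<le> radW N m s"
proof -
  define K where "K = radk N s"
  let ?f = "\<lambda>r. r ^ (m + N - 2) * (radW N m r - (real m - K) * radw N m r)"
  have f0: "?f 0 \<le> ?f r" if r: "0 < r" "r < s" for r
  proof (rule nondecreasing_from_0[where b=s and f="?f" and f'="\<lambda>x. x ^ (m + N - 2) * ((real m + real N - 2) * K * radw N m x + (K - radk N x) * radW N m x) / x"])
    show "continuous_on {0..<s} ?f" using s
      by (intro continuous_intros continuous_on_subset[OF continuous_on_radW[OF N]] continuous_on_subset[OF continuous_on_radw[OF N]]) auto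
    fix x :: real assume x': "0 < x" "x < s"
    then have x: "0 < x" "x < 1" using s by auto
    have "real (m + N - 2) = real m + real N - 2" using N by (simp add: of_nat_diff)
    note d = DERIV_mult[OF DERIV_power_self[OF x(1), of "m + N - 2", unfolded this]
        DERIV_diff[OF radw_deriv(2)[OF N x, of m] DERIV_cmult[OF radw_deriv(1)[OF N x, of m], of "real m - K"]]]
    show "(?f has_real_derivative x ^ (m + N - 2) * ((real m + real N - 2) * K * radw N m x + (K - radk N x) * radW N m x) / x) (at x)"
      by (rule DERIV_cong[OF d]) (use x in \<open>simp add: field_simps\<close>)
    show "x ^ (m + N - 2) * ((real m + real N - 2) * K * radw N m x + (K - radk N x) * radW N m x) / x \<ge> 0"
      using x x' s radw_pos_aux[OF N x, of m] radk_mono[OF N, of x s] radk_nonneg[OF N, of s] N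
      by (intro divide_nonneg_pos mult_nonneg_nonneg add_nonneg_nonneg) (auto simp: K_def)
  qed (use r in auto)
  have f00: "0 \<le> ?f 0" using radk_nonneg[OF N, of s] s
    by (cases m) (auto simp: radw_def K_def)
  have pos: "radW N m r - (real m - K) * radw N m r \<ge> 0" if "0 < r" "r < s" for r
    using order_trans[OF f00 f0[OF that]] zero_less_power[OF that(1), of "m + N - 2"]
    by (simp only: zero_le_mult_iff) auto
  \<comment> \<open>The monotonicity argument covers radii strictly below \<open>s\<close>; the
    value at \<open>s\<close> is a limit from the left.\<close>
  have "isCont (\<lambda>r. radW N m r - (real m - K) * radw N m r) s"
    using radw_deriv[OF N s, of m] by (intro continuous_intros) (auto intro: DERIV_isCont)
  then have "((\<lambda>r. radW N m r - (real m - K) * radw N m r) \<longlongrightarrow> radW N m s - (real m - K) * radw N m s) (at_left s)"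
    by (auto simp: isCont_def intro: filterlim_mono at_le)
  then have "0 \<le> radW N m s - (real m - K) * radw N m s"
  proof (rule tendsto_lowerbound)
    show "\<forall>\<^sub>F r in at_left s. 0 \<le> radW N m r - (real m - K) * radw N m r"
      using eventually_at_left_real[OF s(1)] by eventually_elim (use pos in auto)
  qed simp
  then show ?thesis by (simp add: K_def)
qed

text \<open>The two preceding inequalities in the variable \<open>z = r\<^sup>2\<close>. The second
  is a differential inequality saying that \<open>hypF N m z / (1 - z) ^ (N - 2)\<close> does not
  decrease.\<close>

lemma hypF1_bounds:
  assumes N: "N \<ge> 2" and z: "0 < z" "z < 1"
  shows "hypF1 N m z \<le> 0" "- (real N - 2) * hypF N m z \<le> (1 - z) * hypF1 N m z"
proof -
  define r where "r = sqrt z"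
  have r: "0 < r" "r < 1" "r\<^sup>2 = z" using z by (auto simp: r_def)
  have p: "r ^ m > 0" using r by simp
  have "r ^ m * (2 * z * hypF1 N m z) \<le> 0"
    using radv_nonneg[OF N r(1,2), of m] by (simp add: radw_def radW_def r(3) algebra_simps)
  then show "hypF1 N m z \<le> 0" using p z by (simp add: mult_le_0_iff zero_le_mult_iff)
  have "0 \<le> radW N m r - (real m - radk N r) * radw N m r"
    using radv_lower[OF N r(1,2), of m] by simp
  also have "\<dots> = r ^ m * (2 * z * hypF1 N m z + radk N r * hypF N m z)"
    by (simp add: radw_def radW_def r(3) algebra_simps)
  finally have "0 \<le> 2 * z * hypF1 N m z + radk N r * hypF N m z" using p by (simp add: zero_le_mult_iff)
  then have "0 \<le> (1 - z) * (2 * z * hypF1 N m z + radk N r * hypF N m z)" using z by simp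
  also have "\<dots> = 2 * z * ((1 - z) * hypF1 N m z + (real N - 2) * hypF N m z)"
    using z by (simp add: radk_def r(3) field_simps)
  finally have "0 \<le> (1 - z) * hypF1 N m z + (real N - 2) * hypF N m z"
    using z by (simp add: zero_le_mult_iff)
  then show "- (real N - 2) * hypF N m z \<le> (1 - z) * hypF1 N m z"
    by (simp add: algebra_simps)
qed

lemma hypF_antimono:
  assumes N: "N \<ge> 2" and yz: "0 \<le> y" "y \<le> z" "z \<le> 1"
  shows "hypF N m z \<le> hypF N m y"
proof (rule DERIV_nonpos_imp_decreasing_open[OF yz(2)])
  show "\<exists>y. (hypF N m has_real_derivative y) (at x) \<and> y \<le> 0" if "y < x" "x < z" for x
    using hypF_deriv(1)[OF N, of x m] hypF1_bounds(1)[OF N, of x m] that yz by auto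
qed (use yz in \<open>auto intro: continuous_on_subset[OF continuous_on_hypF[OF N]]\<close>)

lemma hypF_le_1: "N \<ge> 2 \<Longrightarrow> 0 \<le> z \<Longrightarrow> z \<le> 1 \<Longrightarrow> hypF N m z \<le> 1"
  using hypF_antimono[of N 0 z m] by simp

text \<open>The bound does not depend on \<open>m\<close>. Together with \<open>hypF_le_1\<close> it
  makes \<open>radw N m r\<close> comparable with \<open>r ^ m\<close> at any fixed radius below
  one.\<close>

lemma hypF_lower:
  assumes N: "N \<ge> 2" and z: "0 \<le> z" "z < 1"
  shows "(1 - z) ^ (N - 2) \<le> hypF N m z"
proof -
  let ?g = "\<lambda>z. hypF N m z / (1 - z) ^ (N - 2)"
  have "?g 0 \<le> ?g z"
  proof (rule nondecreasing_from_0[where b=1 and f="?g" and f'="\<lambda>x. ((1 - x) * hypF1 N m x + (real N - 2) * hypF N m x) / ((1 - x) * (1 - x) ^ (N - 2))"])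
    show "continuous_on {0..<1} ?g"
      by (intro continuous_intros continuous_on_subset[OF continuous_on_hypF[OF N]]) auto
    fix x :: real assume x: "0 < x" "x < 1"
    have pw: "real (N - 2) * (1 - x) ^ (N - 2 - 1) = (real N - 2) * (1 - x) ^ (N - 2) / (1 - x)"
      using x N by (cases "N - 2") (auto simp: of_nat_diff)
    have "((\<lambda>z. (1 - z) ^ (N - 2)) has_real_derivative - ((real N - 2) * (1 - x) ^ (N - 2) / (1 - x))) (at x)"
      by (rule derivative_eq_intros refl)+ (simp add: pw[symmetric] del: One_nat_def)
    from DERIV_divide[OF hypF_deriv(1)[OF N, of x m] this]
    show "(?g has_real_derivative ((1 - x) * hypF1 N m x + (real N - 2) * hypF N m x) / ((1 - x) * (1 - x) ^ (N - 2))) (at x)"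
      by (rule DERIV_cong) (use x in \<open>auto simp: field_simps\<close>)
    have "(1 - x) * hypF1 N m x + (real N - 2) * hypF N m x \<ge> 0"
      using hypF1_bounds(2)[OF N x, of m] by (simp add: algebra_simps)
    then show "((1 - x) * hypF1 N m x + (real N - 2) * hypF N m x) / ((1 - x) * (1 - x) ^ (N - 2)) \<ge> 0"
      using x by (intro divide_nonneg_pos) auto
  qed (use z in auto)
  then show ?thesis using z by (simp add: field_simps)
qed

lemma hypF1_uniform_bound:
  assumes N: "N \<ge> 2" and r: "0 \<le> r" "r < 1"
  obtains B where "\<And>m z. 0 \<le> z \<Longrightarrow> z \<le> r \<Longrightarrow> \<bar>hypF1 N m z\<bar> \<le> B"
proof
  fix m and z :: real assume z: "0 \<le> z" "z \<le> r"
  \<comment> \<open>The second summand takes care of \<open>z = 0\<close>, where the value is the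
    first Taylor coefficient and is bounded by \<open>hypT N 1\<close>.\<close>
  show "\<bar>hypF1 N m z\<bar> \<le> (real N - 2) / (1 - r) + \<bar>1 - real N / 2\<bar>"
  proof (cases "z = 0")
    case True
    have "\<bar>hypF1 N m 0\<bar> = \<bar>fps_nth (hypf N m) 1\<bar>" by (simp add: hypF1_def eval_fps_at_0)
    also have "\<dots> \<le> \<bar>1 - real N / 2\<bar>" using hypf_bound[OF N, of m 1] by (simp add: hypT_def)
    finally show ?thesis using True N r by (simp add: add_increasing)
  next
    case False
    then have z': "0 < z" "z < 1" using z r by auto
    have "(1 - z) * \<bar>hypF1 N m z\<bar> \<le> (real N - 2) * hypF N m z"
      using hypF1_bounds[OF N z', of m] by (simp add: algebra_simps)
    also have "\<dots> \<le> real N - 2" using hypF_le_1[OF N, of z m] z' N by (simp add: mult_left_le)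
    finally have "\<bar>hypF1 N m z\<bar> \<le> (real N - 2) / (1 - z)" using z' by (simp add: field_simps)
    also have "\<dots> \<le> (real N - 2) / (1 - r)" using z r N by (intro divide_left_mono) auto
    finally show ?thesis by simp
  qed
qed

section \<open>Uniqueness of the regular solution\<close>

lemma has_vector_derivative_0_imp_const:
  fixes f :: "real \<Rightarrow> 'a::banach"
  assumes c: "continuous_on {0..<b} f" and d: "\<And>x. 0 < x \<Longrightarrow> x < b \<Longrightarrow> (f has_vector_derivative 0) (at x)"
    and r: "0 \<le> r" "r < b"
  shows "f r = f 0"
proof (rule has_derivative_zero_unique_strong_interval[of "{0, r}" 0 r f])
  show "(f has_derivative (\<lambda>h. 0)) (at x within {0..r})" if "x \<in> {0..r} - {0, r}" for x
    using d[of x] that r unfolding has_vector_derivative_def by (auto intro: has_derivative_at_withinI)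
qed (use r in \<open>auto intro: continuous_on_subset[OF c]\<close>)

text \<open>The Wronskian of a regular solution with \<open>radw\<close> vanishes.\<close>

lemma radial_solution:
  fixes a a1 a2 :: "real \<Rightarrow> complex"
  assumes N: "N \<ge> 2"
    and a: "\<And>r. 0 \<le> r \<Longrightarrow> r < 1 \<Longrightarrow> (a has_vector_derivative a1 r) (at r)"
    and a1: "\<And>r. 0 \<le> r \<Longrightarrow> r < 1 \<Longrightarrow> (a1 has_vector_derivative a2 r) (at r)"
    and ode: "\<And>r. 0 < r \<Longrightarrow> r < 1 \<Longrightarrow> r\<^sup>2 *\<^sub>R a2 r + ((real N - 1) * r) *\<^sub>R a1 r
         - (real m * (real m + real N - 2)) *\<^sub>R a r = - (radk N r * r) *\<^sub>R a1 r"
  obtains \<alpha> where "\<And>r. 0 \<le> r \<Longrightarrow> r < 1 \<Longrightarrow> a r = radw N m r *\<^sub>R \<alpha>"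
proof -
  let ?w = "radw N m" and ?W = "radW N m"
  define lam where "lam = real m * (real m + real N - 2)"
  have ca: "continuous_on {0..<1} a" and ca1: "continuous_on {0..<1} a1"
    by (intro continuous_at_imp_continuous_on ballI has_vector_derivative_continuous[OF a]
        has_vector_derivative_continuous[OF a1]; simp)+
  have cw: "continuous_on {0..<1} ?w" by (rule continuous_on_subset[OF continuous_on_radw[OF N]]) auto
  have vec: "x *\<^sub>R (\<mu> *\<^sub>R ((x * w) *\<^sub>R A + (x * (W / x) + 1 * w) *\<^sub>R B - (W *\<^sub>R B + ((l * w - p * W) / x) *\<^sub>R C))
      + (p * \<mu> / x) *\<^sub>R ((x * w) *\<^sub>R B - W *\<^sub>R C))
    = \<mu> *\<^sub>R (w *\<^sub>R (x\<^sup>2 *\<^sub>R A) + (x * w * (1 + p)) *\<^sub>R B - (l * w) *\<^sub>R C)"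
    if "x \<noteq> 0" for x \<mu> w W l p :: real and A B C :: complex
    using that by (simp add: scaleR_conv_of_real field_simps power2_eq_square)
  \<comment> \<open>The Wronskian of \<open>w\<close> and \<open>a\<close> times the integrating
    factor. At the origin the bracket vanishes, so \<open>Q 0 = 0\<close> also for
    \<open>N = 2\<close>, where \<open>radmu\<close> is constantly \<open>1\<close>.\<close>
  define Q where "Q r = radmu N r *\<^sub>R ((r * ?w r) *\<^sub>R a1 r - ?W r *\<^sub>R a r)" for r
  have cQ: "continuous_on {0..<1} Q"
    unfolding Q_def[abs_def] by (intro continuous_intros continuous_on_radmu continuous_on_radW[OF N] ca ca1 cw)
  have dQ: "(Q has_vector_derivative 0) (at r)" if r: "0 < r" "r < 1" for r
  proof -
    let ?p = "real N - 2 + radk N r"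
    have "(Q has_vector_derivative
       radmu N r *\<^sub>R ((r * ?w r) *\<^sub>R a2 r + (r * (?W r / r) + 1 * ?w r) *\<^sub>R a1 r
          - (?W r *\<^sub>R a1 r + ((lam * ?w r - ?p * ?W r) / r) *\<^sub>R a r))
       + (?p * radmu N r / r) *\<^sub>R ((r * ?w r) *\<^sub>R a1 r - ?W r *\<^sub>R a r)) (at r)"
      unfolding Q_def[abs_def] lam_def using r
      by (intro has_vector_derivative_scaleR has_vector_derivative_diff a a1 radmu_deriv[OF N] radw_deriv[OF N]
          DERIV_mult' DERIV_ident) auto
    moreover have "r *\<^sub>R (radmu N r *\<^sub>R ((r * ?w r) *\<^sub>R a2 r + (r * (?W r / r) + 1 * ?w r) *\<^sub>R a1 r
          - (?W r *\<^sub>R a1 r + ((lam * ?w r - ?p * ?W r) / r) *\<^sub>R a r))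
       + (?p * radmu N r / r) *\<^sub>R ((r * ?w r) *\<^sub>R a1 r - ?W r *\<^sub>R a r)) = 0"
    proof -
      have e: "r\<^sup>2 *\<^sub>R a2 r = lam *\<^sub>R a r - ((real N - 1 + radk N r) * r) *\<^sub>R a1 r"
        using ode[OF r] unfolding lam_def by (simp add: algebra_simps)
      have "r *\<^sub>R (radmu N r *\<^sub>R ((r * ?w r) *\<^sub>R a2 r + (r * (?W r / r) + 1 * ?w r) *\<^sub>R a1 r
          - (?W r *\<^sub>R a1 r + ((lam * ?w r - ?p * ?W r) / r) *\<^sub>R a r))
          + (?p * radmu N r / r) *\<^sub>R ((r * ?w r) *\<^sub>R a1 r - ?W r *\<^sub>R a r))
        = radmu N r *\<^sub>R (?w r *\<^sub>R (r\<^sup>2 *\<^sub>R a2 r) + (r * ?w r * (1 + ?p)) *\<^sub>R a1 r - (lam * ?w r) *\<^sub>R a r)"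
        using r by (intro vec) simp
      also have "\<dots> = 0" unfolding e by (simp add: algebra_simps)
      finally show ?thesis .
    qed
    ultimately show ?thesis using r by simp
  qed
  have "Q 0 = 0" by (simp add: Q_def)
  then have Q: "Q r = 0" if "0 \<le> r" "r < 1" for r
    using has_vector_derivative_0_imp_const[OF cQ dQ that] by simp
  have eq: "(r * ?w r) *\<^sub>R a1 r = ?W r *\<^sub>R a r" if "0 < r" "r < 1" for r
    using Q[of r] that radmu_pos[OF that, of N] by (simp add: Q_def)
  define q where "q r = (1 / ?w r) *\<^sub>R a r" for r
  have dq: "(q has_vector_derivative 0) (at r)" if r: "0 < r" "r < 1" for r
  proof -
    have w: "?w r > 0" by (rule radw_pos_aux(1)[OF N r])
    have "((\<lambda>r. 1 / ?w r) has_real_derivative - (?W r / r) / (?w r)\<^sup>2) (at r)"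
      using w by (auto intro!: derivative_eq_intros radw_deriv[OF N r] simp: power2_eq_square)
    then have "(q has_vector_derivative ((1 / ?w r) *\<^sub>R a1 r + (- (?W r / r) / (?w r)\<^sup>2) *\<^sub>R a r)) (at r)"
      unfolding q_def[abs_def] using r by (intro has_vector_derivative_scaleR a) auto
    moreover have "(1 / ?w r) *\<^sub>R a1 r + (- (?W r / r) / (?w r)\<^sup>2) *\<^sub>R a r
        = (1 / (r * (?w r)\<^sup>2)) *\<^sub>R ((r * ?w r) *\<^sub>R a1 r - ?W r *\<^sub>R a r)"
      using w r by (simp add: scaleR_diff_right power2_eq_square)
    ultimately show ?thesis unfolding eq[OF r] by simp
  qed
  have "\<exists>c. \<forall>r\<in>{0<..<1}. q r = c"
    by (rule has_vector_derivative_zero_constant[of "{0<..<1}"])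
      (auto intro: has_vector_derivative_at_within dq)
  then obtain \<alpha> where \<alpha>: "\<And>r. 0 < r \<Longrightarrow> r < 1 \<Longrightarrow> q r = \<alpha>" by auto
  have pos: "a r = ?w r *\<^sub>R \<alpha>" if "0 < r" "r < 1" for r
    using \<alpha>[OF that] radw_pos_aux(1)[OF N that, of m] by (auto simp: q_def)
  \<comment> \<open>For \<open>m \<ge> 1\<close> the value \<open>radw N m 0\<close> is zero and the
    quotient says nothing there; the identity is extended to the origin by continuity.\<close>
  have "a 0 = ?w 0 *\<^sub>R \<alpha>"
  proof -
    have "((\<lambda>r. a r - ?w r *\<^sub>R \<alpha>) \<longlongrightarrow> a 0 - ?w 0 *\<^sub>R \<alpha>) (at 0 within {0..<1})"
      using ca cw by (intro tendsto_intros) (auto simp: continuous_on_def)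
    moreover have "eventually (\<lambda>r. a r - ?w r *\<^sub>R \<alpha> = 0) (at 0 within {0..<1})"
      using pos by (auto simp: eventually_at_filter)
    then have "((\<lambda>r. a r - ?w r *\<^sub>R \<alpha>) \<longlongrightarrow> 0) (at 0 within {0..<1})"
      by (rule tendsto_eventually)
    moreover have "at (0::real) within {0..<1} \<noteq> bot"
    proof -
      have "{0..<1} - {0::real} = {0<..<1}" by auto
      then show ?thesis by (simp add: at_within_eq_bot_iff closure_greaterThanLessThan)
    qed
    ultimately have "a 0 - ?w 0 *\<^sub>R \<alpha> = 0" by (metis tendsto_unique)
    then show ?thesis by simp
  qed
  with pos show ?thesis by (intro that[of \<alpha>]) (metis less_eq_real_def)
qed

section \<open>Orthogonality and completeness of spherical harmonics\<close>

lemma emeasure_sphm [simp]: "emeasure (sphm :: (real ^ 'n::finite) measure) (sphere 0 1) = 1"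
  using prob_space.emeasure_space_1[OF prob_space_sphm[where 'n='n]] by simp

lemma measure_sphm [simp]: "measure (sphm :: (real ^ 'n::finite) measure) (sphere 0 1) = 1"
  by (simp add: measure_def)

lemma C2_on_poly [intro]:
  fixes q :: "real ^ 'n::finite \<Rightarrow> complex"
  shows "polynomial_function q \<Longrightarrow> C2_on S q"
  by (auto simp: C2_on_def)

lemma partial_shift:
  fixes q :: "real ^ 'n::finite \<Rightarrow> complex"
  assumes q: "polynomial_function q"
  shows "partial j (\<lambda>y. q (x + y)) = (\<lambda>y. partial j q (x + y))"
proof
  fix y
  have "((\<lambda>y. q (x + y)) has_derivative (\<lambda>v. \<Sum>k\<in>UNIV. v $ k *\<^sub>R partial k q (x + y))) (at y)"
    by (rule has_derivative_compose[where f="\<lambda>y. x + y" and f'="\<lambda>v. v" and g=q])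
      (use q in \<open>auto intro!: derivative_eq_intros has_derivative_partial\<close>)
  from partial_eqI[OF this, of j] show "partial j (\<lambda>y. q (x + y)) y = partial j q (x + y)"
    by (simp add: axis_def if_distrib[where f="\<lambda>r. r *\<^sub>R _"] cong: if_cong)
qed

text \<open>\<open>spherical_mean_ODE\<close> with \<open>m = 0\<close> and \<open>e = 1\<close>,
  applied to a translate of \<open>q\<close>: the function \<open>s ^ (n - 1) *\<^sub>R a1 s\<close>
  is constant and vanishes at \<open>0\<close> because \<open>n \<ge> 2\<close>, so the mean does
  not depend on the radius.\<close>

lemma harmonic_mean_value:
  fixes q :: "real ^ 'n::finite \<Rightarrow> complex"
  assumes n: "CARD('n) \<ge> 2" and q: "polynomial_function q" and lap: "\<And>x. laplacian q x = 0" and r: "0 \<le> r"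
  shows "(\<integral>z. q (x + r *\<^sub>R z) \<partial>sphm) = q x"
proof -
  let ?g = "\<lambda>y. q (x + y)"
  have g: "polynomial_function ?g"
  proof -
    have "polynomial_function (\<lambda>y. x + y)" by (intro polynomial_function_add) auto
    from polynomial_function_compose[OF this q] show ?thesis by (simp add: comp_def)
  qed
  have lg: "laplacian ?g y = 0" for y
    using lap[of "x + y"] q by (simp add: laplacian_def partial_shift)
  have C2: "C2_on (ball 0 (r + 1)) ?g" using g by auto
  have e: "(\<lambda>x. 1) \<in> (harmonic_poly 0 :: (real^'n \<Rightarrow> complex) set)" by simp
  let ?a = "\<lambda>r. \<integral>z. q (x + r *\<^sub>R z) * 1 \<partial>sphm"
  show ?thesis
  proof (rule spherical_mean_ODE[OF C2 e])
    fix a1 a2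
    assume a: "\<And>s. 0 \<le> s \<Longrightarrow> s < r + 1 \<Longrightarrow> (?a has_vector_derivative a1 s) (at s)"
      and a1: "\<And>s. 0 \<le> s \<Longrightarrow> s < r + 1 \<Longrightarrow> (a1 has_vector_derivative a2 s) (at s)"
      and "\<And>s. 0 < s \<Longrightarrow> s < r + 1 \<Longrightarrow> s *\<^sub>R a1 s = (\<integral>z. euler ?g (s *\<^sub>R z) * 1 \<partial>sphm)"
      and ode: "\<And>s. 0 < s \<Longrightarrow> s < r + 1 \<Longrightarrow>
       s\<^sup>2 *\<^sub>R a2 s + ((real CARD('n) - 1) * s) *\<^sub>R a1 s - (real 0 * (real 0 + real CARD('n) - 2)) *\<^sub>R ?a s
       = s\<^sup>2 *\<^sub>R (\<integral>z. laplacian ?g (s *\<^sub>R z) * 1 \<partial>sphm)"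
    let ?b = "\<lambda>s. s ^ (CARD('n) - 1) *\<^sub>R a1 s"
    have ca1: "continuous_on {0..<r + 1} a1" and ca: "continuous_on {0..<r + 1} ?a"
      by (intro continuous_at_imp_continuous_on ballI has_vector_derivative_continuous[OF a]
          has_vector_derivative_continuous[OF a1]; simp)+
    have bc: "?b s = ?b 0" if "0 \<le> s" "s < r + 1" for s
    proof (rule has_vector_derivative_0_imp_const[OF _ _ that])
      show "continuous_on {0..<r + 1} ?b" by (intro continuous_intros ca1)
      fix s assume s: "0 < s" "s < r + 1"
      have "(?b has_vector_derivative s ^ (CARD('n) - 1) *\<^sub>R a2 s + (real (CARD('n) - 1) * s ^ (CARD('n) - 1) / s) *\<^sub>R a1 s) (at s)"
        using s by (intro has_vector_derivative_scaleR DERIV_power_self a1) auto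
      moreover have "s ^ (CARD('n) - 1) *\<^sub>R a2 s + (real (CARD('n) - 1) * s ^ (CARD('n) - 1) / s) *\<^sub>R a1 s
         = (s ^ (CARD('n) - 1) / s\<^sup>2) *\<^sub>R (s\<^sup>2 *\<^sub>R a2 s + ((real CARD('n) - 1) * s) *\<^sub>R a1 s)"
        using s n by (simp add: scaleR_add_right power2_eq_square of_nat_diff)
      ultimately show "(?b has_vector_derivative 0) (at s)"
        using ode[OF s] by (simp add: lg)
    qed
    have z: "a1 s = 0" if "0 < s" "s < r + 1" for s
      using bc[of s] that n by (auto simp: power_0_left split: if_splits)
    have "?a r = ?a 0"
    proof (rule has_vector_derivative_0_imp_const[OF ca])
      show "(?a has_vector_derivative 0) (at s)" if "0 < s" "s < r + 1" for s
        using a[of s] z[OF that] that by simp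
    qed (use r in auto)
    then show ?thesis by simp
  qed
qed

section \<open>\<open>L\<^sup>2\<close> norms and sup norms on the sphere\<close>

definition l2 :: "(real ^ 'n::finite \<Rightarrow> complex) \<Rightarrow> real" where
  "l2 q = sqrt (\<integral>z. (norm (q z))\<^sup>2 \<partial>sphm)"

lemma l2_nonneg [simp]: "l2 q \<ge> 0"
  by (simp add: l2_def)

lemma l2_squared: "(l2 q)\<^sup>2 = (\<integral>z. (norm (q z))\<^sup>2 \<partial>sphm)"
  by (simp add: l2_def)

text \<open>The variance with respect to the probability measure \<open>sphm\<close> is
  nonnegative.\<close>

lemma l1_le_l2:
  fixes u :: "real ^ 'n::finite \<Rightarrow> complex"
  assumes "continuous_on (sphere 0 1) u"
  shows "(\<integral>z. norm (u z) \<partial>sphm) \<le> l2 u"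
proof -
  have "integrable sphm (\<lambda>z. norm (u z))" "integrable sphm (\<lambda>z. (norm (u z))\<^sup>2)"
    by (intro integrable_sphm_continuous continuous_intros assms)+
  from sphm.variance_eq[OF this] sphm.variance_positive[of "\<lambda>z. norm (u z)"]
  show ?thesis unfolding l2_def by (intro real_le_rsqrt) simp
qed

lemma nn_integral_sphm_continuous:
  fixes u :: "real ^ 'n::finite \<Rightarrow> real"
  assumes "continuous_on (sphere 0 1) u" "\<And>z. z \<in> sphere 0 1 \<Longrightarrow> u z \<ge> 0"
  shows "(\<integral>\<^sup>+z. ennreal (u z) \<partial>sphm) = ennreal (\<integral>z. u z \<partial>sphm)"
  using assms by (intro nn_integral_eq_integral integrable_sphm_continuous AE_I2) auto

lemma emeasure_ball_scale:
  assumes "R > 0"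
  shows "emeasure lborel (ball (0::real^'n::finite) R) = ennreal (R ^ CARD('n)) * emeasure lborel (ball (0::real^'n) 1)"
proof -
  have "indicator (ball 0 R) (R *\<^sub>R x) = (indicator (ball 0 1) x :: ennreal)" for x :: "real^'n"
    using assms by (simp add: indicator_def)
  moreover have "indicator (ball (0::real^'n) R) \<in> borel_measurable borel"
    by (intro borel_measurable_indicator) simp
  ultimately show ?thesis
    using nn_integral_lborel_scaleR[of "indicator (ball (0::real^'n) R)" R] assms by simp
qed

lemma nn_integral_radial_power:
  assumes R: "R > 0"
  shows "of_nat CARD('n::finite) * emeasure lborel (ball (0::real^'n) 1) *
    (\<integral>\<^sup>+r. indicator {0<..} r * (ennreal (r ^ (CARD('n) - 1)) * indicator {..<R} r) \<partial>lborel)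
    = ennreal (R ^ CARD('n)) * emeasure lborel (ball (0::real^'n) 1)"
proof -
  have eq: "indicator {0<..} r * (ennreal (r ^ (CARD('n) - 1)) * (\<integral>\<^sup>+z. indicator (ball (0::real^'n) R) (r *\<^sub>R z) \<partial>sphm))
      = indicator {0<..} r * (ennreal (r ^ (CARD('n) - 1)) * indicator {..<R} r)" for r
  proof (cases "r > 0")
    case True
    have "(\<integral>\<^sup>+z. indicator (ball (0::real^'n) R) (r *\<^sub>R z) \<partial>sphm) = (\<integral>\<^sup>+z. indicator {..<R} r \<partial>(sphm :: (real^'n) measure))"
      using True by (intro nn_integral_cong) (auto simp: indicator_def)
    then show ?thesis by simp
  qed simp
  have "(indicator (ball (0::real^'n) R) :: _ \<Rightarrow> ennreal) \<in> borel_measurable borel"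
    by (intro borel_measurable_indicator) simp
  then show ?thesis
    using nn_integral_polar[of "indicator (ball (0::real^'n) R)"] emeasure_ball_scale[OF R, where 'n='n]
    unfolding eq by simp
qed

lemma nn_integral_polar_ball:
  fixes h :: "real ^ 'n::finite \<Rightarrow> ennreal"
  assumes [measurable]: "h \<in> borel_measurable borel"
  shows "(\<integral>\<^sup>+x. indicator (ball 0 R) x * h x \<partial>lborel) = of_nat CARD('n) * emeasure lborel (ball (0::real^'n) 1) *
    (\<integral>\<^sup>+r. indicator {0<..} r * (ennreal (r ^ (CARD('n) - 1)) * (indicator {..<R} r * (\<integral>\<^sup>+z. h (r *\<^sub>R z) \<partial>sphm))) \<partial>lborel)"
proof -
  have "ball (0::real^'n) R \<in> sets borel" by simp
  note [measurable] = this
  have eq: "indicator {0<..} r * (ennreal (r ^ (CARD('n) - 1)) * (\<integral>\<^sup>+z. indicator (ball (0::real^'n) R) (r *\<^sub>R z) * h (r *\<^sub>R z) \<partial>sphm))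
      = indicator {0<..} r * (ennreal (r ^ (CARD('n) - 1)) * (indicator {..<R} r * (\<integral>\<^sup>+z. h (r *\<^sub>R z) \<partial>sphm)))" for r
  proof (cases "r > 0")
    case True
    have "(\<integral>\<^sup>+z. indicator (ball (0::real^'n) R) (r *\<^sub>R z) * h (r *\<^sub>R z) \<partial>sphm) = (\<integral>\<^sup>+z. indicator {..<R} r * h (r *\<^sub>R z) \<partial>sphm)"
      using True by (intro nn_integral_cong) (auto simp: indicator_def)
    also have "\<dots> = indicator {..<R} r * (\<integral>\<^sup>+z. h (r *\<^sub>R z) \<partial>sphm)"
      by (cases "r < R") auto
    finally show ?thesis by simp
  qed simp
  show ?thesis
    using nn_integral_polar[of "\<lambda>x. indicator (ball (0::real^'n) R) x * h x"] unfolding eq by simp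
qed

text \<open>The constant comes from averaging the mean value property over \<open>ball x \<rho>\<close>.\<close>

lemma harmonic_sup_bound_aux:
  fixes q :: "real ^ 'n::finite \<Rightarrow> complex"
  assumes n: "CARD('n) \<ge> 2" and q: "q \<in> harmonic_poly m" and x: "norm x \<le> 1" and \<rho>: "\<rho> > 0"
  shows "\<rho> ^ CARD('n) * (norm (q x))\<^sup>2 \<le> (1 + \<rho>) ^ CARD('n) * ((1 + \<rho>) ^ m * l2 q)\<^sup>2"
proof -
  let ?n = "CARD('n)" and ?K = "emeasure lborel (ball (0::real^'n) 1)"
  note P = harmonic_polyD(1)[OF q]
  have qc: "continuous_on S q" for S using P by auto
  then have [measurable]: "q \<in> borel_measurable borel" by (intro borel_measurable_continuous_onI)
  have bs: "ball (0::real^'n) R \<in> sets borel" for R by simp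
  note [measurable] = bs
  have cs: "continuous_on (sphere 0 1) (\<lambda>z. (norm (q (x + r *\<^sub>R z)))\<^sup>2)" for r x
    by (intro continuous_intros continuous_on_compose2[OF qc[of UNIV]]) auto
  \<comment> \<open>The mean value property followed by \<open>l1_le_l2\<close> puts the square of
    the point value below every spherical mean of the square.\<close>
  have low: "ennreal ((norm (q x))\<^sup>2) \<le> (\<integral>\<^sup>+z. ennreal ((norm (q (x + r *\<^sub>R z)))\<^sup>2) \<partial>sphm)" if "r > 0" for r
  proof -
    have c: "continuous_on (sphere 0 1) (\<lambda>z. q (x + r *\<^sub>R z))"
      by (intro continuous_intros continuous_on_compose2[OF qc[of UNIV]]) auto
    have "norm (q x) = norm (\<integral>z. q (x + r *\<^sub>R z) \<partial>sphm)"
      using harmonic_mean_value[OF n P harmonic_polyD(3)[OF q], of r x] that by simp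
    also have "\<dots> \<le> (\<integral>z. norm (q (x + r *\<^sub>R z)) \<partial>sphm)" by (rule integral_norm_bound)
    also have "\<dots> \<le> l2 (\<lambda>z. q (x + r *\<^sub>R z))" by (rule l1_le_l2[OF c])
    finally have "(norm (q x))\<^sup>2 \<le> (l2 (\<lambda>z. q (x + r *\<^sub>R z)))\<^sup>2" by (intro power_mono) auto
    then show ?thesis unfolding l2_squared
      by (subst nn_integral_sphm_continuous[OF cs]) (auto intro: ennreal_leI)
  qed
  have up: "indicator {..<1 + \<rho>} r * (\<integral>\<^sup>+z. ennreal ((norm (q (r *\<^sub>R z)))\<^sup>2) \<partial>sphm)
      \<le> indicator {..<1 + \<rho>} r * ennreal (((1 + \<rho>) ^ m * l2 q)\<^sup>2)" if "r > 0" for r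
  proof (cases "r < 1 + \<rho>")
    case True
    have "(\<integral>z. (norm (q (r *\<^sub>R z)))\<^sup>2 \<partial>sphm) = (r ^ m)\<^sup>2 * (l2 q)\<^sup>2"
      unfolding harmonic_polyD(2)[OF q] l2_squared by (simp add: power_mult_distrib)
    also have "\<dots> \<le> ((1 + \<rho>) ^ m)\<^sup>2 * (l2 q)\<^sup>2"
      using that True by (intro mult_right_mono power_mono) auto
    finally have "(\<integral>z. (norm (q (r *\<^sub>R z)))\<^sup>2 \<partial>sphm) \<le> ((1 + \<rho>) ^ m * l2 q)\<^sup>2"
      by (simp add: power_mult_distrib)
    then show ?thesis using cs[of 0 r] True
      by (simp, subst nn_integral_sphm_continuous) (auto intro: ennreal_leI)
  qed simp
  have "ennreal (\<rho> ^ ?n) * ?K * ennreal ((norm (q x))\<^sup>2)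
      = of_nat ?n * ?K * (\<integral>\<^sup>+r. indicator {0<..} r * (ennreal (r ^ (?n - 1)) * indicator {..<\<rho>} r) * ennreal ((norm (q x))\<^sup>2) \<partial>lborel)"
    using nn_integral_radial_power[OF \<rho>, where 'n='n] by (simp add: nn_integral_multc mult.assoc[symmetric])
  also have "\<dots> \<le> of_nat ?n * ?K * (\<integral>\<^sup>+r. indicator {0<..} r * (ennreal (r ^ (?n - 1)) *
       (indicator {..<\<rho>} r * (\<integral>\<^sup>+z. ennreal ((norm (q (x + r *\<^sub>R z)))\<^sup>2) \<partial>sphm))) \<partial>lborel)"
    by (intro mult_left_mono nn_integral_mono) (auto simp: indicator_def mult_left_mono low)
  also have "\<dots> = (\<integral>\<^sup>+y. indicator (ball 0 \<rho>) y * ennreal ((norm (q (x + y)))\<^sup>2) \<partial>lborel)"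
    by (subst nn_integral_polar_ball) auto
  also have "\<dots> \<le> (\<integral>\<^sup>+y. indicator (ball 0 (1 + \<rho>)) (x + y) * ennreal ((norm (q (x + y)))\<^sup>2) \<partial>lborel)"
  proof (rule nn_integral_mono)
    fix y :: "real^'n"
    have "norm y < \<rho> \<Longrightarrow> norm (x + y) < 1 + \<rho>" using norm_triangle_ineq[of x y] x by linarith
    then show "indicator (ball 0 \<rho>) y * ennreal ((norm (q (x + y)))\<^sup>2)
       \<le> indicator (ball 0 (1 + \<rho>)) (x + y) * ennreal ((norm (q (x + y)))\<^sup>2)"
      by (auto simp: indicator_def)
  qed
  also have "\<dots> = (\<integral>\<^sup>+y. indicator (ball 0 (1 + \<rho>)) y * ennreal ((norm (q y))\<^sup>2) \<partial>lborel)"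
    by (subst (2) lborel_distr_plus[of x, symmetric]) (simp add: nn_integral_distr)
  also have "\<dots> = of_nat ?n * ?K * (\<integral>\<^sup>+r. indicator {0<..} r * (ennreal (r ^ (?n - 1)) *
       (indicator {..<1 + \<rho>} r * (\<integral>\<^sup>+z. ennreal ((norm (q (r *\<^sub>R z)))\<^sup>2) \<partial>sphm))) \<partial>lborel)"
    by (subst nn_integral_polar_ball) auto
  also have "\<dots> \<le> of_nat ?n * ?K * (\<integral>\<^sup>+r. indicator {0<..} r * (ennreal (r ^ (?n - 1)) *
       (indicator {..<1 + \<rho>} r * ennreal (((1 + \<rho>) ^ m * l2 q)\<^sup>2))) \<partial>lborel)"
  proof (rule mult_left_mono, rule nn_integral_mono)
    fix r :: real
    show "indicator {0<..} r * (ennreal (r ^ (?n - 1)) * (indicator {..<1 + \<rho>} r * (\<integral>\<^sup>+z. ennreal ((norm (q (r *\<^sub>R z)))\<^sup>2) \<partial>sphm)))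
      \<le> indicator {0<..} r * (ennreal (r ^ (?n - 1)) * (indicator {..<1 + \<rho>} r * ennreal (((1 + \<rho>) ^ m * l2 q)\<^sup>2)))"
      using up[of r] by (cases "r > 0") (auto intro: mult_left_mono)
  qed simp
  also have "\<dots> = of_nat ?n * ?K * (\<integral>\<^sup>+r. indicator {0<..} r * (ennreal (r ^ (?n - 1)) * indicator {..<1 + \<rho>} r) \<partial>lborel)
       * ennreal (((1 + \<rho>) ^ m * l2 q)\<^sup>2)"
    unfolding mult.assoc by (subst nn_integral_multc[symmetric]) (auto simp: mult.assoc)
  also have "\<dots> = ennreal ((1 + \<rho>) ^ ?n) * ?K * ennreal (((1 + \<rho>) ^ m * l2 q)\<^sup>2)"
    using \<rho> by (subst nn_integral_radial_power) auto
  finally have "?K * ennreal (\<rho> ^ ?n * (norm (q x))\<^sup>2) \<le> ?K * ennreal ((1 + \<rho>) ^ ?n * ((1 + \<rho>) ^ m * l2 q)\<^sup>2)"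
    using \<rho> by (simp add: ennreal_mult mult_ac del: ennreal_power)
  moreover have "?K = ennreal (enn2real ?K)" "enn2real ?K > 0"
    using emeasure_lborel_unit_ball[where 'a="real^'n"] by (auto simp: enn2real_positive_iff less_top zero_less_iff_neq_zero)
  ultimately have "ennreal (enn2real ?K * (\<rho> ^ ?n * (norm (q x))\<^sup>2)) \<le> ennreal (enn2real ?K * ((1 + \<rho>) ^ ?n * ((1 + \<rho>) ^ m * l2 q)\<^sup>2))"
    by (metis ennreal_mult' enn2real_nonneg)
  then have "enn2real ?K * (\<rho> ^ ?n * (norm (q x))\<^sup>2) \<le> enn2real ?K * ((1 + \<rho>) ^ ?n * ((1 + \<rho>) ^ m * l2 q)\<^sup>2)"
    using \<rho> by (subst (asm) ennreal_le_iff) auto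
  then show ?thesis using \<open>enn2real ?K > 0\<close> by simp
qed

text \<open>\<open>C\<close> depends on \<rho> but not on the degree. Since \<rho> > 0 is arbitrary,
  this is subexponential growth of the sup norm relative to \<open>l2\<close>; homogeneity extends
  the bound from the unit ball to all \<open>x\<close>.\<close>

lemma harmonic_sup_bound:
  assumes n: "CARD('n::finite) \<ge> 2" and \<rho>: "\<rho> > 0"
  shows "\<exists>C>0. \<forall>m. \<forall>q\<in>(harmonic_poly m :: (real ^ 'n \<Rightarrow> complex) set). \<forall>x.
    norm (q x) \<le> C * (1 + \<rho>) ^ m * norm x ^ m * l2 q"
proof -
  define C where "C = sqrt ((1 + \<rho>) ^ CARD('n) / \<rho> ^ CARD('n))"
  have C: "C > 0" using \<rho> by (simp add: C_def)
  have 1: "norm (q x) \<le> C * ((1 + \<rho>) ^ m * l2 q)" if q: "q \<in> harmonic_poly m" and x: "norm x \<le> 1"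
    for m and q :: "real ^ 'n \<Rightarrow> complex" and x
  proof (rule power2_le_imp_le)
    have "(C * ((1 + \<rho>) ^ m * l2 q))\<^sup>2 = (1 + \<rho>) ^ CARD('n) / \<rho> ^ CARD('n) * ((1 + \<rho>) ^ m * l2 q)\<^sup>2"
      using \<rho> by (simp add: C_def power_mult_distrib)
    moreover have "(norm (q x))\<^sup>2 \<le> (1 + \<rho>) ^ CARD('n) * ((1 + \<rho>) ^ m * l2 q)\<^sup>2 / \<rho> ^ CARD('n)"
      using harmonic_sup_bound_aux[OF n q x \<rho>] \<rho> by (simp add: pos_le_divide_eq mult.commute)
    ultimately show "(norm (q x))\<^sup>2 \<le> (C * ((1 + \<rho>) ^ m * l2 q))\<^sup>2"
      by simp
  qed (use C \<rho> in simp)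
  have "norm (q x) \<le> C * (1 + \<rho>) ^ m * norm x ^ m * l2 q" if q: "q \<in> harmonic_poly m"
    for m and q :: "real ^ 'n \<Rightarrow> complex" and x
  proof (cases "x = 0")
    case True
    then show ?thesis using 1[OF q, of 0] harmonic_polyD(2)[OF q, of 0 0] by (cases m) auto
  next
    case False
    then have "q x = norm x ^ m *\<^sub>R q (x /\<^sub>R norm x)"
      using harmonic_polyD(2)[OF q, of "norm x" "x /\<^sub>R norm x"] by simp
    then have "norm (q x) = norm x ^ m * norm (q (x /\<^sub>R norm x))" by simp
    also have "\<dots> \<le> norm x ^ m * (C * ((1 + \<rho>) ^ m * l2 q))"
      using False by (intro mult_left_mono 1[OF q]) auto
    finally show ?thesis by (simp add: mult_ac)
  qed
  with C show ?thesis by blast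
qed

text \<open>Bilinear rather than sesquilinear, because the radial equation is derived for the
  pairing of \<open>f\<close> with \<open>e\<close> itself; conjugates are written out wherever a
  norm is meant.\<close>

definition ip :: "(real ^ 'n::finite \<Rightarrow> complex) \<Rightarrow> (real ^ 'n \<Rightarrow> complex) \<Rightarrow> complex" where
  "ip u v = (\<integral>z. u z * v z \<partial>sphm)"

lemma harmonic_continuous: "q \<in> harmonic_poly m \<Longrightarrow> continuous_on S q"
  using harmonic_polyD(1) by auto

lemma ip_integrable:
  "continuous_on (sphere 0 1) u \<Longrightarrow> continuous_on (sphere 0 1) v \<Longrightarrow> integrable sphm (\<lambda>z. u z * v z :: complex)"
  by (intro integrable_sphm_continuous continuous_intros)

lemma ip_add_left:
  "continuous_on (sphere 0 1) u \<Longrightarrow> continuous_on (sphere 0 1) v \<Longrightarrow> continuous_on (sphere 0 1) w \<Longrightarrow>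
   ip (\<lambda>z. u z + v z) w = ip u w + ip v w"
  unfolding ip_def distrib_right by (intro Bochner_Integration.integral_add ip_integrable)

lemma ip_diff_left:
  "continuous_on (sphere 0 1) u \<Longrightarrow> continuous_on (sphere 0 1) v \<Longrightarrow> continuous_on (sphere 0 1) w \<Longrightarrow>
   ip (\<lambda>z. u z - v z) w = ip u w - ip v w"
  unfolding ip_def left_diff_distrib by (intro Bochner_Integration.integral_diff ip_integrable)

lemma ip_sum_left:
  assumes "\<And>i. i \<in> A \<Longrightarrow> continuous_on (sphere 0 1) (u i)" "continuous_on (sphere 0 1) v"
  shows "ip (\<lambda>z. \<Sum>i\<in>A. u i z) v = (\<Sum>i\<in>A. ip (u i) v)"
  unfolding ip_def sum_distrib_right by (intro Bochner_Integration.integral_sum ip_integrable assms)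

lemma ip_cmult_left: "ip (\<lambda>z. c * u z) v = c * ip u v"
  by (simp add: ip_def mult.assoc)

lemma ip_commute: "ip u v = ip v u"
  by (simp add: ip_def mult.commute)

lemma ip_cong: "(\<And>z. z \<in> sphere 0 1 \<Longrightarrow> u z = u' z) \<Longrightarrow> (\<And>z. z \<in> sphere 0 1 \<Longrightarrow> v z = v' z) \<Longrightarrow> ip u v = ip u' v'"
  unfolding ip_def by (intro Bochner_Integration.integral_cong) auto

lemma ip_cnj_self:
  assumes "continuous_on (sphere 0 1) u"
  shows "ip u (\<lambda>z. cnj (u z)) = of_real ((l2 u)\<^sup>2)"
  unfolding ip_def l2_squared complex_norm_square[symmetric] by (rule integral_complex_of_real)

lemma ip_cnj: "ip (\<lambda>z. cnj (u z)) (\<lambda>z. cnj (v z)) = cnj (ip u v)"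
  by (simp add: ip_def flip: complex_cnj_mult)

lemma norm_ip_le:
  assumes u: "continuous_on (sphere 0 1) u" and v: "continuous_on (sphere 0 1) v"
    and M: "\<And>z. z \<in> sphere 0 1 \<Longrightarrow> norm (v z) \<le> M"
  shows "norm (ip u v) \<le> M * (\<integral>z. norm (u z) \<partial>sphm)"
proof -
  have "norm (ip u v) \<le> (\<integral>z. norm (u z * v z) \<partial>sphm)" unfolding ip_def by (rule integral_norm_bound)
  also have "\<dots> \<le> (\<integral>z. M * norm (u z) \<partial>sphm)"
    using M by (intro integral_mono integrable_sphm_continuous continuous_intros u v)
      (auto simp: norm_mult mult.commute[of M] intro!: mult_left_mono)
  finally show ?thesis by simp
qed

lemma l2_eq_0_imp:
  assumes u: "continuous_on (sphere 0 1) u" and "l2 u = 0" and "z \<in> sphere 0 1"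
  shows "u z = 0"
proof -
  have "(\<lambda>z. (norm (u z))\<^sup>2) z = 0"
    by (rule integral_sphm_eq_0_imp[OF _ _ _ assms(3)])
      (use assms(2) l2_squared[of u] in \<open>auto intro!: continuous_intros u\<close>)
  then show ?thesis by simp
qed

text \<open>One integration by parts moves an operator back onto \<open>q\<close>, and the sum of
  squares acts on \<open>q\<close> by its eigenvalue.\<close>

lemma ip_tangential_squared:
  fixes q e :: "real ^ 'n::finite \<Rightarrow> complex"
  assumes q: "q \<in> harmonic_poly m" and e: "e \<in> harmonic_poly k"
  shows "(\<Sum>i\<in>UNIV. \<Sum>j\<in>UNIV. ip (tangential i j q) (tangential i j e)) = of_real (2 * real m * (real m + real CARD('n) - 2)) * ip q e"
proof -
  have Tq: "tangential i j q \<in> harmonic_poly m" and TTq: "tangential i j (tangential i j q) \<in> harmonic_poly m" for i j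
    using q by auto
  have "ip (tangential i j q) (tangential i j e) = - ip (tangential i j (tangential i j q)) e" for i j
    unfolding ip_def using integral_tangential_by_parts[of 2 "tangential i j q" e i j]
      harmonic_polyD(1)[OF Tq] harmonic_polyD(1)[OF e] by (simp add: C1_on_poly)
  then have "(\<Sum>i\<in>UNIV. \<Sum>j\<in>UNIV. ip (tangential i j q) (tangential i j e))
      = - (\<Sum>i\<in>UNIV. \<Sum>j\<in>UNIV. ip (tangential i j (tangential i j q)) e)"
    by (simp add: sum_negf)
  also have "(\<Sum>i\<in>UNIV. \<Sum>j\<in>UNIV. ip (tangential i j (tangential i j q)) e)
      = ip (\<lambda>z. \<Sum>i\<in>UNIV. \<Sum>j\<in>UNIV. tangential i j (tangential i j q) z) e"
    by (subst ip_sum_left | intro continuous_on_sum harmonic_continuous[OF TTq] harmonic_continuous[OF e] sum.cong refl)+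
  also have "\<dots> = - (of_real (2 * real m * (real m + real CARD('n) - 2)) * ip q e)"
    unfolding sum_tangential_squared_harmonic[OF q]
    by (simp add: scaleR_conv_of_real[where 'a=complex] flip: ip_cmult_left)
      (simp add: ip_def)
  finally show ?thesis by simp
qed

text \<open>The quadratic form of \<open>ip_tangential_squared\<close> is symmetric, so two degrees
  with different eigenvalues are orthogonal; \<open>m (m + n - 2)\<close> is injective in
  \<open>m\<close> because \<open>n \<ge> 2\<close>.\<close>

lemma harmonic_orthogonal:
  fixes q e :: "real ^ 'n::finite \<Rightarrow> complex"
  assumes n: "CARD('n) \<ge> 2" and q: "q \<in> harmonic_poly m" and e: "e \<in> harmonic_poly k" and mk: "m \<noteq> k"
  shows "ip q e = 0"
proof -
  let ?l = "\<lambda>m. 2 * real m * (real m + real CARD('n) - 2)"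
  have "of_real (?l m) * ip q e = (\<Sum>i\<in>UNIV. \<Sum>j\<in>UNIV. ip (tangential i j q) (tangential i j e))"
    by (rule ip_tangential_squared[OF q e, symmetric])
  also have "\<dots> = (\<Sum>i\<in>UNIV. \<Sum>j\<in>UNIV. ip (tangential i j e) (tangential i j q))"
    by (simp add: ip_commute)
  also have "\<dots> = of_real (?l k) * ip e q" by (rule ip_tangential_squared[OF e q])
  finally have "complex_of_real (?l m) * ip q e = of_real (?l k) * ip q e" by (simp add: ip_commute)
  moreover have "?l m \<noteq> ?l k"
  proof -
    have "?l m - ?l k = 2 * (real m - real k) * (real m + real k + (real CARD('n) - 2))"
      by (simp add: algebra_simps)
    moreover have "real m + real k + (real CARD('n) - 2) > 0" using n mk by (cases m) auto
    moreover have "2 * (real m - real k) \<noteq> 0" using mk by simp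
    ultimately have "?l m - ?l k \<noteq> 0" by simp
    then show ?thesis by (metis diff_self)
  qed
  ultimately show ?thesis by (simp only: mult_cancel_right of_real_eq_iff) simp
qed

text \<open>An orthonormal system in \<open>harmonic_poly m\<close> has boundedly many elements: evaluate the sup bound
  on the kernel \<open>\<Sum>e. cnj (e x) e\<close> at \<open>x\<close>.  A maximal one is therefore a basis.\<close>

definition orthonormal :: "(real ^ 'n::finite \<Rightarrow> complex) set \<Rightarrow> bool" where
  "orthonormal B \<longleftrightarrow> (\<forall>e\<in>B. \<forall>e'\<in>B. ip e (\<lambda>z. cnj (e' z)) = of_bool (e = e'))"

lemma ip_orthonormal_sum:
  assumes fin: "finite B" and B: "B \<subseteq> harmonic_poly m" and on: "orthonormal B" and e: "e \<in> B"
  shows "ip (\<lambda>z. \<Sum>b\<in>B. c b * b z) (\<lambda>z. cnj (e z)) = c e"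
proof -
  have "ip (\<lambda>z. \<Sum>b\<in>B. c b * b z) (\<lambda>z. cnj (e z)) = (\<Sum>b\<in>B. ip (\<lambda>z. c b * b z) (\<lambda>z. cnj (e z)))"
    by (rule ip_sum_left) (use B e in \<open>auto intro!: continuous_intros intro: harmonic_continuous\<close>)
  also have "\<dots> = (\<Sum>b\<in>B. if b = e then c b else 0)"
    using on e by (intro sum.cong) (auto simp: ip_cmult_left orthonormal_def)
  finally show ?thesis using fin e by simp
qed

lemma orthonormal_card_bound:
  assumes n: "CARD('n::finite) \<ge> 2"
  obtains A :: real where "\<And>B. finite B \<Longrightarrow> B \<subseteq> (harmonic_poly m :: (real ^ 'n \<Rightarrow> complex) set) \<Longrightarrow> orthonormal B \<Longrightarrow> real (card B) \<le> A"
proof -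
  obtain C where C: "C > 0"
    "\<And>k (q :: real ^ 'n \<Rightarrow> complex) x. q \<in> harmonic_poly k \<Longrightarrow> norm (q x) \<le> C * (1 + 1) ^ k * norm x ^ k * l2 q"
    using harmonic_sup_bound[OF n zero_less_one] by auto
  show ?thesis
  proof (rule that[of "(C * 2 ^ m)\<^sup>2"])
    fix B :: "(real ^ 'n \<Rightarrow> complex) set"
    assume fin: "finite B" and B: "B \<subseteq> harmonic_poly m" and on: "orthonormal B"
    have pt: "(\<Sum>b\<in>B. (norm (b x))\<^sup>2) \<le> (C * 2 ^ m)\<^sup>2" if x: "x \<in> sphere 0 1" for x
    proof -
      let ?q = "\<lambda>z. \<Sum>b\<in>B. cnj (b x) * b z" and ?s = "\<Sum>b\<in>B. (norm (b x))\<^sup>2"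
      have q: "?q \<in> harmonic_poly m" using fin B by (intro harmonic_poly_sum) auto
      have s: "?s \<ge> 0" by (intro sum_nonneg) auto
      have "of_real ((l2 ?q)\<^sup>2) = ip ?q (\<lambda>z. cnj (?q z))"
        by (rule ip_cnj_self[symmetric]) (rule harmonic_continuous[OF q])
      also have "\<dots> = ip (\<lambda>z. \<Sum>b\<in>B. b x * cnj (b z)) ?q" by (subst ip_commute) simp
      also have "\<dots> = (\<Sum>b\<in>B. b x * ip ?q (\<lambda>z. cnj (b z)))"
        by (subst ip_sum_left)
          (use B in \<open>auto simp: ip_cmult_left ip_commute[of ?q] intro!: continuous_intros intro: harmonic_continuous\<close>)
      also have "\<dots> = (\<Sum>b\<in>B. b x * cnj (b x))"
        by (intro sum.cong refl) (simp add: ip_orthonormal_sum[OF fin B on])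
      also have "\<dots> = of_real ?s" unfolding of_real_sum complex_norm_square ..
      finally have "(l2 ?q)\<^sup>2 = ?s" by (simp only: of_real_eq_iff)
      then have l2: "l2 ?q = sqrt ?s" by (rule real_sqrt_unique[symmetric]) (rule l2_nonneg)
      have "?q x = of_real ?s" unfolding of_real_sum complex_norm_square by (simp add: mult.commute)
      then have "?s = norm (?q x)" using s by (simp only: norm_of_real abs_of_nonneg)
      also have "\<dots> \<le> C * 2 ^ m * sqrt ?s" using C(2)[OF q, of x] x l2 by simp
      finally have le: "sqrt ?s * sqrt ?s \<le> C * 2 ^ m * sqrt ?s" using s by simp
      have "sqrt ?s \<le> C * 2 ^ m"
      proof (cases "?s = 0")
        case True
        then show ?thesis unfolding True using C(1) by simp
      next
        case False
        then have "sqrt ?s > 0" using s by simp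
        then show ?thesis by (rule mult_right_le_imp_le[OF le])
      qed
      then have "(sqrt ?s)\<^sup>2 \<le> (C * 2 ^ m)\<^sup>2" using s by (intro power_mono) auto
      then show ?thesis using s by simp
    qed
    \<comment> \<open>Every element has norm one, so integrating the pointwise bound over the sphere
      counts the elements.\<close>
    have "real (card B) = (\<Sum>b\<in>B. (l2 b)\<^sup>2)"
    proof -
      have "(l2 b)\<^sup>2 = 1" if "b \<in> B" for b
        using ip_cnj_self[OF harmonic_continuous, of b m] on that B
        by (auto simp: orthonormal_def dest!: subsetD) (metis of_real_eq_1_iff of_real_power)
      then show ?thesis by simp
    qed
    also have "\<dots> = (\<integral>z. (\<Sum>b\<in>B. (norm (b z))\<^sup>2) \<partial>sphm)"
      unfolding l2_squared using B
      by (intro Bochner_Integration.integral_sum[symmetric] integrable_sphm_continuous)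
        (auto intro!: continuous_intros intro: harmonic_continuous)
    also have "\<dots> \<le> (\<integral>z. (C * 2 ^ m)\<^sup>2 \<partial>(sphm :: (real^'n) measure))"
      using B by (intro integral_mono integrable_sphm_continuous)
        (auto intro!: continuous_intros intro: harmonic_continuous pt)
    also have "\<dots> = (C * 2 ^ m)\<^sup>2" using prob_space.prob_space[OF prob_space_sphm[where 'n='n]] by simp
    finally show "real (card B) \<le> (C * 2 ^ m)\<^sup>2" .
  qed
qed

lemma harmonic_basis:
  assumes n: "CARD('n::finite) \<ge> 2"
  obtains B where "finite B" "B \<subseteq> (harmonic_poly m :: (real ^ 'n \<Rightarrow> complex) set)" "orthonormal B"
    "\<And>q. q \<in> harmonic_poly m \<Longrightarrow> (\<And>e. e \<in> B \<Longrightarrow> ip q (\<lambda>z. cnj (e z)) = 0) \<Longrightarrow> l2 q = 0"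
proof -
  let ?P = "\<lambda>B. finite B \<and> B \<subseteq> (harmonic_poly m :: (real ^ 'n \<Rightarrow> complex) set) \<and> orthonormal B"
  obtain A :: real where A: "\<And>B. ?P B \<Longrightarrow> real (card B) \<le> A"
    using orthonormal_card_bound[OF n, of m] by metis
  have bnd: "card B \<le> nat \<lfloor>A\<rfloor>" if "?P B" for B using A[OF that] by (simp add: le_nat_floor)
  have "?P {}" by (simp add: orthonormal_def)
  then obtain B where B: "?P B" and max: "\<And>B'. ?P B' \<Longrightarrow> card B' \<le> card B"
    using ex_has_greatest_nat[of ?P "{}" card "Suc (nat \<lfloor>A\<rfloor>)"] bnd by (metis less_Suc_eq_le)
  have "l2 q = 0" if q: "q \<in> harmonic_poly m" and orth: "\<And>e. e \<in> B \<Longrightarrow> ip q (\<lambda>z. cnj (e z)) = 0" for q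
  proof (rule ccontr)
    assume nz: "l2 q \<noteq> 0"
    define p where "p z = complex_of_real (1 / l2 q) * q z" for z
    have p: "p \<in> harmonic_poly m" unfolding p_def[abs_def] by (rule harmonic_poly_cmult[OF q])
    have pp: "ip p (\<lambda>z. cnj (p z)) = 1"
    proof -
      have "ip p (\<lambda>z. cnj (p z)) = of_real (1 / l2 q) * ip q (\<lambda>z. of_real (1 / l2 q) * cnj (q z))"
        unfolding p_def ip_cmult_left by simp
      also have "\<dots> = of_real (1 / l2 q) * (of_real (1 / l2 q) * of_real ((l2 q)\<^sup>2))"
        unfolding ip_cnj_self[OF harmonic_continuous[OF q], symmetric]
        by (subst ip_commute) (simp only: ip_cmult_left ip_commute)
      also have "\<dots> = 1" using nz by (simp add: power2_eq_square)
      finally show ?thesis .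
    qed
    have pe: "ip p (\<lambda>z. cnj (e z)) = 0" if "e \<in> B" for e
      unfolding p_def ip_cmult_left orth[OF that] by simp
    have ep: "ip e (\<lambda>z. cnj (p z)) = 0" if "e \<in> B" for e
      using ip_cnj[of p "\<lambda>z. cnj (e z)"] pe[OF that] by (simp add: ip_commute)
    have "p \<notin> B" using pp pe by force
    moreover have "?P (insert p B)"
      using B p pp pe ep \<open>p \<notin> B\<close> by (auto simp: orthonormal_def)
    ultimately show False using max[of "insert p B"] B by auto
  qed
  with B show ?thesis by (intro that[of B]) auto
qed

text \<open>\<open>P\<close> is the orthogonal projection of \<open>f\<close> to degree
  \<open>m\<close>. As \<open>ip\<close> has no conjugation, the test function \<open>q\<close> must
  be a combination of conjugated basis elements; this is achieved by expanding \<open>cnj q\<close>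
  in the basis.\<close>

lemma harmonic_projection:
  fixes f :: "real ^ 'n::finite \<Rightarrow> complex"
  assumes n: "CARD('n) \<ge> 2" and f: "continuous_on (sphere 0 1) f"
  obtains P where "P \<in> harmonic_poly m" "\<And>q. q \<in> harmonic_poly m \<Longrightarrow> ip f q = ip P q"
proof -
  obtain B where fin: "finite B" and B: "B \<subseteq> (harmonic_poly m :: (real ^ 'n \<Rightarrow> complex) set)" and on: "orthonormal B"
    and max: "\<And>q. q \<in> harmonic_poly m \<Longrightarrow> (\<And>e. e \<in> B \<Longrightarrow> ip q (\<lambda>z. cnj (e z)) = 0) \<Longrightarrow> l2 q = 0"
    using harmonic_basis[OF n, of m] by metis
  define P where "P z = (\<Sum>b\<in>B. ip f (\<lambda>z. cnj (b z)) * b z)" for z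
  have P: "P \<in> harmonic_poly m" unfolding P_def[abs_def] using fin B by (intro harmonic_poly_sum) auto
  have Pe: "ip P (\<lambda>z. cnj (e z)) = ip f (\<lambda>z. cnj (e z))" if "e \<in> B" for e
    unfolding P_def[abs_def] by (rule ip_orthonormal_sum[OF fin B on that])
  have "ip f q = ip P q" if q: "q \<in> harmonic_poly m" for q
  proof -
    define c where "c b = ip (\<lambda>z. cnj (q z)) (\<lambda>z. cnj (b z))" for b
    let ?d = "\<lambda>z. cnj (q z) - (\<Sum>b\<in>B. c b * b z)"
    have q': "(\<lambda>z. cnj (q z)) \<in> harmonic_poly m" using q by auto
    have s: "(\<lambda>z. \<Sum>b\<in>B. c b * b z) \<in> harmonic_poly m" using fin B by (intro harmonic_poly_sum) auto
    have d: "?d \<in> harmonic_poly m" using q' s by auto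
    have "l2 ?d = 0"
    proof (rule max[OF d])
      fix e assume e: "e \<in> B"
      have "ip ?d (\<lambda>z. cnj (e z)) = c e - ip (\<lambda>z. \<Sum>b\<in>B. c b * b z) (\<lambda>z. cnj (e z))"
        unfolding c_def using B e
        by (intro ip_diff_left harmonic_continuous[OF q'] harmonic_continuous[OF s[unfolded c_def]])
          (auto intro!: continuous_intros intro: harmonic_continuous)
      then show "ip ?d (\<lambda>z. cnj (e z)) = 0" by (simp add: ip_orthonormal_sum[OF fin B on e])
    qed
    then have "?d z = 0" if "z \<in> sphere 0 1" for z
      using l2_eq_0_imp[OF harmonic_continuous[OF d] _ that] by blast
    then have "cnj (?d z) = 0" if "z \<in> sphere 0 1" for z using that by (metis complex_cnj_zero)
    then have qz: "q z = (\<Sum>b\<in>B. cnj (c b) * cnj (b z))" if "z \<in> sphere 0 1" for z using that by simp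
    have exp: "ip u q = (\<Sum>b\<in>B. cnj (c b) * ip u (\<lambda>z. cnj (b z)))" if u: "continuous_on (sphere 0 1) u" for u
    proof -
      have "ip u q = ip (\<lambda>z. \<Sum>b\<in>B. cnj (c b) * cnj (b z)) u"
        by (subst ip_commute) (auto intro!: ip_cong qz)
      also have "\<dots> = (\<Sum>b\<in>B. ip (\<lambda>z. cnj (c b) * cnj (b z)) u)"
        by (rule ip_sum_left[OF _ u]) (use B in \<open>auto intro!: continuous_intros intro: harmonic_continuous\<close>)
      finally show ?thesis by (simp add: ip_cmult_left ip_commute)
    qed
    show ?thesis unfolding exp[OF f] exp[OF harmonic_continuous[OF P]] by (simp add: Pe)
  qed
  with P show ?thesis by (rule that)
qed

section \<open>Density of spherical harmonics and completeness\<close>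

inductive sphspan :: "(real ^ 'n::finite \<Rightarrow> complex) \<Rightarrow> bool" where
  harm: "q \<in> harmonic_poly m \<Longrightarrow> sphspan q"
| add: "sphspan g \<Longrightarrow> sphspan h \<Longrightarrow> sphspan (\<lambda>z. g z + h z)"
| eq: "sphspan g \<Longrightarrow> (\<And>z. z \<in> sphere 0 1 \<Longrightarrow> g z = h z) \<Longrightarrow> sphspan h"

lemma sphspan_cmult: "sphspan g \<Longrightarrow> sphspan (\<lambda>z. c * g z)"
proof (induction rule: sphspan.induct)
  case (harm q m) then show ?case by (auto intro: sphspan.harm)
next
  case (add g h) then show ?case using sphspan.add by (simp add: distrib_left)
next
  case (eq g h) show ?case by (rule sphspan.eq[OF eq.IH]) (simp add: eq.hyps)
qed

text \<open>By \<open>harmonic_poly_crd_mult\<close>, \<open>x\<^sub>i q\<close> is a harmonic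
  polynomial of degree \<open>m + 1\<close> plus a multiple of
  \<open>|x|\<^sup>2 \<partial>\<^sub>i q\<close>. On the sphere the factor
  \<open>|x|\<^sup>2\<close> is one, which rule \<open>eq\<close> permits to use, and the rest is
  again harmonic.\<close>

lemma sphspan_crd_mult: "sphspan g \<Longrightarrow> sphspan (\<lambda>z. crd i z * g z)"
proof (induction rule: sphspan.induct)
  case (harm q m)
  let ?k = "1 / (real CARD('a) + 2 * real m - 2)"
  have "sphspan (\<lambda>x. (crd i x * q x - ?k *\<^sub>R (of_real ((norm x)\<^sup>2) * partial i q x)) + ?k *\<^sub>R partial i q x)"
    by (intro sphspan.add sphspan.harm[OF harmonic_poly_crd_mult[OF harm]]
        sphspan.harm[OF harmonic_poly_scaleR[OF harmonic_poly_partial[OF harm]]])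
  then show ?case by (rule sphspan.eq) auto
next
  case (add g h) then show ?case using sphspan.add by (simp add: distrib_left)
next
  case (eq g h) show ?case by (rule sphspan.eq[OF eq.IH]) (simp add: eq.hyps)
qed

lemma sphspan_poly:
  fixes p :: "real ^ 'n::finite \<Rightarrow> complex"
  assumes "polynomial_function p" shows "sphspan p"
proof -
  \<comment> \<open>Polynomials are viewed as multiplication operators on the span: with arbitrary
    \<open>g\<close> the product case is a composition, which would fail for the bare statement
    about \<open>p\<close>.\<close>
  have "\<forall>g. sphspan g \<longrightarrow> sphspan (\<lambda>z. p z * g z)"
    using assms
  proof (induction p rule: polynomial_function_complex_induct)
    case (add q r) then show ?case by (intro allI impI, simp only: distrib_right, intro sphspan.add) auto
  qed (auto intro: sphspan_cmult sphspan_crd_mult simp: mult.assoc)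
  moreover have "sphspan (\<lambda>z::real^'n. 1)" by (rule sphspan.harm[OF harmonic_poly_const])
  ultimately show ?thesis by fastforce
qed

text \<open>Polynomials approximate \<open>cnj u\<close> uniformly on the sphere, and each of them
  is orthogonal to \<open>u\<close> by \<open>sphspan_poly\<close>; so the \<open>L\<^sup>2\<close>
  norm of \<open>u\<close> is arbitrarily small.\<close>

lemma harmonic_complete:
  fixes u :: "real ^ 'n::finite \<Rightarrow> complex"
  assumes u: "continuous_on (sphere 0 1) u" and orth: "\<And>m q. q \<in> harmonic_poly m \<Longrightarrow> ip u q = 0"
    and z: "z \<in> sphere 0 1"
  shows "u z = 0"
proof (rule l2_eq_0_imp[OF u _ z])
  have span: "continuous_on (sphere 0 1) g \<and> ip g u = 0" if "sphspan g" for g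
    using that
  proof (induction rule: sphspan.induct)
    case (harm q m) then show ?case using orth by (auto simp: ip_commute intro: harmonic_continuous)
  next
    case (add g h) then show ?case using u by (auto simp: ip_add_left intro!: continuous_intros)
  next
    case (eq g h)
    then show ?case using ip_cong[of g h u u] by (auto cong: continuous_on_cong_simp)
  qed
  let ?M = "\<integral>z. norm (u z) \<partial>sphm"
  have le: "(l2 u)\<^sup>2 \<le> e * ?M" if e: "e > 0" for e
  proof -
    have uc: "continuous_on (sphere 0 1) (\<lambda>z. cnj (u z))" by (intro continuous_intros u)
    from Stone_Weierstrass_polynomial_function[OF compact_sphere uc e]
    obtain g where g: "polynomial_function g" "\<And>z. z \<in> sphere 0 1 \<Longrightarrow> norm (cnj (u z) - g z) < e" by auto
    have gc: "continuous_on (sphere 0 1) g" using g by auto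
    have "of_real ((l2 u)\<^sup>2) = ip (\<lambda>z. cnj (u z)) u" by (subst ip_commute) (rule ip_cnj_self[OF u, symmetric])
    also have "\<dots> = ip (\<lambda>z. cnj (u z) - g z) u"
      using span[OF sphspan_poly[OF g(1)]] by (subst ip_diff_left[OF uc gc u]) simp
    finally have "norm (complex_of_real ((l2 u)\<^sup>2)) = norm (ip u (\<lambda>z. cnj (u z) - g z))" by (simp add: ip_commute)
    also have "\<dots> \<le> e * ?M"
      by (rule norm_ip_le[OF u]) (use g uc gc in \<open>auto intro!: continuous_intros less_imp_le\<close>)
    finally show ?thesis by (simp only: norm_of_real abs_power2)
  qed
  have M: "?M \<ge> 0" by simp
  have "(l2 u)\<^sup>2 \<le> 0"
  proof (rule field_le_epsilon)
    fix d :: real assume d: "d > 0"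
    have M1: "?M + 1 > 0" using M by linarith
    have "(l2 u)\<^sup>2 \<le> d / (?M + 1) * ?M" by (intro le divide_pos_pos d M1)
    also have "\<dots> \<le> d" using M1 d by (simp only: times_divide_eq_left pos_divide_le_eq) (simp add: algebra_simps)
    finally show "(l2 u)\<^sup>2 \<le> 0 + d" by simp
  qed
  then show "l2 u = 0" by simp
qed

section \<open>Expansions of hyperbolic-harmonic functions\<close>

text \<open>Equivalently, the power series with coefficients \<open>a m\<close> has radius of
  convergence at least one. Unlike a bound by one fixed geometric sequence, this property is stable
  under products.\<close>

definition subexp :: "(nat \<Rightarrow> real) \<Rightarrow> bool" where
  "subexp a \<longleftrightarrow> (\<forall>r. 0 < r \<longrightarrow> r < 1 \<longrightarrow> (\<exists>C. \<forall>m. \<bar>a m\<bar> * r ^ m \<le> C))"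

lemma subexpD: "subexp a \<Longrightarrow> 0 < r \<Longrightarrow> r < 1 \<Longrightarrow> \<exists>C\<ge>0. \<forall>m. \<bar>a m\<bar> * r ^ m \<le> C"
  unfolding subexp_def by (metis abs_ge_zero mult_nonneg_nonneg order_trans zero_le_power less_imp_le)

lemma subexp_const: "subexp (\<lambda>m. c)"
  unfolding subexp_def by (auto intro!: exI[of _ "\<bar>c\<bar>"] mult_right_le_one_le power_le_one)

lemma subexp_of_nat: "subexp (\<lambda>m. real m)"
  unfolding subexp_def
proof safe
  fix r :: real assume "0 < r" "r < 1"
  then have "(\<lambda>n. real n * r ^ n) \<longlonglongrightarrow> 0" using powser_times_n_limit_0[of r] by simp
  then have "Bseq (\<lambda>n. real n * r ^ n)" by (intro convergent_imp_Bseq convergentI)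
  then obtain K where "\<And>n. norm (real n * r ^ n) \<le> K" by (auto simp: Bseq_def)
  then show "\<exists>C. \<forall>m. \<bar>real m\<bar> * r ^ m \<le> C" using \<open>0 < r\<close> by (auto simp: abs_mult power_abs)
qed

lemma subexp_mult:
  assumes "subexp a" "subexp b" shows "subexp (\<lambda>m. a m * b m)"
  unfolding subexp_def
proof safe
  fix r :: real assume r: "0 < r" "r < 1"
  \<comment> \<open>Half of the decay is spent on each factor.\<close>
  let ?s = "sqrt r"
  have s: "0 < ?s" "?s < 1" using r by auto
  obtain A B where A: "A \<ge> 0" "\<And>m. \<bar>a m\<bar> * ?s ^ m \<le> A" and B: "B \<ge> 0" "\<And>m. \<bar>b m\<bar> * ?s ^ m \<le> B"
    using subexpD[OF assms(1) s] subexpD[OF assms(2) s] by metis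
  have "\<bar>a m * b m\<bar> * r ^ m \<le> A * B" for m
  proof -
    have "r ^ m = ?s ^ m * ?s ^ m" using r by (simp flip: power_mult_distrib)
    then have "\<bar>a m * b m\<bar> * r ^ m = (\<bar>a m\<bar> * ?s ^ m) * (\<bar>b m\<bar> * ?s ^ m)" by (simp add: abs_mult)
    also have "\<dots> \<le> A * B" using A B s by (intro mult_mono) auto
    finally show ?thesis .
  qed
  then show "\<exists>C. \<forall>m. \<bar>a m * b m\<bar> * r ^ m \<le> C" by blast
qed

lemma subexp_add:
  assumes "subexp a" "subexp b" shows "subexp (\<lambda>m. a m + b m)"
  unfolding subexp_def
proof safe
  fix r :: real assume r: "0 < r" "r < 1"
  obtain A B where A: "\<And>m. \<bar>a m\<bar> * r ^ m \<le> A" and B: "\<And>m. \<bar>b m\<bar> * r ^ m \<le> B"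
    using subexpD[OF assms(1) r] subexpD[OF assms(2) r] by metis
  have "\<bar>a m + b m\<bar> * r ^ m \<le> A + B" for m
  proof -
    have "\<bar>a m + b m\<bar> * r ^ m \<le> (\<bar>a m\<bar> + \<bar>b m\<bar>) * r ^ m"
      using r by (intro mult_right_mono abs_triangle_ineq) auto
    then show ?thesis using A[of m] B[of m] by (simp add: distrib_right)
  qed
  then show "\<exists>C. \<forall>m. \<bar>a m + b m\<bar> * r ^ m \<le> C" by blast
qed

lemma subexp_mono:
  assumes "subexp b" "\<And>m. \<bar>a m\<bar> \<le> \<bar>b m\<bar>" shows "subexp a"
  unfolding subexp_def
proof safe
  fix r :: real assume r: "0 < r" "r < 1"
  obtain B where B: "\<And>m. \<bar>b m\<bar> * r ^ m \<le> B" using subexpD[OF assms(1) r] by metis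
  have "\<bar>a m\<bar> * r ^ m \<le> B" for m
  proof -
    have "\<bar>a m\<bar> * r ^ m \<le> \<bar>b m\<bar> * r ^ m" using assms(2)[of m] r by (intro mult_right_mono) auto
    then show ?thesis using B[of m] by linarith
  qed
  then show "\<exists>C. \<forall>m. \<bar>a m\<bar> * r ^ m \<le> C" by blast
qed

text \<open>The coefficient sequences of the expansions: on every smaller ball \<open>\<Sum>m. hypF m (|x|\<^sup>2) G m x\<close>
  converges geometrically.\<close>

definition admissible :: "(nat \<Rightarrow> real ^ 'n::finite \<Rightarrow> complex) \<Rightarrow> bool" where
  "admissible G \<longleftrightarrow> (\<forall>m. G m \<in> harmonic_poly m) \<and>
     (\<forall>r. 0 < r \<longrightarrow> r < 1 \<longrightarrow> (\<exists>C. \<forall>m x. norm (G m x) * r ^ m \<le> C * norm x ^ m))"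

lemma admissibleD:
  assumes "admissible G"
  shows "G m \<in> harmonic_poly m"
    "0 < r \<Longrightarrow> r < 1 \<Longrightarrow> \<exists>C\<ge>0. \<forall>m x. norm (G m x) * r ^ m \<le> C * norm x ^ m"
proof -
  show "G m \<in> harmonic_poly m" using assms by (auto simp: admissible_def)
  assume r: "0 < r" "r < 1"
  then obtain C where C: "\<And>m x. norm (G m x) * r ^ m \<le> C * norm x ^ m"
    using assms unfolding admissible_def by meson
  have "norm (G m x) * r ^ m \<le> \<bar>C\<bar> * norm x ^ m" for m x
    using C[of m x] mult_right_mono[OF abs_ge_self, of "norm x ^ m" C] by simp
  then show "\<exists>C\<ge>0. \<forall>m x. norm (G m x) * r ^ m \<le> C * norm x ^ m" by (intro exI[of _ "\<bar>C\<bar>"]) auto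
qed

text \<open>Sup norm and \<open>l2\<close> differ by a subexponential factor only. The
  \<open>L\<^sup>2\<close> form is the convenient one for multipliers and tangential derivatives,
  the pointwise form for convergence.\<close>

lemma admissible_iff_l2:
  fixes G :: "nat \<Rightarrow> real ^ 'n::finite \<Rightarrow> complex"
  assumes n: "CARD('n) \<ge> 2"
  shows "admissible G \<longleftrightarrow> (\<forall>m. G m \<in> harmonic_poly m) \<and> subexp (\<lambda>m. l2 (G m))"
proof safe
  assume adm: "admissible G"
  show "G m \<in> harmonic_poly m" for m by (rule admissibleD(1)[OF adm])
  show "subexp (\<lambda>m. l2 (G m))"
    unfolding subexp_def
  proof safe
    fix r :: real assume r: "0 < r" "r < 1"
    obtain C where C: "C \<ge> 0" "\<And>m x. norm (G m x) * r ^ m \<le> C * norm x ^ m"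
      using admissibleD(2)[OF adm r] by metis
    have "\<bar>l2 (G m)\<bar> * r ^ m \<le> C" for m
    proof -
      have c: "continuous_on (sphere 0 1) (G m)" by (rule harmonic_continuous[OF admissibleD(1)[OF adm]])
      have "(l2 (G m) * r ^ m)\<^sup>2 = (\<integral>z. (norm (G m z) * r ^ m)\<^sup>2 \<partial>sphm)"
        by (simp add: l2_squared power_mult_distrib)
      also have "\<dots> \<le> (\<integral>z. C\<^sup>2 \<partial>(sphm :: (real^'n) measure))"
      proof (intro integral_mono integrable_sphm_continuous continuous_intros c)
        fix z :: "real^'n" assume "z \<in> space sphm"
        then have "norm (G m z) * r ^ m \<le> C" using C(2)[of m z] by simp
        then show "(norm (G m z) * r ^ m)\<^sup>2 \<le> C\<^sup>2" using r by (intro power_mono) auto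
      qed
      also have "\<dots> = C\<^sup>2" by simp
      finally have "l2 (G m) * r ^ m \<le> C" by (rule power2_le_imp_le[OF _ C(1)])
      then show ?thesis by simp
    qed
    then show "\<exists>C. \<forall>m. \<bar>l2 (G m)\<bar> * r ^ m \<le> C" by blast
  qed
next
  assume H: "\<forall>m. G m \<in> harmonic_poly m" and S: "subexp (\<lambda>m. l2 (G m))"
  show "admissible G"
    unfolding admissible_def
  proof safe
    show "G m \<in> harmonic_poly m" for m using H by auto
    fix r :: real assume r: "0 < r" "r < 1"
    \<comment> \<open>The gap between \<open>r\<close> and \<open>s\<close> absorbs the growth of
      the sup norm: \<open>1 + \<rho> = s / r\<close>.\<close>
    define s where "s = (1 + r) / 2"
    have s: "0 < s" "s < 1" "r < s" using r by (auto simp: s_def)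
    have "s / r - 1 > 0" using s r by simp
    obtain K where K: "K > 0"
      "\<And>m (q :: real ^ 'n \<Rightarrow> complex) x. q \<in> harmonic_poly m \<Longrightarrow> norm (q x) \<le> K * (1 + (s / r - 1)) ^ m * norm x ^ m * l2 q"
      using harmonic_sup_bound[OF n \<open>s / r - 1 > 0\<close>] by auto
    obtain C where C: "C \<ge> 0" "\<And>m. \<bar>l2 (G m)\<bar> * s ^ m \<le> C" using subexpD[OF S s(1,2)] by metis
    have "norm (G m x) * r ^ m \<le> (K * C) * norm x ^ m" for m x
    proof -
      have "norm (G m x) * r ^ m \<le> K * (s / r) ^ m * norm x ^ m * l2 (G m) * r ^ m"
        using K(2)[of "G m" m x] H r by (intro mult_right_mono) auto
      also have "\<dots> = K * (\<bar>l2 (G m)\<bar> * s ^ m) * norm x ^ m" using r by (simp add: power_divide)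
      also have "\<dots> \<le> K * C * norm x ^ m" using K(1) C(2)[of m] by (intro mult_right_mono mult_left_mono) auto
      finally show ?thesis .
    qed
    then show "\<exists>C. \<forall>m x. norm (G m x) * r ^ m \<le> C * norm x ^ m" by blast
  qed
qed

section \<open>Operations on admissible families\<close>

lemma l2_scaleR: "l2 (\<lambda>x. c *\<^sub>R q x) = \<bar>c\<bar> * l2 q"
  by (simp add: l2_def power_mult_distrib real_sqrt_mult)

lemma admissible_multiplier:
  fixes G :: "nat \<Rightarrow> real ^ 'n::finite \<Rightarrow> complex"
  assumes n: "CARD('n) \<ge> 2" and G: "admissible G" and g: "subexp \<gamma>"
  shows "admissible (\<lambda>m x. \<gamma> m *\<^sub>R G m x)"
  using G subexp_mult[OF g, of "\<lambda>m. l2 (G m)"] unfolding admissible_iff_l2[OF n]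
  by (auto simp: l2_scaleR intro: subexp_mono)

text \<open>This identity serves twice: it bounds each single tangential derivative from above, and
  the largest of them from below.\<close>

lemma l2_tangential_le:
  fixes q :: "real ^ 'n::finite \<Rightarrow> complex"
  assumes q: "q \<in> harmonic_poly m"
  shows "(\<Sum>i\<in>UNIV. \<Sum>j\<in>UNIV. (l2 (tangential i j q))\<^sup>2) = 2 * real m * (real m + real CARD('n) - 2) * (l2 q)\<^sup>2"
proof -
  have Tc: "tangential i j (\<lambda>x. cnj (q x)) = (\<lambda>x. cnj (tangential i j q x))" for i j
    using harmonic_polyD(1)[OF q] by (simp add: fun_eq_iff tangential_def partial_cnj_poly)
  have "complex_of_real (\<Sum>i\<in>UNIV. \<Sum>j\<in>UNIV. (l2 (tangential i j q))\<^sup>2)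
      = (\<Sum>i\<in>UNIV. \<Sum>j\<in>UNIV. ip (tangential i j q) (tangential i j (\<lambda>x. cnj (q x))))"
    unfolding of_real_sum Tc using q
    by (intro sum.cong refl ip_cnj_self[symmetric] harmonic_continuous[OF harmonic_poly_tangential])
  also have "\<dots> = of_real (2 * real m * (real m + real CARD('n) - 2)) * ip q (\<lambda>x. cnj (q x))"
    by (rule ip_tangential_squared) (use q in auto)
  also have "\<dots> = of_real (2 * real m * (real m + real CARD('n) - 2) * (l2 q)\<^sup>2)"
    by (simp only: ip_cnj_self[OF harmonic_continuous[OF q]] of_real_mult)
  finally show ?thesis by (simp only: of_real_eq_iff)
qed

lemma admissible_tangential:
  fixes G :: "nat \<Rightarrow> real ^ 'n::finite \<Rightarrow> complex"
  assumes n: "CARD('n) \<ge> 2" and G: "admissible G"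
  shows "admissible (\<lambda>m. tangential i j (G m))"
  unfolding admissible_iff_l2[OF n]
proof safe
  fix m show "tangential i j (G m) \<in> harmonic_poly m" using admissibleD(1)[OF G] by auto
next
  \<comment> \<open>Slightly larger than the factor in \<open>l2_tangential_le\<close>, so that it
    is at least one and may be replaced by its square; this avoids square roots.\<close>
  let ?l = "\<lambda>m. 2 * (real m + 1) * (real m + real CARD('n))"
  have le: "l2 (tangential i j (G m)) \<le> ?l m * l2 (G m)" for m
  proof (rule power2_le_imp_le)
    have "(l2 (tangential i j (G m)))\<^sup>2 \<le> (\<Sum>j\<in>UNIV. (l2 (tangential i j (G m)))\<^sup>2)"
      by (rule member_le_sum) auto
    also have "\<dots> \<le> (\<Sum>i\<in>UNIV. \<Sum>j\<in>UNIV. (l2 (tangential i j (G m)))\<^sup>2)"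
      by (rule member_le_sum[of i UNIV "\<lambda>i. \<Sum>j\<in>UNIV. (l2 (tangential i j (G m)))\<^sup>2"]) (auto intro: sum_nonneg)
    also have "\<dots> = 2 * real m * (real m + real CARD('n) - 2) * (l2 (G m))\<^sup>2"
      by (rule l2_tangential_le[OF admissibleD(1)[OF G]])
    also have "\<dots> \<le> ?l m * (l2 (G m))\<^sup>2"
      using n by (intro mult_right_mono mult_mono) auto
    also have "\<dots> \<le> (?l m)\<^sup>2 * (l2 (G m))\<^sup>2"
    proof (intro mult_right_mono)
      have "1 * 1 \<le> (2 * (real m + 1)) * (real m + real CARD('n))" using n by (intro mult_mono) auto
      then have "?l m * 1 \<le> ?l m * ?l m" by (intro mult_left_mono) auto
      then show "?l m \<le> (?l m)\<^sup>2" by (simp only: power2_eq_square mult_1_right)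
    qed auto
    finally show "(l2 (tangential i j (G m)))\<^sup>2 \<le> (?l m * l2 (G m))\<^sup>2" by (simp add: power_mult_distrib)
  qed (use n in auto)
  have "subexp (\<lambda>m. 2 * (real m + 1) * (real m + real CARD('n)) * l2 (G m))"
    using G unfolding admissible_iff_l2[OF n]
    by (intro subexp_mult subexp_add subexp_const subexp_of_nat) auto
  then show "subexp (\<lambda>m. l2 (tangential i j (G m)))"
    by (rule subexp_mono) (use le in \<open>auto simp: abs_mult intro: order_trans\<close>)
qed

text \<open>The gradient split into its radial part, which Euler's identity evaluates, and its
  tangential parts; bounds for \<open>partial\<close> thus follow from those for multipliers and
  tangential operators.\<close>

lemma partial_on_sphere:
  fixes q :: "real ^ 'n::finite \<Rightarrow> complex"
  assumes q: "q \<in> harmonic_poly m" and z: "z \<in> sphere 0 1"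
  shows "partial j q z = (z $ j * real m) *\<^sub>R q z + (\<Sum>i\<in>UNIV. z $ i *\<^sub>R tangential i j q z)"
proof -
  have "(\<Sum>i\<in>UNIV. z $ i *\<^sub>R tangential i j q z) = of_real ((norm z)\<^sup>2) * partial j q z - z $ j *\<^sub>R euler q z"
    unfolding nsq_eq sum_distrib_right
    by (simp add: tangential_def euler_def scaleR_conv_of_real[where 'a=complex] sum_subtractf
        right_diff_distrib sum_distrib_left mult_ac)
  then show ?thesis using z by (simp add: euler_harmonic[OF q] scaleR_conv_of_real[where 'a=complex])
qed

text \<open>The derivative has degree \<open>m - 1\<close>, whence the shifted exponent on the
  right; the estimate is made on the sphere and extended by homogeneity.\<close>

lemma admissible_partial_bound:
  fixes G :: "nat \<Rightarrow> real ^ 'n::finite \<Rightarrow> complex"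
  assumes n: "CARD('n) \<ge> 2" and G: "admissible G" and r: "0 < r" "r < 1"
  obtains C where "C \<ge> 0" "\<And>m x. norm (partial j (G m) x) * r ^ m \<le> C * norm x ^ (m - 1)"
proof -
  have mG: "admissible (\<lambda>m x. real m *\<^sub>R G m x)" by (rule admissible_multiplier[OF n G subexp_of_nat])
  obtain A where A: "A \<ge> 0" "\<And>m x. norm (real m *\<^sub>R G m x) * r ^ m \<le> A * norm x ^ m"
    using admissibleD(2)[OF mG r] by metis
  have "\<forall>i. \<exists>B\<ge>0. \<forall>m x. norm (tangential i j (G m) x) * r ^ m \<le> B * norm x ^ m"
    using admissibleD(2)[OF admissible_tangential[OF n G] r] by metis
  then obtain B where B: "\<And>i. B i \<ge> 0" "\<And>i m x. norm (tangential i j (G m) x) * r ^ m \<le> B i * norm x ^ m"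
    by metis
  define C where "C = A + (\<Sum>i\<in>UNIV. B i)"
  have C0: "C \<ge> 0" using A(1) B(1) by (auto simp: C_def intro!: add_nonneg_nonneg sum_nonneg)
  have sph: "norm (partial j (G m) z) * r ^ m \<le> C" if z: "z \<in> sphere 0 1" for m z
  proof -
    have z1: "norm z = 1" using z by simp
    have "norm (partial j (G m) z) \<le> norm ((z $ j * real m) *\<^sub>R G m z) + norm (\<Sum>i\<in>UNIV. z $ i *\<^sub>R tangential i j (G m) z)"
      unfolding partial_on_sphere[OF admissibleD(1)[OF G] z] by (rule norm_triangle_ineq)
    also have "\<dots> \<le> norm (real m *\<^sub>R G m z) + (\<Sum>i\<in>UNIV. norm (tangential i j (G m) z))"
    proof (rule add_mono)
      show "norm ((z $ j * real m) *\<^sub>R G m z) \<le> norm (real m *\<^sub>R G m z)"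
        using component_le_norm_cart[of z j] z1 by (simp add: abs_mult mult_left_le_one_le mult.assoc)
      show "norm (\<Sum>i\<in>UNIV. z $ i *\<^sub>R tangential i j (G m) z) \<le> (\<Sum>i\<in>UNIV. norm (tangential i j (G m) z))"
        using component_le_norm_cart[of z] z1
        by (intro order_trans[OF norm_sum] sum_mono) (auto intro: mult_left_le_one_le)
    qed
    finally have "norm (partial j (G m) z) * r ^ m \<le> (norm (real m *\<^sub>R G m z) + (\<Sum>i\<in>UNIV. norm (tangential i j (G m) z))) * r ^ m"
      using r by (intro mult_right_mono) auto
    also have "\<dots> = norm (real m *\<^sub>R G m z) * r ^ m + (\<Sum>i\<in>UNIV. norm (tangential i j (G m) z) * r ^ m)"
      by (simp add: distrib_right sum_distrib_right)
    also have "\<dots> \<le> C" unfolding C_def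
      using A(2)[of m z] B(2)[of _ m z] z1 by (intro add_mono sum_mono) auto
    finally show ?thesis .
  qed
  have "norm (partial j (G m) x) * r ^ m \<le> C * norm x ^ (m - 1)" for m x
  proof -
    have H: "partial j (G m) \<in> harmonic_poly (m - 1)" using admissibleD(1)[OF G] by (rule harmonic_poly_partial)
    define z where "z = (if x = 0 then axis j 1 else x /\<^sub>R norm x)"
    have z: "z \<in> sphere 0 1" "x = norm x *\<^sub>R z" by (auto simp: z_def)
    have "partial j (G m) x = norm x ^ (m - 1) *\<^sub>R partial j (G m) z"
      by (subst z(2)) (rule harmonic_polyD(2)[OF H])
    then have "norm (partial j (G m) x) * r ^ m = norm x ^ (m - 1) * (norm (partial j (G m) z) * r ^ m)"
      by simp
    also have "\<dots> \<le> norm x ^ (m - 1) * C" by (intro mult_left_mono sph z) auto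
    finally show ?thesis by (simp add: mult.commute)
  qed
  with C0 show ?thesis by (rule that)
qed

section \<open>Series of H-harmonic terms and existence of the expansion\<close>

definition hterm :: "(nat \<Rightarrow> real ^ 'n::finite \<Rightarrow> complex) \<Rightarrow> nat \<Rightarrow> real ^ 'n \<Rightarrow> complex" where
  "hterm G m x = hypF CARD('n) m ((norm x)\<^sup>2) *\<^sub>R G m x"

lemma norm_sq_le_1: "norm x < 1 \<Longrightarrow> (norm x)\<^sup>2 < 1"
  by (simp add: power_less_one_iff)

lemma norm_hterm_le:
  fixes x :: "real ^ 'n::finite"
  assumes n: "CARD('n) \<ge> 2" and x: "norm x < 1" shows "norm (hterm G m x) \<le> norm (G m x)"
proof -
  have "0 < hypF CARD('n) m ((norm x)\<^sup>2)" "hypF CARD('n) m ((norm x)\<^sup>2) \<le> 1"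
    using norm_sq_le_1[OF x] by (auto intro: hypF_pos[OF n] hypF_le_1[OF n])
  then show ?thesis by (simp add: hterm_def mult_left_le_one_le)
qed

lemma hterm_bound:
  fixes G :: "nat \<Rightarrow> real ^ 'n::finite \<Rightarrow> complex"
  assumes n: "CARD('n) \<ge> 2" and G: "admissible G" and R: "0 < R" "R < 1"
  obtains M where "summable M" "\<And>m x. norm x \<le> R \<Longrightarrow> norm (hterm G m x) \<le> M m" "\<And>m. M m \<ge> 0"
    "\<And>m x. norm x \<le> R \<Longrightarrow> norm (G m x) \<le> M m"
proof -
  define r where "r = (1 + R) / 2"
  have r: "0 < r" "r < 1" "R < r" using R by (auto simp: r_def)
  obtain C where C: "C \<ge> 0" "\<And>m x. norm (G m x) * r ^ m \<le> C * norm x ^ m"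
    using admissibleD(2)[OF G r(1,2)] by metis
  have G': "norm (G m x) \<le> C * (R / r) ^ m" if "norm x \<le> R" for m x
  proof -
    have "norm (G m x) \<le> C * norm x ^ m / r ^ m" using C(2)[of m x] r by (simp add: pos_le_divide_eq)
    also have "\<dots> \<le> C * R ^ m / r ^ m" using that C(1) r by (intro divide_right_mono mult_left_mono power_mono) auto
    finally show ?thesis by (simp add: power_divide)
  qed
  show ?thesis
  proof (rule that[of "\<lambda>m. C * (R / r) ^ m"])
    show "summable (\<lambda>m. C * (R / r) ^ m)" using R r by (intro summable_mult summable_geometric) auto
    show "norm (hterm G m x) \<le> C * (R / r) ^ m" if "norm x \<le> R" for m x
      using order_trans[OF norm_hterm_le[OF n, of x G m] G'[OF that]] that R by simp
  qed (use C R r G' in auto)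
qed

text \<open>On a sphere of radius \<open>r\<close> the series converges uniformly and may be paired
  with \<open>q\<close> term by term; orthogonality leaves only the term of degree
  \<open>k\<close>.\<close>

lemma ip_series:
  fixes G :: "nat \<Rightarrow> real ^ 'n::finite \<Rightarrow> complex"
  assumes n: "CARD('n) \<ge> 2" and G: "admissible G" and r: "0 \<le> r" "r < 1"
    and g: "\<And>x. x \<in> ball 0 1 \<Longrightarrow> (\<lambda>m. hterm G m x) sums g x" and q: "q \<in> harmonic_poly k"
  shows "ip (\<lambda>z. g (r *\<^sub>R z)) q = radw CARD('n) k r *\<^sub>R ip (G k) q"
    "continuous_on (sphere 0 1) (\<lambda>z. g (r *\<^sub>R z))"
proof -
  define R where "R = (1 + r) / 2"
  have R: "0 < R" "R < 1" "r \<le> R" using r by (auto simp: R_def)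
  obtain M where M: "summable M" "\<And>m x. norm x \<le> R \<Longrightarrow> norm (hterm G m x) \<le> M m" "\<And>m. M m \<ge> 0"
    using hterm_bound[OF n G R(1,2)] by metis
  have rz: "norm (r *\<^sub>R z) \<le> R" "r *\<^sub>R z \<in> ball 0 1" if "z \<in> sphere 0 1" for z :: "real^'n"
    using that R r by auto
  have t: "hterm G m (r *\<^sub>R z) = radw CARD('n) m r *\<^sub>R G m z" if "z \<in> sphere 0 1" for m z
    using that r by (simp add: hterm_def radw_def harmonic_polyD(2)[OF admissibleD(1)[OF G]] mult.commute)
  have Gc: "continuous_on S (G m)" for m S by (rule harmonic_continuous[OF admissibleD(1)[OF G]])
  have qc: "continuous_on S q" for S by (rule harmonic_continuous[OF q])
  have eq: "g (r *\<^sub>R z) = (\<Sum>m. radw CARD('n) m r *\<^sub>R G m z)" if "z \<in> sphere 0 1" for z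
    using sums_unique[OF g[OF rz(2)[OF that]]] t[OF that] by simp
  have "uniform_limit (sphere 0 1) (\<lambda>k z. \<Sum>m<k. radw CARD('n) m r *\<^sub>R G m z) (\<lambda>z. \<Sum>m. radw CARD('n) m r *\<^sub>R G m z) sequentially"
    by (rule Weierstrass_m_test[OF _ M(1)]) (use M(2)[OF rz(1)] t in auto)
  then have "continuous_on (sphere 0 1) (\<lambda>z. \<Sum>m. radw CARD('n) m r *\<^sub>R G m z)"
    by (rule uniform_limit_theorem[rotated]) (auto intro!: continuous_intros always_eventually Gc)
  then show gc: "continuous_on (sphere 0 1) (\<lambda>z. g (r *\<^sub>R z))"
    by (rule continuous_on_eq) (simp add: eq)
  obtain B where B: "\<And>z. z \<in> sphere 0 1 \<Longrightarrow> norm (q z) \<le> B"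
    using compact_bound_obtain[OF compact_sphere qc] by metis
  have B0: "B \<ge> 0" using B[of "axis undefined 1"] norm_ge_zero[of "q (axis undefined 1)"] by (simp del: norm_ge_zero)
  let ?h = "\<lambda>m z. (radw CARD('n) m r *\<^sub>R G m z) * q z"
  have hb: "norm (?h m z) \<le> M m * B" if "z \<in> sphere 0 1" for m z
    unfolding norm_mult using M(2)[OF rz(1)[OF that], of m] t[OF that] B[OF that] M(3)
    by (intro mult_mono) auto
  have hi: "integrable sphm (?h m)" for m
    by (intro integrable_sphm_continuous continuous_intros Gc qc)
  have "(\<lambda>m. \<integral>z. ?h m z \<partial>sphm) sums (\<integral>z. (\<Sum>m. ?h m z) \<partial>sphm)"
  proof (rule sums_integral[OF hi])
    show "AE z in sphm. summable (\<lambda>m. norm (?h m z))"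
      by (rule AE_I2, rule summable_comparison_test'[OF summable_mult2[OF M(1), of B], of 0]) (use hb in auto)
    show "summable (\<lambda>m. \<integral>z. norm (?h m z) \<partial>sphm)"
    proof (rule summable_comparison_test'[OF summable_mult2[OF M(1), of B], of 0])
      fix m
      have "(\<integral>z. norm (?h m z) \<partial>sphm) \<le> (\<integral>z. M m * B \<partial>(sphm::(real^'n) measure))"
        by (intro integral_mono integrable_norm hi) (use hb in auto)
      then show "norm (\<integral>z. norm (?h m z) \<partial>sphm) \<le> M m * B" by simp
    qed
  qed
  moreover have "(\<integral>z. ?h m z \<partial>sphm) = (if m = k then radw CARD('n) k r *\<^sub>R ip (G k) q else 0)" for m
  proof -
    have "(\<integral>z. ?h m z \<partial>sphm) = radw CARD('n) m r *\<^sub>R ip (G m) q" by (simp add: ip_def)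
    then show ?thesis using harmonic_orthogonal[OF n admissibleD(1)[OF G] q, of m] by auto
  qed
  ultimately have "(\<lambda>m. if m = k then radw CARD('n) k r *\<^sub>R ip (G k) q else 0) sums (\<integral>z. (\<Sum>m. ?h m z) \<partial>sphm)"
    by simp
  then have "radw CARD('n) k r *\<^sub>R ip (G k) q = (\<integral>z. (\<Sum>m. ?h m z) \<partial>sphm)"
    by (rule sums_unique2[OF sums_single[of k "\<lambda>m. radw CARD('n) k r *\<^sub>R ip (G k) q"]])
  also have "\<dots> = ip (\<lambda>z. g (r *\<^sub>R z)) q"
    unfolding ip_def
  proof (intro Bochner_Integration.integral_cong refl)
    fix z :: "real^'n" assume "z \<in> space sphm"
    then have z: "z \<in> sphere 0 1" by simp
    have "summable (\<lambda>m. radw CARD('n) m r *\<^sub>R G m z)"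
      using sums_summable[OF g[OF rz(2)[OF z]]] t[OF z] by simp
    then show "(\<Sum>m. ?h m z) = g (r *\<^sub>R z) * q z" unfolding eq[OF z] by (rule suminf_mult2[symmetric])
  qed
  finally show "ip (\<lambda>z. g (r *\<^sub>R z)) q = radw CARD('n) k r *\<^sub>R ip (G k) q" by simp
qed

text \<open>The coefficients are projections of \<open>f\<close> on one sphere divided by
  \<open>radw\<close>. Since every pairing with a harmonic polynomial is a multiple of
  \<open>radw\<close>, they are correct on all spheres, and completeness on each sphere identifies
  the sum with \<open>f\<close>.\<close>

lemma hyp_harmonic_expansion:
  fixes f :: "real ^ 'n::finite \<Rightarrow> complex"
  assumes n: "CARD('n) \<ge> 2" and f: "f \<in> hyp_harmonic"
  obtains G where "admissible G" "\<And>x. x \<in> ball 0 1 \<Longrightarrow> (\<lambda>m. hterm G m x) sums f x"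
proof -
  let ?N = "CARD('n)"
  have C2: "C2_on (ball 0 1) f" and L: "\<And>x. x \<in> ball 0 1 \<Longrightarrow> hyp_laplacian f x = 0"
    using f by (auto simp: hyp_harmonic_def)
  have fc: "continuous_on (ball 0 1) f" by (rule C1_on_continuous[OF C2_onD(1)[OF C2]])
  have fr: "continuous_on (sphere 0 1) (\<lambda>z. f (r *\<^sub>R z))" if "0 \<le> r" "r < 1" for r
    by (rule continuous_on_compose2[OF fc]) (use that in \<open>auto intro!: continuous_intros\<close>)
  \<comment> \<open>The equation \<open>\<Delta>\<^sub>h f = 0\<close> divided by
    \<open>(1 - |x|\<^sup>2)\<^sup>2\<close> and multiplied by \<open>|x|\<^sup>2\<close>, the form
    in which it enters \<open>spherical_mean_ODE\<close>.\<close>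
  have lap: "(norm x)\<^sup>2 *\<^sub>R laplacian f x = - radk ?N (norm x) *\<^sub>R euler f x" if x: "x \<in> ball 0 1" for x
  proof -
    have p: "1 - (norm x)\<^sup>2 > 0" using x norm_sq_le_1[of x] by simp
    let ?p = "1 - (norm x)\<^sup>2"
    have "?p *\<^sub>R (?p *\<^sub>R laplacian f x + (2 * (real ?N - 2)) *\<^sub>R euler f x) = 0"
      using L[OF x] by (simp add: hyp_laplacian_def euler_def scaleR_add_right power2_eq_square mult_ac)
    then have "?p *\<^sub>R laplacian f x = - ((2 * (real ?N - 2)) *\<^sub>R euler f x)"
      using p by (simp add: eq_neg_iff_add_eq_0)
    then have "(norm x)\<^sup>2 *\<^sub>R (1 / ?p) *\<^sub>R ?p *\<^sub>R laplacian f x = (norm x)\<^sup>2 *\<^sub>R (1 / ?p) *\<^sub>R (- ((2 * (real ?N - 2)) *\<^sub>R euler f x))"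
      by simp
    then show ?thesis using p by (simp add: radk_def mult_ac)
  qed
  have rad: "\<exists>\<alpha>. \<forall>r. 0 \<le> r \<longrightarrow> r < 1 \<longrightarrow> ip (\<lambda>z. f (r *\<^sub>R z)) q = radw ?N m r *\<^sub>R \<alpha>"
    if q: "q \<in> harmonic_poly m" for q m
  proof (rule spherical_mean_ODE[OF C2 q])
    fix a1 a2
    assume a: "\<And>r. 0 \<le> r \<Longrightarrow> r < 1 \<Longrightarrow> ((\<lambda>r. \<integral>z. f (r *\<^sub>R z) * q z \<partial>sphm) has_vector_derivative a1 r) (at r)"
      and a1: "\<And>r. 0 \<le> r \<Longrightarrow> r < 1 \<Longrightarrow> (a1 has_vector_derivative a2 r) (at r)"
      and e: "\<And>r. 0 < r \<Longrightarrow> r < 1 \<Longrightarrow> r *\<^sub>R a1 r = (\<integral>z. euler f (r *\<^sub>R z) * q z \<partial>sphm)"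
      and ode: "\<And>r. 0 < r \<Longrightarrow> r < 1 \<Longrightarrow>
       r\<^sup>2 *\<^sub>R a2 r + ((real ?N - 1) * r) *\<^sub>R a1 r
         - (real m * (real m + real ?N - 2)) *\<^sub>R (\<integral>z. f (r *\<^sub>R z) * q z \<partial>sphm)
       = r\<^sup>2 *\<^sub>R (\<integral>z. laplacian f (r *\<^sub>R z) * q z \<partial>sphm)"
    have "r\<^sup>2 *\<^sub>R (\<integral>z. laplacian f (r *\<^sub>R z) * q z \<partial>sphm) = - (radk ?N r * r) *\<^sub>R a1 r" if r: "0 < r" "r < 1" for r
    proof -
      have "r\<^sup>2 *\<^sub>R (\<integral>z. laplacian f (r *\<^sub>R z) * q z \<partial>sphm) = (\<integral>z. (r\<^sup>2 *\<^sub>R laplacian f (r *\<^sub>R z)) * q z \<partial>sphm)"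
        by simp
      also have "\<dots> = (\<integral>z. - radk ?N r *\<^sub>R (euler f (r *\<^sub>R z) * q z) \<partial>sphm)"
      proof (intro Bochner_Integration.integral_cong refl)
        fix z :: "real^'n" assume "z \<in> space sphm"
        then have "r *\<^sub>R z \<in> ball 0 1" "norm (r *\<^sub>R z) = r" using r by auto
        from lap[OF this(1)] this(2) show "(r\<^sup>2 *\<^sub>R laplacian f (r *\<^sub>R z)) * q z = - radk ?N r *\<^sub>R (euler f (r *\<^sub>R z) * q z)"
          by simp
      qed
      also have "\<dots> = - radk ?N r *\<^sub>R (r *\<^sub>R a1 r)" unfolding e[OF r] by (rule Bochner_Integration.integral_scaleR_right)
      finally show ?thesis by simp
    qed
    then have ode': "r\<^sup>2 *\<^sub>R a2 r + ((real ?N - 1) * r) *\<^sub>R a1 r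
         - (real m * (real m + real ?N - 2)) *\<^sub>R (\<integral>z. f (r *\<^sub>R z) * q z \<partial>sphm) = - (radk ?N r * r) *\<^sub>R a1 r"
      if "0 < r" "r < 1" for r using ode that by simp
    obtain \<alpha> where "\<And>r. 0 \<le> r \<Longrightarrow> r < 1 \<Longrightarrow> (\<integral>z. f (r *\<^sub>R z) * q z \<partial>sphm) = radw ?N m r *\<^sub>R \<alpha>"
      using radial_solution[OF n a a1 ode'] by metis
    then show ?thesis by (auto simp: ip_def)
  qed
  \<comment> \<open>The radius \<open>1/2\<close> is arbitrary; it only has to be positive, so that
    \<open>radw\<close> does not vanish there.\<close>
  have "\<exists>P. P \<in> harmonic_poly m \<and> (\<forall>q\<in>harmonic_poly m. ip (\<lambda>z. f ((1/2) *\<^sub>R z)) q = ip P q)" for m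
    using harmonic_projection[OF n fr[of "1/2"], of m] by (metis half_gt_zero_iff less_imp_le zero_less_one field_sum_of_halves less_add_same_cancel1)
  then obtain P where P: "\<And>m. P m \<in> harmonic_poly m" "\<And>m q. q \<in> harmonic_poly m \<Longrightarrow> ip (\<lambda>z. f ((1/2) *\<^sub>R z)) q = ip (P m) q"
    by metis
  define G where "G m x = (1 / radw ?N m (1/2)) *\<^sub>R P m x" for m x
  have GH: "G m \<in> harmonic_poly m" for m
    unfolding G_def[abs_def] by (rule harmonic_poly_scaleR[OF P(1)])
  have Gip: "ip (\<lambda>z. f (r *\<^sub>R z)) q = radw ?N m r *\<^sub>R ip (G m) q" if q: "q \<in> harmonic_poly m" and r: "0 \<le> r" "r < 1" for q m r
  proof -
    obtain \<alpha> where \<alpha>: "\<And>r. 0 \<le> r \<Longrightarrow> r < 1 \<Longrightarrow> ip (\<lambda>z. f (r *\<^sub>R z)) q = radw ?N m r *\<^sub>R \<alpha>"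
      using rad[OF q] by metis
    have w: "radw ?N m (1/2) > 0" by (rule radw_pos[OF n]) auto
    have "ip (P m) q = radw ?N m (1/2) *\<^sub>R \<alpha>" using \<alpha>[of "1/2"] P(2)[OF q] by simp
    moreover have "ip (G m) q = (1 / radw ?N m (1/2)) *\<^sub>R ip (P m) q" by (simp add: ip_def G_def)
    ultimately have "ip (G m) q = \<alpha>" using w by simp
    then show ?thesis using \<alpha>[OF r] by simp
  qed
  have adm: "admissible G"
    unfolding admissible_iff_l2[OF n] subexp_def
  proof safe
    fix m show "G m \<in> harmonic_poly m" by (rule GH)
  next
    fix r :: real assume r: "0 < r" "r < 1"
    have rs: "continuous_on (cball 0 r) f" using fc by (rule continuous_on_subset) (use r in auto)
    obtain M where M: "\<And>x. x \<in> cball 0 r \<Longrightarrow> norm (f x) \<le> M"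
      using compact_bound_obtain[OF compact_cball rs] by metis
    have r2: "1 - r\<^sup>2 > 0" using sq_less_1[of r] r by simp
    \<comment> \<open>Pairing \<open>f\<close> on the sphere of radius \<open>r\<close> with
      \<open>cnj (G m)\<close> gives \<open>radw * l2\<^sup>2 \<le> M * l2\<close>; after cancelling
      one factor, \<open>hypF_lower\<close> replaces \<open>radw\<close> by a multiple of
      \<open>r ^ m\<close>.\<close>
    have "\<bar>l2 (G m)\<bar> * r ^ m \<le> M / (1 - r\<^sup>2) ^ (?N - 2)" for m
    proof (cases "l2 (G m) = 0")
      case True
      have "M \<ge> 0" using M[of 0] norm_ge_zero[of "f 0"] r by (simp del: norm_ge_zero)
      then show ?thesis using True r2 by simp
    next
      case False
      have Gc: "continuous_on (sphere 0 1) (G m)" by (rule harmonic_continuous[OF GH])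
      have cG: "(\<lambda>z. cnj (G m z)) \<in> harmonic_poly m" using GH by auto
      have "radw ?N m r * (l2 (G m))\<^sup>2 = norm (radw ?N m r *\<^sub>R complex_of_real ((l2 (G m))\<^sup>2))"
        using radw_pos[OF n r(1), of m] r by (simp add: norm_mult del: of_real_power)
      also have "radw ?N m r *\<^sub>R complex_of_real ((l2 (G m))\<^sup>2) = ip (\<lambda>z. f (r *\<^sub>R z)) (\<lambda>z. cnj (G m z))"
        using Gip[OF cG, of r] r by (simp only: ip_cnj_self[OF Gc] less_imp_le)
      also have "\<dots> = ip (\<lambda>z. cnj (G m z)) (\<lambda>z. f (r *\<^sub>R z))" by (rule ip_commute)
      also have "norm \<dots> \<le> M * (\<integral>z. norm (cnj (G m z)) \<partial>sphm)"
        by (rule norm_ip_le) (use fr[of r] r in \<open>auto intro!: continuous_intros Gc M\<close>)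
      also have "\<dots> \<le> M * l2 (G m)"
        using l1_le_l2[OF Gc] order_trans[OF norm_ge_zero M[of 0]] r by (intro mult_left_mono) auto
      finally have "radw ?N m r * l2 (G m) * l2 (G m) \<le> M * l2 (G m)" by (simp add: power2_eq_square)
      then have 1: "radw ?N m r * l2 (G m) \<le> M"
        using False l2_nonneg[of "G m"] by (simp add: mult_le_cancel_right)
      have "r ^ m * (1 - r\<^sup>2) ^ (?N - 2) * l2 (G m) \<le> radw ?N m r * l2 (G m)"
        unfolding radw_def using hypF_lower[OF n, of "r\<^sup>2" m] r r2
        by (intro mult_right_mono mult_left_mono) auto
      then have "l2 (G m) * r ^ m * (1 - r\<^sup>2) ^ (?N - 2) \<le> M" using 1 by (simp add: mult_ac)
      then show ?thesis using r2 by (simp add: pos_le_divide_eq)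
    qed
    then show "\<exists>C. \<forall>m. \<bar>l2 (G m)\<bar> * r ^ m \<le> C" by blast
  qed
  define g where "g x = (\<Sum>m. hterm G m x)" for x
  have g: "(\<lambda>m. hterm G m x) sums g x" if x: "x \<in> ball 0 1" for x
  proof -
    have "0 < (1 + norm x) / 2" "(1 + norm x) / 2 < 1" using x by (auto intro: add_pos_nonneg)
    from hterm_bound[OF n adm this]
    obtain M where M: "summable M" "\<And>m y. norm y \<le> (1 + norm x) / 2 \<Longrightarrow> norm (hterm G m y) \<le> M m"
      by metis
    have "summable (\<lambda>m. hterm G m x)"
      by (rule summable_comparison_test'[OF M(1), of 0]) (use M(2)[of x] x in auto)
    then show ?thesis unfolding g_def by (rule summable_sums)
  qed
  have "f x = g x" if x: "x \<in> ball 0 1" for x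
  proof -
    define z where "z = sph x"
    have z: "z \<in> sphere 0 1" "x = norm x *\<^sub>R z" by (auto simp: z_def sph_def)
    have r: "0 \<le> norm x" "norm x < 1" using x by auto
    note S = ip_series[OF n adm r g]
    have gc: "continuous_on (sphere 0 1) (\<lambda>z. g (norm x *\<^sub>R z))" by (rule S(2)[OF _ harmonic_poly_const])
    have "f (norm x *\<^sub>R z) - g (norm x *\<^sub>R z) = 0"
    proof (rule harmonic_complete[OF _ _ z(1), where u="\<lambda>z. f (norm x *\<^sub>R z) - g (norm x *\<^sub>R z)"])
      show "continuous_on (sphere 0 1) (\<lambda>z. f (norm x *\<^sub>R z) - g (norm x *\<^sub>R z))"
        by (intro continuous_intros fr r gc)
      show "ip (\<lambda>z. f (norm x *\<^sub>R z) - g (norm x *\<^sub>R z)) q = 0" if q: "q \<in> harmonic_poly m" for m q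
        using Gip[OF q r] S(1)[OF _ q] by (subst ip_diff_left[OF fr[OF r] gc harmonic_continuous[OF q]]) simp
    qed
    then show ?thesis using z(2) by simp
  qed
  with g show ?thesis by (intro that[OF adm]) auto
qed

section \<open>Termwise differentiation\<close>

lemma has_derivative_hterm:
  fixes G :: "nat \<Rightarrow> real ^ 'n::finite \<Rightarrow> complex"
  assumes n: "CARD('n) \<ge> 2" and G: "G m \<in> harmonic_poly m" and x: "norm x < 1"
  shows "(hterm G m has_derivative (\<lambda>h. \<Sum>k\<in>UNIV. h $ k *\<^sub>R
     ((2 * x $ k * hypF1 CARD('n) m ((norm x)\<^sup>2)) *\<^sub>R G m x + hypF CARD('n) m ((norm x)\<^sup>2) *\<^sub>R partial k (G m) x))) (at x)"
proof -
  let ?F = "hypF CARD('n) m" and ?F1 = "hypF1 CARD('n) m"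
  have z: "\<bar>(norm x)\<^sup>2\<bar> < 1" using norm_sq_le_1[OF x] by simp
  have sq: "((\<lambda>x. x \<bullet> x) has_derivative (\<lambda>h. 2 * (x \<bullet> h))) (at x)"
    by (auto intro!: derivative_eq_intros simp: inner_commute)
  have "((\<lambda>x. ?F (x \<bullet> x)) has_derivative (\<lambda>h. ?F1 (x \<bullet> x) * (2 * (x \<bullet> h)))) (at x)"
    using has_derivative_compose[OF sq, of ?F "\<lambda>h. ?F1 (x \<bullet> x) * h"] hypF_deriv(1)[OF n z, of m]
    by (simp add: has_field_derivative_def power2_norm_eq_inner)
  from has_derivative_scaleR[OF this has_derivative_partial[of "G m" x]]
  have "((\<lambda>x. ?F (x \<bullet> x) *\<^sub>R G m x) has_derivative
     (\<lambda>h. ?F (x \<bullet> x) *\<^sub>R (\<Sum>k\<in>UNIV. h $ k *\<^sub>R partial k (G m) x) + (?F1 (x \<bullet> x) * (2 * (x \<bullet> h))) *\<^sub>R G m x)) (at x)"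
    using harmonic_polyD(1)[OF G] by simp
  moreover have "?F (x \<bullet> x) *\<^sub>R (\<Sum>k\<in>UNIV. h $ k *\<^sub>R partial k (G m) x) + (?F1 (x \<bullet> x) * (2 * (x \<bullet> h))) *\<^sub>R G m x
     = (\<Sum>k\<in>UNIV. h $ k *\<^sub>R ((2 * x $ k * ?F1 ((norm x)\<^sup>2)) *\<^sub>R G m x + ?F ((norm x)\<^sup>2) *\<^sub>R partial k (G m) x))" for h
  proof -
    have "(?F1 (x \<bullet> x) * (2 * (x \<bullet> h))) *\<^sub>R G m x = (\<Sum>k\<in>UNIV. (h $ k * (2 * x $ k * ?F1 (x \<bullet> x))) *\<^sub>R G m x)"
    proof -
      have "c * (2 * (x \<bullet> h)) = (\<Sum>k\<in>UNIV. h $ k * (2 * x $ k * c))" for c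
        by (simp add: inner_vec_def sum_distrib_left mult_ac)
      then show ?thesis unfolding scaleR_sum_left[symmetric] by (simp only:)
    qed
    then show ?thesis
      by (simp add: power2_norm_eq_inner scaleR_add_right sum.distrib scaleR_sum_right mult_ac)
  qed
  ultimately show ?thesis by (simp add: hterm_def[abs_def] power2_norm_eq_inner)
qed

text \<open>The majorant for differentiating under the sum. It combines the bound on
  \<open>hypF1\<close>, uniform in \<open>m\<close>, with the geometric decay of \<open>G m\<close>
  and of its partial derivatives on a smaller ball.\<close>

lemma partial_hterm_bound:
  fixes G :: "nat \<Rightarrow> real ^ 'n::finite \<Rightarrow> complex"
  assumes n: "CARD('n) \<ge> 2" and G: "admissible G" and R: "0 < R" "R < 1"
  obtains M where "summable M"
    "\<And>m x. norm x \<le> R \<Longrightarrow> norm ((2 * x $ k * hypF1 CARD('n) m ((norm x)\<^sup>2)) *\<^sub>R G m x + hypF CARD('n) m ((norm x)\<^sup>2) *\<^sub>R partial k (G m) x) \<le> M m"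
proof -
  define r where "r = (1 + R) / 2"
  have r: "0 < r" "r < 1" "R < r" using R by (auto simp: r_def)
  have R2: "0 \<le> R\<^sup>2" "R\<^sup>2 < 1" using sq_less_1[of R] R by auto
  obtain B where B: "\<And>m z. 0 \<le> z \<Longrightarrow> z \<le> R\<^sup>2 \<Longrightarrow> \<bar>hypF1 CARD('n) m z\<bar> \<le> B"
    using hypF1_uniform_bound[OF n R2] by metis
  have B0: "B \<ge> 0" using B[of 0 0] R2 by linarith
  obtain C where C: "C \<ge> 0" "\<And>m x. norm (partial k (G m) x) * r ^ m \<le> C * norm x ^ (m - 1)"
    using admissible_partial_bound[OF n G r(1,2)] by metis
  obtain M where M: "summable M" "\<And>m x. norm x \<le> R \<Longrightarrow> norm (G m x) \<le> M m" "\<And>m. M m \<ge> 0"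
    using hterm_bound[OF n G R] by metis
  have P: "norm (partial k (G m) x) \<le> C / R * (R / r) ^ m" if x: "norm x \<le> R" for m x
  proof -
    have "norm x ^ (m - 1) \<le> R ^ (m - 1)" using x by (intro power_mono) auto
    also have "\<dots> \<le> R ^ m / R" using R by (cases m) auto
    finally have "norm (partial k (G m) x) * r ^ m \<le> C * (R ^ m / R)"
      by (rule order_trans[OF C(2) mult_left_mono[OF _ C(1)]])
    then have "norm (partial k (G m) x) \<le> C * (R ^ m / R) / r ^ m" using r by (simp only: pos_le_divide_eq zero_less_power)
    then show ?thesis by (simp add: power_divide)
  qed
  show ?thesis
  proof (rule that[of "\<lambda>m. 2 * B * M m + C / R * (R / r) ^ m"])
    show "summable (\<lambda>m. 2 * B * M m + C / R * (R / r) ^ m)"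
      using R r by (intro summable_add summable_mult summable_geometric M(1)) auto
    fix m and x :: "real ^ 'n" assume x: "norm x \<le> R"
    have z: "0 \<le> (norm x)\<^sup>2" "(norm x)\<^sup>2 \<le> R\<^sup>2" using x by (auto intro: power_mono)
    have z1: "(norm x)\<^sup>2 \<le> 1" using z R2 by linarith
    have "norm ((2 * x $ k * hypF1 CARD('n) m ((norm x)\<^sup>2)) *\<^sub>R G m x) \<le> 2 * B * M m"
    proof -
      have "\<bar>x $ k\<bar> \<le> 1" using component_le_norm_cart[of x k] x R by linarith
      then have "\<bar>x $ k\<bar> * \<bar>hypF1 CARD('n) m ((norm x)\<^sup>2)\<bar> \<le> 1 * B"
        using B[OF z, of m] by (intro mult_mono) auto
      then have "2 * (\<bar>x $ k\<bar> * \<bar>hypF1 CARD('n) m ((norm x)\<^sup>2)\<bar>) * norm (G m x) \<le> 2 * B * M m"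
        using M(2)[OF x, of m] B0 by (intro mult_mono) auto
      then show ?thesis by (simp add: abs_mult mult.assoc)
    qed
    moreover have "norm (hypF CARD('n) m ((norm x)\<^sup>2) *\<^sub>R partial k (G m) x) \<le> C / R * (R / r) ^ m"
    proof -
      have "norm (hypF CARD('n) m ((norm x)\<^sup>2) *\<^sub>R partial k (G m) x) \<le> norm (partial k (G m) x)"
        using hypF_pos[OF n z(1) z1, of m] hypF_le_1[OF n z(1) z1, of m] by (simp add: mult_left_le_one_le)
      then show ?thesis using P[OF x, of m] by linarith
    qed
    ultimately show "norm ((2 * x $ k * hypF1 CARD('n) m ((norm x)\<^sup>2)) *\<^sub>R G m x + hypF CARD('n) m ((norm x)\<^sup>2) *\<^sub>R partial k (G m) x)
       \<le> 2 * B * M m + C / R * (R / r) ^ m"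
      by (rule norm_triangle_le[OF add_mono])
  qed
qed

text \<open>Locally uniform convergence of the differentiated series gives the first claim. In the
  tangential combination the two contributions of the radial factor, both proportional to
  \<open>x $ i * x $ j\<close>, cancel, so the operator acts on \<open>G m\<close> alone.\<close>

lemma series_differentiable:
  fixes G :: "nat \<Rightarrow> real ^ 'n::finite \<Rightarrow> complex"
  assumes n: "CARD('n) \<ge> 2" and G: "admissible G"
    and g: "\<And>x. x \<in> ball 0 1 \<Longrightarrow> (\<lambda>m. hterm G m x) sums g x" and x: "x \<in> ball 0 1"
  shows "g differentiable (at x)" "(\<lambda>m. hterm (\<lambda>m. tangential i j (G m)) m x) sums tangential i j g x"
proof -
  let ?N = "CARD('n)"
  define D where "D k m x = (2 * x $ k * hypF1 ?N m ((norm x)\<^sup>2)) *\<^sub>R G m x + hypF ?N m ((norm x)\<^sup>2) *\<^sub>R partial k (G m) x" for k m x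
  define R where "R = (1 + norm x) / 2"
  have R: "0 < R" "R < 1" "norm x < R" using x by (auto simp: R_def intro: add_pos_nonneg)
  let ?S = "ball (0::real^'n) R"
  have xS: "x \<in> ?S" using R by simp
  have S1: "norm y < 1" if "y \<in> ?S" for y using that R by simp
  have SR: "norm y \<le> R" if "y \<in> ?S" for y using that by simp
  have "\<exists>M. summable M \<and> (\<forall>m y. norm y \<le> R \<longrightarrow> norm (D k m y) \<le> M m)" for k
    using partial_hterm_bound[OF n G R(1,2), of k] unfolding D_def by metis
  then obtain M where M: "\<And>k. summable (M k)" "\<And>k m y. norm y \<le> R \<Longrightarrow> norm (D k m y) \<le> M k m" by metis
  have unif: "uniform_limit ?S (\<lambda>n y. \<Sum>m<n. D k m y) (\<lambda>y. \<Sum>m. D k m y) sequentially" for k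
    by (rule Weierstrass_m_test[OF _ M(1)[of k]]) (use M(2) SR in auto)
  have sumD: "(\<lambda>m. D k m x) sums (\<Sum>m. D k m x)" for k
    by (rule summable_sums, rule summable_comparison_test'[OF M(1)[of k], of 0]) (use M(2) R in auto)
  have "\<exists>g'. \<forall>y\<in>?S. (\<lambda>m. hterm G m y) sums g' y \<and> (g' has_derivative (\<lambda>h. \<Sum>k\<in>UNIV. h $ k *\<^sub>R (\<Sum>m. D k m y))) (at y within ?S)"
  proof (rule has_derivative_series[where f'="\<lambda>m y h. \<Sum>k\<in>UNIV. h $ k *\<^sub>R D k m y" and x=x])
    show "(hterm G m has_derivative (\<lambda>h. \<Sum>k\<in>UNIV. h $ k *\<^sub>R D k m y)) (at y within ?S)" if "y \<in> ?S" for m y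
      unfolding D_def by (rule has_derivative_at_withinI[OF has_derivative_hterm[OF n admissibleD(1)[OF G] S1[OF that]]])
    fix e :: real assume e: "e > 0"
    have e': "e / ?N > 0" using e by simp
    have "\<forall>k. \<forall>\<^sub>F n in sequentially. \<forall>y\<in>?S. norm ((\<Sum>m<n. D k m y) - (\<Sum>m. D k m y)) < e / ?N"
      using unif e' unfolding uniform_limit_iff dist_norm by blast
    then have "\<forall>\<^sub>F n in sequentially. \<forall>k. \<forall>y\<in>?S. norm ((\<Sum>m<n. D k m y) - (\<Sum>m. D k m y)) < e / ?N"
      by (intro eventually_all_finite) blast
    then show "\<forall>\<^sub>F n in sequentially. \<forall>y\<in>?S. \<forall>h. norm ((\<Sum>m<n. \<Sum>k\<in>UNIV. h $ k *\<^sub>R D k m y) - (\<Sum>k\<in>UNIV. h $ k *\<^sub>R (\<Sum>m. D k m y))) \<le> e * norm h"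
    proof eventually_elim
      case (elim n)
      show ?case
      proof safe
        fix y :: "real^'n" and h :: "real^'n" assume y: "y \<in> ?S"
        have "(\<Sum>m<n. \<Sum>k\<in>UNIV. h $ k *\<^sub>R D k m y) - (\<Sum>k\<in>UNIV. h $ k *\<^sub>R (\<Sum>m. D k m y))
            = (\<Sum>k\<in>UNIV. h $ k *\<^sub>R ((\<Sum>m<n. D k m y) - (\<Sum>m. D k m y)))"
          by (subst sum.swap) (simp add: scaleR_diff_right sum_subtractf scaleR_sum_right)
        also have "norm \<dots> \<le> (\<Sum>k\<in>(UNIV::'n set). norm h * (e / ?N))"
        proof (intro order_trans[OF norm_sum] sum_mono)
          fix k
          have "norm ((\<Sum>m<n. D k m y) - (\<Sum>m. D k m y)) \<le> e / ?N" using elim y by (auto intro: less_imp_le)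
          then show "norm (h $ k *\<^sub>R ((\<Sum>m<n. D k m y) - (\<Sum>m. D k m y))) \<le> norm h * (e / ?N)"
            unfolding norm_scaleR using component_le_norm_cart[of h k] by (intro mult_mono) auto
        qed
        also have "\<dots> = e * norm h" by simp
        finally show "norm ((\<Sum>m<n. \<Sum>k\<in>UNIV. h $ k *\<^sub>R D k m y) - (\<Sum>k\<in>UNIV. h $ k *\<^sub>R (\<Sum>m. D k m y))) \<le> e * norm h" .
      qed
    qed
  qed (use xS g[OF x] in auto)
  then obtain g' where g': "\<And>y. y \<in> ?S \<Longrightarrow> (\<lambda>m. hterm G m y) sums g' y"
    "\<And>y. y \<in> ?S \<Longrightarrow> (g' has_derivative (\<lambda>h. \<Sum>k\<in>UNIV. h $ k *\<^sub>R (\<Sum>m. D k m y))) (at y within ?S)" by blast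
  have gg: "g' y = g y" if "y \<in> ?S" for y
    using sums_unique2[OF g'(1)[OF that] g] S1[OF that] by simp
  have "(g' has_derivative (\<lambda>h. \<Sum>k\<in>UNIV. h $ k *\<^sub>R (\<Sum>m. D k m x))) (at x)"
    using g'(2)[OF xS] at_within_open[OF xS open_ball] by simp
  from has_derivative_transform_within_open[OF this open_ball xS gg]
  have dg: "(g has_derivative (\<lambda>h. \<Sum>k\<in>UNIV. h $ k *\<^sub>R (\<Sum>m. D k m x))) (at x)" .
  then show "g differentiable (at x)" by (auto simp: differentiable_def)
  have pg: "partial k g x = (\<Sum>m. D k m x)" for k
    by (subst partial_eqI[OF dg]) (auto simp: axis_def if_distrib[where f="\<lambda>r. r *\<^sub>R _"] cong: if_cong)
  have "(\<lambda>m. x $ i *\<^sub>R D j m x - x $ j *\<^sub>R D i m x) sums tangential i j g x"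
    unfolding tangential_def pg by (intro sums_diff sums_scaleR_right sumD)
  moreover have "x $ i *\<^sub>R D j m x - x $ j *\<^sub>R D i m x = hterm (\<lambda>m. tangential i j (G m)) m x" for m
    by (simp add: D_def hterm_def tangential_def scaleR_add_right scaleR_diff_right mult_ac)
  ultimately show "(\<lambda>m. hterm (\<lambda>m. tangential i j (G m)) m x) sums tangential i j g x" by simp
qed

lemma finite_tangential_ops: "finite (tangential_ops k :: (((real, 'n::{finite,linorder}) vec \<Rightarrow> complex) \<Rightarrow> _) set)"
proof (induction k)
  case (Suc k)
  have "tangential_ops (Suc k) \<subseteq> (\<lambda>(p, T). tangential (fst p) (snd p) \<circ> T) ` (UNIV \<times> (tangential_ops k :: (((real, 'n) vec \<Rightarrow> complex) \<Rightarrow> _) set))"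
  proof
    fix T :: "((real, 'n) vec \<Rightarrow> complex) \<Rightarrow> (real, 'n) vec \<Rightarrow> complex" assume "T \<in> tangential_ops (Suc k)"
    then obtain i j U where "U \<in> tangential_ops k" "T = tangential i j \<circ> U" by auto
    then show "T \<in> (\<lambda>(p, T). tangential (fst p) (snd p) \<circ> T) ` (UNIV \<times> tangential_ops k)"
      by (intro image_eqI[of _ _ "((i, j), U)"]) auto
  qed
  then show ?case by (rule finite_subset) (intro finite_imageI finite_cartesian_product finite Suc)
qed simp

lemma tangential_ops_series:
  fixes G :: "nat \<Rightarrow> real ^ 'n::{finite,linorder} \<Rightarrow> complex"
  assumes n: "CARD('n) \<ge> 2" and G: "admissible G"
    and g: "\<And>x. x \<in> ball 0 1 \<Longrightarrow> (\<lambda>m. hterm G m x) sums g x" and T: "T \<in> tangential_ops k"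
  shows "admissible (\<lambda>m. T (G m)) \<and> (\<forall>x\<in>ball 0 1. (\<lambda>m. hterm (\<lambda>m. T (G m)) m x) sums T g x)"
  using T
proof (induction k arbitrary: T)
  case 0
  then show ?case using G g by simp
next
  case (Suc k)
  then obtain i j U where U: "U \<in> tangential_ops k" "T = tangential i j \<circ> U" by auto
  from Suc.IH[OF U(1)] have IH: "admissible (\<lambda>m. U (G m))"
    "\<And>x. x \<in> ball 0 1 \<Longrightarrow> (\<lambda>m. hterm (\<lambda>m. U (G m)) m x) sums U g x" by auto
  show ?case
    unfolding U(2) comp_apply
    using admissible_tangential[OF n IH(1), of i j] series_differentiable(2)[OF n IH, of _ i j] by auto
qed

text \<open>Since \<open>\<Sum>i j. \<parallel>T i j q\<parallel>\<^sup>2 = 2 \<lambda> \<parallel>q\<parallel>\<^sup>2\<close> with \<open>\<lambda> \<ge> 1\<close>, one of the operators does not shrink \<open>q\<close> by more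
  than the factor \<open>n\<close>.\<close>

lemma l2_le_tangential_ops:
  fixes q :: "real ^ 'n::{finite,linorder} \<Rightarrow> complex"
  assumes n: "CARD('n) \<ge> 2" and q: "q \<in> harmonic_poly m" and m: "m \<ge> 1"
  shows "\<exists>T\<in>tangential_ops k. T q \<in> harmonic_poly m \<and> l2 q \<le> real CARD('n) ^ k * l2 (T q)"
proof (induction k)
  case 0 then show ?case using q by simp
next
  case (Suc k)
  let ?n = "real CARD('n)"
  from Suc obtain T where T: "T \<in> tangential_ops k" "T q \<in> harmonic_poly m" "l2 q \<le> ?n ^ k * l2 (T q)" by auto
  let ?u = "T q"
  have "\<exists>i j. i < j \<and> l2 ?u \<le> ?n * l2 (tangential i j ?u)"
  proof (rule ccontr)
    assume "\<not> ?thesis"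
    then have less: "?n * l2 (tangential i j ?u) < l2 ?u" if "i < j" for i j using that by force
    have neg: "l2 (\<lambda>x. - v x) = l2 v" for v :: "(real, 'n) vec \<Rightarrow> complex" by (simp add: l2_def)
    have sw: "l2 (tangential j i ?u) = l2 (tangential i j ?u)" for i j
      using tangential_swap[of j i ?u] neg[of "tangential i j ?u"] by (metis ext)
    have nd: "?n * l2 (tangential i j ?u) < l2 ?u" if "i \<noteq> j" for i j
      using less[of i j] less[of j i] that sw[of i j] by (metis neq_iff)
    \<comment> \<open>Two distinct indices exist since \<open>n \<ge> 2\<close>; the strict
      inequality for this pair forces \<open>l2 ?u > 0\<close>, so that the norm can be cancelled
      below.\<close>
    obtain i0 j0 :: 'n where ne: "i0 \<noteq> j0"
      using n by (metis (full_types) One_nat_def Suc_1 card_2_iff' card_le_Suc0_iff_eq finite_class.finite_UNIV not_less_eq_eq UNIV_I)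
    have pos: "l2 ?u > 0" by (rule le_less_trans[OF _ nd[OF ne]]) simp
    have each: "?n\<^sup>2 * (l2 (tangential i j ?u))\<^sup>2 \<le> (l2 ?u)\<^sup>2" for i j
    proof (cases "i = j")
      case True
      then have "tangential i j ?u = (\<lambda>x. 0)" by (simp add: tangential_def fun_eq_iff)
      then show ?thesis by (simp add: l2_def)
    next
      case False
      have "(?n * l2 (tangential i j ?u))\<^sup>2 \<le> (l2 ?u)\<^sup>2" using nd[OF False] by (intro power_mono) auto
      then show ?thesis by (simp add: power_mult_distrib)
    qed
    have "?n\<^sup>2 * (\<Sum>i\<in>UNIV. \<Sum>j\<in>UNIV. (l2 (tangential i j ?u))\<^sup>2) \<le> (\<Sum>i\<in>(UNIV::'n set). \<Sum>j\<in>(UNIV::'n set). (l2 ?u)\<^sup>2)"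
      unfolding sum_distrib_left by (intro sum_mono each)
    also have "\<dots> = ?n\<^sup>2 * (l2 ?u)\<^sup>2" by (simp add: power2_eq_square)
    finally have "(\<Sum>i\<in>UNIV. \<Sum>j\<in>UNIV. (l2 (tangential i j ?u))\<^sup>2) \<le> (l2 ?u)\<^sup>2" using n by simp
    then have le: "2 * real m * (real m + ?n - 2) * (l2 ?u)\<^sup>2 \<le> 1 * (l2 ?u)\<^sup>2"
      unfolding l2_tangential_le[OF T(2)] by simp
    have "2 * 1 * 1 \<le> 2 * real m * (real m + ?n - 2)" using n m by (intro mult_mono) auto
    moreover have "2 * real m * (real m + ?n - 2) \<le> 1" using le pos by (subst (asm) mult_le_cancel_right) auto
    ultimately show False by simp
  qed
  then obtain i j where ij: "i < j" "l2 ?u \<le> ?n * l2 (tangential i j ?u)" by auto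
  have "l2 q \<le> ?n ^ k * (?n * l2 (tangential i j ?u))"
    using T(3) ij(2) by (meson mult_left_mono of_nat_0_le_iff order_trans zero_le_power)
  then have "l2 q \<le> ?n ^ Suc k * l2 ((tangential i j \<circ> T) q)" by (simp add: mult_ac)
  moreover have "tangential i j \<circ> T \<in> tangential_ops (Suc k)" using T(1) ij(1) by auto
  moreover have "(tangential i j \<circ> T) q \<in> harmonic_poly m" using T(2) by auto
  ultimately show ?case by blast
qed

section \<open>Uniqueness of the expansion\<close>

lemma S_fun_eq: "S_fun TYPE('n::finite) m r = hypF CARD('n) m (r\<^sup>2) / hypF CARD('n) m 1"
  by (simp add: S_fun_def hypF_def)

lemma is_expansion_iff:
  fixes F :: "nat \<Rightarrow> real ^ 'n::finite \<Rightarrow> complex"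
  shows "is_expansion f F \<longleftrightarrow> (\<forall>m. F m \<in> harmonic_poly m) \<and>
    (\<forall>x\<in>ball 0 1. (\<lambda>m. hterm (\<lambda>m x. (1 / hypF CARD('n) m 1) *\<^sub>R F m x) m x) sums f x)"
  by (simp add: is_expansion_def hterm_def S_fun_eq)

text \<open>As for power series, the first nonzero term would dominate as \<open>r\<close> tends to
  zero. The factors \<open>hypF\<close> vary with \<open>m\<close>, but they lie between a positive
  constant and one, so the term of degree \<open>M\<close> is of exact order \<open>r ^ M\<close>
  and the tail is of order \<open>r ^ (M + 1)\<close>.\<close>

lemma hypF_series_unique:
  fixes c :: "nat \<Rightarrow> complex"
  assumes N: "N \<ge> 2" and s: "\<And>r. 0 < r \<Longrightarrow> r < 1 \<Longrightarrow> (\<lambda>m. radw N m r *\<^sub>R c m) sums 0"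
  shows "c m = 0"
proof (induction m rule: less_induct)
  case (less M)
  have conv: "(\<lambda>m. radw N m (1/2) *\<^sub>R c m) \<longlonglongrightarrow> 0"
    using s[of "1/2"] by (intro summable_LIMSEQ_zero) (auto simp: sums_iff)
  then obtain K where K: "\<And>m. norm (radw N m (1/2) *\<^sub>R c m) \<le> K"
    using convergent_imp_Bseq[OF convergentI[OF conv]] unfolding Bseq_def by blast
  \<comment> \<open>The value of the lower bound in \<open>hypF_lower\<close> at radius
    \<open>1/2\<close>; it is valid for all smaller radii too.\<close>
  define a where "a = (3/4 :: real) ^ (N - 2)"
  have a: "a > 0" by (simp add: a_def)
  have cb: "norm (c m) \<le> K / a * 2 ^ m" for m
  proof -
    have "a \<le> hypF N m ((1/2)\<^sup>2)" using hypF_lower[OF N, of "(1/2)\<^sup>2" m] by (simp add: a_def power2_eq_square)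
    then have "a * (1/2) ^ m \<le> radw N m (1/2)" by (simp add: radw_def)
    then have "a * (1/2) ^ m * norm (c m) \<le> \<bar>radw N m (1/2)\<bar> * norm (c m)" by (intro mult_right_mono) auto
    also have "\<dots> \<le> K" using K[of m] by simp
    finally show ?thesis using a by (simp add: field_simps power_divide)
  qed
  have K0: "K \<ge> 0" using K[of 0] norm_ge_zero order_trans by blast
  \<comment> \<open>Convergence at radius \<open>1/2\<close> allows coefficients as large as
    \<open>2 ^ m\<close>; for \<open>r \<le> 1/4\<close> the tail is then dominated by a geometric
    series of ratio \<open>1/2\<close>.\<close>
  have bound: "norm (c M) * a \<le> 2 * (K / a) * 2 ^ Suc M * r" if r: "0 < r" "r \<le> 1/4" for r
  proof -
    have r1: "r < 1" using r by simp
    have "(\<lambda>m. radw N (m + Suc M) r *\<^sub>R c (m + Suc M)) sums (0 - (\<Sum>m<Suc M. radw N m r *\<^sub>R c m))"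
      by (rule sums_split_initial_segment[OF s[OF r(1) r1]])
    also have "(\<Sum>m<Suc M. radw N m r *\<^sub>R c m) = radw N M r *\<^sub>R c M"
      using less by simp
    finally have S: "(\<lambda>m. radw N (m + Suc M) r *\<^sub>R c (m + Suc M)) sums - (radw N M r *\<^sub>R c M)" by simp
    have t: "norm (radw N (m + Suc M) r *\<^sub>R c (m + Suc M)) \<le> (K / a * (2 * r) ^ Suc M) * (1/2) ^ m" for m
    proof -
      have r2: "0 \<le> r\<^sup>2" "r\<^sup>2 \<le> 1" using r by (auto simp: power_le_one)
      have "0 \<le> radw N (m + Suc M) r" using radw_pos[OF N r(1), of "m + Suc M"] r1 by simp
      moreover have "radw N (m + Suc M) r \<le> r ^ (m + Suc M)"
        unfolding radw_def using hypF_le_1[OF N r2, of "m + Suc M"] r by (intro mult_left_le) auto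
      ultimately have "norm (radw N (m + Suc M) r *\<^sub>R c (m + Suc M)) \<le> r ^ (m + Suc M) * (K / a * 2 ^ (m + Suc M))"
        using cb[of "m + Suc M"] r unfolding norm_scaleR by (intro mult_mono) auto
      also have "\<dots> = (K / a * (2 * r) ^ Suc M) * (2 * r) ^ m" by (simp add: power_add power_mult_distrib)
      also have "\<dots> \<le> (K / a * (2 * r) ^ Suc M) * (1/2) ^ m"
        using r K0 a by (intro mult_left_mono power_mono) auto
      finally show ?thesis .
    qed
    have "norm (- (radw N M r *\<^sub>R c M)) \<le> (\<Sum>m. (K / a * (2 * r) ^ Suc M) * (1/2) ^ m)"
      unfolding sums_unique[OF S] by (rule norm_suminf_le[OF t]) (intro summable_mult summable_geometric, simp)
    also have "\<dots> = (K / a * (2 * r) ^ Suc M) * 2"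
      by (subst suminf_mult) (auto simp: suminf_geometric)
    finally have 1: "\<bar>radw N M r\<bar> * norm (c M) \<le> (K / a * (2 * r) ^ Suc M) * 2" by simp
    have "a \<le> hypF N M (r\<^sup>2)"
    proof -
      have "r\<^sup>2 \<le> (1/2)\<^sup>2" using r by (intro power_mono) auto
      then have "a \<le> (1 - r\<^sup>2) ^ (N - 2)" unfolding a_def by (intro power_mono) (auto simp: power2_eq_square)
      also have "\<dots> \<le> hypF N M (r\<^sup>2)" using r by (intro hypF_lower[OF N]) (auto simp: power_less_one_iff)
      finally show ?thesis .
    qed
    then have "r ^ M * a \<le> \<bar>radw N M r\<bar>" unfolding radw_def using r a by (simp add: abs_mult)
    then have "r ^ M * a * norm (c M) \<le> (K / a * (2 * r) ^ Suc M) * 2"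
      using 1 by (meson mult_right_mono norm_ge_zero order_trans)
    then have "r ^ M * (norm (c M) * a) \<le> r ^ M * (2 * (K / a) * 2 ^ Suc M * r)"
      by (simp add: power_mult_distrib mult_ac)
    then show ?thesis by (rule mult_left_le_imp_le) (use r in simp)
  qed
  have "norm (c M) * a \<le> 0"
  proof (rule field_le_epsilon)
    fix e :: real assume e: "e > 0"
    define Q where "Q = 2 * (K / a) * 2 ^ Suc M"
    have Q: "Q \<ge> 0" using K0 a by (simp add: Q_def)
    define r where "r = min (1/4) (e / (Q + 1))"
    have r: "0 < r" "r \<le> 1/4" "r \<le> e / (Q + 1)"
      unfolding r_def by (use e Q in simp) (rule min.cobounded1 min.cobounded2)+
    have "norm (c M) * a \<le> Q * r" using bound[OF r(1,2)] by (simp add: Q_def)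
    also have "\<dots> \<le> Q * (e / (Q + 1))" using r Q by (intro mult_left_mono) auto
    also have "\<dots> \<le> e" using Q e by (simp add: field_simps)
    finally show "norm (c M) * a \<le> 0 + e" by simp
  qed
  then show "c M = 0" using a by (simp add: mult_le_0_iff)
qed

lemma expansion_unique:
  fixes F F' :: "nat \<Rightarrow> real ^ 'n::finite \<Rightarrow> complex"
  assumes n: "CARD('n) \<ge> 2" and F: "is_expansion f F" and F': "is_expansion f F'"
  shows "F = F'"
proof -
  have H: "F m \<in> harmonic_poly m" "F' m \<in> harmonic_poly m" for m using F F' by (auto simp: is_expansion_def)
  have sph: "F m z = F' m z" if z: "z \<in> sphere 0 1" for m z
  proof -
    have "(\<lambda>m. radw CARD('n) m r *\<^sub>R ((1 / hypF CARD('n) m 1) *\<^sub>R (F m z - F' m z))) sums 0" if r: "0 < r" "r < 1" for r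
    proof -
      have b: "r *\<^sub>R z \<in> ball 0 1" "norm (r *\<^sub>R z) = r" using r z by auto
      have "(\<lambda>m. S_fun TYPE('n) m r *\<^sub>R F m (r *\<^sub>R z) - S_fun TYPE('n) m r *\<^sub>R F' m (r *\<^sub>R z)) sums (f (r *\<^sub>R z) - f (r *\<^sub>R z))"
      proof (rule sums_diff)
        show "(\<lambda>m. S_fun TYPE('n) m r *\<^sub>R F m (r *\<^sub>R z)) sums f (r *\<^sub>R z)"
          "(\<lambda>m. S_fun TYPE('n) m r *\<^sub>R F' m (r *\<^sub>R z)) sums f (r *\<^sub>R z)"
          using F F' b(1) unfolding is_expansion_def by (metis b(2))+
      qed
      moreover have "S_fun TYPE('n) m r *\<^sub>R F m (r *\<^sub>R z) - S_fun TYPE('n) m r *\<^sub>R F' m (r *\<^sub>R z)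
         = radw CARD('n) m r *\<^sub>R ((1 / hypF CARD('n) m 1) *\<^sub>R (F m z - F' m z))" for m
        unfolding harmonic_polyD(2)[OF H(1)] harmonic_polyD(2)[OF H(2)]
        by (simp add: S_fun_eq radw_def scaleR_diff_right mult_ac)
      ultimately show ?thesis by simp
    qed
    from hypF_series_unique[OF n this, of m] show ?thesis using hypF_pos[OF n, of 1 m] by simp
  qed
  have "F m x = F' m x" for m x
  proof -
    have "F m (norm x *\<^sub>R sph x) = F' m (norm x *\<^sub>R sph x)"
      unfolding harmonic_polyD(2)[OF H(1)] harmonic_polyD(2)[OF H(2)] using sph[of "sph x" m] by simp
    moreover have "norm x *\<^sub>R sph x = x" by (simp add: sph_def)
    ultimately show ?thesis by simp
  qed
  then show ?thesis by blast
qed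

text \<open>Existence and uniqueness of the expansion evaluate the definite description in
  \<open>expansion_term\<close>. The factor \<open>hypF CARD('n) m 1\<close> converts between the
  normalization of \<open>S_fun\<close> and that of \<open>hterm\<close>.\<close>

lemma expansion_term_props:
  fixes f :: "real ^ 'n::finite \<Rightarrow> complex"
  assumes n: "CARD('n) \<ge> 2" and f: "f \<in> hyp_harmonic"
  obtains G where "admissible G" "\<And>x. x \<in> ball 0 1 \<Longrightarrow> (\<lambda>m. hterm G m x) sums f x"
    "\<And>m x. expansion_term f m x = hypF CARD('n) m 1 *\<^sub>R G m x"
proof -
  obtain G where G: "admissible G" "\<And>x. x \<in> ball 0 1 \<Longrightarrow> (\<lambda>m. hterm G m x) sums f x"
    using hyp_harmonic_expansion[OF n f] by metis
  define F where "F m x = hypF CARD('n) m 1 *\<^sub>R G m x" for m x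
  have "F m \<in> harmonic_poly m" for m
    unfolding F_def[abs_def] using admissibleD(1)[OF G(1)] by (rule harmonic_poly_scaleR)
  moreover have "(1 / hypF CARD('n) m 1) *\<^sub>R F m x = G m x" for m x
    using hypF_pos[OF n, of 1 m] by (simp add: F_def)
  ultimately have F: "is_expansion f F" using G(2) by (simp add: is_expansion_iff)
  have "expansion_term f = F"
    unfolding expansion_term_def using F expansion_unique[OF n _ F] by (intro the_equality)
  then show ?thesis by (intro that[OF G]) (auto simp: F_def)
qed

section \<open>The multipliers of the radial derivatives\<close>

lemma subexp_power: "subexp (\<lambda>m. real m ^ k)"
  by (induction k) (auto intro: subexp_const subexp_mult subexp_of_nat)

text \<open>Compare with \<open>m ^ k\<close> for a natural number \<open>k \<ge> b\<close>, using \<open>1 + k / m \<le> (1 + 1 / m) ^ k\<close>.\<close>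

lemma subexp_ratio:
  assumes pos: "\<And>m. a m \<ge> 0" and rat: "\<And>m. m \<ge> 1 \<Longrightarrow> a (Suc m) \<le> (1 + b / real m) * a m"
  shows "subexp a"
proof -
  obtain k :: nat where k: "b \<le> real k" using real_arch_simple by blast
  have "a (Suc m) \<le> a 1 * real (Suc m) ^ k" for m
  proof (induction m)
    case (Suc m)
    have "1 + b / real (Suc m) \<le> 1 + real k * (1 / real (Suc m))" using k by (simp add: divide_right_mono)
    also have "\<dots> \<le> (1 + 1 / real (Suc m)) ^ k" by (rule Bernoulli_inequality) (simp add: field_simps)
    finally have "1 + b / real (Suc m) \<le> (1 + 1 / real (Suc m)) ^ k" .
    then have "a (Suc (Suc m)) \<le> (1 + 1 / real (Suc m)) ^ k * a (Suc m)"
      using rat[of "Suc m"] pos[of "Suc m"] by (auto intro: order_trans mult_right_mono)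
    also have "\<dots> \<le> (1 + 1 / real (Suc m)) ^ k * (a 1 * real (Suc m) ^ k)"
      using Suc by (intro mult_left_mono) auto
    also have "\<dots> = a 1 * ((1 + 1 / real (Suc m)) * real (Suc m)) ^ k"
      unfolding power_mult_distrib by (simp only: mult_ac)
    also have "(1 + 1 / real (Suc m)) * real (Suc m) = real (Suc (Suc m))" by (simp add: field_simps)
    finally show ?case .
  qed simp
  then have le: "a m \<le> a 1 * real m ^ k + a 0" for m
    using pos[of 0] pos[of 1] by (cases m) (auto intro: add_increasing2)
  have "subexp (\<lambda>m. a 1 * real m ^ k + a 0)" by (intro subexp_add subexp_mult subexp_const subexp_power)
  then show ?thesis by (rule subexp_mono) (use le pos in \<open>auto intro: order_trans[OF _ abs_ge_self]\<close>)
qed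

text \<open>By the functional equation of \<open>Gamma\<close>, consecutive coefficients have
  quotient \<open>m / (m + \<beta>)\<close> for \<open>m \<ge> 1\<close>, where
  \<open>\<beta> = - \<alpha> - 1\<close> is nonnegative. So the sequence does not increase from
  there on, and its reciprocal grows at most polynomially.\<close>

lemma c_coeff_small:
  assumes "\<alpha> \<le> -1"
  shows "c_coeff N m \<alpha> > 0" "subexp (\<lambda>m. c_coeff N m \<alpha>)" "subexp (\<lambda>m. 1 / c_coeff N m \<alpha>)"
proof -
  define \<beta> where "\<beta> = - \<alpha> - 1"
  have \<beta>: "\<beta> \<ge> 0" using assms by (simp add: \<beta>_def)
  have c: "c_coeff N m \<alpha> = (if m = 0 then 1 else Gamma (real m) / Gamma (real m + \<beta>))" for m
    using assms by (simp add: c_coeff_def \<beta>_def algebra_simps)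
  show pos: "c_coeff N m \<alpha> > 0" for m
    using \<beta> by (auto simp: c intro!: divide_pos_pos Gamma_real_pos add_pos_nonneg)
  have rec: "c_coeff N (Suc m) \<alpha> = c_coeff N m \<alpha> * (real m / (real m + \<beta>))" if "m \<ge> 1" for m
  proof -
    have nz: "real m \<noteq> 0" "real m + \<beta> > 0" using that \<beta> by auto
    have 1: "Gamma (real m + 1) = real m * Gamma (real m)" "Gamma (real m + \<beta> + 1) = (real m + \<beta>) * Gamma (real m + \<beta>)"
      using nz by (auto intro!: Gamma_plus1 elim!: nonpos_Ints_cases)
    have "real (Suc m) = real m + 1" "real (Suc m) + \<beta> = real m + \<beta> + 1" by simp_all
    then show ?thesis using that unfolding c by (simp only: 1) (simp add: mult.commute)
  qed
  show "subexp (\<lambda>m. c_coeff N m \<alpha>)"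
  proof (rule subexp_ratio[where b=0])
    show "c_coeff N (Suc m) \<alpha> \<le> (1 + 0 / real m) * c_coeff N m \<alpha>" if "m \<ge> 1" for m
    proof -
      have "real m / (real m + \<beta>) \<le> 1" using \<beta> that by simp
      then have "c_coeff N m \<alpha> * (real m / (real m + \<beta>)) \<le> c_coeff N m \<alpha>"
        using pos[of m] by (intro mult_left_le) auto
      then show ?thesis unfolding rec[OF that] by (simp only: div_0 add_0_right mult_1)
    qed
  qed (use pos in \<open>auto intro: less_imp_le\<close>)
  show "subexp (\<lambda>m. 1 / c_coeff N m \<alpha>)"
  proof (rule subexp_ratio[where b=\<beta>])
    show "1 / c_coeff N (Suc m) \<alpha> \<le> (1 + \<beta> / real m) * (1 / c_coeff N m \<alpha>)" if "m \<ge> 1" for m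
      using that \<beta> pos[of m] unfolding rec[OF that] by (simp add: field_simps)
  qed (use pos in \<open>auto intro: less_imp_le\<close>)
qed

text \<open>Normalized at radius one, monotonicity of \<open>radw\<close> and of \<open>hypF\<close>
  bounds \<open>S_fun\<close> from both sides; these are the bounds for the integrand in
  \<open>c_coeff\<close>.\<close>

lemma radw_quotient:
  assumes n: "CARD('n::finite) \<ge> 2" and r: "0 \<le> r" "r \<le> 1"
  shows "0 \<le> r ^ m * S_fun TYPE('n) m r" "r ^ m * S_fun TYPE('n) m r \<le> 1" "1 \<le> S_fun TYPE('n) m r"
proof -
  let ?N = "CARD('n)"
  have p: "hypF ?N m 1 > 0" by (rule hypF_pos[OF n]) auto
  have r2: "0 \<le> r\<^sup>2" "r\<^sup>2 \<le> 1" using r by (auto simp: power_le_one)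
  have eq: "r ^ m * S_fun TYPE('n) m r = radw ?N m r / hypF ?N m 1" by (simp add: S_fun_eq radw_def)
  have "radw ?N m r \<le> radw ?N m 1" using r by (intro radw_mono_aux[OF n]) auto
  then show "r ^ m * S_fun TYPE('n) m r \<le> 1" unfolding eq using p by (simp add: radw_def)
  show "0 \<le> r ^ m * S_fun TYPE('n) m r"
    unfolding eq using p r hypF_pos[OF n r2, of m] by (simp add: radw_def)
  show "1 \<le> S_fun TYPE('n) m r"
    using hypF_antimono[OF n r2 order_refl, of m] p by (simp add: S_fun_eq)
qed

text \<open>The factor \<open>r\<close> provides an explicit antiderivative; it is available in
  \<open>c_coeff\<close> because the exponent \<open>2 m + n - 1\<close> is at least one.\<close>

lemma set_integrable_weight:
  assumes "\<alpha> > -1"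
  shows "integrable lborel (\<lambda>r. indicator {0..1} r *\<^sub>R (r * (1 - r\<^sup>2) powr \<alpha>) :: real)"
proof -
  let ?f = "\<lambda>r::real. r * (1 - r\<^sup>2) powr \<alpha>"
  let ?F = "\<lambda>r::real. - ((1 - r\<^sup>2) powr (\<alpha> + 1)) / (2 * (\<alpha> + 1))"
  have lim: "continuous_on {0..1} ?F"
  proof -
    have "continuous_on {0..1} (\<lambda>r::real. (1 - r\<^sup>2) powr (\<alpha> + 1))"
      using assms by (intro continuous_on_powr' continuous_intros) (auto simp: power_le_one)
    from continuous_on_divide[OF continuous_on_minus[OF this] continuous_on_const] show ?thesis
      using assms by simp
  qed
  have "set_integrable lborel (einterval 0 1) ?f"
  proof (rule interval_integral_FTC_nonneg(1)[where F="?F"])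
    show "(?F has_real_derivative ?f x) (at x)" if "0 < ereal x" "ereal x < 1" for x
    proof -
      have x: "0 < x" "x < 1" using that by (auto simp: zero_ereal_def one_ereal_def)
      have "1 - x\<^sup>2 > 0" using sq_less_1[of x] x by simp
      moreover have "((\<lambda>r. 1 - r\<^sup>2) has_real_derivative - 2 * x) (at x)"
        by (auto intro!: derivative_eq_intros)
      ultimately have "((\<lambda>r. (1 - r\<^sup>2) powr (\<alpha> + 1)) has_real_derivative (\<alpha> + 1) * (1 - x\<^sup>2) powr \<alpha> * (- 2 * x)) (at x)"
        using DERIV_fun_powr[of "\<lambda>r. 1 - r\<^sup>2" "- 2 * x" x "\<alpha> + 1"] by simp
      from DERIV_cdivide[OF DERIV_minus[OF this], of "2 * (\<alpha> + 1)"] show ?thesis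
        by (rule DERIV_cong) (use assms in \<open>simp add: field_simps\<close>)
    qed
    show "isCont ?f x" if "0 < ereal x" "ereal x < 1" for x
    proof -
      have x: "0 < x" "x < 1" using that by (auto simp: zero_ereal_def one_ereal_def)
      have "1 - x\<^sup>2 \<noteq> 0" using sq_less_1[of x] x by simp
      then show ?thesis by (intro continuous_intros) auto
    qed
    show "AE x in lborel. 0 < ereal x \<longrightarrow> ereal x < 1 \<longrightarrow> 0 \<le> ?f x"
      by (auto simp: zero_ereal_def one_ereal_def)
    have "(?F \<longlongrightarrow> ?F 0) (at_right 0)"
      by (rule continuous_on_Icc_at_rightD[OF lim]) simp
    then show "((?F \<circ> real_of_ereal) \<longlongrightarrow> ?F 0) (at_right 0)"
      unfolding zero_ereal_def ereal_tendsto_simps1 .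
    have "(?F \<longlongrightarrow> ?F 1) (at_left 1)"
      by (rule continuous_on_Icc_at_leftD[OF lim]) simp
    then show "((?F \<circ> real_of_ereal) \<longlongrightarrow> ?F 1) (at_left 1)"
      unfolding one_ereal_def ereal_tendsto_simps1 .
  qed auto
  then have "integrable lborel (\<lambda>r. indicator {0<..<1} r *\<^sub>R ?f r)"
    by (simp add: set_integrable_def zero_ereal_def one_ereal_def)
  moreover have "indicator {0<..<1} r *\<^sub>R ?f r = indicator {0..1} r *\<^sub>R ?f r" for r
    by (cases "r = 0 \<or> r = 1") (auto simp: indicator_def)
  ultimately show ?thesis by (simp only:)
qed

text \<open>The integral \<open>J m\<close> is bounded above independently of \<open>m\<close>,
  because \<open>r ^ m S_fun \<le> 1\<close>, and below by a multiple of
  \<open>\<rho> ^ (2 m)\<close> for every \<rho> < 1, because \<open>S_fun \<ge> 1\<close>. This is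
  subexponential control in both directions.\<close>

lemma c_coeff_large:
  assumes n: "CARD('n::finite) \<ge> 2" and \<alpha>: "\<alpha> > -1"
  shows "c_coeff TYPE('n) m \<alpha> > 0" "subexp (\<lambda>m. c_coeff TYPE('n) m \<alpha>)" "subexp (\<lambda>m. 1 / c_coeff TYPE('n) m \<alpha>)"
proof -
  let ?N = "CARD('n)"
  define V where "V = vol_const TYPE('n) \<alpha>"
  have V: "V > 0" unfolding V_def vol_const_def using \<alpha>
    by (auto intro!: divide_pos_pos mult_pos_pos Gamma_real_pos add_pos_nonneg simp: add.assoc add_pos_pos)
  let ?g = "\<lambda>m r. r ^ (2 * m + ?N - 1) * (1 - r\<^sup>2) powr \<alpha> * (S_fun TYPE('n) m r)\<^sup>2"
  define J where "J m = (LBINT r:{0..1}. ?g m r)" for m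
  have c: "c_coeff TYPE('n) m \<alpha> = V / (real ?N * J m)" for m
    using \<alpha> by (simp add: c_coeff_def V_def J_def)
  define C where "C = (LBINT r:{0..1}. r * (1 - r\<^sup>2) powr \<alpha>)"
  have pw: "r ^ (2 * m + ?N - 1) = r ^ (?N - 2) * r * (r ^ m)\<^sup>2" for r :: real and m
  proof -
    have "2 * m + ?N - 1 = (?N - 2) + 1 + m * 2" using n by simp
    then show ?thesis by (simp only: power_add power_mult power_one_right)
  qed
  have up: "0 \<le> ?g m r" "?g m r \<le> r * (1 - r\<^sup>2) powr \<alpha>" if r: "0 \<le> r" "r \<le> 1" for m r
  proof -
    have "?g m r = r ^ (?N - 2) * (r * (1 - r\<^sup>2) powr \<alpha>) * (r ^ m * S_fun TYPE('n) m r)\<^sup>2"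
      unfolding pw by (simp add: power_mult_distrib mult_ac)
    also have "\<dots> \<le> 1 * (r * (1 - r\<^sup>2) powr \<alpha>) * 1"
      using r radw_quotient[OF n r, of m] by (intro mult_mono) (auto simp: power_le_one)
    finally show "?g m r \<le> r * (1 - r\<^sup>2) powr \<alpha>" by simp
    show "0 \<le> ?g m r" using r by (intro mult_nonneg_nonneg) auto
  qed
  have int: "integrable lborel (\<lambda>r. indicator {0..1} r *\<^sub>R ?g m r)" for m
  proof (rule Bochner_Integration.integrable_bound[OF set_integrable_weight[OF \<alpha>]])
    have "continuous_on {0..1} (\<lambda>r. (S_fun TYPE('n) m r)\<^sup>2)"
      unfolding S_fun_eq using hypF_pos[OF n, of 1 m]
      by (intro continuous_intros continuous_on_compose2[OF continuous_on_hypF[OF n]])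
        (auto simp: power_le_one neg_1_le_power2)
    from borel_measurable_continuous_on_indicator[OF _ this]
    have [measurable]: "(\<lambda>r. indicator {0..1} r *\<^sub>R (S_fun TYPE('n) m r)\<^sup>2) \<in> borel_measurable borel" by simp
    have "(\<lambda>r. (r ^ (2 * m + ?N - 1) * (1 - r\<^sup>2) powr \<alpha>) * (indicator {0..1} r *\<^sub>R (S_fun TYPE('n) m r)\<^sup>2)) \<in> borel_measurable lborel"
      by measurable
    then show "(\<lambda>r. indicator {0..1} r *\<^sub>R ?g m r) \<in> borel_measurable lborel"
      by (simp add: mult_ac)
    show "AE r in lborel. norm (indicator {0..1} r *\<^sub>R ?g m r) \<le> norm (indicator {0..1} r *\<^sub>R (r * (1 - r\<^sup>2) powr \<alpha>) :: real)"
    proof (rule AE_I2)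
      fix r :: real
      show "norm (indicator {0..1} r *\<^sub>R ?g m r) \<le> norm (indicator {0..1} r *\<^sub>R (r * (1 - r\<^sup>2) powr \<alpha>) :: real)"
      proof (cases "0 \<le> r \<and> r \<le> 1")
        case True
        then show ?thesis using up[of r m] by (simp add: abs_of_nonneg)
      qed (auto simp: indicator_def)
    qed
  qed
  have JC: "J m \<le> C" for m
    unfolding J_def C_def set_lebesgue_integral_def
    by (rule integral_mono[OF int set_integrable_weight[OF \<alpha>]]) (use up in \<open>auto simp: indicator_def\<close>)
  \<comment> \<open>Only the part of the integral over \<open>[\<rho>, \<sigma>]\<close> is kept:
    this interval stays away from \<open>1\<close>, so the weight has a positive minimum there
    whatever the sign of \<alpha>.\<close>
  have Jlow: "\<exists>d>0. \<forall>m. d * \<rho> ^ (2 * m) \<le> J m" if \<rho>: "0 < \<rho>" "\<rho> < 1" for \<rho>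
  proof -
    define \<sigma> where "\<sigma> = (1 + \<rho>) / 2"
    have \<sigma>: "\<rho> < \<sigma>" "\<sigma> < 1" using \<rho> by (auto simp: \<sigma>_def)
    have pos: "1 - r\<^sup>2 > 0" if "r \<in> {\<rho>..\<sigma>}" for r using sq_less_1[of r] that \<rho> \<sigma> by auto
    have "continuous_on {\<rho>..\<sigma>} (\<lambda>r. (1 - r\<^sup>2) powr \<alpha>)"
      using pos by (intro continuous_intros) fastforce
    from continuous_attains_inf[OF compact_Icc _ this] \<sigma>
    obtain r0 where r0: "r0 \<in> {\<rho>..\<sigma>}" "\<And>r. r \<in> {\<rho>..\<sigma>} \<Longrightarrow> (1 - r0\<^sup>2) powr \<alpha> \<le> (1 - r\<^sup>2) powr \<alpha>"
      by (auto simp: less_imp_le)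
    define w where "w = (1 - r0\<^sup>2) powr \<alpha>"
    have w: "w > 0" using pos[OF r0(1)] by (simp add: w_def)
    define d where "d = \<rho> ^ (?N - 1) * w * (\<sigma> - \<rho>)"
    have d: "d > 0" using \<rho> \<sigma> w by (simp add: d_def)
    have "d * \<rho> ^ (2 * m) \<le> J m" for m
    proof -
      have e: "2 * m + ?N - 1 = 2 * m + (?N - 1)" using n by simp
      let ?c = "\<rho> ^ (2 * m + ?N - 1) * w"
      have "d * \<rho> ^ (2 * m) = ?c * (\<sigma> - \<rho>)" unfolding e power_add by (simp add: d_def mult_ac)
      also have "\<dots> = (\<integral>r. indicator {\<rho>..\<sigma>} r *\<^sub>R ?c \<partial>lborel)" using \<sigma> by simp
      also have "\<dots> \<le> (\<integral>r. indicator {0..1} r *\<^sub>R ?g m r \<partial>lborel)"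
      proof (rule integral_mono[OF _ int])
        show "integrable lborel (\<lambda>r. indicator {\<rho>..\<sigma>} r *\<^sub>R ?c)"
          by (intro integrable_scaleR_left integrable_real_indicator) (auto simp: emeasure_lborel_Icc_eq)
        fix r :: real
        show "indicator {\<rho>..\<sigma>} r *\<^sub>R ?c \<le> indicator {0..1} r *\<^sub>R ?g m r"
        proof (cases "r \<in> {\<rho>..\<sigma>}")
          case True
          then have r: "0 \<le> r" "r \<le> 1" using \<rho> \<sigma> by auto
          have "?c * 1 \<le> r ^ (2 * m + ?N - 1) * (1 - r\<^sup>2) powr \<alpha> * (S_fun TYPE('n) m r)\<^sup>2"
            using True \<rho> r w r0(2)[OF True] radw_quotient(3)[OF n r, of m]
            by (intro mult_mono power_mono) (auto simp: w_def)
          then show ?thesis using True r by simp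
        next
          case False
          then show ?thesis using up(1)[of r m] by (auto simp: indicator_def)
        qed
      qed
      finally show ?thesis by (simp add: J_def set_lebesgue_integral_def)
    qed
    with d show ?thesis by blast
  qed
  have J: "J m > 0" for m
    using Jlow[of "1/2"] by (auto intro: less_le_trans[rotated])
  show pos: "c_coeff TYPE('n) m \<alpha> > 0" for m using V J[of m] n by (simp add: c)
  show "subexp (\<lambda>m. 1 / c_coeff TYPE('n) m \<alpha>)"
  proof (rule subexp_mono[OF subexp_const[of "real ?N * C / V"]])
    show "\<bar>1 / c_coeff TYPE('n) m \<alpha>\<bar> \<le> \<bar>real ?N * C / V\<bar>" for m
      using JC[of m] J[of m] V unfolding c by (simp add: divide_right_mono mult_left_mono)
  qed
  show "subexp (\<lambda>m. c_coeff TYPE('n) m \<alpha>)"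
    unfolding subexp_def
  proof safe
    fix r :: real assume r: "0 < r" "r < 1"
    \<comment> \<open>The lower bound contains the exponent \<open>2 m\<close>, hence \<rho> is the
      square root of \<open>r\<close>.\<close>
    obtain d where d: "d > 0" "\<And>m. d * sqrt r ^ (2 * m) \<le> J m" using Jlow[of "sqrt r"] r by auto
    have "\<bar>c_coeff TYPE('n) m \<alpha>\<bar> * r ^ m \<le> V / (real ?N * d)" for m
    proof -
      have "d * r ^ m \<le> J m" using d(2)[of m] r by (simp add: power_mult)
      then have "V * (r ^ m * d) \<le> V * J m" using V by (simp add: mult.commute)
      then show ?thesis using V J[of m] n d pos[of m] unfolding c by (simp add: field_simps)
    qed
    then show "\<exists>C. \<forall>m. \<bar>c_coeff TYPE('n) m \<alpha>\<bar> * r ^ m \<le> C" by blast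
  qed
qed

lemma c_coeff_subexp:
  assumes n: "CARD('n::finite) \<ge> 2"
  shows "c_coeff TYPE('n) m \<alpha> > 0" "subexp (\<lambda>m. c_coeff TYPE('n) m \<alpha>)" "subexp (\<lambda>m. 1 / c_coeff TYPE('n) m \<alpha>)"
  using c_coeff_small[of \<alpha> "TYPE('n)"] c_coeff_large[OF n, of \<alpha>] by (cases "\<alpha> > -1"; auto)+

section \<open>Bounds for point evaluations\<close>

lemma continuous_on_series:
  fixes G :: "nat \<Rightarrow> real ^ 'n::finite \<Rightarrow> complex"
  assumes n: "CARD('n) \<ge> 2" and G: "admissible G"
    and g: "\<And>x. x \<in> ball 0 1 \<Longrightarrow> (\<lambda>m. hterm G m x) sums g x"
  shows "continuous_on (ball 0 1) g"
  using series_differentiable(1)[OF n G g]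
  by (intro continuous_at_imp_continuous_on ballI differentiable_imp_continuous_within) auto

text \<open>\<open>g\<close> is paired with \<open>cnj (G k)\<close> and one factor
  \<open>l2 (G k)\<close> is cancelled. Estimating the harmonic factor in the sup norm leaves the
  \<open>L\<^sup>1\<close> mean of \<open>g\<close>, which is what permits every
  \<open>p \<ge> 1\<close>.\<close>

lemma coefficient_bound:
  fixes G :: "nat \<Rightarrow> real ^ 'n::finite \<Rightarrow> complex"
  assumes n: "CARD('n) \<ge> 2" and G: "admissible G" and r: "0 < r" "r < 1"
    and g: "\<And>x. x \<in> ball 0 1 \<Longrightarrow> (\<lambda>m. hterm G m x) sums g x"
    and B: "\<And>z. z \<in> sphere 0 1 \<Longrightarrow> norm (G k z) \<le> B * l2 (G k)" and B0: "B \<ge> 0"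
  shows "radw CARD('n) k r * l2 (G k) \<le> B * (\<integral>z. norm (g (r *\<^sub>R z)) \<partial>sphm)"
proof (cases "l2 (G k) = 0")
  case True
  then show ?thesis using B0 by (simp add: mult_nonneg_nonneg)
next
  case False
  note H = admissibleD(1)[OF G, of k]
  have cH: "(\<lambda>z. cnj (G k z)) \<in> harmonic_poly k" using H by auto
  have r': "0 \<le> r" using r by simp
  note S = ip_series[OF n G r' r(2) g cH]
  have "radw CARD('n) k r * (l2 (G k))\<^sup>2 = norm (radw CARD('n) k r *\<^sub>R ip (G k) (\<lambda>z. cnj (G k z)))"
    using radw_pos[OF n r(1), of k] r
    by (simp add: ip_cnj_self[OF harmonic_continuous[OF H]] norm_mult del: of_real_power)
  also have "\<dots> = norm (ip (\<lambda>z. g (r *\<^sub>R z)) (\<lambda>z. cnj (G k z)))" by (simp only: S(1))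
  also have "\<dots> \<le> (B * l2 (G k)) * (\<integral>z. norm (g (r *\<^sub>R z)) \<partial>sphm)"
    by (rule norm_ip_le[OF S(2) harmonic_continuous[OF cH]]) (use B in auto)
  finally have "(radw CARD('n) k r * l2 (G k)) * l2 (G k) \<le> (B * (\<integral>z. norm (g (r *\<^sub>R z)) \<partial>sphm)) * l2 (G k)"
    by (simp add: power2_eq_square mult_ac)
  moreover have "l2 (G k) > 0" using False l2_nonneg[of "G k"] by linarith
  ultimately show ?thesis by (rule mult_right_le_imp_le)
qed

section \<open>From spherical means to weighted \<open>L\<^sup>p\<close> norms\<close>

lemma sets_nu_weighted: "sets (nu_weighted \<beta> :: (real ^ 'n::finite) measure) = sets (lebesgue_on (ball 0 1))"
  by (simp add: nu_weighted_def nu_def)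

text \<open>\<open>nu_weighted\<close> is a density over a normalized restriction of the completed
  Lebesgue measure; here the layers are merged into one integral that can be compared with
  \<open>lborel\<close>.\<close>

lemma nn_integral_nu_weighted:
  fixes u :: "real ^ 'n::finite \<Rightarrow> ennreal"
  assumes u: "u \<in> borel_measurable (nu_weighted \<beta>)"
  shows "(\<integral>\<^sup>+x. u x \<partial>nu_weighted \<beta>) = (\<integral>\<^sup>+x. ennreal (1 / vol_const TYPE('n) \<beta> * (1 - (norm x)\<^sup>2) powr \<beta>) * u x * indicator (ball 0 1) x \<partial>lebesgue)
     / emeasure lborel (ball (0::real^'n) 1)"
proof -
  let ?L = "lebesgue_on (ball (0::real^'n) 1)"
  let ?w = "\<lambda>x::real^'n. ennreal (1 / vol_const TYPE('n) \<beta> * (1 - (norm x)\<^sup>2) powr \<beta>)"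
  have w0: "?w \<in> borel_measurable borel" by measurable
  then have "?w \<in> borel_measurable lebesgue" by (intro measurable_completion) simp
  then have wL: "?w \<in> borel_measurable ?L" by (rule measurable_restrict_space1)
  then have w: "?w \<in> borel_measurable nu" by (simp add: nu_def measurable_def)
  have uL: "u \<in> borel_measurable ?L" using u unfolding measurable_cong_sets[OF sets_nu_weighted refl] .
  then have un: "u \<in> borel_measurable nu" by (simp add: nu_def measurable_def)
  have em: "emeasure ?L (ball 0 1) = emeasure lborel (ball (0::real^'n) 1)"
    by (simp add: emeasure_restrict_space)
  have "(\<integral>\<^sup>+x. u x \<partial>nu_weighted \<beta>) = (\<integral>\<^sup>+x. ?w x * u x \<partial>nu)"
    unfolding nu_weighted_def by (rule nn_integral_density[OF w un])
  also have "\<dots> = (\<integral>\<^sup>+x. ?w x * u x * indicator (ball 0 1) x \<partial>?L) / emeasure ?L (ball 0 1)"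
    unfolding nu_def by (rule nn_integral_uniform_measure) (use wL uL in \<open>auto simp: sets_restrict_space\<close>)
  also have "(\<integral>\<^sup>+x. ?w x * u x * indicator (ball 0 1) x \<partial>?L) = (\<integral>\<^sup>+x. (?w x * u x * indicator (ball 0 1) x) * indicator (ball 0 1) x \<partial>lebesgue)"
    by (rule nn_integral_restrict_space) simp
  finally show ?thesis unfolding em by (simp add: mult.assoc flip: indicator_inter_arith)
qed

text \<open>If \<open>u > \<tau>\<close>, then \<open>u = u powr p * u powr (1 - p)\<close> and the
  last factor is at most \<open>\<tau> powr (1 - p)\<close>. Integrated, with \<tau> close to the
  \<open>L\<^sup>p\<close> norm, this does the work of Hoelder's inequality.\<close>

lemma le_add_powr:
  fixes u \<tau> p :: real
  assumes "u \<ge> 0" "\<tau> > 0" "p \<ge> 1"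
  shows "u \<le> \<tau> + u powr p * \<tau> powr (1 - p)"
proof (cases "u \<le> \<tau>")
  case False
  then have u: "u > 0" using assms by linarith
  have "u powr p * \<tau> powr (1 - p) = u * (u / \<tau>) powr (p - 1)"
    using u assms(2) by (simp add: powr_divide powr_diff field_simps)
  moreover have "(u / \<tau>) powr (p - 1) \<ge> 1" using False assms by (intro ge_one_powr_ge_zero) auto
  then have "u * 1 \<le> u * (u / \<tau>) powr (p - 1)" using u by (intro mult_left_mono) auto
  ultimately show ?thesis using assms by simp
qed (use assms in \<open>simp add: add_increasing2\<close>)

text \<open>In polar coordinates the common lower bound \<open>c\<close> for the spherical means
  integrates to \<open>D * c\<close>. From above, the integral of \<open>h\<close> over the annulus
  is at most a multiple of its \<open>L\<^sup>p\<close> norm, as the weight is bounded below by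
  \<open>w0\<close> there. \<open>K\<close> depends neither on \<open>h\<close> nor on
  \<open>c\<close>, so it can serve all degrees.\<close>

lemma annulus_bound:
  assumes n: "CARD('n::finite) \<ge> 2" and ab: "0 < a" "a < b" "b < 1" and p: "1 \<le> p" and \<beta>: "\<beta> > -1"
  shows "\<exists>K>0. \<forall>(h :: real ^ 'n \<Rightarrow> complex) c. continuous_on (ball 0 1) h \<longrightarrow> h \<in> Lp p \<beta> \<longrightarrow> c \<ge> 0 \<longrightarrow>
    (\<forall>r. a < r \<longrightarrow> r < b \<longrightarrow> c \<le> (\<integral>z. norm (h (r *\<^sub>R z)) \<partial>sphm)) \<longrightarrow>
    c \<le> K * (\<integral>x. norm (h x) powr p \<partial>nu_weighted \<beta>) powr (1 / p)"
proof -
  let ?N = "CARD('n)"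
  define V where "V = enn2real (emeasure lborel (ball (0::real^'n) 1))"
  have VK: "emeasure lborel (ball (0::real^'n) 1) = ennreal V" and V: "V > 0"
    using emeasure_lborel_unit_ball[where 'a="real^'n"]
    by (auto simp: V_def enn2real_positive_iff less_top zero_less_iff_neq_zero)
  let ?A = "{x::real^'n. a < norm x \<and> norm x < b}"
  have openA: "open ?A" by (intro open_Collect_conj open_Collect_less continuous_intros)
  have Am: "?A \<in> sets borel" by (rule borel_open[OF openA])
  have AB: "?A \<subseteq> ball 0 1" using ab by auto
  define vc where "vc = vol_const TYPE('n) \<beta>"
  have vc: "vc > 0" unfolding vc_def vol_const_def using \<beta>
    by (auto intro!: divide_pos_pos mult_pos_pos Gamma_real_pos add_pos_nonneg simp: add.assoc add_pos_pos)
  let ?w = "\<lambda>x::real^'n. 1 / vc * (1 - (norm x)\<^sup>2) powr \<beta>"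
  have "\<exists>w0>0. \<forall>x\<in>?A. w0 \<le> ?w x"
  proof -
    have pos: "1 - t\<^sup>2 > 0" if "t \<in> {a..b}" for t using sq_less_1[of t] that ab by auto
    have "continuous_on {a..b} (\<lambda>t. (1 - t\<^sup>2) powr \<beta>)"
      using pos by (intro continuous_intros) fastforce
    from continuous_attains_inf[OF compact_Icc _ this] ab
    obtain t0 where t0: "t0 \<in> {a..b}" "\<And>t. t \<in> {a..b} \<Longrightarrow> (1 - t0\<^sup>2) powr \<beta> \<le> (1 - t\<^sup>2) powr \<beta>"
      by (auto simp: less_imp_le)
    show ?thesis
      using pos[OF t0(1)] vc t0(2)
      by (intro exI[of _ "1 / vc * (1 - t0\<^sup>2) powr \<beta>"] conjI ballI mult_left_mono) auto
  qed
  then obtain w0 where w0: "w0 > 0" "\<And>x. x \<in> ?A \<Longrightarrow> w0 \<le> ?w x" by auto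
  define D where "D = real ?N * V * (a ^ (?N - 1) * (b - a))"
  have D: "D > 0" using ab V by (simp add: D_def)
  define K where "K = (V + V / w0) / D"
  have K: "K > 0" using V w0 D by (simp add: K_def add_pos_pos)
  have "c \<le> K * (\<integral>x. norm (h x) powr p \<partial>nu_weighted \<beta>) powr (1 / p)"
    if h: "continuous_on (ball 0 1) h" and Lp: "h \<in> Lp p \<beta>" and c: "c \<ge> 0"
      and mean: "\<And>r. a < r \<Longrightarrow> r < b \<Longrightarrow> c \<le> (\<integral>z. norm (h (r *\<^sub>R z)) \<partial>sphm)"
    for h :: "real ^ 'n \<Rightarrow> complex" and c
  proof -
    define I where "I = (\<integral>x. norm (h x) powr p \<partial>nu_weighted \<beta>)"
    have I0: "I \<ge> 0" by (simp add: I_def)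
    define L where "L = I powr (1 / p)"
    have L0: "L \<ge> 0" by (simp add: L_def)
    have LI: "L powr p = I" using I0 p by (cases "I = 0") (auto simp: L_def powr_powr)
    \<comment> \<open>Membership in \<open>Lp\<close> yields measurability for the completed measure
      only; continuity on the open annulus makes the truncated function Borel, as the polar formula
      requires.\<close>
    let ?hA = "\<lambda>x. indicator ?A x *\<^sub>R h x"
    have hA[measurable]: "?hA \<in> borel_measurable borel"
      by (rule borel_measurable_continuous_on_indicator) (use openA continuous_on_subset[OF h AB] in auto)
    have nhA: "norm (?hA x) = indicator ?A x * norm (h x)" for x by (auto simp: indicator_def)
    have h': "h \<in> borel_measurable (nu_weighted \<beta>)" and hi: "integrable (nu_weighted \<beta>) (\<lambda>x. norm (h x) powr p)"
      using Lp by (auto simp: Lp_def)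
    have hp: "(\<lambda>x. ennreal (norm (h x) powr p)) \<in> borel_measurable (nu_weighted \<beta>)" using h' by measurable
    have low: "ennreal (D * c) \<le> (\<integral>\<^sup>+x. ennreal (norm (?hA x)) \<partial>lborel)"
    proof -
      have in_mean: "indicator {a<..<b} r * ennreal (a ^ (?N - 1) * c)
          \<le> indicator {0<..} r * (ennreal (r ^ (?N - 1)) * (\<integral>\<^sup>+z. ennreal (norm (?hA (r *\<^sub>R z))) \<partial>sphm))" for r
      proof (cases "a < r \<and> r < b")
        case True
        have sub: "r *\<^sub>R z \<in> ?A" if "z \<in> sphere 0 1" for z :: "real^'n" using that True ab by auto
        have hc: "continuous_on (sphere 0 1) (\<lambda>z. norm (h (r *\<^sub>R z)))"
          by (intro continuous_intros continuous_on_compose2[OF h]) (use sub AB in blast)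
        have "(\<integral>\<^sup>+z. ennreal (norm (?hA (r *\<^sub>R z))) \<partial>sphm) = (\<integral>\<^sup>+z. ennreal (norm (h (r *\<^sub>R z))) \<partial>sphm)"
          using sub by (intro nn_integral_cong) (simp add: indicator_def)
        also have "\<dots> = ennreal (\<integral>z. norm (h (r *\<^sub>R z)) \<partial>sphm)"
          by (rule nn_integral_sphm_continuous[OF hc]) simp
        finally have "ennreal c \<le> (\<integral>\<^sup>+z. ennreal (norm (?hA (r *\<^sub>R z))) \<partial>sphm)"
          using mean[of r] True by (simp add: ennreal_leI)
        then have "ennreal (a ^ (?N - 1)) * ennreal c \<le> ennreal (r ^ (?N - 1)) * (\<integral>\<^sup>+z. ennreal (norm (?hA (r *\<^sub>R z))) \<partial>sphm)"
          using True ab by (intro mult_mono ennreal_leI power_mono) auto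
        then show ?thesis using True ab c by (simp add: ennreal_mult)
      qed (auto simp: indicator_def)
      have "ennreal (D * c) = ennreal (real ?N * V) * (ennreal (a ^ (?N - 1) * c) * ennreal (b - a))"
        using ab V c by (simp add: D_def ennreal_mult[symmetric] mult_ac)
      also have "\<dots> = of_nat ?N * ennreal V * (\<integral>\<^sup>+r. indicator {a<..<b} r * ennreal (a ^ (?N - 1) * c) \<partial>lborel)"
        using ab V by (simp add: nn_integral_multc ennreal_mult ennreal_of_nat_eq_real_of_nat mult_ac)
      also have "\<dots> \<le> of_nat ?N * ennreal V *
         (\<integral>\<^sup>+r. indicator {0<..} r * (ennreal (r ^ (?N - 1)) * (\<integral>\<^sup>+z. ennreal (norm (?hA (r *\<^sub>R z))) \<partial>sphm)) \<partial>lborel)"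
        by (rule mult_left_mono[OF nn_integral_mono[OF in_mean]]) simp
      also have "\<dots> = (\<integral>\<^sup>+x. ennreal (norm (?hA x)) \<partial>lborel)"
        unfolding VK[symmetric] by (rule nn_integral_polar[symmetric]) measurable
      finally show ?thesis .
    qed
    have pint: "(\<integral>\<^sup>+x. indicator ?A x * ennreal (norm (?hA x) powr p) \<partial>lborel) \<le> ennreal (V / w0 * I)"
    proof -
      let ?u = "\<lambda>x. ennreal (norm (h x) powr p)"
      let ?S = "\<integral>\<^sup>+x. ennreal (?w x) * ?u x * indicator (ball 0 1) x \<partial>lebesgue"
      have "ennreal I = (\<integral>\<^sup>+x. ?u x \<partial>nu_weighted \<beta>)"
        unfolding I_def by (rule nn_integral_eq_integral[OF hi, symmetric]) simp
      also have "\<dots> = ?S / ennreal V"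
        unfolding VK[symmetric] vc_def by (rule nn_integral_nu_weighted[OF hp])
      finally have S: "?S = ennreal (V * I)"
        using V I0 by (simp add: ennreal_mult mult.commute[of "ennreal V"] ennreal_divide_times)
      have "ennreal w0 * (\<integral>\<^sup>+x. indicator ?A x * ennreal (norm (?hA x) powr p) \<partial>lborel)
          = (\<integral>\<^sup>+x. ennreal w0 * (indicator ?A x * ennreal (norm (?hA x) powr p)) \<partial>lborel)"
        using openA by (intro nn_integral_cmult[symmetric]) measurable
      also have "\<dots> = (\<integral>\<^sup>+x. ennreal w0 * (indicator ?A x * ennreal (norm (?hA x) powr p)) \<partial>lebesgue)"
        using openA by (intro nn_integral_completion[symmetric]) measurable
      also have "\<dots> \<le> ?S"
      proof (rule nn_integral_mono)
        fix x :: "real^'n"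
        show "ennreal w0 * (indicator ?A x * ennreal (norm (?hA x) powr p)) \<le> ennreal (?w x) * ?u x * indicator (ball 0 1) x"
        proof (cases "x \<in> ?A")
          case True
          then have "x \<in> ball 0 1" using AB by blast
          then show ?thesis using True w0(2)[OF True] by (auto intro!: mult_right_mono ennreal_leI)
        qed simp
      qed
      finally have "ennreal w0 * (\<integral>\<^sup>+x. indicator ?A x * ennreal (norm (?hA x) powr p) \<partial>lborel) \<le> ennreal w0 * ennreal (V / w0 * I)"
        unfolding S using w0 V I0 by (simp add: ennreal_mult[symmetric])
      then show ?thesis using w0 by (subst (asm) ennreal_mult_le_mult_iff) auto
    qed
    have up: "D * c \<le> \<tau> * (V + V / w0)" if \<tau>: "\<tau> > 0" "\<tau> \<ge> L" for \<tau>
    proof -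
      have cm: "(\<integral>\<^sup>+x. ennreal (\<tau> powr (1 - p)) * (indicator ?A x * ennreal (norm (?hA x) powr p)) \<partial>lborel)
          = ennreal (\<tau> powr (1 - p)) * (\<integral>\<^sup>+x. indicator ?A x * ennreal (norm (?hA x) powr p) \<partial>lborel)"
        using Am by (intro nn_integral_cmult) measurable
      have "(\<integral>\<^sup>+x. ennreal (norm (?hA x)) \<partial>lborel)
          \<le> (\<integral>\<^sup>+x. indicator ?A x * ennreal \<tau> + ennreal (\<tau> powr (1 - p)) * (indicator ?A x * ennreal (norm (?hA x) powr p)) \<partial>lborel)"
      proof (rule nn_integral_mono)
        fix x :: "real^'n"
        show "ennreal (norm (?hA x)) \<le> indicator ?A x * ennreal \<tau> + ennreal (\<tau> powr (1 - p)) * (indicator ?A x * ennreal (norm (?hA x) powr p))"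
        proof (cases "x \<in> ?A")
          case True
          have "ennreal (norm (h x)) \<le> ennreal (\<tau> + norm (h x) powr p * \<tau> powr (1 - p))"
            by (rule ennreal_leI[OF le_add_powr]) (use \<tau> p in auto)
          then show ?thesis using True \<tau> by (simp add: ennreal_plus ennreal_mult mult.commute)
        qed simp
      qed
      also have "\<dots> = (\<integral>\<^sup>+x. indicator ?A x * ennreal \<tau> \<partial>lborel) + (\<integral>\<^sup>+x. ennreal (\<tau> powr (1 - p)) * (indicator ?A x * ennreal (norm (?hA x) powr p)) \<partial>lborel)"
        using Am by (intro nn_integral_add) measurable
      also note cm
      also have "(\<integral>\<^sup>+x. indicator ?A x * ennreal \<tau> \<partial>lborel) + ennreal (\<tau> powr (1 - p)) * (\<integral>\<^sup>+x. indicator ?A x * ennreal (norm (?hA x) powr p) \<partial>lborel)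
          \<le> ennreal (V * \<tau>) + ennreal (\<tau> powr (1 - p)) * ennreal (V / w0 * I)"
      proof (rule add_mono[OF _ mult_left_mono[OF pint]])
        have "emeasure lborel ?A \<le> ennreal V"
          unfolding VK[symmetric] using openA AB by (intro emeasure_mono) auto
        then show "(\<integral>\<^sup>+x. indicator ?A x * ennreal \<tau> \<partial>lborel) \<le> ennreal (V * \<tau>)"
          using openA V \<tau> by (simp add: nn_integral_multc ennreal_mult mult_right_mono)
      qed auto
      also have "\<dots> = ennreal (V * \<tau> + \<tau> powr (1 - p) * (V / w0 * I))"
        using V \<tau> w0 I0 by (simp add: ennreal_mult[symmetric] ennreal_plus[symmetric] del: ennreal_plus)
      finally have "ennreal (D * c) \<le> ennreal (V * \<tau> + \<tau> powr (1 - p) * (V / w0 * I))" using low by (rule order_trans[rotated])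
      then have "D * c \<le> V * \<tau> + \<tau> powr (1 - p) * (V / w0 * I)"
        using V \<tau> w0 I0 by (subst (asm) ennreal_le_iff) auto
      also have "\<tau> powr (1 - p) * I \<le> \<tau>"
      proof -
        have "I \<le> \<tau> powr p" using powr_mono2[of p L \<tau>] LI L0 \<tau> p by simp
        then have "\<tau> powr (1 - p) * I \<le> \<tau> powr (1 - p) * \<tau> powr p" by (intro mult_left_mono) auto
        also have "\<dots> = \<tau>" using \<tau> by (simp add: powr_add[symmetric])
        finally show ?thesis .
      qed
      then have "V * \<tau> + \<tau> powr (1 - p) * (V / w0 * I) \<le> V * \<tau> + V / w0 * \<tau>"
        using V w0 by (simp add: mult.left_commute[of "\<tau> powr (1 - p)"] divide_right_mono)
      finally show ?thesis by (simp add: algebra_simps)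
    qed
    have "c \<le> K * L"
    proof (rule field_le_epsilon)
      fix e :: real assume e: "e > 0"
      \<comment> \<open>\<open>L\<close> may be zero while \<open>up\<close> needs \<tau> > 0; the
        surplus \<open>e / K\<close> costs exactly \<open>e\<close> in the conclusion.\<close>
      define \<tau> where "\<tau> = L + e / K"
      have "D * c \<le> \<tau> * (V + V / w0)" by (rule up) (use e K L0 in \<open>auto simp: \<tau>_def add_nonneg_pos\<close>)
      then have "c \<le> \<tau> * K" using D by (simp add: K_def field_simps)
      then show "c \<le> K * L + e" using K by (simp add: \<tau>_def distrib_left mult.commute)
    qed
    then show ?thesis by (simp add: L_def I_def)
  qed
  with K show ?thesis by blast
qed

text \<open>\<rho> is produced here and not prescribed, because the constants in the coefficient
  bounds depend on it: it is fixed by the distance between \<open>norm x\<close> and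
  \<open>a\<close> before those bounds are invoked.\<close>

lemma evaluation_bound:
  assumes n: "CARD('n::finite) \<ge> 2" and x: "norm x < a" "a < 1" and \<delta>: "subexp \<delta>"
  shows "\<exists>\<rho>>0. \<exists>C>0. \<forall>G (f :: real ^ 'n \<Rightarrow> complex) M. admissible G \<longrightarrow> (\<lambda>m. hterm G m x) sums f x \<longrightarrow> M \<ge> 0 \<longrightarrow>
    (\<forall>k. l2 (G k) * a ^ k \<le> \<delta> k * (1 + \<rho>) ^ k * M) \<longrightarrow> norm (f x) \<le> C * M"
proof -
  \<comment> \<open>An intermediate radius, positive even when \<open>x\<close> is the
    origin.\<close>
  define r where "r = (norm x + a) / 2"
  have r: "0 < r" "norm x < r" "r < a" using x norm_ge_zero[of x] unfolding r_def by (auto simp del: norm_ge_zero)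
  have a: "a > 0" using r by linarith
  \<comment> \<open>The gain \<open>r / a\<close> is split into four equal factors: one pays for the
    sup bound of \<open>G k\<close>, one for the growth allowed in the hypothesis on
    \<open>l2 (G k)\<close>, one for \<delta>, and the last remains as the ratio of the geometric
    series.\<close>
  define q where "q = sqrt (sqrt (r / a))"
  have q: "0 < q" "q < 1" using r a by (auto simp: q_def)
  have q4: "r / a = q * q * q * q" using r a by (simp add: q_def mult.assoc)
  define \<rho> where "\<rho> = 1 / q - 1"
  have \<rho>: "\<rho> > 0" "1 + \<rho> = 1 / q" using q by (auto simp: \<rho>_def)
  obtain B where B: "B > 0" "\<And>m (u :: real ^ 'n \<Rightarrow> complex) y. u \<in> harmonic_poly m \<Longrightarrow> norm (u y) \<le> B * (1 + \<rho>) ^ m * norm y ^ m * l2 u"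
    using harmonic_sup_bound[OF n \<rho>(1)] by auto
  obtain A where A: "A \<ge> 0" "\<And>m. \<bar>\<delta> m\<bar> * q ^ m \<le> A" using subexpD[OF \<delta> q] by metis
  \<comment> \<open>The summand \<open>1\<close> keeps \<open>C\<close> positive when
    \<open>A\<close> is zero.\<close>
  define C where "C = B * A * (1 / (1 - q)) + 1"
  have C: "C > 0" using B A q by (simp add: C_def add_nonneg_pos)
  have "norm (f x) \<le> C * M" if G: "admissible G" and s: "(\<lambda>m. hterm G m x) sums f x" and M: "M \<ge> 0"
    and b: "\<And>k. l2 (G k) * a ^ k \<le> \<delta> k * (1 + \<rho>) ^ k * M" for G and f :: "real ^ 'n \<Rightarrow> complex" and M
  proof -
    have t: "norm (hterm G k x) \<le> (B * A * M) * q ^ k" for k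
    proof -
      have "norm (hterm G k x) \<le> norm (G k x)" using x by (intro norm_hterm_le[OF n]) auto
      also have "\<dots> \<le> B * (1 + \<rho>) ^ k * norm x ^ k * l2 (G k)" by (rule B(2)[OF admissibleD(1)[OF G]])
      also have "\<dots> \<le> B * (1 + \<rho>) ^ k * r ^ k * l2 (G k)"
        using B(1) \<rho>(1) r by (intro mult_right_mono mult_left_mono power_mono) auto
      also have "\<dots> = B * ((1 / q) * (r / a)) ^ k * (l2 (G k) * a ^ k)"
        unfolding \<rho>(2) using a by (simp add: power_mult_distrib power_divide)
      also have "\<dots> \<le> B * ((1 / q) * (r / a)) ^ k * (\<delta> k * (1 + \<rho>) ^ k * M)"
        using b[of k] B(1) q r a by (intro mult_left_mono) auto
      also have "\<dots> \<le> B * ((1 / q) * (r / a)) ^ k * (\<bar>\<delta> k\<bar> * (1 + \<rho>) ^ k * M)"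
        using B(1) q r a M \<rho> by (intro mult_left_mono mult_right_mono) auto
      also have "\<dots> = (B * M) * (\<bar>\<delta> k\<bar> * ((1 / q) * (r / a) * (1 / q)) ^ k)"
        unfolding \<rho>(2) power_mult_distrib by (simp only: mult_ac)
      also have "(1 / q) * (r / a) * (1 / q) = q * q" unfolding q4 using q by simp
      also have "\<bar>\<delta> k\<bar> * (q * q) ^ k = \<bar>\<delta> k\<bar> * q ^ k * q ^ k" by (simp add: power_mult_distrib)
      also have "(B * M) * (\<bar>\<delta> k\<bar> * q ^ k * q ^ k) \<le> (B * M) * (A * q ^ k)"
        using A(2)[of k] B(1) M q by (intro mult_left_mono mult_right_mono) auto
      finally show ?thesis by (simp add: mult_ac)
    qed
    have "norm (f x) \<le> (\<Sum>k. (B * A * M) * q ^ k)"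
      unfolding sums_unique[OF s] by (rule norm_suminf_le[OF t]) (use q in \<open>auto intro!: summable_mult summable_geometric\<close>)
    also have "\<dots> = (B * A * M) * (1 / (1 - q))"
      using q by (subst suminf_mult) (auto simp: suminf_geometric intro!: summable_geometric)
    also have "\<dots> \<le> C * M" using M by (simp add: C_def algebra_simps)
    finally show ?thesis .
  qed
  with C \<rho>(1) show ?thesis by blast
qed

text \<open>Since \<open>radw\<close> is nondecreasing, its value at \<open>a\<close> may replace
  the one at any \<open>r\<close> in the annulus; this gives a lower bound for the spherical means
  that is common to all these radii, as \<open>annulus_bound\<close> demands.\<close>

lemma coefficient_Lp_bound:
  assumes n: "CARD('n::finite) \<ge> 2" and a: "0 < a" "a < 1" and p: "1 \<le> p" and \<beta>: "\<beta> > -1" and \<rho>: "\<rho> > 0"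
  shows "\<exists>K>0. \<forall>G (g :: real ^ 'n \<Rightarrow> complex) k. admissible G \<longrightarrow> (\<forall>x\<in>ball 0 1. (\<lambda>m. hterm G m x) sums g x) \<longrightarrow>
    g \<in> Lp p \<beta> \<longrightarrow> l2 (G k) * a ^ k \<le> K * (1 + \<rho>) ^ k * (\<integral>x. norm (g x) powr p \<partial>nu_weighted \<beta>) powr (1 / p)"
proof -
  let ?N = "CARD('n)"
  define b where "b = (1 + a) / 2"
  have b: "a < b" "b < 1" using a by (auto simp: b_def)
  obtain K0 where K0: "K0 > 0" "\<And>(h :: real ^ 'n \<Rightarrow> complex) c. continuous_on (ball 0 1) h \<Longrightarrow> h \<in> Lp p \<beta> \<Longrightarrow> c \<ge> 0 \<Longrightarrow>
    (\<And>r. a < r \<Longrightarrow> r < b \<Longrightarrow> c \<le> (\<integral>z. norm (h (r *\<^sub>R z)) \<partial>sphm)) \<Longrightarrow>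
    c \<le> K0 * (\<integral>x. norm (h x) powr p \<partial>nu_weighted \<beta>) powr (1 / p)"
    using annulus_bound[OF n a(1) b p \<beta>] by blast
  obtain B where B: "B > 0" "\<And>m (u :: real ^ 'n \<Rightarrow> complex) y. u \<in> harmonic_poly m \<Longrightarrow> norm (u y) \<le> B * (1 + \<rho>) ^ m * norm y ^ m * l2 u"
    using harmonic_sup_bound[OF n \<rho>] by auto
  define d where "d = (1 - a\<^sup>2) ^ (?N - 2)"
  have a2: "0 \<le> a\<^sup>2" "a\<^sup>2 < 1" using sq_less_1[of a] a by auto
  have d: "d > 0" using a2 by (simp add: d_def)
  define K where "K = B * K0 / d"
  have K: "K > 0" using B K0 d by (simp add: K_def)
  have "l2 (G k) * a ^ k \<le> K * (1 + \<rho>) ^ k * (\<integral>x. norm (g x) powr p \<partial>nu_weighted \<beta>) powr (1 / p)"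
    if G: "admissible G" and s: "\<And>x. x \<in> ball 0 1 \<Longrightarrow> (\<lambda>m. hterm G m x) sums g x" and Lp: "g \<in> Lp p \<beta>"
    for G k and g :: "real ^ 'n \<Rightarrow> complex"
  proof -
    let ?L = "(\<integral>x. norm (g x) powr p \<partial>nu_weighted \<beta>) powr (1 / p)"
    let ?B = "B * (1 + \<rho>) ^ k"
    have B': "?B > 0" using B(1) \<rho> by simp
    define c where "c = radw ?N k a * l2 (G k) / ?B"
    have w: "radw ?N k a > 0" using a by (intro radw_pos[OF n]) auto
    have c0: "c \<ge> 0" using w B' by (simp add: c_def)
    have "c \<le> K0 * ?L"
    proof (rule K0(2)[OF continuous_on_series[OF n G s] Lp c0])
      fix r assume r: "a < r" "r < b"
      have r1: "0 < r" "r < 1" using r a b by auto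
      have "radw ?N k a * l2 (G k) \<le> radw ?N k r * l2 (G k)"
        using r r1 a by (intro mult_right_mono radw_mono_aux[OF n]) auto
      also have "\<dots> \<le> ?B * (\<integral>z. norm (g (r *\<^sub>R z)) \<partial>sphm)"
      proof (rule coefficient_bound[OF n G r1 s])
        show "norm (G k z) \<le> ?B * l2 (G k)" if "z \<in> sphere 0 1" for z
          using B(2)[OF admissibleD(1)[OF G], of k z] that by simp
      qed (use B' in auto)
      finally show "c \<le> (\<integral>z. norm (g (r *\<^sub>R z)) \<partial>sphm)"
        unfolding c_def using B' by (simp add: pos_divide_le_eq mult.commute)
    qed auto
    then have 1: "radw ?N k a * l2 (G k) \<le> K0 * ?L * ?B" unfolding c_def using B' by (simp only: pos_divide_le_eq)
    have "a ^ k * d \<le> radw ?N k a"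
      unfolding radw_def d_def using hypF_lower[OF n a2, of k] a by (intro mult_left_mono) auto
    then have "a ^ k * d * l2 (G k) \<le> K0 * ?L * ?B"
      using 1 by (meson l2_nonneg mult_right_mono order_trans)
    then have "(l2 (G k) * a ^ k) * d \<le> (B * K0) * (1 + \<rho>) ^ k * ?L" by (simp add: mult_ac)
    then have "l2 (G k) * a ^ k \<le> (B * K0) * (1 + \<rho>) ^ k * ?L / d" using d by (simp only: pos_le_divide_eq)
    then show ?thesis by (simp add: K_def)
  qed
  with K show ?thesis by blast
qed

text \<open>\<open>D_op s t\<close> multiplies the coefficient of degree \<open>m\<close> by
  \<open>\<gamma> m\<close>. Subexponential growth of \<gamma> makes the new family admissible, and
  that of \<open>1 / \<gamma>\<close> allows passing back from the coefficients of
  \<open>D_op s t f\<close> to those of \<open>f\<close>.\<close>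

lemma D_norm_bound:
  fixes x0 :: "real ^ 'n::finite"
  assumes n: "CARD('n) \<ge> 2" and p: "1 \<le> p" and \<beta>: "\<alpha> + p * t > -1" and x0: "x0 \<in> ball 0 1"
  shows "\<exists>C>0. \<forall>f\<in>hyp_harmonic. ennreal (norm (f x0)) \<le> ennreal C * D_norm p \<alpha> s t f"
proof -
  let ?c = "\<lambda>m. c_coeff TYPE('n) m"
  define \<gamma> where "\<gamma> m = ?c m (s + t) / ?c m s" for m
  have \<gamma>: "\<gamma> m > 0" for m unfolding \<gamma>_def by (intro divide_pos_pos c_coeff_subexp[OF n])
  have g1: "subexp \<gamma>"
    using subexp_mult[OF c_coeff_subexp(2)[OF n, of "s + t"] c_coeff_subexp(3)[OF n, of s]] by (simp add: \<gamma>_def[abs_def])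
  have g2: "subexp (\<lambda>m. 1 / \<gamma> m)"
    using subexp_mult[OF c_coeff_subexp(2)[OF n, of s] c_coeff_subexp(3)[OF n, of "s + t"]] by (simp add: \<gamma>_def[abs_def])
  define a where "a = (1 + norm x0) / 2"
  have a: "norm x0 < a" "a < 1" "0 < a" using x0 by (auto simp: a_def intro: add_pos_nonneg)
  obtain \<rho> C0 where \<rho>: "\<rho> > 0" and C0: "C0 > 0"
    "\<And>G (f :: real ^ 'n \<Rightarrow> complex) M. admissible G \<Longrightarrow> (\<lambda>m. hterm G m x0) sums f x0 \<Longrightarrow> M \<ge> 0 \<Longrightarrow>
      (\<And>k. l2 (G k) * a ^ k \<le> (1 / \<gamma> k) * (1 + \<rho>) ^ k * M) \<Longrightarrow> norm (f x0) \<le> C0 * M"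
    using evaluation_bound[OF n a(1,2) g2] by blast
  obtain K where K: "K > 0" "\<And>G (g :: real ^ 'n \<Rightarrow> complex) k. admissible G \<Longrightarrow> (\<And>x. x \<in> ball 0 1 \<Longrightarrow> (\<lambda>m. hterm G m x) sums g x) \<Longrightarrow>
    g \<in> Lp p (\<alpha> + p * t) \<Longrightarrow> l2 (G k) * a ^ k \<le> K * (1 + \<rho>) ^ k * (\<integral>x. norm (g x) powr p \<partial>nu_weighted (\<alpha> + p * t)) powr (1 / p)"
    using coefficient_Lp_bound[OF n a(3,2) p \<beta> \<rho>] by blast
  have "ennreal (norm (f x0)) \<le> ennreal (C0 * K) * D_norm p \<alpha> s t f" if f: "f \<in> hyp_harmonic" for f :: "real ^ 'n \<Rightarrow> complex"
  proof (cases "D_op s t f \<in> Lp p (\<alpha> + p * t)")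
    case False
    then show ?thesis using C0 K by (simp add: D_norm_def Lp_norm_def ennreal_mult_top)
  next
    case True
    obtain G where G: "admissible G" "\<And>x. x \<in> ball 0 1 \<Longrightarrow> (\<lambda>m. hterm G m x) sums f x"
      "\<And>m x. expansion_term f m x = hypF CARD('n) m 1 *\<^sub>R G m x"
      using expansion_term_props[OF n f] by metis
    let ?H = "\<lambda>m x. \<gamma> m *\<^sub>R G m x"
    have H: "admissible ?H" by (rule admissible_multiplier[OF n G(1) g1])
    have Hs: "(\<lambda>m. hterm ?H m x) sums D_op s t f x" if x: "x \<in> ball 0 1" for x
    proof -
      have "(?c m (s + t) / ?c m s * S_fun TYPE('n) m (norm x)) *\<^sub>R expansion_term f m x = hterm ?H m x" for m
        using hypF_pos[OF n, of 1 m] unfolding G(3) by (simp add: \<gamma>_def S_fun_eq hterm_def mult_ac)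
      then have eq: "D_op s t f x = (\<Sum>m. hterm ?H m x)" by (simp add: D_op_def)
      have "0 < (1 + norm x) / 2" "(1 + norm x) / 2 < 1" using x by (auto intro: add_pos_nonneg)
      from hterm_bound[OF n H this]
      obtain M where M: "summable M" "\<And>m y. norm y \<le> (1 + norm x) / 2 \<Longrightarrow> norm (hterm ?H m y) \<le> M m"
        by metis
      have "summable (\<lambda>m. hterm ?H m x)"
        by (rule summable_comparison_test'[OF M(1), of 0]) (use M(2)[of x] x in auto)
      then show ?thesis unfolding eq by (rule summable_sums)
    qed
    define L where "L = (\<integral>x. norm (D_op s t f x) powr p \<partial>nu_weighted (\<alpha> + p * t)) powr (1 / p)"
    have L0: "L \<ge> 0" by (simp add: L_def)
    have "norm (f x0) \<le> C0 * (K * L)"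
    proof (rule C0(2)[where G=G and f=f, OF G(1) G(2)[OF x0]])
      fix k
      have "\<gamma> k * (l2 (G k) * a ^ k) \<le> K * (1 + \<rho>) ^ k * L"
        using K(2)[OF H Hs True, of k] \<gamma>[of k] by (simp add: l2_scaleR L_def mult_ac)
      then have "l2 (G k) * a ^ k \<le> (K * (1 + \<rho>) ^ k * L) / \<gamma> k"
        using \<gamma>[of k] by (simp add: pos_le_divide_eq mult.commute)
      then show "l2 (G k) * a ^ k \<le> (1 / \<gamma> k) * (1 + \<rho>) ^ k * (K * L)" by (simp add: mult_ac)
    qed (use K L0 in auto)
    then have "ennreal (norm (f x0)) \<le> ennreal (C0 * K * L)" by (simp add: ennreal_leI mult.assoc)
    also have "\<dots> = ennreal (C0 * K) * ennreal L" using C0 K L0 by (intro ennreal_mult) auto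
    finally show ?thesis using True by (simp add: D_norm_def Lp_norm_def L_def)
  qed
  moreover have "C0 * K > 0" using C0(1) K(1) by simp
  ultimately show ?thesis by blast
qed

text \<open>The tangential operators of order \<open>k \<ge> 1\<close> annihilate constants, so
  degree zero is controlled by the summand \<open>norm (f 0)\<close>. In the other degrees the
  operator supplied by \<open>l2_le_tangential_ops\<close> varies with \<open>m\<close>; summing
  over all of \<open>tangential_ops k\<close> covers every choice.\<close>

lemma T_norm_bound:
  fixes x0 :: "(real, 'n::{finite,linorder}) vec"
  assumes n: "CARD('n) \<ge> 2" and p: "1 \<le> p" and \<beta>: "\<alpha> + p * real k > -1" and x0: "x0 \<in> ball 0 1"
  shows "\<exists>C>0. \<forall>f\<in>hyp_harmonic. ennreal (norm (f x0)) \<le> ennreal C * T_norm p \<alpha> k f"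
proof -
  let ?\<beta> = "\<alpha> + p * real k" and ?n = "real CARD('n)"
  define a where "a = (1 + norm x0) / 2"
  have a: "norm x0 < a" "a < 1" "0 < a" using x0 by (auto simp: a_def intro: add_pos_nonneg)
  obtain \<rho> C0 where \<rho>: "\<rho> > 0" and C0: "C0 > 0"
    "\<And>G (f :: (real, 'n) vec \<Rightarrow> complex) M. admissible G \<Longrightarrow> (\<lambda>m. hterm G m x0) sums f x0 \<Longrightarrow> M \<ge> 0 \<Longrightarrow>
      (\<And>m. l2 (G m) * a ^ m \<le> 1 * (1 + \<rho>) ^ m * M) \<Longrightarrow> norm (f x0) \<le> C0 * M"
    using evaluation_bound[OF n a(1,2) subexp_const[of 1]] by blast
  obtain K where K: "K > 0" "\<And>G (g :: (real, 'n) vec \<Rightarrow> complex) m. admissible G \<Longrightarrow> (\<And>x. x \<in> ball 0 1 \<Longrightarrow> (\<lambda>m. hterm G m x) sums g x) \<Longrightarrow>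
    g \<in> Lp p ?\<beta> \<Longrightarrow> l2 (G m) * a ^ m \<le> K * (1 + \<rho>) ^ m * (\<integral>x. norm (g x) powr p \<partial>nu_weighted ?\<beta>) powr (1 / p)"
    using coefficient_Lp_bound[OF n a(3,2) p \<beta> \<rho>] by blast
  \<comment> \<open>The summand \<open>1\<close> makes \<open>K' \<ge> 1\<close>, which is what
    degree zero uses.\<close>
  define K' where "K' = ?n ^ k * K + 1"
  have K': "K' \<ge> 1" "?n ^ k * K \<le> K'" using K(1) by (auto simp: K'_def)
  have "ennreal (norm (f x0)) \<le> ennreal (C0 * K') * T_norm p \<alpha> k f" if f: "f \<in> hyp_harmonic" for f :: "(real, 'n) vec \<Rightarrow> complex"
  proof (cases "\<forall>T\<in>tangential_ops k. T f \<in> Lp p ?\<beta>")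
    case False
    then obtain T where T: "T \<in> tangential_ops k" "T f \<notin> Lp p ?\<beta>" by auto
    have "(\<Sum>T\<in>tangential_ops k. Lp_norm p ?\<beta> (T f)) = \<infinity>"
    proof -
      have "Lp_norm p ?\<beta> (T f) \<le> (\<Sum>T\<in>tangential_ops k. Lp_norm p ?\<beta> (T f))"
        by (rule member_le_sum[OF T(1)]) (auto intro: finite_tangential_ops)
      then show ?thesis using T(2) by (simp add: Lp_norm_def top_unique)
    qed
    then show ?thesis using C0 K' by (simp add: T_norm_def ennreal_mult_top)
  next
    case True
    obtain G where G: "admissible G" "\<And>x. x \<in> ball 0 1 \<Longrightarrow> (\<lambda>m. hterm G m x) sums f x"
      using hyp_harmonic_expansion[OF n f] by metis
    define L where "L T = (\<integral>x. norm (T f x) powr p \<partial>nu_weighted ?\<beta>) powr (1 / p)" for T :: "((real, 'n) vec \<Rightarrow> complex) \<Rightarrow> (real, 'n) vec \<Rightarrow> complex"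
    have L0: "L T \<ge> 0" for T by (simp add: L_def)
    define M where "M = (\<Sum>T\<in>tangential_ops k. L T) + norm (f 0)"
    have M0: "M \<ge> 0" using L0 by (auto simp: M_def intro!: add_nonneg_nonneg sum_nonneg)
    have LM: "L T \<le> M" if "T \<in> tangential_ops k" for T
    proof -
      have "L T \<le> sum L (tangential_ops k)"
        by (rule member_le_sum[OF that]) (auto intro: L0 finite_tangential_ops)
      then show ?thesis by (simp add: M_def add_increasing2)
    qed
    have Mf: "norm (f 0) \<le> M" using L0 by (auto simp: M_def intro!: sum_nonneg)
    have "norm (f x0) \<le> C0 * (K' * M)"
    proof (rule C0(2)[where G=G and f=f, OF G(1) G(2)[OF x0]])
      fix m
      show "l2 (G m) * a ^ m \<le> 1 * (1 + \<rho>) ^ m * (K' * M)"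
      proof (cases "m = 0")
        case True
        \<comment> \<open>All terms of positive degree vanish at the origin, so the constant
          \<open>G 0\<close> is the value of \<open>f\<close> there.\<close>
        have G0: "G 0 z = f 0" for z
        proof -
          have "hterm G j 0 = (if j = 0 then G 0 0 else 0)" for j
            using harmonic_polyD(2)[OF admissibleD(1)[OF G(1)], of j 0 0]
            by (cases "j = 0") (simp_all add: hterm_def power_0_left)
          then have "(\<lambda>j. if j = 0 then G 0 0 else 0) sums f 0" using G(2)[of 0] by simp
          then have "f 0 = G 0 0" using sums_unique2[OF sums_single[of 0 "\<lambda>_. G 0 0"]] by fastforce
          then show ?thesis using harmonic_poly_0_const[OF admissibleD(1)[OF G(1), of 0], of z] by simp
        qed
        have "l2 (G 0) = norm (f 0)" by (simp add: l2_def G0)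
        also have "\<dots> \<le> 1 * M" using Mf by simp
        also have "\<dots> \<le> K' * M" using K' M0 by (intro mult_right_mono)
        finally show ?thesis using True by simp
      next
        case False
        then have "m \<ge> 1" by simp
        from l2_le_tangential_ops[OF n admissibleD(1)[OF G(1)] this, of k]
        obtain T where T: "T \<in> tangential_ops k" "l2 (G m) \<le> ?n ^ k * l2 (T (G m))" by auto
        from tangential_ops_series[OF n G T(1)]
        have TG: "admissible (\<lambda>m. T (G m))" "\<And>x. x \<in> ball 0 1 \<Longrightarrow> (\<lambda>m. hterm (\<lambda>m. T (G m)) m x) sums T f x" by auto
        have "l2 (G m) * a ^ m \<le> ?n ^ k * (l2 (T (G m)) * a ^ m)"
          using mult_right_mono[OF T(2), of "a ^ m"] a by (simp add: mult.assoc)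
        also have "\<dots> \<le> ?n ^ k * (K * (1 + \<rho>) ^ m * L T)"
          using K(2)[OF TG, of m] True T(1) by (intro mult_left_mono) (auto simp: L_def)
        also have "\<dots> = (?n ^ k * K) * ((1 + \<rho>) ^ m * L T)" by (simp add: mult_ac)
        also have "\<dots> \<le> K' * ((1 + \<rho>) ^ m * M)"
          using K' K(1) \<rho> L0 LM[OF T(1)] by (intro mult_mono mult_left_mono mult_nonneg_nonneg) auto
        finally show ?thesis by (simp add: mult_ac)
      qed
    qed (use K' M0 in auto)
    then have "ennreal (norm (f x0)) \<le> ennreal (C0 * K' * M)" by (simp add: ennreal_leI mult.assoc)
    also have "\<dots> = ennreal (C0 * K') * ennreal M" using C0 K' M0 by (intro ennreal_mult) auto
    also have "ennreal M = T_norm p \<alpha> k f"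
    proof -
      have "ennreal M = ennreal (\<Sum>T\<in>tangential_ops k. L T) + ennreal (norm (f 0))"
        unfolding M_def using L0 by (intro ennreal_plus sum_nonneg) auto
      also have "ennreal (\<Sum>T\<in>tangential_ops k. L T) = (\<Sum>T\<in>tangential_ops k. ennreal (L T))"
        using L0 by (intro sum_ennreal[symmetric]) auto
      also have "\<dots> = (\<Sum>T\<in>tangential_ops k. Lp_norm p ?\<beta> (T f))"
        using True by (intro sum.cong) (auto simp: Lp_norm_def L_def)
      finally show ?thesis by (simp add: T_norm_def)
    qed
    finally show ?thesis .
  qed
  moreover have "C0 * K' > 0" using C0(1) K' by simp
  ultimately show ?thesis by blast
qed

theorem corollary1p7:
  fixes \<alpha> p :: real
    and x0 :: "real ^ 'n::{finite,linorder}"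
    and N :: "(real ^ 'n::{finite,linorder} \<Rightarrow> complex) \<Rightarrow> ennreal"
  assumes "CARD('n) \<ge> 2"
    and "1 \<le> p"
    and "N \<in> bergman_besov_norms p \<alpha>"
    and "x0 \<in> ball 0 1"
  shows "\<exists>C::real. C > 0 \<and> (\<forall>f\<in>bergman_besov p \<alpha>. ennreal (norm (f x0)) \<le> ennreal C * N f)"
proof -
  have sub: "bergman_besov p \<alpha> \<subseteq> (hyp_harmonic :: (real ^ 'n::{finite,linorder} \<Rightarrow> complex) set)"
    by (auto simp: bergman_besov_def)
  from assms(3) consider s t where "N = D_norm p \<alpha> s t" "\<alpha> + p * t > -1"
    | k where "N = T_norm p \<alpha> k" "\<alpha> + p * real k > -1"
    by (auto simp: bergman_besov_norms_def)
  then show ?thesis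
  proof cases
    case 1
    then show ?thesis using D_norm_bound[OF assms(1,2) 1(2) assms(4), of s] sub by blast
  next
    case 2
    then show ?thesis using T_norm_bound[OF assms(1,2) 2(2) assms(4)] sub by blast
  qed
qed

end
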